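(* Assume that at least one of the following six conditions holds: (1) the only $u\in H^1_D(\Omega)$ with $a(u,v)=0$ for all $v\in H^1_D(\Omega)$ is $u=0$; (2) there is a constant $C>0$ such that, for every $g\in (H^1_D(\Omega))'$, the solution $u\in H^1_D(\Omega)$ of problem (P) satisfies $\|\nabla u\|_0\le C\|g\|_{-1}$; (3) for every $g\in (H^1_D(\Omega))'$, problem (P) has a unique solution $u\in H^1_D(\Omega)$; (4) the only $u\in H^1_D(\Omega)$ with $a(v,u)=0$ for all $v\in H^1_D(\Omega)$ is $u=0$; (5) there is a constant $C>0$ such that, for every $g\in (H^1_D(\Omega))'$, the solution $u\in H^1_D(\Omega)$ of the adjoint problem (P* ) satisfies $\|\nabla u\|_0\le C\|g\|_{-1}$; (6) for every $g\in (H^1_D(\Omega))'$, the adjoint problem (P* ) has a unique solution $u\in H^1_D(\Omega)$. Then there exists a constant $C>0$ such that for all $(\tau,v)\in \mathbb{X}=H_N(\mathrm{div};\Omega)\times H^1_D(\Omega)$, $$C\left(\|\tau\|_0^2+\|\nabla\cdot\tau\|_0^2+\|\nabla v\|_0^2\right)\le L(\tau,v;0),\qquad C\left(\|\tau\|_0^2+\|\nabla v\|_0^2\right)\le L_{-1}(\tau,v;0),$$ $$C\left(\|\tau\|_0^2+\|\nabla\cdot\tau\|_0^2+\|\nabla v\|_0^2\right)\le J(\tau,v;0),\qquad C\left(\|\tau\|_0^2+\|\nabla v\|_0^2\right)\le J_{-1}(\tau,v;0).$$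
   Context: Domain: $\Omega\subset\mathbb{R}^d$ ($d=2$ or $3$) is bounded, open and connected with Lipschitz boundary $\partial\Omega$ and outward unit normal $n$. The boundary is partitioned as $\partial\Omega=\overline{\Gamma_D}\cup\overline{\Gamma_N}$ with $\Gamma_D,\Gamma_N$ relatively open, $\Gamma_D\cap\Gamma_N=\emptyset$, and $\Gamma_D$ connected with $\mathrm{meas}(\Gamma_D)\ne 0$. Coefficients: $A\in L^\infty(\Omega)^{d\times d}$ is symmetric and there are constants $0<\Lambda_0\le\Lambda_1$ with $\Lambda_0 y^Ty\le y^TA(x)y\le\Lambda_1y^Ty$ for all $y\in\mathbb{R}^d$ and almost all $x\in\Omega$; $b\in L^\infty(\Omega)^d$ and $c\in L^\infty(\Omega)$. No sign condition is imposed on $c$. All functions are real-valued. Spaces and norms: $(\cdot,\cdot)$ and $\|\cdot\|_0$ are the inner product and norm of $L^2(\Omega)$ or $L^2(\Omega)^d$. $H^1_D(\Omega)=\{v\in H^1(\Omega): v=0 \text{ on }\Gamma_D\}$. $H(\mathrm{div};\Omega)=\{\tau\in L^2(\Omega)^d:\nabla\cdot\tau\in L^2(\Omega)\}$ and $H_N(\mathrm{div};\Omega)=\{\tau\in H(\mathrm{div};\Omega): n\cdot\tau=0\text{ on }\Gamma_N\}$, where the boundary condition is understood in the sense of normal traces, i.e. $(\tau,\nabla w)+(\nabla\cdot\tau,w)=0$ for all $w\in H^1_D(\Omega)$. The dual space $(H^1_D(\Omega))'$ carries the norm $\|g\|_{-1}=\sup_{0\ne w\in H^1_D(\Omega)}\langle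 g,w\rangle/\|\nabla w\|_0$; an $f\in L^2(\Omega)$ is identified with the functional $w\mapsto (f,w)$. Bilinear form: $Xv=b\cdot\nabla v+cv$ and $a(w,v)=(A\nabla w,\nabla v)+(Xw,v)$ for $w,v\in H^1_D(\Omega)$. Problem (P): given $g\in(H^1_D(\Omega))'$, find $u\in H^1_D(\Omega)$ with $a(u,v)=\langle g,v\rangle$ for all $v\in H^1_D(\Omega)$. Adjoint problem (P* ): given $g\in(H^1_D(\Omega))'$, find $u\in H^1_D(\Omega)$ with $a(v,u)=\langle g,v\rangle$ for all $v\in H^1_D(\Omega)$. In conditions (2) and (5), the bound is understood to hold for every $g$ and every solution $u$. Least-squares functionals: for $(\tau,v)\in\mathbb{X}$ and $f\in L^2(\Omega)$, $$L(\tau,v;f)=\|A^{-1/2}\tau+A^{1/2}\nabla v\|_0^2+\|\nabla\cdot\tau+Xv-f\|_0^2,$$ $$L_{-1}(\tau,v;f)=\|A^{-1/2}\tau+A^{1/2}\nabla v\|_0^2+\|\nabla\cdot\tau+Xv-f\|_{-1}^2,$$ $$J(\tau,v;f)=\|\tau+A\nabla v+bv\|_0^2+\|\nabla\cdot\tau+cv-f\|_0^2,$$ $$J_{-1}(\tau,v;f)=\|\tau+A\nabla v+bv\|_0^2+\|\nabla\cdot\tau+cv-f\|_{-1}^2.$$ *)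

theory Defs
  imports "HOL-Analysis.Analysis"
begin

text \<open>
  Elements of Lebesgue and Sobolev spaces on \<open>\<Omega>\<close> are represented by everywhere defined functions;
  only their values on \<open>\<Omega>\<close> matter, and equality of elements is equality almost everywhere on \<open>\<Omega>\<close>.
\<close>

definition L2 :: "(real^'n) set \<Rightarrow> (real^'n \<Rightarrow> 'b::euclidean_space) set" where
  "L2 \<Omega> = {f. f \<in> borel_measurable (lebesgue_on \<Omega>) \<and> integrable (lebesgue_on \<Omega>) (\<lambda>x. (norm (f x))\<^sup>2)}"

definition Linf :: "(real^'n) set \<Rightarrow> (real^'n \<Rightarrow> 'b::euclidean_space) set" where
  "Linf \<Omega> = {f. f \<in> borel_measurable (lebesgue_on \<Omega>) \<and> (\<exists>K. AE x in lebesgue_on \<Omega>. norm (f x) \<le> K)}"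

definition L2_inner :: "(real^'n) set \<Rightarrow> (real^'n \<Rightarrow> 'b::euclidean_space) \<Rightarrow> (real^'n \<Rightarrow> 'b) \<Rightarrow> real" where
  "L2_inner \<Omega> f g = (LINT x|lebesgue_on \<Omega>. f x \<bullet> g x)"

definition L2_norm :: "(real^'n) set \<Rightarrow> (real^'n \<Rightarrow> 'b::euclidean_space) \<Rightarrow> real" where
  "L2_norm \<Omega> f = sqrt (L2_inner \<Omega> f f)"

definition eq_ae :: "(real^'n) set \<Rightarrow> (real^'n \<Rightarrow> real) \<Rightarrow> (real^'n \<Rightarrow> real) \<Rightarrow> bool" where
  "eq_ae \<Omega> f g \<longleftrightarrow> (AE x in lebesgue_on \<Omega>. f x = g x)"

definition pderiv_dir :: "'n::finite \<Rightarrow> (real^'n \<Rightarrow> real) \<Rightarrow> real^'n \<Rightarrow> real" where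
  "pderiv_dir i f x = frechet_derivative f (at x) (axis i 1)"

primrec Ck :: "nat \<Rightarrow> (real^'n::finite \<Rightarrow> real) \<Rightarrow> bool" where
  "Ck 0 f \<longleftrightarrow> continuous_on UNIV f"
| "Ck (Suc k) f \<longleftrightarrow> (\<forall>x. f differentiable (at x)) \<and> (\<forall>i. Ck k (pderiv_dir i f))"

definition smooth :: "(real^'n::finite \<Rightarrow> real) \<Rightarrow> bool" where
  "smooth f \<longleftrightarrow> (\<forall>k. Ck k f)"

definition test_functions :: "(real^'n::finite) set \<Rightarrow> (real^'n \<Rightarrow> real) set" where
  "test_functions \<Omega> =
     {\<phi>. smooth \<phi> \<and> compact (closure {x. \<phi> x \<noteq> 0}) \<and> closure {x. \<phi> x \<noteq> 0} \<subseteq> \<Omega>}"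

definition is_weak_grad :: "(real^'n::finite) set \<Rightarrow> (real^'n \<Rightarrow> real) \<Rightarrow> (real^'n \<Rightarrow> real^'n) \<Rightarrow> bool" where
  "is_weak_grad \<Omega> v G \<longleftrightarrow>
     (\<forall>\<phi>\<in>test_functions \<Omega>. \<forall>i.
        (LINT x|lebesgue_on \<Omega>. v x * pderiv_dir i \<phi> x) = - (LINT x|lebesgue_on \<Omega>. G x $ i * \<phi> x))"

definition is_weak_div :: "(real^'n::finite) set \<Rightarrow> (real^'n \<Rightarrow> real^'n) \<Rightarrow> (real^'n \<Rightarrow> real) \<Rightarrow> bool" where
  "is_weak_div \<Omega> \<tau> D \<longleftrightarrow>
     (\<forall>\<phi>\<in>test_functions \<Omega>.
        (LINT x|lebesgue_on \<Omega>. \<tau> x \<bullet> (\<chi> i. pderiv_dir i \<phi> x)) = - (LINT x|lebesgue_on \<Omega>. D x * \<phi> x))"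

text \<open>Weak gradient and divergence are unique only almost everywhere; a representative is chosen.\<close>

definition weak_grad :: "(real^'n::finite) set \<Rightarrow> (real^'n \<Rightarrow> real) \<Rightarrow> real^'n \<Rightarrow> real^'n" where
  "weak_grad \<Omega> v = (SOME G. G \<in> L2 \<Omega> \<and> is_weak_grad \<Omega> v G)"

definition weak_div :: "(real^'n::finite) set \<Rightarrow> (real^'n \<Rightarrow> real^'n) \<Rightarrow> real^'n \<Rightarrow> real" where
  "weak_div \<Omega> \<tau> = (SOME D. D \<in> L2 \<Omega> \<and> is_weak_div \<Omega> \<tau> D)"

definition H1 :: "(real^'n::finite) set \<Rightarrow> (real^'n \<Rightarrow> real) set" where
  "H1 \<Omega> = {v \<in> L2 \<Omega>. \<exists>G. G \<in> L2 \<Omega> \<and> is_weak_grad \<Omega> v G}"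

definition H1_norm :: "(real^'n::finite) set \<Rightarrow> (real^'n \<Rightarrow> real) \<Rightarrow> real" where
  "H1_norm \<Omega> v = sqrt ((L2_norm \<Omega> v)\<^sup>2 + (L2_norm \<Omega> (weak_grad \<Omega> v))\<^sup>2)"

definition Hdiv :: "(real^'n::finite) set \<Rightarrow> (real^'n \<Rightarrow> real^'n) set" where
  "Hdiv \<Omega> = {\<tau> \<in> L2 \<Omega>. \<exists>D. D \<in> L2 \<Omega> \<and> is_weak_div \<Omega> \<tau> D}"

text \<open>
  Near each boundary point, in suitable orthonormal coordinates with last axis \<open>e\<close>, \<open>\<Omega>\<close> is the
  strict epigraph of a Lipschitz function \<open>\<gamma>\<close> on the hyperplane orthogonal to \<open>e\<close>;
  \<open>x - (x \<bullet> e) *\<^sub>R e\<close> is the projection of \<open>x\<close> to that hyperplane.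
\<close>

definition Lipschitz_boundary :: "(real^'n::finite) set \<Rightarrow> bool" where
  "Lipschitz_boundary \<Omega> \<longleftrightarrow>
     (\<forall>x0\<in>frontier \<Omega>. \<exists>r>0. \<exists>e \<gamma> K. norm e = 1 \<and> K-lipschitz_on {y. y \<bullet> e = 0} \<gamma> \<and>
        \<Omega> \<inter> ball x0 r = {x \<in> ball x0 r. \<gamma> (x - (x \<bullet> e) *\<^sub>R e) < x \<bullet> e})"

text \<open>
  Hausdorff measure of integer dimension \<open>s > 0\<close>, normalised to agree with Lebesgue measure.
  Boundedness of the covering sets is required since \<open>diameter\<close> is meaningful only for bounded sets.
  \<open>hausdorff_outer s\<close> is a metric outer measure, hence countably additive on the Borel sets, so that
  \<open>measure_of\<close> does not fall back to its default value, the zero measure.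
\<close>

definition hausdorff_pre :: "nat \<Rightarrow> real \<Rightarrow> 'a::metric_space set \<Rightarrow> ennreal" where
  "hausdorff_pre s \<delta> E =
     (INF U \<in> {U::nat \<Rightarrow> 'a set. E \<subseteq> (\<Union>i. U i) \<and> (\<forall>i. bounded (U i) \<and> diameter (U i) \<le> \<delta>)}.
        \<Sum>i. ennreal (unit_ball_vol (real s) * (diameter (U i) / 2) ^ s))"

definition hausdorff_outer :: "nat \<Rightarrow> 'a::metric_space set \<Rightarrow> ennreal" where
  "hausdorff_outer s E = (SUP \<delta>\<in>{0<..}. hausdorff_pre s \<delta> E)"

definition hausdorff_measure :: "nat \<Rightarrow> 'a::metric_space measure" where
  "hausdorff_measure s = measure_of UNIV (sets borel) (hausdorff_outer s)"

definition surface_measure :: "(real^'n::finite) measure" where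
  "surface_measure = hausdorff_measure (CARD('n) - 1)"

text \<open>
  The trace on \<open>\<Gamma> \<subseteq> \<partial>\<Omega>\<close> is the continuous extension, from \<open>H\<^sup>1(\<Omega>)\<close> to \<open>L\<^sup>2(\<Gamma>)\<close>, of restriction to \<open>\<Gamma>\<close>
  of functions that are smooth up to the boundary.
\<close>

definition has_trace ::
  "(real^'n::finite) set \<Rightarrow> (real^'n) set \<Rightarrow> (real^'n \<Rightarrow> real) \<Rightarrow> (real^'n \<Rightarrow> real) \<Rightarrow> bool" where
  "has_trace \<Omega> \<Gamma> v w \<longleftrightarrow>
     w \<in> borel_measurable (restrict_space surface_measure \<Gamma>) \<and>
     (\<exists>\<phi>::nat \<Rightarrow> real^'n \<Rightarrow> real. (\<forall>k. smooth (\<phi> k)) \<and>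
        (\<lambda>k. H1_norm \<Omega> (\<lambda>x. \<phi> k x - v x)) \<longlonglongrightarrow> 0 \<and>
        (\<lambda>k. \<integral>\<^sup>+x\<in>\<Gamma>. ennreal ((\<phi> k x - w x)\<^sup>2) \<partial>surface_measure) \<longlonglongrightarrow> 0)"

definition H1D :: "(real^'n::finite) set \<Rightarrow> (real^'n) set \<Rightarrow> (real^'n \<Rightarrow> real) set" where
  "H1D \<Omega> \<Gamma>D = {v \<in> H1 \<Omega>. has_trace \<Omega> \<Gamma>D v (\<lambda>_. 0)}"

definition HNdiv :: "(real^'n::finite) set \<Rightarrow> (real^'n) set \<Rightarrow> (real^'n \<Rightarrow> real^'n) set" where
  "HNdiv \<Omega> \<Gamma>D = {\<tau> \<in> Hdiv \<Omega>. \<forall>w\<in>H1D \<Omega> \<Gamma>D.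
      L2_inner \<Omega> \<tau> (weak_grad \<Omega> w) + L2_inner \<Omega> (weak_div \<Omega> \<tau>) w = 0}"

text \<open>Continuity forces such functionals to respect equality almost everywhere.\<close>

definition H1D_dual :: "(real^'n::finite) set \<Rightarrow> (real^'n) set \<Rightarrow> ((real^'n \<Rightarrow> real) \<Rightarrow> real) set" where
  "H1D_dual \<Omega> \<Gamma>D = {g.
     (\<forall>w1\<in>H1D \<Omega> \<Gamma>D. \<forall>w2\<in>H1D \<Omega> \<Gamma>D. g (\<lambda>x. w1 x + w2 x) = g w1 + g w2) \<and>
     (\<forall>w\<in>H1D \<Omega> \<Gamma>D. \<forall>t::real. g (\<lambda>x. t * w x) = t * g w) \<and>
     (\<exists>K. \<forall>w\<in>H1D \<Omega> \<Gamma>D. \<bar>g w\<bar> \<le> K * H1_norm \<Omega> w)}"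

definition dual_norm ::
  "(real^'n::finite) set \<Rightarrow> (real^'n) set \<Rightarrow> ((real^'n \<Rightarrow> real) \<Rightarrow> real) \<Rightarrow> real" where
  "dual_norm \<Omega> \<Gamma>D g =
     (SUP w \<in> {w \<in> H1D \<Omega> \<Gamma>D. \<not> eq_ae \<Omega> w (\<lambda>_. 0)}. g w / L2_norm \<Omega> (weak_grad \<Omega> w))"

definition L2_functional :: "(real^'n) set \<Rightarrow> (real^'n \<Rightarrow> real) \<Rightarrow> (real^'n \<Rightarrow> real) \<Rightarrow> real" where
  "L2_functional \<Omega> f = (\<lambda>w. L2_inner \<Omega> f w)"

definition lower_order ::
  "(real^'n::finite) set \<Rightarrow> (real^'n \<Rightarrow> real^'n) \<Rightarrow> (real^'n \<Rightarrow> real) \<Rightarrow> (real^'n \<Rightarrow> real) \<Rightarrow> real^'n \<Rightarrow> real" where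
  "lower_order \<Omega> b c v = (\<lambda>x. b x \<bullet> weak_grad \<Omega> v x + c x * v x)"

definition bil ::
  "(real^'n::finite) set \<Rightarrow> (real^'n \<Rightarrow> real^'n^'n) \<Rightarrow> (real^'n \<Rightarrow> real^'n) \<Rightarrow> (real^'n \<Rightarrow> real)
     \<Rightarrow> (real^'n \<Rightarrow> real) \<Rightarrow> (real^'n \<Rightarrow> real) \<Rightarrow> real" where
  "bil \<Omega> A b c w v =
     L2_inner \<Omega> (\<lambda>x. A x *v weak_grad \<Omega> w x) (weak_grad \<Omega> v) + L2_inner \<Omega> (lower_order \<Omega> b c w) v"

definition solves ::
  "(real^'n::finite) set \<Rightarrow> (real^'n) set \<Rightarrow> (real^'n \<Rightarrow> real^'n^'n) \<Rightarrow> (real^'n \<Rightarrow> real^'n)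
     \<Rightarrow> (real^'n \<Rightarrow> real) \<Rightarrow> ((real^'n \<Rightarrow> real) \<Rightarrow> real) \<Rightarrow> (real^'n \<Rightarrow> real) \<Rightarrow> bool" where
  "solves \<Omega> \<Gamma>D A b c g u \<longleftrightarrow> u \<in> H1D \<Omega> \<Gamma>D \<and> (\<forall>v\<in>H1D \<Omega> \<Gamma>D. bil \<Omega> A b c u v = g v)"

definition solves_adj ::
  "(real^'n::finite) set \<Rightarrow> (real^'n) set \<Rightarrow> (real^'n \<Rightarrow> real^'n^'n) \<Rightarrow> (real^'n \<Rightarrow> real^'n)
     \<Rightarrow> (real^'n \<Rightarrow> real) \<Rightarrow> ((real^'n \<Rightarrow> real) \<Rightarrow> real) \<Rightarrow> (real^'n \<Rightarrow> real) \<Rightarrow> bool" where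
  "solves_adj \<Omega> \<Gamma>D A b c g u \<longleftrightarrow> u \<in> H1D \<Omega> \<Gamma>D \<and> (\<forall>v\<in>H1D \<Omega> \<Gamma>D. bil \<Omega> A b c v u = g v)"

definition matrix_sqrt :: "real^'n^'n \<Rightarrow> real^'n^'n" where
  "matrix_sqrt M = (THE B. transpose B = B \<and> (\<forall>y. 0 \<le> y \<bullet> (B *v y)) \<and> B ** B = M)"

definition flux_defect ::
  "(real^'n::finite) set \<Rightarrow> (real^'n \<Rightarrow> real^'n^'n) \<Rightarrow> (real^'n \<Rightarrow> real^'n) \<Rightarrow> (real^'n \<Rightarrow> real) \<Rightarrow> real^'n \<Rightarrow> real^'n" where
  "flux_defect \<Omega> A \<tau> v =
     (\<lambda>x. matrix_inv (matrix_sqrt (A x)) *v \<tau> x + matrix_sqrt (A x) *v weak_grad \<Omega> v x)"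

definition LS_L ::
  "(real^'n::finite) set \<Rightarrow> (real^'n \<Rightarrow> real^'n^'n) \<Rightarrow> (real^'n \<Rightarrow> real^'n) \<Rightarrow> (real^'n \<Rightarrow> real)
     \<Rightarrow> (real^'n \<Rightarrow> real^'n) \<Rightarrow> (real^'n \<Rightarrow> real) \<Rightarrow> (real^'n \<Rightarrow> real) \<Rightarrow> real" where
  "LS_L \<Omega> A b c \<tau> v f =
     (L2_norm \<Omega> (flux_defect \<Omega> A \<tau> v))\<^sup>2 +
     (L2_norm \<Omega> (\<lambda>x. weak_div \<Omega> \<tau> x + lower_order \<Omega> b c v x - f x))\<^sup>2"

definition LS_L_minus1 ::
  "(real^'n::finite) set \<Rightarrow> (real^'n) set \<Rightarrow> (real^'n \<Rightarrow> real^'n^'n) \<Rightarrow> (real^'n \<Rightarrow> real^'n) \<Rightarrow> (real^'n \<Rightarrow> real)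
     \<Rightarrow> (real^'n \<Rightarrow> real^'n) \<Rightarrow> (real^'n \<Rightarrow> real) \<Rightarrow> (real^'n \<Rightarrow> real) \<Rightarrow> real" where
  "LS_L_minus1 \<Omega> \<Gamma>D A b c \<tau> v f =
     (L2_norm \<Omega> (flux_defect \<Omega> A \<tau> v))\<^sup>2 +
     (dual_norm \<Omega> \<Gamma>D (L2_functional \<Omega> (\<lambda>x. weak_div \<Omega> \<tau> x + lower_order \<Omega> b c v x - f x)))\<^sup>2"

definition LS_J ::
  "(real^'n::finite) set \<Rightarrow> (real^'n \<Rightarrow> real^'n^'n) \<Rightarrow> (real^'n \<Rightarrow> real^'n) \<Rightarrow> (real^'n \<Rightarrow> real)
     \<Rightarrow> (real^'n \<Rightarrow> real^'n) \<Rightarrow> (real^'n \<Rightarrow> real) \<Rightarrow> (real^'n \<Rightarrow> real) \<Rightarrow> real" where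
  "LS_J \<Omega> A b c \<tau> v f =
     (L2_norm \<Omega> (\<lambda>x. \<tau> x + A x *v weak_grad \<Omega> v x + v x *\<^sub>R b x))\<^sup>2 +
     (L2_norm \<Omega> (\<lambda>x. weak_div \<Omega> \<tau> x + c x * v x - f x))\<^sup>2"

definition LS_J_minus1 ::
  "(real^'n::finite) set \<Rightarrow> (real^'n) set \<Rightarrow> (real^'n \<Rightarrow> real^'n^'n) \<Rightarrow> (real^'n \<Rightarrow> real^'n) \<Rightarrow> (real^'n \<Rightarrow> real)
     \<Rightarrow> (real^'n \<Rightarrow> real^'n) \<Rightarrow> (real^'n \<Rightarrow> real) \<Rightarrow> (real^'n \<Rightarrow> real) \<Rightarrow> real" where
  "LS_J_minus1 \<Omega> \<Gamma>D A b c \<tau> v f =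
     (L2_norm \<Omega> (\<lambda>x. \<tau> x + A x *v weak_grad \<Omega> v x + v x *\<^sub>R b x))\<^sup>2 +
     (dual_norm \<Omega> \<Gamma>D (L2_functional \<Omega> (\<lambda>x. weak_div \<Omega> \<tau> x + c x * v x - f x)))\<^sup>2"

end

theory Submission
  imports Defs "HOL-Library.Function_Algebras"
begin

text \<open>
  Write \<open>a\<close> for the bilinear form \<open>bil\<close>. For \<open>\<tau>\<close> in \<open>HNdiv\<close> and \<open>v\<close>, \<open>w\<close> in \<open>H1D\<close>, Green's formula turns
  the residuals of the first-order system into the bilinear form: with \<open>q = \<tau> + A \<nabla>v\<close> and
  \<open>f = div \<tau> + b \<bullet> \<nabla>v + c v\<close> one has \<open>a(v, w) = (q, \<nabla>w) + (f, w)\<close>, and with the residuals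
  \<open>q = \<tau> + A \<nabla>v + v b\<close> and \<open>f = div \<tau> + c v\<close> of the functional \<open>J\<close> one has
  \<open>a(w, v) = (q, \<nabla>w) + (f, w)\<close> (\<open>bil_first_order_system\<close>). Hence an inf-sup estimate for \<open>a\<close> in its first
  argument bounds \<open>v\<close> by the residuals of \<open>L\<close>, and one in its second argument bounds \<open>v\<close> by those of \<open>J\<close>;
  here the second residual enters only as a functional on \<open>H1D\<close>, so that its dual norm suffices.
  Then \<open>\<tau>\<close> and \<open>div \<tau>\<close> are recovered from the residuals by subtracting terms in \<open>v\<close>.
  In the functional \<open>L\<close> the first residual is weighted; the bounded square root of \<open>A\<close> maps it to \<open>q\<close>, so it
  dominates \<open>q\<close>.

  It remains to get both inf-sup estimates from any one of the six conditions. Applied to the zero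
  functional, each condition says that \<open>a\<close> is injective in its first or in its second argument.
  The abstract tool is a Garding inequality in which the compact perturbation is a finite sum:
  \<open>c \<parallel>u\<parallel>\<^sup>2 \<le> a(u, u) + C \<Sum>\<^sub>i (\<l>\<^sub>i u)\<^sup>2\<close> with finitely many bounded functionals \<open>\<l>\<^sub>i\<close>. In such a situation
  injectivity yields an inf-sup estimate: otherwise there are unit vectors \<open>v\<^sub>n\<close> with \<open>a(v\<^sub>n, \<cdot>) \<rightarrow> 0\<close>,
  and a subsequence along which the finitely many numbers \<open>\<l>\<^sub>i v\<^sub>n\<close> converge is Cauchy, so its
  limit is a unit vector in the kernel (\<open>garding.inf_sup\<close>). Moreover injectivity in one argument passes to
  the other, since Lax-Milgram reduces the Fredholm alternative to a finite square matrix and its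
  transpose (\<open>garding.injective_transpose\<close>).

  The functionals \<open>\<l>\<^sub>i\<close> are means over small balls. For every \<open>\<epsilon> > 0\<close> there are finitely many balls \<open>B\<close> in
  the domain with \<open>\<parallel>v\<parallel>\<^sup>2 \<le> C \<Sum>\<^sub>B (mean\<^sub>B v)\<^sup>2 + \<epsilon> \<parallel>\<nabla>v\<parallel>\<^sup>2\<close> (\<open>dirichlet_domain.mean_estimate\<close>): a Lipschitz domain
  has a uniform interior cone near each point of its closure, and \<open>v x\<close> differs from its mean over a ball in
  that cone at distance \<open>t\<close> from \<open>x\<close> by an amount controlled by \<open>t\<close> times the gradient. This inequality
  with small \<open>\<epsilon>\<close> plays the role of Rellich's compactness theorem.

  With \<open>(\<nabla>u, \<nabla>v)\<close> as bilinear form, the same tool gives the Poincare inequality, provided that a function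
  in \<open>H1D\<close> with zero gradient vanishes (\<open>dirichlet_domain.zero_if_weak_grad_zero\<close>). By connectedness it
  is a constant \<open>m\<close>. Its smooth approximations tend to \<open>0\<close> at almost every point \<open>x\<close> of \<open>\<Gamma>D\<close> and,
  by integrating the gradient along rays that enter the domain, tend to \<open>m\<close> at the feet of almost all
  such rays. If \<open>m \<noteq> 0\<close>, the cylinder of rays above almost all of a piece of \<open>\<Gamma>D\<close> is therefore Lebesgue
  null, and a slice of a thin covering of the cylinder shows that the piece has Hausdorff measure zero.
\<close>

section \<open>Hilbert spaces and Garding inequalities of finite rank\<close>

text \<open>
  Pointwise scaling makes function spaces real vector spaces, so that the \<open>subspace\<close> and \<open>span\<close> theory
  applies to spaces of functions.
\<close>

instantiation "fun" :: (type, real_vector) real_vector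
begin

definition scaleR_fun :: "real \<Rightarrow> ('a \<Rightarrow> 'b) \<Rightarrow> 'a \<Rightarrow> 'b" where
  "scaleR_fun r f = (\<lambda>x. r *\<^sub>R f x)"

instance
  by standard (auto simp: scaleR_fun_def fun_eq_iff scaleR_add_left scaleR_add_right)

end

lemma scaleR_fun_apply [simp]: "(r *\<^sub>R f) x = r *\<^sub>R f x"
  by (simp add: scaleR_fun_def)

lemma sum_fun_apply: "(\<Sum>i\<in>I. f i) x = (\<Sum>i\<in>I. f i x)"
  by (induction I rule: infinite_finite_induct) auto

lemma inverse_Suc_tendsto_0: "(\<lambda>n. 1 / real (Suc n)) \<longlonglongrightarrow> 0"
  using LIMSEQ_inverse_real_of_nat by (simp add: inverse_eq_divide)

text \<open>
  Row rank equals column rank, for a matrix indexed by a finite set of any type. Since the rows are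
  independent, \<open>y \<mapsto> y\<^sup>T Q\<close> is onto, so \<open>x = y\<^sup>T Q\<close> for some \<open>y\<close> and \<open>x\<^sup>T x = y\<^sup>T Q x = 0\<close>.
\<close>

lemma square_system_injective_transpose:
  fixes Q :: "'i \<Rightarrow> 'i \<Rightarrow> real"
  assumes I: "finite I"
    and left: "\<And>y. (\<And>i. i \<in> I \<Longrightarrow> (\<Sum>j\<in>I. y j * Q j i) = 0) \<Longrightarrow> (\<forall>j\<in>I. y j = 0)"
    and right: "\<And>j. j \<in> I \<Longrightarrow> (\<Sum>i\<in>I. Q j i * x i) = 0"
    and "i \<in> I"
  shows "x i = 0"
proof -
  define f where "f = (\<lambda>(y::'i \<Rightarrow> real) i. if i \<in> I then (\<Sum>j\<in>I. y j * Q j i) else 0)"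
  define e where "e = (\<lambda>(i::'i) k. if k = i then 1 else (0::real))"
  define S where "S = {y::'i \<Rightarrow> real. \<forall>i. i \<notin> I \<longrightarrow> y i = 0}"
  have linf: "linear f"
    by (rule linearI) (auto simp: f_def fun_eq_iff sum.distrib distrib_right sum_distrib_left mult.assoc)
  have subS: "subspace S"
    by (auto simp: S_def subspace_def)
  have eS: "e ` I \<subseteq> S"
    by (auto simp: e_def S_def)
  have expand: "y = (\<Sum>i\<in>I. y i *\<^sub>R e i)" if "y \<in> S" for y
  proof
    fix k
    have "(\<Sum>i\<in>I. y i * e i k) = (\<Sum>i\<in>I. if k = i then y i else 0)"
      by (rule sum.cong) (auto simp: e_def)
    also have "\<dots> = (if k \<in> I then y k else 0)"
      using I by simp
    finally show "y k = (\<Sum>i\<in>I. y i *\<^sub>R e i) k"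
      using that by (auto simp: sum_fun_apply S_def)
  qed
  have spanE: "span (e ` I) = S"
  proof
    show "span (e ` I) \<subseteq> S"
      by (rule span_minimal[OF eS subS])
    show "S \<subseteq> span (e ` I)"
    proof
      fix y assume "y \<in> S"
      have "(\<Sum>i\<in>I. y i *\<^sub>R e i) \<in> span (e ` I)"
        by (intro span_sum span_scale span_base) auto
      then show "y \<in> span (e ` I)" using expand[OF \<open>y \<in> S\<close>] by simp
    qed
  qed
  have inje: "inj_on e I"
    by (rule inj_onI) (auto simp: e_def fun_eq_iff split: if_splits)
  have indE: "independent (e ` I)"
    unfolding dependent_finite[OF finite_imageI[OF I]]
  proof safe
    fix u i
    assume s: "(\<Sum>v\<in>e ` I. u v *\<^sub>R v) = 0" and i: "i \<in> I" and ne: "u (e i) \<noteq> 0"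
    have "(\<Sum>j\<in>I. u (e j) *\<^sub>R e j) = 0"
      using s by (simp add: sum.reindex[OF inje])
    moreover have "(\<Sum>j\<in>I. u (e j) * e j i) = (\<Sum>j\<in>I. if i = j then u (e j) else 0)"
      by (rule sum.cong) (auto simp: e_def)
    ultimately have "u (e i) = 0"
      using I i by (auto simp: fun_eq_iff sum_fun_apply)
    then show False using ne by simp
  qed
  have injf: "inj_on f S"
    unfolding linear_injective_on_subspace_0[OF linf subS]
  proof safe
    fix y assume y: "y \<in> S" "f y = 0"
    have "(\<Sum>j\<in>I. y j * Q j i) = 0" if "i \<in> I" for i
      using fun_cong[OF y(2), of i] that by (simp add: f_def)
    then have "\<forall>j\<in>I. y j = 0" by (rule left)
    then show "y = 0" using y(1) by (auto simp: S_def fun_eq_iff)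
  qed
  have fS: "f y \<in> S" for y
    by (simp add: S_def f_def)
  define x' where "x' = (\<lambda>i. if i \<in> I then x i else 0)"
  have x'S: "x' \<in> S" by (simp add: x'_def S_def)
  have indf: "independent (f ` e ` I)"
    using linear_independent_injective_image[OF linf indE] injf spanE by simp
  have cardf: "card (f ` e ` I) = card (e ` I)"
    by (rule card_image) (rule inj_on_subset[OF injf eS])
  have "x' \<in> span (f ` e ` I)"
  proof (rule ccontr)
    assume notin: "x' \<notin> span (f ` e ` I)"
    then have "independent (insert x' (f ` e ` I))"
      using indf by (simp add: independent_insert)
    then have "card (insert x' (f ` e ` I)) \<le> card (e ` I)"
      using independent_span_bound[OF finite_imageI[OF I], of "insert x' (f ` e ` I)" e] spanE x'S fS
      by auto
    moreover have "x' \<notin> f ` e ` I" using notin span_base[of x' "f ` e ` I"] by blast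
    moreover have "finite (f ` e ` I)" using I by blast
    ultimately show False using cardf by (metis card_insert_disjoint not_less_eq_eq order_refl)
  qed
  also have "span (f ` e ` I) = f ` S"
    using linear_span_image[OF linf, of "e ` I"] spanE by simp
  finally obtain y where y: "x' = f y" by blast
  have "(\<Sum>i\<in>I. x i * x i) = (\<Sum>i\<in>I. (\<Sum>j\<in>I. y j * Q j i) * x i)"
    by (rule sum.cong) (use y in \<open>auto simp: x'_def f_def fun_eq_iff dest!: spec split: if_splits\<close>)
  also have "\<dots> = (\<Sum>j\<in>I. y j * (\<Sum>i\<in>I. Q j i * x i))"
    unfolding sum_distrib_right sum_distrib_left by (subst sum.swap) (simp add: mult.assoc)
  also have "\<dots> = 0" using right by simp
  finally have "\<forall>i\<in>I. x i * x i = 0"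
    using I by (subst (asm) sum_nonneg_eq_0_iff) auto
  then show ?thesis using \<open>i \<in> I\<close> by simp
qed

text \<open>
  Linearity is required only on the subspace: functionals such as \<open>v \<mapsto> L2_inner \<Omega> v f\<close> are not linear
  on all functions.
\<close>

definition lin_fun :: "'v::real_vector set \<Rightarrow> ('v \<Rightarrow> real) \<Rightarrow> bool" where
  "lin_fun V f \<longleftrightarrow> (\<forall>u\<in>V. \<forall>v\<in>V. f (u + v) = f u + f v) \<and> (\<forall>r. \<forall>u\<in>V. f (r *\<^sub>R u) = r * f u)"

definition bilin :: "'v::real_vector set \<Rightarrow> ('v \<Rightarrow> 'v \<Rightarrow> real) \<Rightarrow> bool" where
  "bilin V \<beta> \<longleftrightarrow> (\<forall>w\<in>V. lin_fun V (\<lambda>u. \<beta> u w)) \<and> (\<forall>u\<in>V. lin_fun V (\<beta> u))"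

lemma lin_funD:
  assumes "lin_fun V f"
  shows "u \<in> V \<Longrightarrow> v \<in> V \<Longrightarrow> f (u + v) = f u + f v"
    and "u \<in> V \<Longrightarrow> f (r *\<^sub>R u) = r * f u"
  using assms by (auto simp: lin_fun_def)

lemma lin_fun_diff:
  assumes "lin_fun V f" "subspace V" "u \<in> V" "v \<in> V"
  shows "f (u - v) = f u - f v"
proof -
  have "f (u + (-1) *\<^sub>R v) = f u + (-1) * f v"
    using assms by (metis lin_funD subspace_scale)
  then show ?thesis by simp
qed

lemma lin_fun_0: "lin_fun V f \<Longrightarrow> subspace V \<Longrightarrow> f 0 = 0"
  using lin_funD(2)[of V f 0 0] subspace_0 by force

lemma lin_fun_sum:
  assumes "lin_fun V f" "subspace V" "\<And>i. i \<in> I \<Longrightarrow> u i \<in> V"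
  shows "f (\<Sum>i\<in>I. y i *\<^sub>R u i) = (\<Sum>i\<in>I. y i * f (u i))"
  using assms(3)
proof (induction I rule: infinite_finite_induct)
  case (insert i I)
  have "(\<Sum>i\<in>I. y i *\<^sub>R u i) \<in> V"
    by (rule subspace_sum[OF assms(2)]) (use insert in \<open>auto intro: subspace_scale[OF assms(2)]\<close>)
  then show ?case
    using insert assms(1,2) by (simp add: lin_funD subspace_scale)
qed (use lin_fun_0[OF assms(1,2)] in auto)

lemma bilinD:
  assumes "bilin V \<beta>"
  shows "w \<in> V \<Longrightarrow> lin_fun V (\<lambda>u. \<beta> u w)" "u \<in> V \<Longrightarrow> lin_fun V (\<beta> u)"
  using assms by (auto simp: bilin_def)

lemma bilin_flip: "bilin V \<beta> \<Longrightarrow> bilin V (\<lambda>u v. \<beta> v u)"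
  by (auto simp: bilin_def)

text \<open>
  Functions are not identified when they agree almost everywhere, so the forms below are only
  semidefinite. The theory is therefore developed for semi-inner products on a subspace.
\<close>

locale semi_inner =
  fixes V :: "'v::real_vector set" and ip :: "'v \<Rightarrow> 'v \<Rightarrow> real"
  assumes subspace: "subspace V"
    and bilin_ip: "bilin V ip"
    and sym: "u \<in> V \<Longrightarrow> v \<in> V \<Longrightarrow> ip u v = ip v u"
    and nonneg: "u \<in> V \<Longrightarrow> 0 \<le> ip u u"
begin

definition nrm :: "'v \<Rightarrow> real" where "nrm u = sqrt (ip u u)"

lemmas V_simps [simp] = subspace_0[OF subspace] subspace_add[OF subspace]
  subspace_scale[OF subspace] subspace_diff[OF subspace] subspace_neg[OF subspace]

lemma ip_simps:
  assumes "u \<in> V" "v \<in> V" "w \<in> V"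
  shows "ip (u + v) w = ip u w + ip v w" "ip w (u + v) = ip w u + ip w v"
    "ip (u - v) w = ip u w - ip v w" "ip w (u - v) = ip w u - ip w v"
    "ip (r *\<^sub>R u) w = r * ip u w" "ip w (r *\<^sub>R u) = r * ip w u"
  using assms bilinD[OF bilin_ip] subspace
  by (auto simp: lin_funD(1)[of V "ip w"] lin_funD(1)[of V "\<lambda>u. ip u w"]
      lin_funD(2)[of V "ip w"] lin_funD(2)[of V "\<lambda>u. ip u w"]
      lin_fun_diff[of V "ip w"] lin_fun_diff[of V "\<lambda>u. ip u w"])

lemma nrm_sq: "u \<in> V \<Longrightarrow> (nrm u)\<^sup>2 = ip u u"
  by (simp add: nrm_def nonneg)

lemma nrm_nonneg [simp]: "u \<in> V \<Longrightarrow> 0 \<le> nrm u"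
  by (simp add: nrm_def nonneg)

lemma ip_square_expand:
  assumes "u \<in> V" "v \<in> V"
  shows "ip (u + t *\<^sub>R v) (u + t *\<^sub>R v) = ip u u + 2 * t * ip u v + t\<^sup>2 * ip v v"
  using assms by (simp add: ip_simps sym[of v u] power2_eq_square algebra_simps)

text \<open>
  A quadratic polynomial that is nonnegative everywhere and vanishes at \<open>0\<close> has a critical point there.
\<close>

lemma quadratic_linear_term_zero:
  fixes d q :: real
  assumes "\<And>t. 0 \<le> 2 * t * d + t\<^sup>2 * q" "0 \<le> q"
  shows "d = 0"
proof (rule ccontr)
  assume "d \<noteq> 0"
  \<comment> \<open>Testing with \<open>t = - d / p\<close>, where \<open>p = q + 1\<close> is positive even if \<open>q = 0\<close>.\<close>
  define p where "p = q + 1"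
  have p: "0 < p" "q - 2 * p < 0" using assms(2) by (auto simp: p_def)
  have "0 \<le> 2 * (- d / p) * d + (- d / p)\<^sup>2 * q"
    by (rule assms)
  also have "\<dots> = d\<^sup>2 / p\<^sup>2 * (q - 2 * p)"
    using p(1) by (simp add: field_simps power2_eq_square)
  also have "\<dots> < 0"
    by (rule mult_pos_neg) (use p \<open>d \<noteq> 0\<close> in simp_all)
  finally show False by simp
qed

lemma cauchy_schwarz:
  assumes "u \<in> V" "v \<in> V"
  shows "\<bar>ip u v\<bar> \<le> nrm u * nrm v"
proof -
  have nn: "0 \<le> ip u u + 2 * t * ip u v + t\<^sup>2 * ip v v" for t
    using nonneg[of "u + t *\<^sub>R v"] assms by (simp add: ip_square_expand)
  have "(ip u v)\<^sup>2 \<le> ip u u * ip v v"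
  proof (cases "ip v v = 0")
    case True
    have "ip u v = 0"
    proof (rule ccontr)
      assume "ip u v \<noteq> 0"
      then show False
        using nn[of "- (ip u u + 1) / (2 * ip u v)"] True by (simp add: field_simps)
    qed
    then show ?thesis using nonneg assms by simp
  next
    case False
    then have "ip v v > 0" using nonneg[OF assms(2)] by simp
    then show ?thesis
      using nn[of "- ip u v / ip v v"] by (simp add: field_simps power2_eq_square)
  qed
  then have "\<bar>ip u v\<bar> \<le> sqrt (ip u u * ip v v)"
    by (metis real_sqrt_abs real_sqrt_le_mono)
  then show ?thesis by (simp add: nrm_def real_sqrt_mult)
qed

lemma nrm_triangle:
  assumes "u \<in> V" "v \<in> V"
  shows "nrm (u + v) \<le> nrm u + nrm v"
proof (rule power2_le_imp_le)
  have "(nrm (u + v))\<^sup>2 = ip u u + 2 * ip u v + ip v v"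
    using ip_square_expand[OF assms, of 1] assms by (simp add: nrm_sq)
  also have "\<dots> \<le> (nrm u + nrm v)\<^sup>2"
    using cauchy_schwarz[OF assms] assms by (simp add: power2_sum nrm_sq)
  finally show "(nrm (u + v))\<^sup>2 \<le> (nrm u + nrm v)\<^sup>2" .
qed (use assms in simp)

lemma nrm_scale: "u \<in> V \<Longrightarrow> nrm (r *\<^sub>R u) = \<bar>r\<bar> * nrm u"
  by (simp add: nrm_def ip_simps real_sqrt_mult flip: mult.assoc)

lemma nrm_0 [simp]: "nrm 0 = 0"
  using nrm_scale[of 0 0] by simp

lemma nrm_diff_le:
  assumes "u \<in> V" "v \<in> V"
  shows "nrm (u - v) \<le> nrm u + nrm v"
  using nrm_triangle[of u "(-1) *\<^sub>R v"] nrm_scale[of v "-1"] assms by simp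

lemma nrm_diff_commute: "u \<in> V \<Longrightarrow> v \<in> V \<Longrightarrow> nrm (u - v) = nrm (v - u)"
  using nrm_scale[of "v - u" "-1"] by simp

lemma nrm_diff_abs:
  assumes "u \<in> V" "v \<in> V"
  shows "\<bar>nrm u - nrm v\<bar> \<le> nrm (u - v)"
  using nrm_triangle[of "u - v" v] nrm_triangle[of "v - u" u] nrm_diff_commute[of u v] assms by auto

lemma tendsto_bounded_lin_fun:
  assumes f: "lin_fun V f" "\<And>v. v \<in> V \<Longrightarrow> \<bar>f v\<bar> \<le> K * nrm v"
    and s: "\<And>n. s n \<in> V" "v \<in> V" "(\<lambda>n. nrm (s n - v)) \<longlonglongrightarrow> 0"
  shows "(\<lambda>n. f (s n)) \<longlonglongrightarrow> f v"
proof -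
  have "(\<lambda>n. f (s n) - f v) \<longlonglongrightarrow> 0"
  proof (rule Lim_null_comparison)
    show "\<forall>\<^sub>F n in sequentially. norm (f (s n) - f v) \<le> K * nrm (s n - v)"
      using f(2) s(1,2) by (simp flip: lin_fun_diff[OF f(1) subspace])
    show "(\<lambda>n. K * nrm (s n - v)) \<longlonglongrightarrow> 0"
      using tendsto_mult_right_zero[OF s(3)] by simp
  qed
  then show ?thesis by (simp add: LIM_zero_iff)
qed

definition bounded_fun :: "('v \<Rightarrow> real) \<Rightarrow> bool" where
  "bounded_fun f \<longleftrightarrow> lin_fun V f \<and> (\<exists>K. \<forall>v\<in>V. \<bar>f v\<bar> \<le> K * nrm v)"

lemma bounded_funE:
  assumes "bounded_fun f"
  obtains K where "0 \<le> K" "\<And>v. v \<in> V \<Longrightarrow> \<bar>f v\<bar> \<le> K * nrm v"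
proof -
  obtain K where K: "\<forall>v\<in>V. \<bar>f v\<bar> \<le> K * nrm v"
    using assms by (auto simp: bounded_fun_def)
  have "\<bar>f v\<bar> \<le> \<bar>K\<bar> * nrm v" if "v \<in> V" for v
    using K[rule_format, OF that] mult_right_mono[OF abs_ge_self nrm_nonneg[OF that], of K] by simp
  then show ?thesis using that[of "\<bar>K\<bar>"] by simp
qed

end

locale semi_hilbert = semi_inner +
  assumes complete:
    "(\<And>n::nat. s n \<in> V) \<Longrightarrow> (\<And>e. 0 < e \<Longrightarrow> \<exists>N. \<forall>m\<ge>N. \<forall>n\<ge>N. nrm (s m - s n) < e)
       \<Longrightarrow> \<exists>v\<in>V. (\<lambda>n. nrm (s n - v)) \<longlonglongrightarrow> 0"
begin

text \<open>
  The representing vector minimises \<open>ip v v - 2 f v\<close>: minimising sequences are Cauchy by the parallelogram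
  identity.
\<close>

lemma riesz:
  assumes f: "bounded_fun f"
  shows "\<exists>r\<in>V. \<forall>w\<in>V. ip r w = f w"
proof -
  have lin: "lin_fun V f" using f by (simp add: bounded_fun_def)
  obtain K where K: "0 \<le> K" "\<And>v. v \<in> V \<Longrightarrow> \<bar>f v\<bar> \<le> K * nrm v"
    by (rule bounded_funE[OF f]) (rule that)
  define J where "J = (\<lambda>v. ip v v - 2 * f v)"
  have lower: "- K\<^sup>2 \<le> J v" if "v \<in> V" for v
  proof -
    have "0 \<le> (nrm v - K)\<^sup>2" by simp
    then show ?thesis
      using K(2)[OF that] nrm_sq[OF that] by (simp add: J_def power2_diff abs_le_iff algebra_simps)
  qed
  define m where "m = (INF v\<in>V. J v)"
  have bdd: "bdd_below (J ` V)"
    using lower by (auto simp: bdd_below_def)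
  have m_le: "m \<le> J v" if "v \<in> V" for v
    unfolding m_def by (rule cINF_lower[OF bdd that])
  have "\<exists>v\<in>V. J v < m + e" if "0 < e" for e
  proof -
    have "Inf (J ` V) < m + e" using that by (simp add: m_def)
    then show ?thesis
      using cInf_lessD[of "J ` V" "m + e"] subspace_0[OF subspace] by blast
  qed
  then have "\<forall>n. \<exists>v\<in>V. J v < m + 1 / real (Suc n)" by simp
  then obtain s where s: "\<And>n. s n \<in> V" "\<And>n. J (s n) < m + 1 / real (Suc n)" by metis
  have par: "ip (u - v) (u - v) = 2 * J u + 2 * J v - 4 * J ((1/2) *\<^sub>R (u + v))"
    if "u \<in> V" "v \<in> V" for u v
    using that by (simp add: J_def ip_simps lin_funD[OF lin] sym[of v u] algebra_simps)
  have inv: "1 / real (Suc n) \<le> 1 / real (Suc N)" if "N \<le> n" for n N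
    using that by (simp add: frac_le)
  have "\<exists>v\<in>V. (\<lambda>n. nrm (s n - v)) \<longlonglongrightarrow> 0"
  proof (rule complete[OF s(1)])
    fix e :: real assume e: "0 < e"
    obtain N where N: "1 / real (Suc N) < e\<^sup>2 / 4"
      using reals_Archimedean[of "e\<^sup>2 / 4"] e by (auto simp: inverse_eq_divide)
    have "nrm (s i - s j) < e" if "N \<le> i" "N \<le> j" for i j
    proof -
      have "(nrm (s i - s j))\<^sup>2 = 2 * J (s i) + 2 * J (s j) - 4 * J ((1/2) *\<^sub>R (s i + s j))"
        using s par by (simp add: nrm_sq)
      also have "\<dots> \<le> 2 * (J (s i) - m) + 2 * (J (s j) - m)"
        using m_le[of "(1/2) *\<^sub>R (s i + s j)"] s by simp
      also have "\<dots> < e\<^sup>2"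
        using s(2)[of i] s(2)[of j] N inv[OF that(1)] inv[OF that(2)] by simp
      finally show ?thesis using e by (simp add: power_less_imp_less_base)
    qed
    then show "\<exists>N. \<forall>m\<ge>N. \<forall>n\<ge>N. nrm (s m - s n) < e" by blast
  qed
  then obtain r where r: "r \<in> V" "(\<lambda>n. nrm (s n - r)) \<longlonglongrightarrow> 0" by blast
  have "ip r w = f w" if w: "w \<in> V" for w
  proof -
    have "0 \<le> 2 * t * (ip r w - f w) + t\<^sup>2 * ip w w" for t
    proof (rule LIMSEQ_le_const)
      have "(\<lambda>n. ip w (s n)) \<longlonglongrightarrow> ip w r"
        by (rule tendsto_bounded_lin_fun[OF _ _ s(1) r])
           (use w bilinD[OF bilin_ip] cauchy_schwarz in auto)
      then have "(\<lambda>n. ip (s n) w) \<longlonglongrightarrow> ip r w"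
        using sym[OF s(1) w] sym[OF r(1) w] by simp
      then have "(\<lambda>n. 2 * t * (ip (s n) w - f w) + t\<^sup>2 * ip w w)
          \<longlonglongrightarrow> 2 * t * (ip r w - f w) + t\<^sup>2 * ip w w"
        by (intro tendsto_intros)
      from tendsto_add[OF inverse_Suc_tendsto_0 this]
      show "(\<lambda>n. 1 / real (Suc n) + (2 * t * (ip (s n) w - f w) + t\<^sup>2 * ip w w))
          \<longlonglongrightarrow> 2 * t * (ip r w - f w) + t\<^sup>2 * ip w w" by simp
      have "0 \<le> 1 / real (Suc n) + (2 * t * (ip (s n) w - f w) + t\<^sup>2 * ip w w)" for n
      proof -
        have "m \<le> J (s n + t *\<^sub>R w)" using s w by (simp add: m_le)
        also have "\<dots> = J (s n) + (2 * t * (ip (s n) w - f w) + t\<^sup>2 * ip w w)"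
          using s(1)[of n] w by (simp add: J_def ip_square_expand lin_funD[OF lin] algebra_simps)
        finally show ?thesis using s(2)[of n] by simp
      qed
      then show "\<exists>N. \<forall>n\<ge>N. 0 \<le> 1 / real (Suc n) + (2 * t * (ip (s n) w - f w) + t\<^sup>2 * ip w w)"
        by blast
    qed
    then have "ip r w - f w = 0"
      by (rule quadratic_linear_term_zero) (simp add: nonneg w)
    then show ?thesis by simp
  qed
  then show ?thesis using r(1) by blast
qed

text \<open>
  For symmetric \<open>s\<close> this would be Riesz for the inner product \<open>s\<close>. In general let \<open>T\<close> be the operator with
  \<open>ip (T u) w = s u w\<close>. Then \<open>s u (T v) = ip (T u) (T v)\<close> is a complete inner product, equivalent to \<open>ip\<close>. If
  \<open>r\<close> represents \<open>f\<close>, then Riesz for this product gives \<open>u\<close> with \<open>s w (T u) = s w r\<close> for all \<open>w\<close>; taking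
  \<open>w = T u - r\<close> shows that \<open>T u - r\<close> has norm zero, so \<open>T u\<close> represents \<open>f\<close> as well.
\<close>

lemma lax_milgram:
  assumes s: "bilin V s" "\<And>u v. u \<in> V \<Longrightarrow> v \<in> V \<Longrightarrow> \<bar>s u v\<bar> \<le> M * nrm u * nrm v"
    and coercive: "0 < c" "\<And>u. u \<in> V \<Longrightarrow> c * ip u u \<le> s u u"
    and f: "bounded_fun f"
  shows "\<exists>u\<in>V. \<forall>w\<in>V. s u w = f w"
proof -
  have "\<exists>r\<in>V. \<forall>w\<in>V. ip r w = s u w" if "u \<in> V" for u
    by (rule riesz) (use that s bilinD in \<open>force simp: bounded_fun_def\<close>)
  then obtain T where T: "\<And>u. u \<in> V \<Longrightarrow> T u \<in> V" "\<And>u w. u \<in> V \<Longrightarrow> w \<in> V \<Longrightarrow> ip (T u) w = s u w"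
    by metis
  have T_sym: "s u (T v) = s v (T u)" if "u \<in> V" "v \<in> V" for u v
    using T sym that by metis
  have T_lower: "c * nrm u \<le> nrm (T u)" if u: "u \<in> V" for u
  proof (cases "nrm u = 0")
    case False
    then have pos: "0 < nrm u" using nrm_nonneg[OF u] by linarith
    have "c * nrm u * nrm u \<le> s u u"
      using coercive(2)[OF u] nrm_sq[OF u] by (simp add: power2_eq_square mult.assoc)
    also have "\<dots> \<le> nrm (T u) * nrm u"
      using cauchy_schwarz[of "T u" u] T u by auto
    finally show ?thesis using pos by simp
  qed (use T u in simp)
  have T_upper: "nrm (T u) \<le> M * nrm u" if u: "u \<in> V" for u
  proof (cases "nrm (T u) = 0")
    case False
    then have pos: "0 < nrm (T u)" using nrm_nonneg[OF T(1)[OF u]] by linarith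
    have "nrm (T u) * nrm (T u) = s u (T u)"
      using T u nrm_sq[of "T u"] by (simp add: power2_eq_square)
    also have "\<dots> \<le> M * nrm u * nrm (T u)"
      using s(2)[OF u T(1)[OF u]] by simp
    finally show ?thesis using pos by simp
  next
    case True
    have "0 \<le> M * nrm u * nrm u" using s(2)[OF u u] by linarith
    then show ?thesis using True nrm_nonneg[OF u]
      by (metis mult_zero_right order_refl zero_le_mult_iff mult_le_0_iff order_antisym)
  qed
  define ip' where "ip' = (\<lambda>u v. s u (T v))"
  interpret A: semi_inner V ip'
  proof
    show "subspace V" by (rule subspace)
    have 1: "lin_fun V (\<lambda>u. ip' u w)" if "w \<in> V" for w
      using bilinD(1)[OF s(1) T(1)[OF that]] by (simp add: ip'_def)
    have 2: "lin_fun V (ip' w)" if "w \<in> V" for w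
      using 1[OF that] T_sym[OF that] by (simp add: ip'_def lin_fun_def)
    show "bilin V ip'" using 1 2 by (simp add: bilin_def)
    show "ip' u v = ip' v u" if "u \<in> V" "v \<in> V" for u v
      using T_sym[OF that] by (simp add: ip'_def)
    show "0 \<le> ip' u u" if "u \<in> V" for u
      using nonneg[of "T u"] T that by (simp add: ip'_def)
  qed
  have A_nrm: "A.nrm u = nrm (T u)" if "u \<in> V" for u
    unfolding A.nrm_def nrm_def using T that by (simp add: ip'_def)
  interpret A: semi_hilbert V ip'
  proof
    fix q :: "nat \<Rightarrow> 'a"
    assume q: "\<And>n. q n \<in> V" "\<And>e. 0 < e \<Longrightarrow> \<exists>N. \<forall>m\<ge>N. \<forall>n\<ge>N. A.nrm (q m - q n) < e"
    have "\<exists>v\<in>V. (\<lambda>n. nrm (q n - v)) \<longlonglongrightarrow> 0"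
    proof (rule complete[OF q(1)])
      fix e :: real assume "0 < e"
      then obtain N where N: "\<forall>m\<ge>N. \<forall>n\<ge>N. A.nrm (q m - q n) < c * e"
        using q(2)[of "c * e"] coercive by auto
      have "nrm (q m - q n) < e" if "m \<ge> N" "n \<ge> N" for m n
      proof -
        have "c * nrm (q m - q n) < c * e"
          using N[rule_format, OF that] T_lower[of "q m - q n"] A_nrm[of "q m - q n"] q(1) by simp
        then show ?thesis using coercive(1) by simp
      qed
      then show "\<exists>N. \<forall>m\<ge>N. \<forall>n\<ge>N. nrm (q m - q n) < e" by blast
    qed
    then obtain v where v: "v \<in> V" "(\<lambda>n. nrm (q n - v)) \<longlonglongrightarrow> 0" by blast
    have "(\<lambda>n. A.nrm (q n - v)) \<longlonglongrightarrow> 0"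
    proof (rule Lim_null_comparison)
      show "\<forall>\<^sub>F n in sequentially. norm (A.nrm (q n - v)) \<le> M * nrm (q n - v)"
        using T_upper A_nrm T q(1) v(1) by simp
      show "(\<lambda>n. M * nrm (q n - v)) \<longlonglongrightarrow> 0"
        using tendsto_mult_right_zero[OF v(2)] by simp
    qed
    then show "\<exists>v\<in>V. (\<lambda>n. A.nrm (q n - v)) \<longlonglongrightarrow> 0" using v(1) by blast
  qed
  obtain r where r: "r \<in> V" "\<And>w. w \<in> V \<Longrightarrow> ip r w = f w"
    using riesz[OF f] by blast
  have "A.bounded_fun (\<lambda>w. s w r)"
    unfolding A.bounded_fun_def
  proof (intro conjI exI[of _ "nrm r"] ballI)
    show "lin_fun V (\<lambda>w. s w r)" by (rule bilinD(1)[OF s(1) r(1)])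
    show "\<bar>s w r\<bar> \<le> nrm r * A.nrm w" if "w \<in> V" for w
      using cauchy_schwarz[OF T(1)[OF that] r(1)] A_nrm[OF that] T(2)[OF that r(1)] by (simp add: mult.commute)
  qed
  then obtain u where u: "u \<in> V" "\<And>w. w \<in> V \<Longrightarrow> ip' u w = s w r"
    using A.riesz by blast
  define d where "d = T u - r"
  have d: "d \<in> V" using T u r by (simp add: d_def)
  have "s d d = s d (T u) - s d r"
    unfolding d_def[symmetric] using lin_fun_diff[OF bilinD(2)[OF s(1) d] subspace T(1)[OF u(1)] r(1)]
    by (simp add: d_def)
  also have "\<dots> = 0"
    using u(2)[OF d] T_sym[OF u(1) d] by (simp add: ip'_def)
  finally have "c * ip d d \<le> 0" using coercive(2)[OF d] by simp
  then have "nrm d = 0"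
    using coercive(1) nonneg[OF d] by (simp add: nrm_def mult_le_0_iff)
  have "s u w = f w" if w: "w \<in> V" for w
  proof -
    have "ip d w = 0" using cauchy_schwarz[OF d w] \<open>nrm d = 0\<close> by simp
    then show ?thesis
      using T[OF u(1)] r w by (simp add: d_def ip_simps)
  qed
  then show ?thesis using u(1) by blast
qed

end

lemma finite_family_bounded_subseq:
  fixes x :: "'i \<Rightarrow> nat \<Rightarrow> real"
  assumes "finite I" "\<And>i. i \<in> I \<Longrightarrow> bounded (range (x i))"
  shows "\<exists>r. strict_mono r \<and> (\<forall>i\<in>I. convergent (\<lambda>n. x i (r n)))"
  using assms
proof (induction I)
  case empty
  show ?case by (intro exI[of _ id]) (auto simp: strict_mono_def)
next
  case (insert i I)
  then obtain r where r: "strict_mono r" "\<forall>i\<in>I. convergent (\<lambda>n. x i (r n))" by auto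
  have "bounded (range (\<lambda>n. x i (r n)))"
    by (rule bounded_subset[of "range (x i)"]) (use insert.prems in auto)
  then obtain l r' where r': "strict_mono r'" "((\<lambda>n. x i (r n)) \<circ> r') \<longlonglongrightarrow> l"
    using bounded_imp_convergent_subsequence by blast
  show ?case
  proof (intro exI[of _ "r \<circ> r'"] conjI ballI)
    show "strict_mono (r \<circ> r')" using r(1) r'(1) by (rule strict_mono_o)
    show "convergent (\<lambda>n. x j ((r \<circ> r') n))" if "j \<in> insert i I" for j
      using that r(2) r'(1) convergent_subseq_convergent[of "\<lambda>n. x j (r n)" r'] r'(2)
      by (auto simp: o_def convergent_def)
  qed
qed

text \<open>
  Coercivity up to finitely many bounded functionals. A finite sum in place of the usual norm of a
  weaker space keeps the compactness argument finite-dimensional.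
\<close>

locale garding = semi_hilbert +
  fixes \<alpha> :: "'a \<Rightarrow> 'a \<Rightarrow> real" and M c C :: real and I :: "'i set" and \<l> :: "'i \<Rightarrow> 'a \<Rightarrow> real"
  assumes bilin_form: "bilin V \<alpha>"
    and form_bounded: "u \<in> V \<Longrightarrow> v \<in> V \<Longrightarrow> \<bar>\<alpha> u v\<bar> \<le> M * nrm u * nrm v"
    and finite_I: "finite I"
    and functional: "i \<in> I \<Longrightarrow> bounded_fun (\<l> i)"
    and c_pos: "0 < c" and C_nonneg: "0 \<le> C"
    and garding: "u \<in> V \<Longrightarrow> c * ip u u \<le> \<alpha> u u + C * (\<Sum>i\<in>I. (\<l> i u)\<^sup>2)"
begin

lemma garding_flip: "garding V ip (\<lambda>u v. \<alpha> v u) M c C I \<l>"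
proof unfold_locales
  show "\<bar>\<alpha> v u\<bar> \<le> M * nrm u * nrm v" if "u \<in> V" "v \<in> V" for u v
    using form_bounded[OF that(2,1)] by (simp add: mult_ac)
qed (use bilin_form finite_I functional c_pos C_nonneg garding in \<open>auto simp: bilin_flip\<close>)

text \<open>
  Compactness argument: the Garding inequality makes a normalised sequence with \<open>\<alpha> (v n) \<rightarrow> 0\<close> Cauchy as soon as
  all \<open>\<l> i (v n)\<close> converge, and its limit would be a normalised element of the kernel. The conclusion
  bounds \<open>nrm u\<close> by every upper bound \<open>B\<close> of \<open>\<alpha> u\<close> on the unit ball, which avoids naming the dual norm.
\<close>

lemma inf_sup:
  assumes inj: "\<And>u. u \<in> V \<Longrightarrow> (\<And>v. v \<in> V \<Longrightarrow> \<alpha> u v = 0) \<Longrightarrow> ip u u = 0"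
  shows "\<exists>K>0. \<forall>u\<in>V. \<forall>B\<ge>0. (\<forall>w\<in>V. \<alpha> u w \<le> B * nrm w) \<longrightarrow> nrm u \<le> K * B"
proof (rule ccontr)
  assume neg: "\<not> ?thesis"
  have "\<exists>v\<in>V. nrm v = 1 \<and> (\<forall>w\<in>V. \<bar>\<alpha> v w\<bar> \<le> 1 / real (Suc n) * nrm w)" for n
  proof -
    from neg obtain u B where u: "u \<in> V" "0 \<le> B" "\<And>w. w \<in> V \<Longrightarrow> \<alpha> u w \<le> B * nrm w"
      "real (Suc n) * B < nrm u"
      by (auto simp: not_le) (metis of_nat_0_less_iff of_nat_Suc zero_less_Suc)
    have pos: "0 < nrm u" using u(2,4) by (smt (verit) mult_nonneg_nonneg of_nat_0_le_iff)
    have absb: "\<bar>\<alpha> u w\<bar> \<le> B * nrm w" if w: "w \<in> V" for w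
      using u(3)[OF w] u(3)[of "(-1) *\<^sub>R w"] w nrm_scale[OF w, of "-1"]
        lin_funD(2)[OF bilinD(2)[OF bilin_form u(1)], of w "-1"] by (simp add: abs_le_iff)
    have "\<bar>\<alpha> ((1 / nrm u) *\<^sub>R u) w\<bar> \<le> 1 / real (Suc n) * nrm w" if w: "w \<in> V" for w
    proof -
      have "\<bar>\<alpha> ((1 / nrm u) *\<^sub>R u) w\<bar> = \<bar>\<alpha> u w\<bar> / nrm u"
        using lin_funD(2)[OF bilinD(1)[OF bilin_form w] u(1), of "1 / nrm u"] pos by (simp add: abs_mult)
      also have "\<dots> \<le> B * nrm w / nrm u"
        using absb[OF w] pos by (simp add: divide_right_mono)
      also have "\<dots> = (B / nrm u) * nrm w" by simp
      also have "\<dots> \<le> 1 / real (Suc n) * nrm w"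
        by (rule mult_right_mono) (use u(4) pos w in \<open>auto simp: field_simps\<close>)
      finally show ?thesis .
    qed
    moreover have "nrm ((1 / nrm u) *\<^sub>R u) = 1" using pos u(1) by (simp add: nrm_scale)
    ultimately show ?thesis using u(1) by (intro bexI[of _ "(1 / nrm u) *\<^sub>R u"]) auto
  qed
  then obtain v where v: "\<And>n. v n \<in> V" "\<And>n. nrm (v n) = 1"
    "\<And>n w. w \<in> V \<Longrightarrow> \<bar>\<alpha> (v n) w\<bar> \<le> 1 / real (Suc n) * nrm w"
    by metis
  have "bounded (range (\<lambda>n. \<l> i (v n)))" if i: "i \<in> I" for i
  proof -
    obtain K where K: "0 \<le> K" "\<And>v. v \<in> V \<Longrightarrow> \<bar>\<l> i v\<bar> \<le> K * nrm v"
      by (rule bounded_funE[OF functional[OF i]]) (rule that)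
    then show ?thesis using v by (intro boundedI[of _ K]) (force)
  qed
  then obtain r where r: "strict_mono r" "\<forall>i\<in>I. convergent (\<lambda>n. \<l> i (v (r n)))"
    using finite_family_bounded_subseq[OF finite_I, of "\<lambda>i n. \<l> i (v n)"] by auto
  define d where "d = (\<lambda>m n. v (r m) - v (r n))"
  have d: "d m n \<in> V" for m n using v by (simp add: d_def)
  have r_le: "1 / real (Suc (r n)) \<le> 1 / real (Suc n)" for n
    using strict_mono_imp_increasing[OF r(1), of n] by (simp add: frac_le)
  have est: "c * (nrm (d m n))\<^sup>2 \<le> 2 * (1 / real (Suc m) + 1 / real (Suc n))
     + C * (\<Sum>i\<in>I. (\<l> i (v (r m)) - \<l> i (v (r n)))\<^sup>2)" for m n
  proof -
    have nd: "nrm (d m n) \<le> 2"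
      using nrm_diff_le[OF v(1) v(1), of "r m" "r n"] v(2) by (simp add: d_def)
    have "\<alpha> (d m n) (d m n) = \<alpha> (v (r m)) (d m n) - \<alpha> (v (r n)) (d m n)"
      using lin_fun_diff[OF bilinD(1)[OF bilin_form d] subspace v(1) v(1)] by (simp add: d_def)
    also have "\<dots> \<le> (1 / real (Suc (r m)) + 1 / real (Suc (r n))) * nrm (d m n)"
      using v(3)[OF d, of "r m" m n] v(3)[OF d, of "r n" m n] by (simp add: distrib_right)
    also have "\<dots> \<le> (1 / real (Suc m) + 1 / real (Suc n)) * 2"
      by (rule mult_mono) (use nd d r_le[of m] r_le[of n] in auto)
    finally have "\<alpha> (d m n) (d m n) \<le> 2 * (1 / real (Suc m) + 1 / real (Suc n))" by simp
    moreover have "\<l> i (d m n) = \<l> i (v (r m)) - \<l> i (v (r n))" if "i \<in> I" for i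
      using lin_fun_diff[OF _ subspace v(1) v(1)] functional[OF that] by (simp add: d_def bounded_fun_def)
    ultimately show ?thesis
      using garding[OF d, of m n] by (simp add: nrm_sq[OF d])
  qed
  have "\<exists>u\<in>V. (\<lambda>n. nrm (v (r n) - u)) \<longlonglongrightarrow> 0"
  proof (rule complete)
    show "v (r n) \<in> V" for n by (rule v)
    fix e :: real assume e: "0 < e"
    define \<eta> where "\<eta> = c * e\<^sup>2 / (8 * (1 + C * (1 + card I)))"
    have den: "0 < 1 + C * (1 + card I)" using C_nonneg by (simp add: add_pos_nonneg)
    have \<eta>: "0 < \<eta>" using c_pos e den by (simp add: \<eta>_def)
    have "\<exists>N. \<forall>m\<ge>N. \<forall>n\<ge>N. (\<l> i (v (r m)) - \<l> i (v (r n)))\<^sup>2 < \<eta>" if i: "i \<in> I" for i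
    proof -
      have "Cauchy (\<lambda>n. \<l> i (v (r n)))" using r(2) i by (simp add: convergent_Cauchy)
      then obtain N where "\<forall>m\<ge>N. \<forall>n\<ge>N. \<bar>\<l> i (v (r m)) - \<l> i (v (r n))\<bar> < sqrt \<eta>"
        using \<eta> unfolding Cauchy_def dist_real_def by (meson real_sqrt_gt_zero)
      then have "\<forall>m\<ge>N. \<forall>n\<ge>N. (\<l> i (v (r m)) - \<l> i (v (r n)))\<^sup>2 < \<eta>"
        using \<eta> real_less_rsqrt real_sqrt_abs by (metis abs_ge_zero less_eq_real_def power2_abs real_sqrt_less_iff)
      then show ?thesis by blast
    qed
    then obtain N where N: "\<And>i m n. i \<in> I \<Longrightarrow> N i \<le> m \<Longrightarrow> N i \<le> n \<Longrightarrow> (\<l> i (v (r m)) - \<l> i (v (r n)))\<^sup>2 < \<eta>"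
      by metis
    obtain N0 where N0: "1 / real (Suc N0) < \<eta>"
      using reals_Archimedean[OF \<eta>] by (auto simp: inverse_eq_divide)
    define N' where "N' = N0 + sum N I"
    have N': "N i \<le> N'" if "i \<in> I" for i
      using member_le_sum[of i I N] that finite_I by (simp add: N'_def)
    have inv: "1 / real (Suc m) < \<eta>" if "N' \<le> m" for m
    proof -
      have "1 / real (Suc m) \<le> 1 / real (Suc N0)" using that by (simp add: N'_def frac_le)
      then show ?thesis using N0 by simp
    qed
    have "nrm (v (r m) - v (r n)) < e" if "N' \<le> m" "N' \<le> n" for m n
    proof -
      have "(\<Sum>i\<in>I. (\<l> i (v (r m)) - \<l> i (v (r n)))\<^sup>2) \<le> (\<Sum>i\<in>I. \<eta>)"
        by (rule sum_mono) (use N N' that in \<open>meson le_trans less_imp_le\<close>)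
      then have "C * (\<Sum>i\<in>I. (\<l> i (v (r m)) - \<l> i (v (r n)))\<^sup>2) \<le> C * (card I * \<eta>)"
        using C_nonneg by (intro mult_left_mono) auto
      then have "c * (nrm (d m n))\<^sup>2 < 4 * \<eta> + C * (card I * \<eta>)"
        using est[of m n] inv[OF that(1)] inv[OF that(2)] by argo
      also have "\<dots> \<le> 8 * (1 + C * (1 + card I)) * \<eta>"
        using C_nonneg \<eta> by (simp add: algebra_simps)
      also have "\<dots> = c * e\<^sup>2"
        using den by (simp add: \<eta>_def)
      finally have "(nrm (d m n))\<^sup>2 < e\<^sup>2" using c_pos by simp
      then show ?thesis using e by (simp add: d_def power_less_imp_less_base)
    qed
    then show "\<exists>N. \<forall>m\<ge>N. \<forall>n\<ge>N. nrm (v (r m) - v (r n)) < e" by blast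
  qed
  then obtain u where u: "u \<in> V" "(\<lambda>n. nrm (v (r n) - u)) \<longlonglongrightarrow> 0" by blast
  have "\<alpha> u w = 0" if w: "w \<in> V" for w
  proof (rule LIMSEQ_unique)
    show "(\<lambda>n. \<alpha> (v (r n)) w) \<longlonglongrightarrow> \<alpha> u w"
      by (rule tendsto_bounded_lin_fun[OF _ _ v(1) u, of _ "M * nrm w"])
         (use bilinD[OF bilin_form] w form_bounded[OF _ w] in \<open>auto simp: mult.assoc mult.commute[of "nrm _" "nrm _"]\<close>)
    show "(\<lambda>n. \<alpha> (v (r n)) w) \<longlonglongrightarrow> 0"
    proof (rule Lim_null_comparison)
      show "\<forall>\<^sub>F n in sequentially. norm (\<alpha> (v (r n)) w) \<le> 1 / real (Suc n) * nrm w"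
      proof (intro always_eventually allI)
        fix n
        show "norm (\<alpha> (v (r n)) w) \<le> 1 / real (Suc n) * nrm w"
          using v(3)[OF w, of "r n"] mult_right_mono[OF r_le[of n] nrm_nonneg[OF w]] by simp
      qed
      show "(\<lambda>n. 1 / real (Suc n) * nrm w) \<longlonglongrightarrow> 0"
        by (rule tendsto_mult_left_zero) (rule inverse_Suc_tendsto_0)
    qed
  qed
  then have "nrm u = 0" using inj[OF u(1)] by (simp add: nrm_def)
  moreover have "\<bar>nrm (v (r n)) - nrm u\<bar> \<le> nrm (v (r n) - u)" for n
    by (rule nrm_diff_abs[OF v(1) u(1)])
  ultimately have "1 \<le> nrm (v (r n) - u)" for n using v(2) by (metis abs_one diff_zero)
  then have "1 \<le> (0::real)" using LIMSEQ_le_const[OF u(2)] by blast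
  then show False by simp
qed

text \<open>
  The form \<open>s = \<alpha> + C \<Sum>\<^sub>i \<l>\<^sub>i \<otimes> \<l>\<^sub>i\<close> is coercive, so \<open>s (\<rho> i) = \<l> i\<close> for some \<open>\<rho> i\<close>. If \<open>\<alpha> _ u = 0\<close>, testing with
  \<open>\<rho> j\<close> gives a square linear system for the numbers \<open>\<l> i u\<close>. A kernel element of the transposed matrix
  would yield \<open>z = \<Sum>\<^sub>j y\<^sub>j \<rho> j\<close> with \<open>\<alpha> z = 0\<close>, so injectivity in the first argument forces
  \<open>\<l> i u = 0\<close> for all \<open>i\<close>, and then coercivity of \<open>s\<close> forces \<open>u\<close> to vanish.
\<close>

lemma injective_transpose:
  assumes inj: "\<And>u. u \<in> V \<Longrightarrow> (\<And>v. v \<in> V \<Longrightarrow> \<alpha> u v = 0) \<Longrightarrow> ip u u = 0"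
    and u: "u \<in> V" "\<And>v. v \<in> V \<Longrightarrow> \<alpha> v u = 0"
  shows "ip u u = 0"
proof -
  define s where "s = (\<lambda>u v. \<alpha> u v + C * (\<Sum>i\<in>I. \<l> i u * \<l> i v))"
  have lin: "lin_fun V (\<l> i)" if "i \<in> I" for i
    using functional[OF that] by (simp add: bounded_fun_def)
  have s_eq: "\<alpha> u v = s u v - C * (\<Sum>i\<in>I. \<l> i u * \<l> i v)" for u v
    by (simp add: s_def)
  have bil: "bilin V s"
    using bilin_form lin_funD[OF lin]
    by (auto simp: s_def bilin_def lin_fun_def sum.distrib algebra_simps sum_distrib_left intro!: sum.cong)
  define K where "K = (\<lambda>i. SOME K. 0 \<le> K \<and> (\<forall>v\<in>V. \<bar>\<l> i v\<bar> \<le> K * nrm v))"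
  have K: "0 \<le> K i \<and> (\<forall>v\<in>V. \<bar>\<l> i v\<bar> \<le> K i * nrm v)" if "i \<in> I" for i
    unfolding K_def by (rule someI_ex) (meson bounded_funE functional that)
  have s_bounded: "\<bar>s u v\<bar> \<le> (M + C * (\<Sum>i\<in>I. K i * K i)) * nrm u * nrm v" if uv: "u \<in> V" "v \<in> V" for u v
  proof -
    have "\<bar>\<l> i u * \<l> i v\<bar> \<le> (K i * nrm u) * (K i * nrm v)" if "i \<in> I" for i
      unfolding abs_mult using K[OF that] uv by (intro mult_mono) auto
    then have "(\<Sum>i\<in>I. \<bar>\<l> i u * \<l> i v\<bar>) \<le> (\<Sum>i\<in>I. (K i * nrm u) * (K i * nrm v))"
      by (rule sum_mono)
    also have "\<dots> = (\<Sum>i\<in>I. K i * K i) * (nrm u * nrm v)"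
      unfolding sum_distrib_right by (rule sum.cong) auto
    finally have "\<bar>\<Sum>i\<in>I. \<l> i u * \<l> i v\<bar> \<le> (\<Sum>i\<in>I. K i * K i) * (nrm u * nrm v)"
      by (rule order_trans[OF sum_abs])
    then have "C * \<bar>\<Sum>i\<in>I. \<l> i u * \<l> i v\<bar> \<le> C * ((\<Sum>i\<in>I. K i * K i) * (nrm u * nrm v))"
      using C_nonneg by (rule mult_left_mono)
    moreover have "\<bar>s u v\<bar> \<le> \<bar>\<alpha> u v\<bar> + C * \<bar>\<Sum>i\<in>I. \<l> i u * \<l> i v\<bar>"
      using C_nonneg abs_triangle_ineq[of "\<alpha> u v" "C * (\<Sum>i\<in>I. \<l> i u * \<l> i v)"] by (simp add: s_def abs_mult)
    ultimately show ?thesis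
      using form_bounded[OF uv] by (simp add: algebra_simps)
  qed
  have s_coercive: "c * ip u u \<le> s u u" if "u \<in> V" for u
    using garding[OF that] by (simp add: s_def power2_eq_square)
  have "\<exists>r\<in>V. \<forall>w\<in>V. s r w = \<l> i w" if "i \<in> I" for i
    by (rule lax_milgram[OF bil s_bounded c_pos s_coercive functional[OF that]])
  then obtain \<rho> where \<rho>: "\<And>i. i \<in> I \<Longrightarrow> \<rho> i \<in> V" "\<And>i w. i \<in> I \<Longrightarrow> w \<in> V \<Longrightarrow> s (\<rho> i) w = \<l> i w"
    by metis
  define Q where "Q = (\<lambda>j i. (if i = j then 1 else 0) - C * \<l> i (\<rho> j))"
  have lu0: "\<l> i u = 0" if i: "i \<in> I" for i
  proof (rule square_system_injective_transpose[OF finite_I _ _ i, of Q])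
    fix j assume j: "j \<in> I"
    have "s (\<rho> j) u = C * (\<Sum>i\<in>I. \<l> i (\<rho> j) * \<l> i u)"
      using u(2)[OF \<rho>(1)[OF j]] by (simp add: s_def)
    then have "\<l> j u = C * (\<Sum>i\<in>I. \<l> i (\<rho> j) * \<l> i u)" using \<rho>(2)[OF j u(1)] by simp
    moreover have "(\<Sum>i\<in>I. (if i = j then 1 else 0) * \<l> i u) = \<l> j u"
      using finite_I j by (simp add: if_distrib[of "\<lambda>x. x * _"] cong: if_cong)
    ultimately show "(\<Sum>i\<in>I. Q j i * \<l> i u) = 0"
      by (simp add: Q_def left_diff_distrib sum_subtractf sum_distrib_left mult.assoc)
  next
    fix y assume y: "\<And>i. i \<in> I \<Longrightarrow> (\<Sum>j\<in>I. y j * Q j i) = 0"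
    define z where "z = (\<Sum>j\<in>I. y j *\<^sub>R \<rho> j)"
    have z: "z \<in> V" unfolding z_def by (intro subspace_sum[OF subspace]) (use \<rho> in auto)
    have lz: "C * \<l> i z = y i" if i: "i \<in> I" for i
    proof -
      have "(\<Sum>j\<in>I. y j * (if i = j then 1 else 0)) = y i"
        using finite_I i by (simp add: if_distrib[of "\<lambda>x. _ * x"] cong: if_cong)
      then show ?thesis
        using y[OF i] lin_fun_sum[OF lin[OF i] subspace, of I \<rho> y] \<rho>(1)
        by (simp add: Q_def right_diff_distrib sum_subtractf z_def sum_distrib_left mult.left_commute)
    qed
    have "\<alpha> z w = 0" if w: "w \<in> V" for w
    proof -
      have "s z w = (\<Sum>j\<in>I. y j * \<l> j w)"
        using lin_fun_sum[OF bilinD(1)[OF bil w] subspace, of I \<rho> y] \<rho> w by (simp add: z_def)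
      also have "\<dots> = (\<Sum>j\<in>I. C * \<l> j z * \<l> j w)"
        by (rule sum.cong) (use lz in auto)
      finally show ?thesis using s_eq[of z w] by (simp add: sum_distrib_left mult.assoc)
    qed
    then have "nrm z = 0" using inj[OF z] by (simp add: nrm_def)
    then have "\<l> i z = 0" if "i \<in> I" for i using K[OF that] z by force
    then show "\<forall>j\<in>I. y j = 0" using lz by force
  qed
  have "s u u = 0" using u lu0 by (simp add: s_def)
  then have "c * ip u u \<le> 0" using s_coercive[OF u(1)] by simp
  then show ?thesis using c_pos nonneg[OF u(1)] by (simp add: mult_le_0_iff)
qed

end

section \<open>Smooth functions and test functions\<close>

definition grad :: "(real^'n::finite \<Rightarrow> real) \<Rightarrow> real^'n \<Rightarrow> real^'n" where
  "grad f x = (\<chi> i. pderiv_dir i f x)"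

lemma grad_nth [simp]: "grad f x $ i = pderiv_dir i f x"
  by (simp add: grad_def)

lemma has_derivative_grad:
  fixes f :: "real^'n::finite \<Rightarrow> real"
  assumes "f differentiable (at x)"
  shows "(f has_derivative (\<lambda>h. grad f x \<bullet> h)) (at x)"
proof -
  let ?D = "frechet_derivative f (at x)"
  have D: "(f has_derivative ?D) (at x)"
    using assms by (simp add: frechet_derivative_works)
  have lin: "linear ?D" by (rule linear_frechet_derivative[OF assms])
  have "?D h = grad f x \<bullet> h" for h
  proof -
    have "h = (\<Sum>i\<in>UNIV. (h $ i) *\<^sub>R axis i 1)"
      by (simp add: vec_eq_iff axis_def if_distrib cong: if_cong)
    then have "?D h = ?D (\<Sum>i\<in>UNIV. (h $ i) *\<^sub>R axis i 1)" by simp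
    also have "\<dots> = (\<Sum>i\<in>UNIV. (h $ i) * ?D (axis i 1))"
      by (simp add: linear_sum[OF lin] linear_scale[OF lin])
    finally show ?thesis
      by (simp add: inner_vec_def pderiv_dir_def mult.commute)
  qed
  then have "?D = (\<lambda>h. grad f x \<bullet> h)" by auto
  then show ?thesis using D by simp
qed

lemma pderiv_dirI: "(f has_derivative D) (at x) \<Longrightarrow> pderiv_dir i f x = D (axis i 1)"
  using frechet_derivative_at by (metis pderiv_dir_def)

lemma Ck_Suc_imp_Ck: "Ck (Suc k) f \<Longrightarrow> Ck k f"
proof (induction k arbitrary: f)
  case 0
  then show ?case
    by (auto simp: continuous_on_eq_continuous_at differentiable_imp_continuous_within)
qed auto

lemma Ck_const: "Ck k (\<lambda>x::real^'n::finite. c)"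
proof (induction k arbitrary: c)
  case (Suc k)
  have "pderiv_dir i (\<lambda>x::real^'n. c) = (\<lambda>x. 0)" for i
    by (auto intro!: pderiv_dirI)
  then show ?case using Suc by simp
qed simp

lemma Ck_add: "Ck k f \<Longrightarrow> Ck k g \<Longrightarrow> Ck k (\<lambda>x. f x + g x)"
proof (induction k arbitrary: f g)
  case 0 then show ?case by (auto intro: continuous_on_add)
next
  case (Suc k)
  have "pderiv_dir i (\<lambda>x. f x + g x) = (\<lambda>x. pderiv_dir i f x + pderiv_dir i g x)" for i
    by (rule ext, rule trans[OF pderiv_dirI[OF has_derivative_add[OF has_derivative_grad has_derivative_grad]]])
       (use Suc.prems in \<open>auto simp: inner_axis\<close>)
  then show ?case using Suc by (simp add: differentiable_add)
qed

lemma Ck_mult: "Ck k f \<Longrightarrow> Ck k g \<Longrightarrow> Ck k (\<lambda>x. f x * g x)"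
proof (induction k arbitrary: f g)
  case 0 then show ?case by (auto intro: continuous_on_mult)
next
  case (Suc k)
  have "pderiv_dir i (\<lambda>x. f x * g x) = (\<lambda>x. f x * pderiv_dir i g x + pderiv_dir i f x * g x)" for i
    by (rule ext, rule trans[OF pderiv_dirI[OF has_derivative_mult[OF has_derivative_grad has_derivative_grad]]])
       (use Suc.prems in \<open>auto simp: inner_axis\<close>)
  moreover have "Ck k (\<lambda>x. f x * pderiv_dir i g x + pderiv_dir i f x * g x)" for i
    using Suc.prems Ck_Suc_imp_Ck[OF Suc.prems(1)] Ck_Suc_imp_Ck[OF Suc.prems(2)]
    by (intro Ck_add Suc.IH) auto
  ultimately show ?case using Suc.prems by (simp add: differentiable_mult)
qed

lemma Ck_prod: "(\<And>j. j \<in> J \<Longrightarrow> Ck k (f j)) \<Longrightarrow> Ck k (\<lambda>x::real^'n::finite. \<Prod>j\<in>J. f j x)"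
  by (induction J rule: infinite_finite_induct) (auto intro: Ck_const Ck_mult)

lemma smooth_const: "smooth (\<lambda>x. c)"
  and smooth_add: "smooth f \<Longrightarrow> smooth g \<Longrightarrow> smooth (\<lambda>x. f x + g x)"
  and smooth_mult: "smooth f \<Longrightarrow> smooth g \<Longrightarrow> smooth (\<lambda>x. f x * g x)"
  by (auto simp: smooth_def intro: Ck_const Ck_add Ck_mult)

lemma smooth_differentiable: "smooth f \<Longrightarrow> f differentiable (at x)"
  unfolding smooth_def by (metis Ck.simps(2))

lemma smooth_has_derivative: "smooth f \<Longrightarrow> (f has_derivative (\<lambda>h. grad f x \<bullet> h)) (at x)"
  by (intro has_derivative_grad smooth_differentiable)

lemma smooth_pderiv: "smooth f \<Longrightarrow> smooth (pderiv_dir i f)"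
  unfolding smooth_def by (metis Ck.simps(2))

lemma smooth_continuous: "smooth f \<Longrightarrow> continuous_on S f"
  unfolding smooth_def using Ck.simps(1) continuous_on_subset by blast

lemma continuous_grad: "smooth f \<Longrightarrow> continuous_on S (grad f)"
  unfolding grad_def by (intro continuous_intros smooth_continuous smooth_pderiv)

lemma grad_add: "smooth f \<Longrightarrow> smooth g \<Longrightarrow> grad (\<lambda>x. f x + g x) x = grad f x + grad g x"
  and grad_cmult: "smooth f \<Longrightarrow> grad (\<lambda>x. c * f x) x = c *\<^sub>R grad f x"
  and grad_mult: "smooth f \<Longrightarrow> smooth g \<Longrightarrow> grad (\<lambda>x. f x * g x) x = f x *\<^sub>R grad g x + g x *\<^sub>R grad f x"
  and grad_const: "grad (\<lambda>x. c) x = 0"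
proof -
  show "grad (\<lambda>x. f x + g x) x = grad f x + grad g x" if "smooth f" "smooth g"
    using pderiv_dirI[OF has_derivative_add[OF that[THEN smooth_has_derivative]]] by (simp add: vec_eq_iff inner_axis)
  show "grad (\<lambda>x. c * f x) x = c *\<^sub>R grad f x" if "smooth f"
    using pderiv_dirI[OF has_derivative_mult_right[OF smooth_has_derivative[OF that]]] by (simp add: vec_eq_iff inner_axis)
  show "grad (\<lambda>x. f x * g x) x = f x *\<^sub>R grad g x + g x *\<^sub>R grad f x" if "smooth f" "smooth g"
    using pderiv_dirI[OF has_derivative_mult[OF that[THEN smooth_has_derivative]]] by (simp add: vec_eq_iff inner_axis)
  show "grad (\<lambda>x. c) x = 0"
    by (simp add: vec_eq_iff pderiv_dirI[OF has_derivative_const])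
qed

text \<open>
  The functions \<open>exp (- 1 / t) / t ^ k\<close>, extended by zero; they are closed under differentiation up to linear
  combinations, which makes smoothness an easy induction.
\<close>

definition flat :: "nat \<Rightarrow> real \<Rightarrow> real" where
  "flat k t = (if t \<le> 0 then 0 else exp (- 1 / t) / t ^ k)"

lemma flat_tendsto_0: "(flat k \<longlongrightarrow> 0) (at 0)"
proof -
  have "((\<lambda>t. flat k t) \<longlongrightarrow> 0) (at_right 0)"
  proof (rule Lim_transform_eventually)
    show "((\<lambda>t::real. inverse t ^ k / exp (inverse t)) \<longlongrightarrow> 0) (at_right 0)"
      by (rule filterlim_compose[OF tendsto_power_div_exp_0 filterlim_inverse_at_top_right])
    show "\<forall>\<^sub>F t::real in at_right 0. inverse t ^ k / exp (inverse t) = flat k t"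
      unfolding eventually_at_right_field
      by (intro exI[of _ 1]) (auto simp: flat_def exp_minus field_simps)
  qed
  moreover have "((\<lambda>t. flat k t) \<longlongrightarrow> 0) (at_left 0)"
  proof (rule Lim_transform_eventually)
    show "((\<lambda>t::real. 0::real) \<longlongrightarrow> 0) (at_left 0)" by simp
    show "\<forall>\<^sub>F t::real in at_left 0. 0 = flat k t"
      unfolding eventually_at_left_field
      by (intro exI[of _ "-1"]) (auto simp: flat_def)
  qed
  ultimately show ?thesis by (simp add: filterlim_split_at)
qed

lemma flat_DERIV: "(flat k has_real_derivative (flat (k + 2) t - k * flat (k + 1) t)) (at t)"
proof -
  consider "t < 0" | "t = 0" | "0 < t" by linarith
  then show ?thesis
  proof cases
    case 1
    have "((\<lambda>_. 0) has_real_derivative 0) (at t)" by simp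
    then have "(flat k has_real_derivative 0) (at t)"
      by (rule has_field_derivative_transform_within_open[of _ _ _ "{..<0}"]) (use 1 in \<open>auto simp: flat_def\<close>)
    then show ?thesis using 1 by (simp add: flat_def)
  next
    case 2
    have "((\<lambda>h. (flat k (0 + h) - flat k 0) / h) \<longlongrightarrow> 0) (at 0)"
    proof (rule Lim_transform_eventually[OF flat_tendsto_0[of "k + 1"]])
      show "\<forall>\<^sub>F h in at 0. flat (k + 1) h = (flat k (0 + h) - flat k 0) / h"
        by (rule always_eventually) (auto simp: flat_def)
    qed
    then show ?thesis using 2 by (simp add: DERIV_def flat_def)
  next
    case 3
    have pk: "real k * t ^ (k - Suc 0) = real k * t ^ k / t"
      using 3 by (cases k) auto
    have "((\<lambda>t. exp (- 1 / t) / t ^ k) has_real_derivative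
      ((exp (- 1 / t) * (1 / (t * t))) * t ^ k - exp (- 1 / t) * (real k * t ^ (k - Suc 0))) / (t ^ k * t ^ k)) (at t)"
      using 3 by (auto intro!: derivative_eq_intros)
    also have "((exp (- 1 / t) * (1 / (t * t))) * t ^ k - exp (- 1 / t) * (real k * t ^ (k - Suc 0))) / (t ^ k * t ^ k)
       = flat (k + 2) t - k * flat (k + 1) t"
      unfolding pk using 3 by (simp add: flat_def field_simps)
    finally show ?thesis
      by (rule has_field_derivative_transform_within_open[of _ _ _ "{0<..}"]) (use 3 in \<open>auto simp: flat_def\<close>)
  qed
qed

lemma Ck_flat: "Ck m (\<lambda>x::real^'n::finite. flat k (s * x $ j + q))"
proof (induction m arbitrary: k)
  have D: "((\<lambda>x::real^'n. flat k (s * x $ j + q)) has_derivative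
     (\<lambda>h. (flat (k + 2) (s * x $ j + q) - k * flat (k + 1) (s * x $ j + q)) * (s * h $ j))) (at x)" for x k
  proof -
    have 1: "((\<lambda>x::real^'n. s * x $ j + q) has_derivative (\<lambda>h. s * h $ j)) (at x)"
      by (auto intro!: derivative_eq_intros bounded_linear_imp_has_derivative bounded_linear_vec_nth)
    show ?thesis
      using has_derivative_compose[OF 1 flat_DERIV[THEN has_field_derivative_imp_has_derivative]] by simp
  qed
  have alg: "(a - k * b) * (s * c) = (s * c) * a + (- (k * s * c)) * b" for a b c k :: real
    by (simp add: algebra_simps)
  {
    case 0
    show ?case
      by (auto simp: continuous_on_eq_continuous_at intro: has_derivative_continuous[OF D])
  next
    case (Suc m)
    have eq: "pderiv_dir i (\<lambda>x::real^'n. flat k (s * x $ j + q)) =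
      (\<lambda>x. (s * axis i 1 $ j) * flat (k + 2) (s * x $ j + q)
         + (- (k * s * axis i 1 $ j)) * flat (k + 1) (s * x $ j + q))" for i
      by (rule ext, rule trans[OF pderiv_dirI[OF D]]) (rule alg)
    have "Ck m (pderiv_dir i (\<lambda>x::real^'n. flat k (s * x $ j + q)))" for i
      unfolding eq by (intro Ck_add Ck_mult Ck_const Suc)
    then show ?case
      using D[of k] unfolding Ck.simps differentiable_def by blast
  }
qed

text \<open>
  Smooth functions supported in the box from \<open>a\<close> to \<open>b\<close> that increase to its indicator as \<open>m\<close> grows.
\<close>

definition bump :: "real^'n::finite \<Rightarrow> real^'n \<Rightarrow> nat \<Rightarrow> real^'n \<Rightarrow> real" where
  "bump a b m x = (\<Prod>j\<in>UNIV. flat 0 (real m * (x $ j - a $ j)) * flat 0 (real m * (b $ j - x $ j)))"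

lemma bump_smooth: "smooth (bump a b m)"
proof -
  have "Ck k (\<lambda>x. flat 0 (real m * x $ j + (- real m * a $ j)) * flat 0 ((- real m) * x $ j + real m * b $ j))" for k j
    by (intro Ck_mult Ck_flat)
  then show ?thesis
    unfolding smooth_def bump_def by (intro allI Ck_prod) (simp add: algebra_simps)
qed

lemma flat0_bounds: "0 \<le> flat 0 t" "flat 0 t \<le> 1"
  by (auto simp: flat_def)

lemma bump_bounds: "0 \<le> bump a b m x" "bump a b m x \<le> 1"
  unfolding bump_def using flat0_bounds
  by (auto intro!: prod_nonneg prod_le_1 mult_le_one)

lemma bump_eq_0:
  assumes "x \<notin> box a b" shows "bump a b m x = 0"
proof -
  obtain j where "x $ j \<le> a $ j \<or> b $ j \<le> x $ j"
    using assms by (auto simp: mem_box_cart not_less)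
  then have "flat 0 (real m * (x $ j - a $ j)) * flat 0 (real m * (b $ j - x $ j)) = 0"
    by (auto simp: flat_def mult_le_0_iff)
  then show ?thesis unfolding bump_def by (meson UNIV_I finite prod_zero)
qed

lemma bump_test_function:
  assumes "cbox a b \<subseteq> \<Omega>" shows "bump a b m \<in> test_functions \<Omega>"
proof -
  have "{x. bump a b m x \<noteq> 0} \<subseteq> cbox a b"
    using bump_eq_0 box_subset_cbox by blast
  then have cl: "closure {x. bump a b m x \<noteq> 0} \<subseteq> cbox a b"
    by (rule closure_minimal) (rule closed_cbox)
  then have "compact (closure {x. bump a b m x \<noteq> 0})"
    by (meson bounded_cbox bounded_subset closed_closure compact_eq_bounded_closed)
  then show ?thesis
    using cl assms bump_smooth by (auto simp: test_functions_def)
qed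

lemma bump_tendsto_indicator: "(\<lambda>m. bump a b m x) \<longlonglongrightarrow> indicator (box a b) x"
proof (cases "x \<in> box a b")
  case True
  have lim: "(\<lambda>m. flat 0 (real m * t)) \<longlonglongrightarrow> 1" if "0 < t" for t
  proof (rule Lim_transform_eventually)
    have "(\<lambda>m. exp (- (1 / t) * (1 / real m))) \<longlonglongrightarrow> exp (- (1 / t) * 0)"
      by (intro tendsto_intros lim_1_over_n)
    then show "(\<lambda>m. exp (- (1 / t) * (1 / real m))) \<longlonglongrightarrow> 1" by simp
    show "\<forall>\<^sub>F m in sequentially. exp (- (1 / t) * (1 / real m)) = flat 0 (real m * t)"
      using eventually_gt_at_top[of 0]
      by eventually_elim (use that in \<open>auto simp: flat_def mult_le_0_iff\<close>)
  qed
  have "(\<lambda>m. bump a b m x) \<longlonglongrightarrow> (\<Prod>j\<in>(UNIV::'a set). 1 * 1)"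
    unfolding bump_def by (intro tendsto_prod tendsto_mult lim) (use True in \<open>auto simp: mem_box_cart\<close>)
  then show ?thesis using True by simp
qed (simp add: bump_eq_0)

text \<open>
  Boxes form an intersection-stable generator of the Borel sets.
\<close>

lemma AE_zero_if_box_integrals_zero:
  fixes F :: "'a::euclidean_space \<Rightarrow> real"
  assumes F: "integrable lborel F" and boxes: "\<And>a b. (LINT x:box a b|lborel. F x) = 0"
  shows "AE x in lborel. F x = 0"
proof -
  have si: "set_integrable lborel A F" if "A \<in> sets borel" for A
    unfolding set_integrable_def using F that by (intro integrable_mult_indicator) auto
  have sb: "sets (borel :: 'a measure) = sigma_sets UNIV (range (\<lambda>(a, b). box a b))"
    by (simp add: borel_eq_box)
  have UNIV0: "(LINT x:UNIV|lborel. F x) = 0"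
  proof -
    let ?A = "\<lambda>n::nat. box (- (real n *\<^sub>R One)) (real n *\<^sub>R One) :: 'a set"
    have "(\<lambda>n. LINT x:?A n|lborel. F x) \<longlonglongrightarrow> (LINT x:(\<Union>n. ?A n)|lborel. F x)"
    proof (rule set_integral_cont_up)
      show "incseq ?A"
        by (intro incseq_SucI subset_box_imp) (auto simp: algebra_simps)
      show "set_integrable lborel (\<Union>n. ?A n) F" by (rule si) auto
    qed auto
    then have "(\<lambda>n::nat. 0) \<longlonglongrightarrow> (LINT x:UNIV|lborel. F x)"
      by (simp add: boxes UN_box_eq_UNIV)
    then show ?thesis by (simp add: LIMSEQ_const_iff)
  qed
  have int: "Int_stable (range (\<lambda>(a, b). box a b :: 'a set))"
    by (auto simp: Int_stable_def box_Int_box)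
  have sub: "range (\<lambda>(a, b). box a b :: 'a set) \<subseteq> Pow UNIV" by simp
  have "(LINT x:A|lborel. F x) = 0" if A: "A \<in> sigma_sets UNIV (range (\<lambda>(a, b). box a b))" for A
    using int sub A
  proof (induction rule: sigma_sets_induct_disjoint)
    case (compl A)
    have A: "A \<in> sets borel" using compl(1) sb by blast
    have "(LINT x:UNIV|lborel. F x) = (LINT x:A \<union> (UNIV - A)|lborel. F x)" by simp
    also have "\<dots> = (LINT x:A|lborel. F x) + (LINT x:UNIV - A|lborel. F x)"
      by (rule set_integral_Un) (use A si in auto)
    finally show ?case using UNIV0 compl by simp
  next
    case (union A)
    have A: "A i \<in> sets borel" for i using union(2) sb by blast
    have "(LINT x:(\<Union>i. A i)|lborel. F x) = (\<Sum>i. LINT x:A i|lborel. F x)"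
      by (rule lebesgue_integral_countable_add)
         (use A si union(1) in \<open>auto simp: disjoint_family_on_def\<close>)
    then show ?case using union(3) by simp
    next
    case empty
    show ?case by (simp add: set_lebesgue_integral_def)
  qed (auto simp: boxes)
  then have "(LINT x:A|lborel. F x) = (LINT x:A|lborel. 0)" if "A \<in> sets lborel" for A
    using that sb by simp
  then show ?thesis
    by (intro density_unique_real) (use F in auto)
qed

lemma L2_mult_bounded_integrable:
  fixes f :: "real^'n::finite \<Rightarrow> 'b::euclidean_space"
  assumes f: "f \<in> L2 \<Omega>" and S: "S \<in> lmeasurable" "S \<subseteq> \<Omega>" and \<Omega>: "\<Omega> \<in> sets lebesgue"
  shows "integrable (lebesgue_on \<Omega>) (\<lambda>x. indicator S x *\<^sub>R f x)"
proof (rule Bochner_Integration.integrable_bound)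
  have Sm: "S \<in> sets (lebesgue_on \<Omega>)"
    using S \<Omega> by (auto simp: sets_restrict_space_iff fmeasurableD)
  have "integrable (lebesgue_on \<Omega>) (indicator S :: _ \<Rightarrow> real)"
    using S \<Omega> fmeasurableD2[OF S(1)]
    by (intro integrable_real_indicator Sm) (simp add: emeasure_restrict_space less_top)
  then show "integrable (lebesgue_on \<Omega>) (\<lambda>x. indicator S x + (norm (f x))\<^sup>2)"
    using f by (simp add: L2_def)
  show "(\<lambda>x. indicator S x *\<^sub>R f x) \<in> borel_measurable (lebesgue_on \<Omega>)"
    using f Sm by (auto simp: L2_def intro!: borel_measurable_scaleR)
  have "\<bar>indicator S x\<bar> * norm (f x) \<le> \<bar>indicator S x + (norm (f x))\<^sup>2\<bar>" for x
  proof (cases "x \<in> S")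
    case True
    have "0 \<le> (norm (f x) - 1)\<^sup>2" by simp
    then have "2 * norm (f x) \<le> 1 + (norm (f x))\<^sup>2" by (simp add: power2_diff)
    then have "norm (f x) \<le> 1 + (norm (f x))\<^sup>2" using norm_ge_zero[of "f x"] by linarith
    then show ?thesis using True by simp
  qed simp
  then show "AE x in lebesgue_on \<Omega>. norm (indicator S x *\<^sub>R f x) \<le> norm (indicator S x + (norm (f x))\<^sup>2)"
    by simp
qed

text \<open>
  Approximating indicators of boxes by \<open>bump\<close> shows that the integral over every box inside the domain
  vanishes. An open set is a countable union of such boxes.
\<close>

lemma zero_if_orthogonal_to_test_functions:
  fixes f :: "real^'n::finite \<Rightarrow> real"
  assumes f: "f \<in> L2 \<Omega>" and \<Omega>: "open \<Omega>"
    and orth: "\<And>\<phi>. \<phi> \<in> test_functions \<Omega> \<Longrightarrow> (LINT x|lebesgue_on \<Omega>. f x * \<phi> x) = 0"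
  shows "AE x in lebesgue_on \<Omega>. f x = 0"
proof -
  have \<Omega>s: "\<Omega> \<in> sets lebesgue" using \<Omega> by (simp add: borel_open)
  have box0: "(LINT x|lebesgue_on \<Omega>. indicator (box a b) x * f x) = 0" if ab: "cbox a b \<subseteq> \<Omega>" for a b
  proof -
    have "(\<lambda>m. LINT x|lebesgue_on \<Omega>. bump a b m x * f x) \<longlonglongrightarrow> (LINT x|lebesgue_on \<Omega>. indicator (box a b) x * f x)"
    proof (rule integral_dominated_convergence)
      have fm: "f \<in> borel_measurable (lebesgue_on \<Omega>)" using f by (simp add: L2_def)
      have bm: "bump a b m \<in> borel_measurable (lebesgue_on \<Omega>)" for m
        using smooth_continuous[OF bump_smooth] \<Omega>s by (rule continuous_imp_measurable_on_sets_lebesgue)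
      show "(\<lambda>x. bump a b m x * f x) \<in> borel_measurable (lebesgue_on \<Omega>)" for m
        using bm fm by (rule borel_measurable_times)
      have "box a b \<subseteq> \<Omega>" using ab box_subset_cbox by blast
      then have "indicator (box a b) \<in> borel_measurable (lebesgue_on \<Omega>)"
        using \<Omega>s by (intro borel_measurable_indicator) (auto simp: sets_restrict_space_iff)
      then show "(\<lambda>x. indicator (box a b) x * f x) \<in> borel_measurable (lebesgue_on \<Omega>)"
        using fm by (rule borel_measurable_times)
      show "integrable (lebesgue_on \<Omega>) (\<lambda>x. norm (indicator (cbox a b) x *\<^sub>R f x))"
        using L2_mult_bounded_integrable[OF f _ ab \<Omega>s] by (intro integrable_norm) simp
      show "AE x in lebesgue_on \<Omega>. (\<lambda>m. bump a b m x * f x) \<longlonglongrightarrow> indicator (box a b) x * f x"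
        by (intro AE_I2 tendsto_mult bump_tendsto_indicator tendsto_const)
      show "AE x in lebesgue_on \<Omega>. norm (bump a b m x * f x) \<le> norm (indicator (cbox a b) x *\<^sub>R f x)" for m
      proof (intro AE_I2)
        fix x
        show "norm (bump a b m x * f x) \<le> norm (indicator (cbox a b) x *\<^sub>R f x)"
        proof (cases "x \<in> box a b")
          case True
          then have "x \<in> cbox a b" using box_subset_cbox by blast
          then show ?thesis
            using bump_bounds[of a b m x] by (simp add: abs_mult mult_left_le_one_le)
        qed (simp add: bump_eq_0)
      qed
    qed
    moreover have "(LINT x|lebesgue_on \<Omega>. bump a b m x * f x) = 0" for m
      using orth[OF bump_test_function[OF ab], of m] by (simp add: mult.commute)
    ultimately show ?thesis by (simp add: LIMSEQ_const_iff)
  qed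
  define F where "F = (\<lambda>x. if x \<in> \<Omega> then f x else 0)"
  have "F \<in> borel_measurable lebesgue"
    unfolding F_def using f \<Omega>s by (simp add: L2_def borel_measurable_if)
  then obtain F' where F': "F' \<in> borel_measurable lborel" "AE x in lborel. F x = F' x"
    using completion_ex_borel_measurable_real by blast
  have AE_box: "AE x in lborel. x \<in> box a b \<longrightarrow> F' x = 0" if ab: "cbox a b \<subseteq> \<Omega>" for a b
  proof -
    define G where "G = (\<lambda>x. indicator (box a b) x * F' x)"
    have Gm: "G \<in> borel_measurable lborel" unfolding G_def using F'(1) by measurable
    have red: "integrable lborel (\<lambda>x. indicator S x * F' x) \<and>
        (LINT x|lborel. indicator S x * F' x) = (LINT x|lebesgue_on \<Omega>. indicator S x * f x)"
      if S: "S \<in> sets borel" "S \<subseteq> cbox a b" for S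
    proof -
      have SF: "(\<lambda>x. indicator S x * F' x) \<in> borel_measurable lborel"
        using F'(1) S(1) by measurable
      have "integrable (lebesgue_on \<Omega>) (\<lambda>x. indicator S x *\<^sub>R f x)"
        by (rule L2_mult_bounded_integrable[OF f _ _ \<Omega>s])
           (use S ab in \<open>auto intro: bounded_set_imp_lmeasurable[OF bounded_subset[OF bounded_cbox]]\<close>)
      then have i1: "integrable lebesgue (\<lambda>x. indicator \<Omega> x *\<^sub>R (indicator S x * f x))"
        using \<Omega>s by (simp add: integrable_restrict_space)
      have ae: "AE x in lebesgue. indicator \<Omega> x *\<^sub>R (indicator S x * f x) = indicator S x * F' x"
        using AE_completion[OF F'(2)]
        by eventually_elim (use S ab in \<open>auto simp: F_def indicator_def\<close>)
      have m: "(\<lambda>x. indicator S x * F' x) \<in> borel_measurable lebesgue"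
        using SF by (rule measurable_completion)
      have i2: "integrable lebesgue (\<lambda>x. indicator S x * F' x)"
        by (rule integrable_cong_AE_imp[OF i1 m ae])
      have "(LINT x|lebesgue_on \<Omega>. indicator S x * f x) = (LINT x|lebesgue. indicator \<Omega> x *\<^sub>R (indicator S x * f x))"
        using \<Omega>s by (simp add: integral_restrict_space)
      also have "\<dots> = (LINT x|lebesgue. indicator S x * F' x)"
        using i1 by (intro integral_cong_AE m ae) (rule borel_measurable_integrable)
      also have "\<dots> = (LINT x|lborel. indicator S x * F' x)"
        by (rule integral_completion[OF SF])
      finally show ?thesis using i2 integrable_completion[OF SF] by simp
    qed
    have "AE x in lborel. G x = 0"
    proof (rule AE_zero_if_box_integrals_zero)
      show "integrable lborel G" using red[OF _ box_subset_cbox] by (simp add: G_def)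
      fix c d
      obtain u v where uv: "box c d \<inter> box a b = box u v" 
        unfolding box_Int_box by blast
      have "cbox u v \<subseteq> \<Omega>" if "box u v \<noteq> {}"
      proof -
        have "closure (box u v) \<subseteq> closure (box a b)" using uv by (intro closure_mono) blast
        moreover have "closure (box a b) \<subseteq> cbox a b"
          by (rule closure_minimal[OF box_subset_cbox closed_cbox])
        ultimately show ?thesis using ab closure_box[OF that] by blast
      qed
      then have "(LINT x|lebesgue_on \<Omega>. indicator (box u v) x * f x) = 0"
        using box0 by (cases "box u v = {}") auto
      moreover have "box u v \<subseteq> cbox a b" using uv box_subset_cbox by blast
      ultimately have "(LINT x|lborel. indicator (box u v) x * F' x) = 0"
        using red[of "box u v"] by simp
      moreover have "(LINT x:box c d|lborel. G x) = (LINT x|lborel. indicator (box u v) x * F' x)"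
        unfolding set_lebesgue_integral_def G_def uv[symmetric]
        by (rule Bochner_Integration.integral_cong) (auto simp: indicator_def)
      ultimately show "(LINT x:box c d|lborel. G x) = 0" by simp
    qed
    then show ?thesis by eventually_elim (auto simp: G_def)
  qed
  obtain D where D: "countable D" "D \<subseteq> Pow \<Omega>" "\<And>X. X \<in> D \<Longrightarrow> \<exists>a b. X = cbox a b" "\<Union>D = \<Omega>"
    using open_countable_Union_open_cbox[OF \<Omega>] by metis
  have "AE x in lborel. x \<in> X \<longrightarrow> F' x = 0" if X: "X \<in> D" for X
  proof -
    obtain a b where ab: "X = cbox a b" using D(3)[OF X] by blast
    have "negligible (cbox a b - box a b)" by (rule negligible_frontier_interval)
    then have "cbox a b - box a b \<in> null_sets lborel"
      by (simp add: negligible_iff_null_sets null_sets_completion_iff)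
    then have "AE x in lborel. x \<notin> cbox a b - box a b" by (rule AE_not_in)
    moreover have "AE x in lborel. x \<in> box a b \<longrightarrow> F' x = 0"
      using AE_box D(2) X ab by blast
    ultimately show ?thesis by eventually_elim (use ab in auto)
  qed
  then have "AE x in lborel. \<forall>X\<in>D. x \<in> X \<longrightarrow> F' x = 0"
    unfolding AE_ball_countable[OF D(1)] by blast
  then have "AE x in lborel. x \<in> \<Omega> \<longrightarrow> f x = 0"
    using F'(2)
  proof eventually_elim
    case (elim x)
    show ?case
    proof
      assume x: "x \<in> \<Omega>"
      then obtain X where "X \<in> D" "x \<in> X" using D(4) by blast
      then show "f x = 0" using elim x by (auto simp: F_def)
    qed
  qed
  then have "AE x in lebesgue. x \<in> \<Omega> \<longrightarrow> f x = 0" by (rule AE_completion)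
  then show ?thesis using \<Omega>s by (simp add: AE_restrict_space_iff)
qed

section \<open>Square-integrable functions\<close>

lemma L2_measurable: "f \<in> L2 \<Omega> \<Longrightarrow> f \<in> borel_measurable (lebesgue_on \<Omega>)"
  by (simp add: L2_def)

lemma L2_bound:
  fixes f :: "real^'n::finite \<Rightarrow> 'b::euclidean_space" and g :: "real^'n::finite \<Rightarrow> 'c::euclidean_space"
  assumes f: "f \<in> L2 \<Omega>" and g: "g \<in> borel_measurable (lebesgue_on \<Omega>)"
    and b: "AE x in lebesgue_on \<Omega>. norm (g x) \<le> K * norm (f x)"
  shows "g \<in> L2 \<Omega>" "L2_norm \<Omega> g \<le> \<bar>K\<bar> * L2_norm \<Omega> f"
proof -
  have b2: "AE x in lebesgue_on \<Omega>. (norm (g x))\<^sup>2 \<le> K\<^sup>2 * (norm (f x))\<^sup>2"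
    using b
  proof eventually_elim
    case (elim x)
    then have "(norm (g x))\<^sup>2 \<le> (K * norm (f x))\<^sup>2" by (intro power_mono) auto
    then show ?case by (simp add: power_mult_distrib)
  qed
  have i: "integrable (lebesgue_on \<Omega>) (\<lambda>x. K\<^sup>2 * (norm (f x))\<^sup>2)"
    using f by (simp add: L2_def)
  have ig: "integrable (lebesgue_on \<Omega>) (\<lambda>x. (norm (g x))\<^sup>2)"
    by (rule Bochner_Integration.integrable_bound[OF i])
       (use g b2 in \<open>auto intro!: borel_measurable_power borel_measurable_norm elim: eventually_mono\<close>)
  then show "g \<in> L2 \<Omega>" using g by (simp add: L2_def)
  have "(LINT x|lebesgue_on \<Omega>. (norm (g x))\<^sup>2) \<le> (LINT x|lebesgue_on \<Omega>. K\<^sup>2 * (norm (f x))\<^sup>2)"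
    by (rule integral_mono_AE[OF ig i b2])
  then have "L2_inner \<Omega> g g \<le> K\<^sup>2 * L2_inner \<Omega> f f"
    by (simp add: L2_inner_def power2_norm_eq_inner)
  then have "sqrt (L2_inner \<Omega> g g) \<le> sqrt (K\<^sup>2 * L2_inner \<Omega> f f)" by (rule real_sqrt_le_mono)
  then show "L2_norm \<Omega> g \<le> \<bar>K\<bar> * L2_norm \<Omega> f"
    by (simp add: L2_norm_def real_sqrt_mult)
qed

lemma L2_add:
  fixes f g :: "real^'n::finite \<Rightarrow> 'b::euclidean_space"
  assumes "f \<in> L2 \<Omega>" "g \<in> L2 \<Omega>" shows "(\<lambda>x. f x + g x) \<in> L2 \<Omega>"
proof -
  have i: "integrable (lebesgue_on \<Omega>) (\<lambda>x. 2 * (norm (f x))\<^sup>2 + 2 * (norm (g x))\<^sup>2)"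
    using assms by (simp add: L2_def)
  have "norm ((norm (f x + g x))\<^sup>2) \<le> norm (2 * (norm (f x))\<^sup>2 + 2 * (norm (g x))\<^sup>2)" for x
  proof -
    have "(norm (f x + g x))\<^sup>2 \<le> (norm (f x) + norm (g x))\<^sup>2"
      by (intro power_mono norm_triangle_ineq) simp
    also have "\<dots> \<le> 2 * (norm (f x))\<^sup>2 + 2 * (norm (g x))\<^sup>2"
      using zero_le_power2[of "norm (f x) - norm (g x)"] by (simp add: power2_sum power2_diff)
    finally show ?thesis by simp
  qed
  moreover have m: "(\<lambda>x. f x + g x) \<in> borel_measurable (lebesgue_on \<Omega>)"
    by (rule borel_measurable_add[OF L2_measurable L2_measurable]) (rule assms)+
  ultimately have "integrable (lebesgue_on \<Omega>) (\<lambda>x. (norm (f x + g x))\<^sup>2)"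
    by (intro Bochner_Integration.integrable_bound[OF i] AE_I2 borel_measurable_power) (use m in measurable)
  then show ?thesis using m by (simp add: L2_def)
qed

lemma L2_scale: "f \<in> L2 \<Omega> \<Longrightarrow> (\<lambda>x. r *\<^sub>R f x) \<in> L2 \<Omega>"
  by (rule L2_bound(1)[of f _ _ "\<bar>r\<bar>"]) (auto simp: L2_def intro!: AE_I2)

lemma L2_zero: "(\<lambda>x. 0) \<in> L2 \<Omega>"
  by (simp add: L2_def)

lemma L2_inner_integrable:
  fixes f g :: "real^'n::finite \<Rightarrow> 'b::euclidean_space"
  assumes "f \<in> L2 \<Omega>" "g \<in> L2 \<Omega>"
  shows "integrable (lebesgue_on \<Omega>) (\<lambda>x. f x \<bullet> g x)"
proof -
  have i: "integrable (lebesgue_on \<Omega>) (\<lambda>x. (norm (f x))\<^sup>2 + (norm (g x))\<^sup>2)"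
    using assms by (simp add: L2_def)
  have "norm (f x \<bullet> g x) \<le> norm ((norm (f x))\<^sup>2 + (norm (g x))\<^sup>2)" for x
  proof -
    have "2 * (norm (f x) * norm (g x)) \<le> (norm (f x))\<^sup>2 + (norm (g x))\<^sup>2"
      using zero_le_power2[of "norm (f x) - norm (g x)"] by (simp add: power2_diff)
    moreover have "0 \<le> norm (f x) * norm (g x)" by simp
    ultimately have "norm (f x) * norm (g x) \<le> (norm (f x))\<^sup>2 + (norm (g x))\<^sup>2" by linarith
    then show ?thesis using Cauchy_Schwarz_ineq2[of "f x" "g x"] by simp
  qed
  then show ?thesis
    by (intro Bochner_Integration.integrable_bound[OF i] AE_I2 borel_measurable_inner L2_measurable assms)
qed

lemma L2_nn_integral:
  fixes f :: "real^'n::finite \<Rightarrow> 'b::euclidean_space"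
  assumes "f \<in> L2 \<Omega>"
  shows "(\<integral>\<^sup>+x. ennreal ((norm (f x))\<^sup>2) \<partial>lebesgue_on \<Omega>) = ennreal ((L2_norm \<Omega> f)\<^sup>2)"
proof -
  have "(\<integral>\<^sup>+x. ennreal ((norm (f x))\<^sup>2) \<partial>lebesgue_on \<Omega>) = ennreal (LINT x|lebesgue_on \<Omega>. (norm (f x))\<^sup>2)"
    using assms by (intro nn_integral_eq_integral) (auto simp: L2_def)
  also have "(LINT x|lebesgue_on \<Omega>. (norm (f x))\<^sup>2) = (L2_norm \<Omega> f)\<^sup>2"
    unfolding L2_norm_def L2_inner_def by (simp add: power2_norm_eq_inner[symmetric] integral_nonneg_AE)
  finally show ?thesis .
qed

lemma L2_from_nn_integral:
  fixes f :: "real^'n::finite \<Rightarrow> 'b::euclidean_space"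
  assumes f: "f \<in> borel_measurable (lebesgue_on \<Omega>)"
    and le: "(\<integral>\<^sup>+x. ennreal ((norm (f x))\<^sup>2) \<partial>lebesgue_on \<Omega>) \<le> ennreal (c\<^sup>2)" and c: "0 \<le> c"
  shows "f \<in> L2 \<Omega>" "L2_norm \<Omega> f \<le> c"
proof -
  have "(\<integral>\<^sup>+x. ennreal (norm ((norm (f x))\<^sup>2)) \<partial>lebesgue_on \<Omega>) < \<infinity>"
    using le ennreal_less_top by (simp add: le_less_trans)
  then have "integrable (lebesgue_on \<Omega>) (\<lambda>x. (norm (f x))\<^sup>2)"
    using f by (intro integrableI_bounded borel_measurable_power borel_measurable_norm) auto
  then show *: "f \<in> L2 \<Omega>" using f by (simp add: L2_def)
  have "(L2_norm \<Omega> f)\<^sup>2 \<le> c\<^sup>2" using le L2_nn_integral[OF *] by simp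
  then show "L2_norm \<Omega> f \<le> c" using c by (rule power2_le_imp_le)
qed

lemma L2_inner_nonneg: "0 \<le> L2_inner \<Omega> f f"
  unfolding L2_inner_def by (intro integral_nonneg_AE) auto

lemma semi_inner_L2: "semi_inner (L2 \<Omega> :: (real^'n::finite \<Rightarrow> 'b::euclidean_space) set) (L2_inner \<Omega>)"
proof
  show "subspace (L2 \<Omega> :: (real^'n::finite \<Rightarrow> 'b::euclidean_space) set)"
    using L2_add[of _ \<Omega>] L2_scale[of _ \<Omega>] L2_zero[of \<Omega>]
    by (auto simp: subspace_def plus_fun_def zero_fun_def scaleR_fun_def)
  show "bilin (L2 \<Omega>) (L2_inner \<Omega>)"
    by (auto simp: bilin_def lin_fun_def L2_inner_def L2_inner_integrable inner_add_left inner_add_right)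
  show "L2_inner \<Omega> u v = L2_inner \<Omega> v u" for u v :: "real^'n \<Rightarrow> 'b"
    by (simp add: L2_inner_def inner_commute)
qed (rule L2_inner_nonneg)

text \<open>
  The series \<open>\<Sum>\<^sub>k 2\<^sup>k |q (k+1) x - q k x|\<^sup>2\<close> has finite integral, hence is finite almost everywhere, and then
  the increments at \<open>x\<close> decay geometrically.
\<close>

lemma fast_Cauchy_AE_convergent:
  fixes q :: "nat \<Rightarrow> 'a \<Rightarrow> 'b::euclidean_space"
  assumes q[measurable]: "\<And>k. q k \<in> borel_measurable M"
    and fast: "\<And>k. (\<integral>\<^sup>+x. ennreal ((norm (q (Suc k) x - q k x))\<^sup>2) \<partial>M) \<le> ennreal ((1/4)^k)"
  shows "AE x in M. convergent (\<lambda>k. q k x)"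
proof -
  have "(\<integral>\<^sup>+x. (\<Sum>k. ennreal (2^k * (norm (q (Suc k) x - q k x))\<^sup>2)) \<partial>M)
      = (\<Sum>k. \<integral>\<^sup>+x. ennreal (2^k * (norm (q (Suc k) x - q k x))\<^sup>2) \<partial>M)"
    by (rule nn_integral_suminf) measurable
  also have "\<dots> = (\<Sum>k. ennreal (2^k) * (\<integral>\<^sup>+x. ennreal ((norm (q (Suc k) x - q k x))\<^sup>2) \<partial>M))"
    by (intro suminf_cong) (simp add: ennreal_mult nn_integral_cmult)
  also have "\<dots> \<le> (\<Sum>k. ennreal ((1/2)^k))"
  proof (intro suminf_le)
    fix k
    have "ennreal (2^k) * (\<integral>\<^sup>+x. ennreal ((norm (q (Suc k) x - q k x))\<^sup>2) \<partial>M) \<le> ennreal (2^k) * ennreal ((1/4)^k)"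
      by (intro mult_left_mono fast) simp
    also have "\<dots> = ennreal ((1/2)^k)"
      by (simp add: ennreal_mult[symmetric] power_mult_distrib[symmetric])
    finally show "ennreal (2^k) * (\<integral>\<^sup>+x. ennreal ((norm (q (Suc k) x - q k x))\<^sup>2) \<partial>M) \<le> ennreal ((1/2)^k)" .
  qed auto
  also have "\<dots> = ennreal (\<Sum>k. (1/2)^k)"
    by (intro suminf_ennreal2) (auto intro: summable_geometric)
  also have "\<dots> < \<infinity>" by simp
  finally have "AE x in M. (\<Sum>k. ennreal (2^k * (norm (q (Suc k) x - q k x))\<^sup>2)) \<noteq> \<infinity>"
    by (intro nn_integral_noteq_infinite) auto
  then show ?thesis
  proof eventually_elim
    case (elim x)
    define g where "g k = norm (q (Suc k) x - q k x)" for k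
    have sm: "summable (\<lambda>k. 2^k * (g k)\<^sup>2)"
      using elim by (intro summable_suminf_not_top) (auto simp: g_def)
    have "summable (\<lambda>k. (1/2)^k + 2^k * (g k)\<^sup>2)"
      by (intro summable_add sm summable_geometric) simp
    moreover have "norm (q (Suc k) x - q k x) \<le> (1/2)^k + 2^k * (g k)\<^sup>2" for k
    proof -
      have "0 \<le> (1/2)^k * (1 - 2^k * g k)\<^sup>2" by simp
      also have "\<dots> = (1/2)^k - 2 * g k + 2^k * (g k)\<^sup>2"
        by (simp add: power2_eq_square algebra_simps power_one_over)
      finally have "2 * g k \<le> (1/2)^k + 2^k * (g k)\<^sup>2" by simp
      moreover have "0 \<le> g k" by (simp add: g_def)
      ultimately have "g k \<le> (1/2)^k + 2^k * (g k)\<^sup>2" by linarith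
      then show ?thesis by (simp add: g_def)
    qed
    ultimately have "summable (\<lambda>k. q (Suc k) x - q k x)"
      by (rule summable_comparison_test'[where N=0])
    then have "convergent (\<lambda>n. \<Sum>k<n. q (Suc k) x - q k x)"
      by (simp add: summable_iff_convergent)
    moreover have "(\<Sum>k<n. q (Suc k) x - q k x) = q n x - q 0 x" for n
      by (rule sum_lessThan_telescope)
    ultimately have "convergent (\<lambda>n. q n x - q 0 x)" by simp
    then have "convergent (\<lambda>n. (q n x - q 0 x) + q 0 x)" by (intro convergent_add convergent_const)
    then show ?case by simp
  qed
qed

text \<open>
  Riesz-Fischer: a rapidly Cauchy subsequence converges almost everywhere, and Fatou's lemma shows that its
  limit is the limit in norm.
\<close>

lemma semi_hilbert_L2:
  "semi_hilbert (L2 \<Omega> :: (real^'n::finite \<Rightarrow> 'b::euclidean_space) set) (L2_inner \<Omega>)"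
proof -
  interpret L: semi_inner "L2 \<Omega> :: (real^'n \<Rightarrow> 'b) set" "L2_inner \<Omega>" by (rule semi_inner_L2)
  have nrm: "L.nrm = L2_norm \<Omega>" by (auto simp: L.nrm_def L2_norm_def fun_eq_iff)
  show ?thesis
  proof
    fix s :: "nat \<Rightarrow> real^'n \<Rightarrow> 'b"
    assume s: "\<And>n. s n \<in> L2 \<Omega>" and "\<And>e. 0 < e \<Longrightarrow> \<exists>N. \<forall>m\<ge>N. \<forall>n\<ge>N. L.nrm (s m - s n) < e"
    then have cau: "\<exists>N. \<forall>m\<ge>N. \<forall>n\<ge>N. L2_norm \<Omega> (s m - s n) < e" if "0 < e" for e
      using that by (simp add: nrm)
    have sm: "s n \<in> borel_measurable (lebesgue_on \<Omega>)" for n using s by (rule L2_measurable)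
    have "\<forall>k. \<exists>N. \<forall>m\<ge>N. \<forall>n\<ge>N. L2_norm \<Omega> (s m - s n) < (1/2)^k" using cau by simp
    then obtain N where N: "\<And>k m n. N k \<le> m \<Longrightarrow> N k \<le> n \<Longrightarrow> L2_norm \<Omega> (s m - s n) < (1/2)^k"
      by metis
    define r where "r k = k + (\<Sum>j\<le>k. N j)" for k
    have r: "N k \<le> r k" "r k \<le> r (Suc k)" "k \<le> r k" for k
      using member_le_sum[of k "{..k}" N] by (auto simp: r_def)
    define f where "f x = lim (\<lambda>k. s (r k) x)" for x
    have fm: "f \<in> borel_measurable (lebesgue_on \<Omega>)"
      unfolding f_def by (rule borel_measurable_lim_metric) (rule sm)
    have nn: "(\<integral>\<^sup>+x. ennreal ((norm (s m x - s n x))\<^sup>2) \<partial>lebesgue_on \<Omega>) = ennreal ((L2_norm \<Omega> (s m - s n))\<^sup>2)" for m n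
      using L2_nn_integral[of "s m - s n" \<Omega>] s by simp
    have "AE x in lebesgue_on \<Omega>. convergent (\<lambda>k. s (r k) x)"
    proof (rule fast_Cauchy_AE_convergent[OF sm])
      fix k
      have "L2_norm \<Omega> (s (r (Suc k)) - s (r k)) < (1/2)^k"
        using r[of k] by (intro N) auto
      then have "(L2_norm \<Omega> (s (r (Suc k)) - s (r k)))\<^sup>2 \<le> ((1/2)^k)\<^sup>2"
        using L.nrm_nonneg[of "s (r (Suc k)) - s (r k)"] s nrm by (intro power_mono) auto
      also have "((1/2)^k)\<^sup>2 = (1/4::real)^k" by (simp add: power_mult[symmetric] mult.commute power_mult power2_eq_square flip: power_mult_distrib)
      finally show "(\<integral>\<^sup>+x. ennreal ((norm (s (r (Suc k)) x - s (r k) x))\<^sup>2) \<partial>lebesgue_on \<Omega>) \<le> ennreal ((1/4)^k)"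
        by (simp add: nn ennreal_leI)
    qed
    then have lim: "AE x in lebesgue_on \<Omega>. (\<lambda>k. s (r k) x) \<longlonglongrightarrow> f x"
      by eventually_elim (simp add: f_def convergent_LIMSEQ_iff)
    have est: "s n - f \<in> L2 \<Omega> \<and> L2_norm \<Omega> (s n - f) \<le> e"
      if e: "0 < e" and M: "\<And>m. m \<ge> M \<Longrightarrow> L2_norm \<Omega> (s n - s m) < e" for n e M
    proof -
      have "(\<integral>\<^sup>+x. ennreal ((norm (s n x - f x))\<^sup>2) \<partial>lebesgue_on \<Omega>)
          = (\<integral>\<^sup>+x. liminf (\<lambda>k. ennreal ((norm (s n x - s (r k) x))\<^sup>2)) \<partial>lebesgue_on \<Omega>)"
      proof (rule nn_integral_cong_AE, use lim in eventually_elim)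
        case (elim x)
        have "(\<lambda>k. ennreal ((norm (s n x - s (r k) x))\<^sup>2)) \<longlonglongrightarrow> ennreal ((norm (s n x - f x))\<^sup>2)"
          by (intro tendsto_intros elim tendsto_ennrealI)
        from lim_imp_Liminf[OF sequentially_bot this] show ?case by (rule sym)
      qed
      also have "\<dots> \<le> liminf (\<lambda>k. \<integral>\<^sup>+x. ennreal ((norm (s n x - s (r k) x))\<^sup>2) \<partial>lebesgue_on \<Omega>)"
        by (rule nn_integral_liminf) (use sm in measurable)
      also have "\<dots> \<le> liminf (\<lambda>k::nat. ennreal (e\<^sup>2))"
      proof (rule Liminf_mono)
        show "\<forall>\<^sub>F k in sequentially. (\<integral>\<^sup>+x. ennreal ((norm (s n x - s (r k) x))\<^sup>2) \<partial>lebesgue_on \<Omega>) \<le> ennreal (e\<^sup>2)"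
          using eventually_ge_at_top[of M]
        proof eventually_elim
          case (elim k)
          have "L2_norm \<Omega> (s n - s (r k)) \<le> e" using M[of "r k"] elim r(3)[of k] by simp
          then have "(L2_norm \<Omega> (s n - s (r k)))\<^sup>2 \<le> e\<^sup>2"
            using L.nrm_nonneg[of "s n - s (r k)"] s nrm by (intro power_mono) auto
          then show ?case by (simp add: nn ennreal_leI)
        qed
      qed
      also have "\<dots> = ennreal (e\<^sup>2)" by (simp add: Liminf_const)
      finally show ?thesis
        using L2_from_nn_integral[of "s n - f" \<Omega> e] e sm[of n] fm
        by (simp add: fun_diff_def borel_measurable_diff)
    qed
    obtain N1 where "\<forall>m\<ge>N1. \<forall>n\<ge>N1. L2_norm \<Omega> (s m - s n) < 1" using cau[of 1] by auto
    then have "s N1 - f \<in> L2 \<Omega>" using est[of 1 N1 N1] by auto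
    then have f: "f \<in> L2 \<Omega>" using L.V_simps(4)[OF s[of N1], of "s N1 - f"] by simp
    moreover have "(\<lambda>n. L.nrm (s n - f)) \<longlonglongrightarrow> 0"
      unfolding nrm
    proof (rule LIMSEQ_I)
      fix e :: real assume e: "0 < e"
      obtain M where M: "\<forall>m\<ge>M. \<forall>n\<ge>M. L2_norm \<Omega> (s m - s n) < e/2" using cau[of "e/2"] e by auto
      have "norm (L2_norm \<Omega> (s n - f) - 0) < e" if "M \<le> n" for n
        using est[of "e/2" M n] M that e L.nrm_nonneg[of "s n - f"] s f nrm by force
      then show "\<exists>no. \<forall>n\<ge>no. norm (L2_norm \<Omega> (s n - f) - 0) < e" by blast
    qed
    ultimately show "\<exists>v\<in>L2 \<Omega>. (\<lambda>n. L.nrm (s n - v)) \<longlonglongrightarrow> 0" by blast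
  qed
qed

interpretation L2: semi_hilbert "L2 \<Omega> :: (real^'n::finite \<Rightarrow> 'b::euclidean_space) set" "L2_inner \<Omega>"
  rewrites "semi_inner.nrm (L2_inner \<Omega>) = L2_norm \<Omega>"
  for \<Omega>
  by (rule semi_hilbert_L2) (auto simp: semi_inner.nrm_def[OF semi_inner_L2] L2_norm_def fun_eq_iff)

section \<open>Weak gradients of smooth functions\<close>

lemma continuous_on_compact_bounded:
  fixes f :: "'a::topological_space \<Rightarrow> 'b::real_normed_vector"
  assumes "continuous_on K f" "compact K"
  obtains B where "0 \<le> B" "\<And>x. x \<in> K \<Longrightarrow> norm (f x) \<le> B"
proof -
  have "bounded (f ` K)" by (intro compact_imp_bounded compact_continuous_image assms)
  then obtain B where "0 < B" "\<forall>y\<in>f ` K. norm y \<le> B" by (auto simp: bounded_pos)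
  then show ?thesis using that[of B] by simp
qed

lemma continuous_compact_support_integrable:
  fixes g :: "'a::euclidean_space \<Rightarrow> 'b::{banach, second_countable_topology}"
  assumes g: "continuous_on UNIV g" and K: "compact K" and supp: "\<And>x. x \<notin> K \<Longrightarrow> g x = 0"
  shows "integrable lborel g"
proof -
  obtain B where B: "\<And>x. x \<in> K \<Longrightarrow> norm (g x) \<le> B"
    using continuous_on_compact_bounded[OF continuous_on_subset[OF g subset_UNIV] K] by blast
  show ?thesis
  proof (rule integrableI_bounded_set[where A=K and B=B])
    show "K \<in> sets lborel" using K by (simp add: compact_imp_closed borel_closed)
    show "emeasure lborel K < \<infinity>" by (rule emeasure_compact_finite[OF K])
    show "g \<in> borel_measurable lborel" using g by (simp add: borel_measurable_continuous_onI)
    show "AE x in lborel. x \<in> K \<longrightarrow> norm (g x) \<le> B" by (intro AE_I2 impI B)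
  qed (simp add: supp)
qed

lemma continuous_compact_support_L2:
  fixes f :: "real^'n::finite \<Rightarrow> 'b::euclidean_space"
  assumes f: "continuous_on UNIV f" and K: "compact K" and supp: "\<And>x. x \<in> \<Omega> \<Longrightarrow> x \<notin> K \<Longrightarrow> f x = 0"
    and \<Omega>: "\<Omega> \<in> sets lebesgue"
  shows "f \<in> L2 \<Omega>"
proof -
  have fm: "f \<in> borel_measurable (lebesgue_on \<Omega>)"
    by (rule continuous_imp_measurable_on_sets_lebesgue[OF continuous_on_subset[OF f] \<Omega>]) simp
  obtain B where B: "\<And>x. x \<in> K \<Longrightarrow> norm (f x) \<le> B" "0 \<le> B"
    using continuous_on_compact_bounded[OF continuous_on_subset[OF f subset_UNIV] K] by blast
  have "integrable lebesgue (indicator K :: _ \<Rightarrow> real)"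
    using K emeasure_compact_finite[OF K]
    by (intro integrable_real_indicator) (auto simp: compact_imp_closed borel_closed)
  then have "integrable lebesgue (\<lambda>x. indicator \<Omega> x *\<^sub>R (indicator K x * B\<^sup>2))"
    by (intro integrable_mult_indicator \<Omega> integrable_mult_left)
  moreover have "\<Omega> \<inter> space lebesgue \<in> sets lebesgue" using \<Omega> by simp
  ultimately have i: "integrable (lebesgue_on \<Omega>) (\<lambda>x. indicator K x * B\<^sup>2)"
    by (simp only: integrable_restrict_space)
  have "AE x in lebesgue_on \<Omega>. norm ((norm (f x))\<^sup>2) \<le> norm (indicator K x * B\<^sup>2)"
  proof (rule AE_I2)
    fix x assume x: "x \<in> space (lebesgue_on \<Omega>)"
    show "norm ((norm (f x))\<^sup>2) \<le> norm (indicator K x * B\<^sup>2)"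
    proof (cases "x \<in> K")
      case True
      then show ?thesis using B(1)[OF True] by (simp add: power_mono)
    next
      case False
      then show ?thesis using supp x by simp
    qed
  qed
  then have "integrable (lebesgue_on \<Omega>) (\<lambda>x. (norm (f x))\<^sup>2)"
    using fm by (intro Bochner_Integration.integrable_bound[OF i]) auto
  then show ?thesis using fm by (simp add: L2_def)
qed

lemma pderiv_zero_off_support:
  assumes "x \<notin> closure {x. f x \<noteq> 0}" shows "pderiv_dir i f x = 0"
proof -
  have "(f has_derivative (\<lambda>h. 0)) (at x)"
    by (rule has_derivative_transform_within_open[OF has_derivative_const[of 0] open_Compl[OF closed_closure]])
       (use assms closure_subset[of "{x. f x \<noteq> 0}"] in auto)
  then show ?thesis by (rule pderiv_dirI)
qed

lemma test_functionD:
  assumes "\<phi> \<in> test_functions \<Omega>"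
  shows "smooth \<phi>" "compact (closure {x. \<phi> x \<noteq> 0})" "closure {x. \<phi> x \<noteq> 0} \<subseteq> \<Omega>"
    "x \<notin> closure {x. \<phi> x \<noteq> 0} \<Longrightarrow> \<phi> x = 0" "x \<notin> closure {x. \<phi> x \<noteq> 0} \<Longrightarrow> pderiv_dir i \<phi> x = 0"
  using assms pderiv_zero_off_support[of x \<phi> i] closure_subset[of "{x. \<phi> x \<noteq> 0}"]
  by (auto simp: test_functions_def)

lemma test_function_L2:
  assumes "\<phi> \<in> test_functions \<Omega>" "\<Omega> \<in> sets lebesgue"
  shows "\<phi> \<in> L2 \<Omega>" "pderiv_dir i \<phi> \<in> L2 \<Omega>"
proof -
  note t = test_functionD[OF assms(1)]
  show "\<phi> \<in> L2 \<Omega>"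
    by (rule continuous_compact_support_L2[OF smooth_continuous[OF t(1)] t(2) t(4) assms(2)])
  show "pderiv_dir i \<phi> \<in> L2 \<Omega>"
    by (rule continuous_compact_support_L2[OF smooth_continuous[OF smooth_pderiv[OF t(1)]] t(2) t(5) assms(2)])
qed

lemma smooth_L2:
  assumes "smooth \<phi>" "bounded \<Omega>" "\<Omega> \<in> sets lebesgue"
  shows "\<phi> \<in> L2 \<Omega>" "grad \<phi> \<in> L2 \<Omega>"
proof -
  have "compact (closure \<Omega>)" using assms(2) by (simp add: compact_closure)
  moreover have "x \<in> closure \<Omega>" if "x \<in> \<Omega>" for x using that closure_subset by blast
  ultimately show "\<phi> \<in> L2 \<Omega>" "grad \<phi> \<in> L2 \<Omega>"
    using continuous_compact_support_L2[of _ "closure \<Omega>" \<Omega>] smooth_continuous[OF assms(1)]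
      continuous_grad[OF assms(1)] assms(3) by blast+
qed

text \<open>
  The integral of a difference quotient vanishes by translation invariance; difference quotients
  converge boundedly to the derivative.
\<close>

lemma integral_pderiv_compact_support:
  fixes h :: "real^'n::finite \<Rightarrow> real"
  assumes h: "smooth h" and K: "compact K" and supp: "\<And>x. x \<notin> K \<Longrightarrow> h x = 0"
  shows "(LINT x|lborel. pderiv_dir i h x) = 0"
proof -
  let ?e = "axis i 1 :: real^'n"
  \<comment> \<open>A compact set that contains the supports of all difference quotients with step at most \<open>1\<close>.\<close>
  define K' where "K' = {x + y |x y. x \<in> K \<and> y \<in> cball 0 1}"
  have K': "compact K'" unfolding K'_def using K by (intro compact_sums) auto
  have "closure {x. h x \<noteq> 0} \<subseteq> K"
    by (rule closure_minimal[OF _ compact_imp_closed[OF K]]) (use supp in blast)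
  then have supp': "\<And>x. x \<notin> K \<Longrightarrow> grad h x = 0"
    by (auto simp: vec_eq_iff intro: pderiv_zero_off_support)
  obtain B where B: "\<And>x. x \<in> K \<Longrightarrow> norm (grad h x) \<le> B" "0 \<le> B"
    using continuous_on_compact_bounded[OF continuous_grad[OF h] K] by blast
  have B': "norm (grad h x) \<le> B" for x
    using B supp' by (cases "x \<in> K") auto
  have lip: "\<bar>h x - h y\<bar> \<le> B * norm (x - y)" for x y
  proof -
    have "norm (h x - h y) \<le> B * norm (x - y)"
    proof (rule differentiable_bound[where S=UNIV and f' = "\<lambda>x h'. grad h x \<bullet> h'"])
      show "(h has_derivative (\<lambda>h'. grad h x \<bullet> h')) (at x within UNIV)" for x
        using smooth_has_derivative[OF h] by simp
      show "onorm (\<lambda>h'. grad h x \<bullet> h') \<le> B" for x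
      proof (rule onorm_bound[OF B(2)])
        show "norm (grad h x \<bullet> y) \<le> B * norm y" for y
          using order_trans[OF Cauchy_Schwarz_ineq2 mult_right_mono[OF B' norm_ge_zero]] by simp
      qed
    qed auto
    then show ?thesis by simp
  qed
  have hm: "h \<in> borel_measurable borel"
    using smooth_continuous[OF h] by (rule borel_measurable_continuous_onI)
  have hi: "integrable lborel h"
    by (rule continuous_compact_support_integrable[OF smooth_continuous[OF h] K supp])
  define D where "D m x = real (Suc m) * (h (x + (1 / real (Suc m)) *\<^sub>R ?e) - h x)" for m x
  have "(\<lambda>m. LINT x|lborel. D m x) \<longlonglongrightarrow> (LINT x|lborel. pderiv_dir i h x)"
  proof (rule integral_dominated_convergence)
    show "pderiv_dir i h \<in> borel_measurable lborel"
      using smooth_continuous[OF smooth_pderiv[OF h]] by (simp add: borel_measurable_continuous_onI)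
    show "D m \<in> borel_measurable lborel" for m
      unfolding D_def using hm by measurable
    show "integrable lborel (\<lambda>x. indicator K' x * B)"
      using K' emeasure_compact_finite[OF K']
      by (intro integrable_mult_left integrable_real_indicator) (auto simp: compact_imp_closed borel_closed less_top)
    show "AE x in lborel. (\<lambda>m. D m x) \<longlonglongrightarrow> pderiv_dir i h x"
    proof (rule AE_I2)
      fix x
      have "((\<lambda>t. h (x + t *\<^sub>R ?e)) has_derivative (\<lambda>t. grad h x \<bullet> (t *\<^sub>R ?e))) (at 0)"
        by (rule has_derivative_compose[where f = "\<lambda>t. x + t *\<^sub>R ?e" and g = h, simplified])
           (auto intro!: derivative_eq_intros smooth_has_derivative[OF h])
      then have "((\<lambda>t. h (x + t *\<^sub>R ?e)) has_real_derivative pderiv_dir i h x) (at 0)"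
        by (simp add: has_field_derivative_def inner_axis mult_commute_abs)
      then have lim: "((\<lambda>t. (h (x + t *\<^sub>R ?e) - h x) / t) \<longlongrightarrow> pderiv_dir i h x) (at 0)"
        by (simp add: DERIV_def)
      have "filterlim (\<lambda>m. 1 / real (Suc m)) (at 0) sequentially"
        unfolding filterlim_at using inverse_Suc_tendsto_0 by auto
      from filterlim_compose[OF lim this]
      show "(\<lambda>m. D m x) \<longlonglongrightarrow> pderiv_dir i h x" by (simp add: D_def mult.commute)
    qed
    show "AE x in lborel. norm (D m x) \<le> indicator K' x * B" for m
    proof (rule AE_I2)
      fix x
      define y where "y = (1 / real (Suc m)) *\<^sub>R ?e"
      have ny: "norm y = 1 / real (Suc m)" by (simp add: y_def)
      show "norm (D m x) \<le> indicator K' x * B"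
      proof (cases "x \<in> K'")
        case True
        have "\<bar>h (x + y) - h x\<bar> \<le> B * (1 / real (Suc m))" using lip[of "x + y" x] ny by simp
        then have "real (Suc m) * \<bar>h (x + y) - h x\<bar> \<le> real (Suc m) * (B * (1 / real (Suc m)))"
          by (rule mult_left_mono) simp
        moreover have "norm (D m x) = real (Suc m) * \<bar>h (x + y) - h x\<bar>"
          unfolding D_def y_def real_norm_def abs_mult by simp
        ultimately show ?thesis using True by simp
      next
        case False
        have "norm y \<le> 1" using ny by simp
        have in_K': "x \<in> K'" if "x + z \<in> K" "norm z \<le> 1" for z
          using that unfolding K'_def by (intro CollectI exI[of _ "x + z"] exI[of _ "- z"]) auto
        have "x + y \<notin> K" using in_K'[of y] False \<open>norm y \<le> 1\<close> by blast
        moreover have "x \<notin> K" using in_K'[of 0] False by auto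
        ultimately show ?thesis using supp False by (simp add: D_def y_def)
      qed
    qed
  qed
  moreover have "(LINT x|lborel. D m x) = 0" for m
  proof -
    define y where "y = (1 / real (Suc m)) *\<^sub>R ?e"
    have "integrable (distr lborel borel ((+) y)) h" using hi by (simp add: lborel_distr_plus)
    then have i: "integrable lborel (\<lambda>x. h (x + y))"
      by (subst (asm) integrable_distr_eq) (use hm in \<open>auto simp: add.commute\<close>)
    have "(LINT x|lborel. h x) = (LINT x|distr lborel borel ((+) y). h x)" by (simp add: lborel_distr_plus)
    also have "\<dots> = (LINT x|lborel. h (x + y))"
      by (subst integral_distr) (use hm in \<open>auto simp: add.commute\<close>)
    finally show ?thesis using i hi by (simp add: D_def y_def)
  qed
  ultimately show ?thesis by (simp add: LIMSEQ_const_iff)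
qed

lemma smooth_weak_grad:
  assumes f: "smooth f" and \<Omega>: "open \<Omega>"
  shows "is_weak_grad \<Omega> f (grad f)"
  unfolding is_weak_grad_def
proof (intro ballI allI)
  fix \<phi> and i :: 'a
  assume \<phi>: "\<phi> \<in> test_functions \<Omega>"
  define K where "K = closure {x. \<phi> x \<noteq> 0}"
  note t = test_functionD[OF \<phi>, folded K_def]
  have \<Omega>s: "\<Omega> \<in> sets lebesgue" using \<Omega> by (simp add: borel_open)
  have sm: "smooth (\<lambda>x. f x * \<phi> x)" using f t(1) by (rule smooth_mult)
  have pd: "pderiv_dir i (\<lambda>x. f x * \<phi> x) x = f x * pderiv_dir i \<phi> x + grad f x $ i * \<phi> x" for x
    using arg_cong[OF grad_mult[OF f t(1)], of "\<lambda>v. v $ i" x] by (simp add: mult.commute)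
  have red: "integrable lborel g \<and> (LINT x|lebesgue_on \<Omega>. g x) = (LINT x|lborel. g x)"
    if c: "continuous_on UNIV g" and z: "\<And>x. x \<notin> K \<Longrightarrow> g x = 0" for g :: "real^'a \<Rightarrow> real"
  proof -
    have gm: "g \<in> borel_measurable lborel" using c by (simp add: borel_measurable_continuous_onI)
    have "integrable lborel g"
      by (rule continuous_compact_support_integrable[OF c t(2) z])
    moreover have "(LINT x|lebesgue_on \<Omega>. g x) = (LINT x|lebesgue. indicator \<Omega> x *\<^sub>R g x)"
      using \<Omega>s by (simp add: integral_restrict_space)
    moreover have "\<dots> = (LINT x|lebesgue. g x)"
      by (rule Bochner_Integration.integral_cong) (use t(3) z in \<open>auto simp: indicator_def\<close>)
    moreover have "\<dots> = (LINT x|lborel. g x)" by (rule integral_completion[OF gm])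
    ultimately show ?thesis by simp
  qed
  note cont = smooth_continuous[OF f, of UNIV] smooth_continuous[OF t(1), of UNIV]
    smooth_continuous[OF smooth_pderiv[OF f], of UNIV i] smooth_continuous[OF smooth_pderiv[OF t(1)], of UNIV i]
  have 1: "integrable lborel (\<lambda>x. f x * pderiv_dir i \<phi> x) \<and>
     (LINT x|lebesgue_on \<Omega>. f x * pderiv_dir i \<phi> x) = (LINT x|lborel. f x * pderiv_dir i \<phi> x)"
    by (rule red) (use t in \<open>auto intro!: continuous_on_mult cont\<close>)
  have 2: "integrable lborel (\<lambda>x. grad f x $ i * \<phi> x) \<and>
     (LINT x|lebesgue_on \<Omega>. grad f x $ i * \<phi> x) = (LINT x|lborel. grad f x $ i * \<phi> x)"
    by (rule red) (use t in \<open>auto intro!: continuous_on_mult cont\<close>)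
  have "(LINT x|lborel. pderiv_dir i (\<lambda>x. f x * \<phi> x) x) = 0"
    by (rule integral_pderiv_compact_support[OF sm t(2)]) (use t in auto)
  then have "(LINT x|lborel. f x * pderiv_dir i \<phi> x) + (LINT x|lborel. grad f x $ i * \<phi> x) = 0"
    unfolding pd using 1 2 by simp
  then show "(LINT x|lebesgue_on \<Omega>. f x * pderiv_dir i \<phi> x) = - (LINT x|lebesgue_on \<Omega>. grad f x $ i * \<phi> x)"
    using 1 2 by simp
qed

section \<open>The Sobolev space of order one\<close>

lemma bilin_subset: "bilin V \<beta> \<Longrightarrow> W \<subseteq> V \<Longrightarrow> bilin W \<beta>"
  unfolding bilin_def lin_fun_def by blast

lemma L2_inner_commute: "L2_inner \<Omega> f g = L2_inner \<Omega> g f"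
  by (simp add: L2_inner_def inner_commute)

lemma L2_inner_cong_AE:
  fixes f f' g g' :: "real^'n::finite \<Rightarrow> 'b::euclidean_space"
  assumes "f \<in> L2 \<Omega>" "f' \<in> L2 \<Omega>" "g \<in> L2 \<Omega>" "g' \<in> L2 \<Omega>"
    and "AE x in lebesgue_on \<Omega>. f x = f' x" "AE x in lebesgue_on \<Omega>. g x = g' x"
  shows "L2_inner \<Omega> f g = L2_inner \<Omega> f' g'"
  unfolding L2_inner_def
proof (rule integral_cong_AE)
  show "AE x in lebesgue_on \<Omega>. f x \<bullet> g x = f' x \<bullet> g' x"
    using assms(5,6) by eventually_elim simp
qed (use assms L2_measurable in \<open>auto intro!: borel_measurable_inner\<close>)

lemma L2_norm_cong_AE:
  fixes f f' :: "real^'n::finite \<Rightarrow> 'b::euclidean_space"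
  assumes "f \<in> L2 \<Omega>" "f' \<in> L2 \<Omega>" "AE x in lebesgue_on \<Omega>. f x = f' x"
  shows "L2_norm \<Omega> f = L2_norm \<Omega> f'"
  unfolding L2_norm_def using assms L2_inner_cong_AE by metis

lemma L2_inner_tendsto:
  fixes l \<psi> :: "real^'n::finite \<Rightarrow> 'b::euclidean_space"
  assumes "\<psi> \<in> L2 \<Omega>" "\<And>n. q n \<in> L2 \<Omega>" "l \<in> L2 \<Omega>" "(\<lambda>n. L2_norm \<Omega> (q n - l)) \<longlonglongrightarrow> 0"
  shows "(\<lambda>n. L2_inner \<Omega> (q n) \<psi>) \<longlonglongrightarrow> L2_inner \<Omega> l \<psi>"
proof (rule L2.tendsto_bounded_lin_fun[where f = "\<lambda>u. L2_inner \<Omega> u \<psi>" and K = "L2_norm \<Omega> \<psi>" and \<Omega> = \<Omega>])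
  show "lin_fun (L2 \<Omega>) (\<lambda>u. L2_inner \<Omega> u \<psi>)" by (rule bilinD(1)[OF L2.bilin_ip assms(1)])
  show "\<bar>L2_inner \<Omega> u \<psi>\<bar> \<le> L2_norm \<Omega> \<psi> * L2_norm \<Omega> u" if u: "u \<in> L2 \<Omega>" for u
    using L2.cauchy_schwarz[OF u assms(1)] by (simp add: mult.commute)
qed (use assms in auto)

lemma L2_norm_eq_0_iff:
  fixes f :: "real^'n::finite \<Rightarrow> 'b::euclidean_space"
  assumes "f \<in> L2 \<Omega>"
  shows "L2_norm \<Omega> f = 0 \<longleftrightarrow> (AE x in lebesgue_on \<Omega>. f x = 0)"
proof -
  have "L2_norm \<Omega> f = 0 \<longleftrightarrow> (LINT x|lebesgue_on \<Omega>. (norm (f x))\<^sup>2) = 0"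
    by (simp add: L2_norm_def L2_inner_def power2_norm_eq_inner)
  also have "\<dots> \<longleftrightarrow> (AE x in lebesgue_on \<Omega>. (norm (f x))\<^sup>2 = 0)"
    using assms by (intro integral_nonneg_eq_0_iff_AE) (auto simp: L2_def)
  finally show ?thesis by simp
qed

lemma is_weak_grad_iff_L2_inner:
  "is_weak_grad \<Omega> v G \<longleftrightarrow> (\<forall>\<phi>\<in>test_functions \<Omega>. \<forall>i.
     L2_inner \<Omega> v (pderiv_dir i \<phi>) = - L2_inner \<Omega> G (\<lambda>x. \<phi> x *\<^sub>R axis i 1))"
  by (simp add: is_weak_grad_def L2_inner_def inner_axis mult.commute)

lemma test_axis_L2:
  assumes "\<phi> \<in> test_functions \<Omega>" "\<Omega> \<in> sets lebesgue"
  shows "(\<lambda>x. \<phi> x *\<^sub>R axis i (1::real)) \<in> L2 \<Omega>"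
proof (rule L2_bound(1)[OF test_function_L2(1)[OF assms], of _ 1])
  have "\<phi> \<in> borel_measurable (lebesgue_on \<Omega>)"
    by (rule L2_measurable[OF test_function_L2(1)[OF assms]])
  then show "(\<lambda>x. \<phi> x *\<^sub>R axis i (1::real)) \<in> borel_measurable (lebesgue_on \<Omega>)"
    by (intro borel_measurable_scaleR) auto
qed simp

locale bounded_domain =
  fixes \<Omega> :: "(real^'n::finite) set"
  assumes open_domain: "open \<Omega>" and bounded_domain: "bounded \<Omega>"
begin

lemma domain_sets [simp]: "\<Omega> \<in> sets lebesgue" "\<Omega> \<in> sets borel"
  using open_domain by (auto simp: borel_open)

lemma weak_grad_unique:
  assumes "G \<in> L2 \<Omega>" "G' \<in> L2 \<Omega>" "is_weak_grad \<Omega> v G" "is_weak_grad \<Omega> v G'"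
  shows "AE x in lebesgue_on \<Omega>. G x = G' x"
proof -
  have d: "G - G' \<in> L2 \<Omega>" by (rule L2.V_simps(4)[OF assms(1,2)])
  have "AE x in lebesgue_on \<Omega>. (G - G') x $ i = 0" for i
  proof (rule zero_if_orthogonal_to_test_functions[OF _ open_domain])
    show "(\<lambda>x. (G - G') x $ i) \<in> L2 \<Omega>"
    proof (rule L2_bound(1)[OF d, of _ 1])
      show "(\<lambda>x. (G - G') x $ i) \<in> borel_measurable (lebesgue_on \<Omega>)"
        unfolding cart_eq_inner_axis by (rule borel_measurable_inner[OF L2_measurable[OF d] measurable_const]) simp
      show "AE x in lebesgue_on \<Omega>. norm ((G - G') x $ i) \<le> 1 * norm ((G - G') x)"
        using component_le_norm_cart[of "(G - G') _" i] by (intro AE_I2) (simp del: minus_apply)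
    qed
    fix \<phi> assume \<phi>: "\<phi> \<in> test_functions \<Omega>"
    note a = test_axis_L2[OF \<phi> domain_sets(1), of i]
    have "(LINT x|lebesgue_on \<Omega>. (G - G') x $ i * \<phi> x) = L2_inner \<Omega> (G - G') (\<lambda>x. \<phi> x *\<^sub>R axis i 1)"
      by (simp add: L2_inner_def inner_axis mult.commute)
    also have "\<dots> = L2_inner \<Omega> G (\<lambda>x. \<phi> x *\<^sub>R axis i 1) - L2_inner \<Omega> G' (\<lambda>x. \<phi> x *\<^sub>R axis i 1)"
      by (rule L2.ip_simps(3)[OF assms(1,2) a])
    also have "\<dots> = 0" using assms(3,4) \<phi> by (simp add: is_weak_grad_iff_L2_inner)
    finally show "(LINT x|lebesgue_on \<Omega>. (G - G') x $ i * \<phi> x) = 0" .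
  qed
  then have "AE x in lebesgue_on \<Omega>. \<forall>i\<in>UNIV. (G - G') x $ i = 0"
    by (intro AE_finite_allI) auto
  then show ?thesis by eventually_elim (simp add: vec_eq_iff)
qed

lemma weak_grad:
  assumes "v \<in> H1 \<Omega>"
  shows "weak_grad \<Omega> v \<in> L2 \<Omega>" "is_weak_grad \<Omega> v (weak_grad \<Omega> v)"
proof -
  have "\<exists>G. G \<in> L2 \<Omega> \<and> is_weak_grad \<Omega> v G" using assms by (simp add: H1_def)
  from someI_ex[OF this] show "weak_grad \<Omega> v \<in> L2 \<Omega>" "is_weak_grad \<Omega> v (weak_grad \<Omega> v)"
    by (auto simp: weak_grad_def)
qed

lemma H1I:
  assumes "v \<in> L2 \<Omega>" "G \<in> L2 \<Omega>" "is_weak_grad \<Omega> v G"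
  shows "v \<in> H1 \<Omega>" "AE x in lebesgue_on \<Omega>. weak_grad \<Omega> v x = G x"
proof -
  show *: "v \<in> H1 \<Omega>" using assms by (auto simp: H1_def)
  show "AE x in lebesgue_on \<Omega>. weak_grad \<Omega> v x = G x"
    using weak_grad_unique weak_grad[OF *] assms by blast
qed

lemma H1_L2: "v \<in> H1 \<Omega> \<Longrightarrow> v \<in> L2 \<Omega>" by (simp add: H1_def)

lemma smooth_H1:
  assumes "smooth \<phi>"
  shows "\<phi> \<in> H1 \<Omega>" "AE x in lebesgue_on \<Omega>. weak_grad \<Omega> \<phi> x = grad \<phi> x"
  using H1I[OF smooth_L2[OF assms bounded_domain domain_sets(1)] smooth_weak_grad[OF assms open_domain]] by auto

lemma is_weak_grad_add:
  assumes "u \<in> L2 \<Omega>" "v \<in> L2 \<Omega>" "G \<in> L2 \<Omega>" "H \<in> L2 \<Omega>" "is_weak_grad \<Omega> u G" "is_weak_grad \<Omega> v H"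
  shows "is_weak_grad \<Omega> (u + v) (G + H)"
  using assms unfolding is_weak_grad_iff_L2_inner
  by (auto simp: L2.ip_simps(1)[OF _ _ test_function_L2(2)] L2.ip_simps(1)[OF _ _ test_axis_L2])

lemma is_weak_grad_scale:
  assumes "u \<in> L2 \<Omega>" "G \<in> L2 \<Omega>" "is_weak_grad \<Omega> u G"
  shows "is_weak_grad \<Omega> (r *\<^sub>R u) (r *\<^sub>R G)"
  using assms unfolding is_weak_grad_iff_L2_inner
  by (auto simp: L2.ip_simps(5)[OF _ _ test_function_L2(2)] L2.ip_simps(5)[OF _ _ test_axis_L2])

lemma H1_add:
  assumes "u \<in> H1 \<Omega>" "v \<in> H1 \<Omega>"
  shows "u + v \<in> H1 \<Omega>" "AE x in lebesgue_on \<Omega>. weak_grad \<Omega> (u + v) x = (weak_grad \<Omega> u + weak_grad \<Omega> v) x"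
  using H1I[OF _ _ is_weak_grad_add] assms[THEN H1_L2] weak_grad[OF assms(1)] weak_grad[OF assms(2)]
  by (simp_all only: L2.V_simps)

lemma H1_scale:
  assumes "u \<in> H1 \<Omega>"
  shows "r *\<^sub>R u \<in> H1 \<Omega>" "AE x in lebesgue_on \<Omega>. weak_grad \<Omega> (r *\<^sub>R u) x = (r *\<^sub>R weak_grad \<Omega> u) x"
  using H1I[OF _ _ is_weak_grad_scale] assms[THEN H1_L2] weak_grad[OF assms(1)]
  by (simp_all only: L2.V_simps)

lemma H1_diff:
  assumes "u \<in> H1 \<Omega>" "v \<in> H1 \<Omega>"
  shows "u - v \<in> H1 \<Omega>" "AE x in lebesgue_on \<Omega>. weak_grad \<Omega> (u - v) x = (weak_grad \<Omega> u - weak_grad \<Omega> v) x"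
proof -
  have eq: "u - v = u + (-1) *\<^sub>R v" by simp
  show "u - v \<in> H1 \<Omega>" unfolding eq by (intro H1_add H1_scale assms)
  have "AE x in lebesgue_on \<Omega>. weak_grad \<Omega> (u - v) x = (weak_grad \<Omega> u + weak_grad \<Omega> ((-1) *\<^sub>R v)) x"
    unfolding eq by (intro H1_add H1_scale assms)
  then show "AE x in lebesgue_on \<Omega>. weak_grad \<Omega> (u - v) x = (weak_grad \<Omega> u - weak_grad \<Omega> v) x"
    using H1_scale(2)[OF assms(2), of "-1"] by eventually_elim simp
qed

lemma grad_inner_lin_fun:
  assumes F: "F \<in> L2 \<Omega>"
  shows "lin_fun (H1 \<Omega>) (\<lambda>u. L2_inner \<Omega> (weak_grad \<Omega> u) F)"
  unfolding lin_fun_def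
proof (intro conjI ballI allI)
  fix u v assume uv: "u \<in> H1 \<Omega>" "v \<in> H1 \<Omega>"
  note W = weak_grad(1)[OF uv(1)] weak_grad(1)[OF uv(2)]
  have "L2_inner \<Omega> (weak_grad \<Omega> (u + v)) F = L2_inner \<Omega> (weak_grad \<Omega> u + weak_grad \<Omega> v) F"
    by (rule L2_inner_cong_AE) (use H1_add[OF uv] weak_grad(1) W F in \<open>auto simp del: plus_fun_apply\<close>)
  also have "\<dots> = L2_inner \<Omega> (weak_grad \<Omega> u) F + L2_inner \<Omega> (weak_grad \<Omega> v) F"
    by (rule L2.ip_simps(1)[OF W F])
  finally show "L2_inner \<Omega> (weak_grad \<Omega> (u + v)) F = L2_inner \<Omega> (weak_grad \<Omega> u) F + L2_inner \<Omega> (weak_grad \<Omega> v) F" .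
next
  fix u r assume u: "u \<in> H1 \<Omega>"
  note W = weak_grad(1)[OF u]
  have "L2_inner \<Omega> (weak_grad \<Omega> (r *\<^sub>R u)) F = L2_inner \<Omega> (r *\<^sub>R weak_grad \<Omega> u) F"
    by (rule L2_inner_cong_AE) (use H1_scale[OF u] weak_grad(1) W F in \<open>auto simp del: scaleR_fun_apply\<close>)
  also have "\<dots> = r * L2_inner \<Omega> (weak_grad \<Omega> u) F"
    by (rule L2.ip_simps(5)[OF W F F])
  finally show "L2_inner \<Omega> (weak_grad \<Omega> (r *\<^sub>R u)) F = r * L2_inner \<Omega> (weak_grad \<Omega> u) F" .
qed

lemma grad_inner_bilin: "bilin (H1 \<Omega>) (\<lambda>u v. L2_inner \<Omega> (weak_grad \<Omega> u) (weak_grad \<Omega> v))"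
  unfolding bilin_def
proof (intro conjI ballI)
  fix w assume w: "w \<in> H1 \<Omega>"
  show lin: "lin_fun (H1 \<Omega>) (\<lambda>u. L2_inner \<Omega> (weak_grad \<Omega> u) (weak_grad \<Omega> w))"
    by (rule grad_inner_lin_fun[OF weak_grad(1)[OF w]])
  show "lin_fun (H1 \<Omega>) (\<lambda>u. L2_inner \<Omega> (weak_grad \<Omega> w) (weak_grad \<Omega> u))"
    using lin by (subst L2_inner_commute)
qed

definition H1_inner :: "(real^'n \<Rightarrow> real) \<Rightarrow> (real^'n \<Rightarrow> real) \<Rightarrow> real" where
  "H1_inner u v = L2_inner \<Omega> u v + L2_inner \<Omega> (weak_grad \<Omega> u) (weak_grad \<Omega> v)"

lemma semi_inner_H1: "semi_inner (H1 \<Omega>) H1_inner"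
proof
  have "(0::real^'n \<Rightarrow> real) \<in> H1 \<Omega>" using smooth_H1(1)[OF smooth_const[of 0]] by (simp add: zero_fun_def)
  then show "subspace (H1 \<Omega>)" by (auto simp: subspace_def H1_add H1_scale)
  have "bilin (H1 \<Omega>) (L2_inner \<Omega>)"
    by (rule bilin_subset[OF L2.bilin_ip]) (use H1_L2 in blast)
  then show "bilin (H1 \<Omega>) H1_inner"
    using grad_inner_bilin by (auto simp: bilin_def lin_fun_def H1_inner_def algebra_simps)
  show "H1_inner u v = H1_inner v u" for u v
    by (simp add: H1_inner_def L2_inner_def inner_commute mult.commute)
  show "0 \<le> H1_inner u u" for u
    unfolding H1_inner_def by (intro add_nonneg_nonneg L2_inner_nonneg)
qed

lemma H1_nrm: "semi_inner.nrm H1_inner = H1_norm \<Omega>"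
  by (simp add: semi_inner.nrm_def[OF semi_inner_H1] H1_norm_def H1_inner_def L2_norm_def fun_eq_iff
      L2_inner_nonneg)

lemma L2_le_H1_norm: "L2_norm \<Omega> v \<le> H1_norm \<Omega> v" "L2_norm \<Omega> (weak_grad \<Omega> v) \<le> H1_norm \<Omega> v"
  unfolding H1_norm_def by (auto intro: real_le_rsqrt)

lemma H1_norm_diff:
  assumes "u \<in> H1 \<Omega>" "v \<in> H1 \<Omega>"
  shows "L2_norm \<Omega> (weak_grad \<Omega> u - weak_grad \<Omega> v) = L2_norm \<Omega> (weak_grad \<Omega> (u - v))"
  using assms H1_diff[OF assms] weak_grad(1)
  by (intro L2_norm_cong_AE L2.V_simps(4)) (auto simp: eq_commute)

text \<open>
  The defining identity of the weak gradient passes to limits in \<open>L2\<close>.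
\<close>

lemma semi_hilbert_H1: "semi_hilbert (H1 \<Omega>) H1_inner"
proof -
  interpret H: semi_inner "H1 \<Omega>" H1_inner by (rule semi_inner_H1)
  show ?thesis
  proof
    fix s :: "nat \<Rightarrow> real^'n \<Rightarrow> real"
    assume s: "\<And>n. s n \<in> H1 \<Omega>" and "\<And>e. 0 < e \<Longrightarrow> \<exists>N. \<forall>m\<ge>N. \<forall>n\<ge>N. H.nrm (s m - s n) < e"
    then have cau: "\<exists>N. \<forall>m\<ge>N. \<forall>n\<ge>N. H1_norm \<Omega> (s m - s n) < e" if "0 < e" for e
      using that by (simp add: H1_nrm)
    have "\<exists>v\<in>L2 \<Omega>. (\<lambda>n. L2_norm \<Omega> (s n - v)) \<longlonglongrightarrow> 0"
    proof (rule L2.complete)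
      show "s n \<in> L2 \<Omega>" for n using s by (rule H1_L2)
      show "\<exists>N. \<forall>m\<ge>N. \<forall>n\<ge>N. L2_norm \<Omega> (s m - s n) < e" if "0 < e" for e
        using cau[OF that] L2_le_H1_norm(1) le_less_trans by meson
    qed
    then obtain v where v: "v \<in> L2 \<Omega>" "(\<lambda>n. L2_norm \<Omega> (s n - v)) \<longlonglongrightarrow> 0" by blast
    have "\<exists>G\<in>L2 \<Omega>. (\<lambda>n. L2_norm \<Omega> (weak_grad \<Omega> (s n) - G)) \<longlonglongrightarrow> 0"
    proof (rule L2.complete)
      show "weak_grad \<Omega> (s n) \<in> L2 \<Omega>" for n using s by (rule weak_grad)
      show "\<exists>N. \<forall>m\<ge>N. \<forall>n\<ge>N. L2_norm \<Omega> (weak_grad \<Omega> (s m) - weak_grad \<Omega> (s n)) < e" if "0 < e" for e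
        using cau[OF that] L2_le_H1_norm(2) le_less_trans unfolding H1_norm_diff[OF s s] by meson
    qed
    then obtain G where G: "G \<in> L2 \<Omega>" "(\<lambda>n. L2_norm \<Omega> (weak_grad \<Omega> (s n) - G)) \<longlonglongrightarrow> 0" by blast
    have wg: "is_weak_grad \<Omega> v G"
      unfolding is_weak_grad_iff_L2_inner
    proof (intro ballI allI)
      fix \<phi> i assume \<phi>: "\<phi> \<in> test_functions \<Omega>"
      have 1: "(\<lambda>n. L2_inner \<Omega> (s n) (pderiv_dir i \<phi>)) \<longlonglongrightarrow> L2_inner \<Omega> v (pderiv_dir i \<phi>)"
        using \<phi> s v by (intro L2_inner_tendsto) (auto simp: test_function_L2 H1_L2)
      have 2: "(\<lambda>n. L2_inner \<Omega> (weak_grad \<Omega> (s n)) (\<lambda>x. \<phi> x *\<^sub>R axis i 1)) \<longlonglongrightarrow> L2_inner \<Omega> G (\<lambda>x. \<phi> x *\<^sub>R axis i 1)"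
        using \<phi> s G by (intro L2_inner_tendsto) (auto simp: test_axis_L2 weak_grad)
      have "L2_inner \<Omega> (s n) (pderiv_dir i \<phi>) = - L2_inner \<Omega> (weak_grad \<Omega> (s n)) (\<lambda>x. \<phi> x *\<^sub>R axis i 1)" for n
        using weak_grad(2)[OF s] \<phi> by (simp add: is_weak_grad_iff_L2_inner)
      with 1 have "(\<lambda>n. - L2_inner \<Omega> (weak_grad \<Omega> (s n)) (\<lambda>x. \<phi> x *\<^sub>R axis i 1)) \<longlonglongrightarrow> L2_inner \<Omega> v (pderiv_dir i \<phi>)"
        by simp
      from LIMSEQ_unique[OF this tendsto_minus[OF 2]]
      show "L2_inner \<Omega> v (pderiv_dir i \<phi>) = - L2_inner \<Omega> G (\<lambda>x. \<phi> x *\<^sub>R axis i 1)" .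
    qed
    note vH = H1I[OF v(1) G(1) wg]
    have "L2_norm \<Omega> (weak_grad \<Omega> (s n - v)) = L2_norm \<Omega> (weak_grad \<Omega> (s n) - G)" for n
    proof -
      have "L2_norm \<Omega> (weak_grad \<Omega> (s n - v)) = L2_norm \<Omega> (weak_grad \<Omega> (s n) - weak_grad \<Omega> v)"
        using H1_norm_diff[OF s vH(1)] by simp
      also have "\<dots> = L2_norm \<Omega> (weak_grad \<Omega> (s n) - G)"
      proof (rule L2_norm_cong_AE)
        show "AE x in lebesgue_on \<Omega>. (weak_grad \<Omega> (s n) - weak_grad \<Omega> v) x = (weak_grad \<Omega> (s n) - G) x"
          using vH(2) by eventually_elim simp
      qed (use weak_grad(1)[OF s] weak_grad(1)[OF vH(1)] G in auto)
      finally show ?thesis .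
    qed
    then have "(\<lambda>n. sqrt ((L2_norm \<Omega> (s n - v))\<^sup>2 + (L2_norm \<Omega> (weak_grad \<Omega> (s n - v)))\<^sup>2)) \<longlonglongrightarrow> sqrt (0\<^sup>2 + 0\<^sup>2)"
      using v(2) G(2) by (intro tendsto_intros) auto
    then have "(\<lambda>n. H.nrm (s n - v)) \<longlonglongrightarrow> 0" by (simp add: H1_nrm H1_norm_def)
    then show "\<exists>v\<in>H1 \<Omega>. (\<lambda>n. H.nrm (s n - v)) \<longlonglongrightarrow> 0" using vH(1) by blast
  qed
qed

end

sublocale bounded_domain \<subseteq> H1: semi_hilbert "H1 \<Omega>" "bounded_domain.H1_inner \<Omega>"
  rewrites "semi_inner.nrm (bounded_domain.H1_inner \<Omega>) = H1_norm \<Omega>"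
  by (rule semi_hilbert_H1) (rule H1_nrm)

section \<open>Functions vanishing on the Dirichlet part\<close>

lemma (in semi_hilbert) closed_subspace:
  assumes W: "subspace W" "W \<subseteq> V"
    and closed: "\<And>s v. (\<And>n. s n \<in> W) \<Longrightarrow> v \<in> V \<Longrightarrow> (\<lambda>n. nrm (s n - v)) \<longlonglongrightarrow> 0 \<Longrightarrow> v \<in> W"
  shows "semi_hilbert W ip"
proof -
  interpret W: semi_inner W ip
  proof
    show "ip u v = ip v u" if "u \<in> W" "v \<in> W" for u v using that W(2) by (intro sym) auto
  qed (use W bilin_subset[OF bilin_ip] nonneg in auto)
  show ?thesis
  proof
    fix s :: "nat \<Rightarrow> 'a"
    assume s: "\<And>n. s n \<in> W" "\<And>e. 0 < e \<Longrightarrow> \<exists>N. \<forall>m\<ge>N. \<forall>n\<ge>N. W.nrm (s m - s n) < e"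
    have "\<exists>v\<in>V. (\<lambda>n. nrm (s n - v)) \<longlonglongrightarrow> 0"
    proof (rule complete)
      show "s n \<in> V" for n using s(1) W(2) by blast
      show "\<exists>N. \<forall>m\<ge>N. \<forall>n\<ge>N. nrm (s m - s n) < e" if "0 < e" for e
        by (rule s(2)[OF that])
    qed
    then show "\<exists>v\<in>W. (\<lambda>n. W.nrm (s n - v)) \<longlonglongrightarrow> 0"
      using closed s(1) by blast
  qed
qed

lemma sets_surface_measure [simp, measurable_cong]: "sets surface_measure = sets borel"
  by (simp add: surface_measure_def hausdorff_measure_def sets.sigma_sets_eq[of borel, simplified])

lemma space_surface_measure [simp]: "space surface_measure = UNIV"
  by (simp add: surface_measure_def hausdorff_measure_def)

locale trace_domain = bounded_domain \<Omega> for \<Omega> :: "(real^'n::finite) set" +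
  fixes \<Gamma>D :: "(real^'n) set"
  assumes boundary_part_borel: "\<Gamma>D \<in> sets borel"
begin

text \<open>
  Approximation up to every \<open>e\<close> replaces the approximating sequence, which makes closure under sums and
  limits accessible.
\<close>

lemma zero_trace_iff:
  "has_trace \<Omega> \<Gamma>D v (\<lambda>_. 0) \<longleftrightarrow> (\<forall>e>0. \<exists>\<phi>. smooth \<phi> \<and> H1_norm \<Omega> (\<phi> - v) < e \<and>
     (\<integral>\<^sup>+x\<in>\<Gamma>D. ennreal ((\<phi> x)\<^sup>2) \<partial>surface_measure) < ennreal e)"
  (is "_ = ?R")
proof
  assume "has_trace \<Omega> \<Gamma>D v (\<lambda>_. 0)"
  then obtain \<phi> where \<phi>: "\<And>k. smooth (\<phi> k)" "(\<lambda>k. H1_norm \<Omega> (\<phi> k - v)) \<longlonglongrightarrow> 0"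
    "(\<lambda>k. \<integral>\<^sup>+x\<in>\<Gamma>D. ennreal ((\<phi> k x)\<^sup>2) \<partial>surface_measure) \<longlonglongrightarrow> 0"
    by (auto simp: has_trace_def fun_diff_def)
  show ?R
  proof (intro allI impI)
    fix e :: real assume e: "0 < e"
    have "eventually (\<lambda>k. H1_norm \<Omega> (\<phi> k - v) < e \<and> (\<integral>\<^sup>+x\<in>\<Gamma>D. ennreal ((\<phi> k x)\<^sup>2) \<partial>surface_measure) < ennreal e) sequentially"
      using order_tendstoD(2)[OF \<phi>(2) e] order_tendstoD(2)[OF \<phi>(3), of "ennreal e"] e
      by (auto intro: eventually_conj)
    from eventually_happens'[OF sequentially_bot this]
    obtain k where "H1_norm \<Omega> (\<phi> k - v) < e \<and> (\<integral>\<^sup>+x\<in>\<Gamma>D. ennreal ((\<phi> k x)\<^sup>2) \<partial>surface_measure) < ennreal e"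
      by blast
    then show "\<exists>\<phi>. smooth \<phi> \<and> H1_norm \<Omega> (\<phi> - v) < e \<and>
       (\<integral>\<^sup>+x\<in>\<Gamma>D. ennreal ((\<phi> x)\<^sup>2) \<partial>surface_measure) < ennreal e"
      using \<phi>(1) by blast
  qed
next
  assume R: ?R
  have "\<exists>\<phi>. smooth \<phi> \<and> H1_norm \<Omega> (\<phi> - v) < 1 / real (Suc k) \<and>
     (\<integral>\<^sup>+x\<in>\<Gamma>D. ennreal ((\<phi> x)\<^sup>2) \<partial>surface_measure) < ennreal (1 / real (Suc k))" for k
  proof -
    have "0 < 1 / real (Suc k)" by simp
    then show ?thesis by (rule R[rule_format])
  qed
  then obtain \<phi> where \<phi>: "\<And>k. smooth (\<phi> k)" "\<And>k. H1_norm \<Omega> (\<phi> k - v) < 1 / real (Suc k)"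
     "\<And>k. (\<integral>\<^sup>+x\<in>\<Gamma>D. ennreal ((\<phi> k x)\<^sup>2) \<partial>surface_measure) < ennreal (1 / real (Suc k))"
    by metis
  have 1: "(\<lambda>k. H1_norm \<Omega> (\<phi> k - v)) \<longlonglongrightarrow> 0"
  proof (rule Lim_null_comparison[OF _ inverse_Suc_tendsto_0], intro always_eventually allI)
    show "norm (H1_norm \<Omega> (\<phi> k - v)) \<le> 1 / real (Suc k)" for k
      using \<phi>(2)[of k] by (simp add: H1_norm_def)
  qed
  have 2: "(\<lambda>k. \<integral>\<^sup>+x\<in>\<Gamma>D. ennreal ((\<phi> k x)\<^sup>2) \<partial>surface_measure) \<longlonglongrightarrow> 0"
  proof (rule tendsto_sandwich[OF _ _ tendsto_const])
    show "(\<lambda>k. ennreal (1 / real (Suc k))) \<longlonglongrightarrow> 0"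
      using tendsto_ennrealI[OF inverse_Suc_tendsto_0] by simp
  qed (use \<phi>(3) in \<open>auto intro!: always_eventually less_imp_le\<close>)
  show "has_trace \<Omega> \<Gamma>D v (\<lambda>_. 0)"
    unfolding has_trace_def using \<phi>(1) 1 2 by (auto simp: fun_diff_def intro!: exI[of _ \<phi>])
qed

lemma trace_integral_measurable:
  "smooth \<phi> \<Longrightarrow> (\<lambda>x. ennreal ((\<phi> x)\<^sup>2) * indicator \<Gamma>D x) \<in> borel_measurable surface_measure"
proof -
  assume "smooth \<phi>"
  then have "\<phi> \<in> borel_measurable borel" by (intro borel_measurable_continuous_onI smooth_continuous)
  then have [measurable]: "\<phi> \<in> borel_measurable surface_measure" by (simp cong: measurable_cong_sets)
  have [measurable]: "\<Gamma>D \<in> sets surface_measure" using boundary_part_borel by simp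
  show ?thesis by measurable
qed

lemma H1D_subset: "H1D \<Omega> \<Gamma>D \<subseteq> H1 \<Omega>"
  by (auto simp: H1D_def)

lemma H1D_add:
  assumes u: "u \<in> H1D \<Omega> \<Gamma>D" and v: "v \<in> H1D \<Omega> \<Gamma>D"
  shows "u + v \<in> H1D \<Omega> \<Gamma>D"
proof -
  have uv: "u \<in> H1 \<Omega>" "v \<in> H1 \<Omega>" using u v by (auto simp: H1D_def)
  have "\<exists>\<phi>. smooth \<phi> \<and> H1_norm \<Omega> (\<phi> - (u + v)) < e \<and>
     (\<integral>\<^sup>+x\<in>\<Gamma>D. ennreal ((\<phi> x)\<^sup>2) \<partial>surface_measure) < ennreal e" if e: "0 < e" for e
  proof -
    obtain \<phi> where \<phi>: "smooth \<phi>" "H1_norm \<Omega> (\<phi> - u) < e/4"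
      "(\<integral>\<^sup>+x\<in>\<Gamma>D. ennreal ((\<phi> x)\<^sup>2) \<partial>surface_measure) < ennreal (e/4)"
      using u e unfolding H1D_def zero_trace_iff by (auto dest!: spec[of _ "e/4"])
    obtain \<psi> where \<psi>: "smooth \<psi>" "H1_norm \<Omega> (\<psi> - v) < e/4"
      "(\<integral>\<^sup>+x\<in>\<Gamma>D. ennreal ((\<psi> x)\<^sup>2) \<partial>surface_measure) < ennreal (e/4)"
      using v e unfolding H1D_def zero_trace_iff by (auto dest!: spec[of _ "e/4"])
    have sm: "smooth (\<phi> + \<psi>)" using smooth_add[OF \<phi>(1) \<psi>(1)] by (simp add: plus_fun_def)
    have eq: "\<phi> + \<psi> - (u + v) = (\<phi> - u) + (\<psi> - v)" by simp
    have "H1_norm \<Omega> (\<phi> + \<psi> - (u + v)) \<le> H1_norm \<Omega> (\<phi> - u) + H1_norm \<Omega> (\<psi> - v)"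
      unfolding eq using smooth_H1(1)[OF \<phi>(1)] smooth_H1(1)[OF \<psi>(1)] uv by (intro H1.nrm_triangle H1_diff)
    then have n: "H1_norm \<Omega> (\<phi> + \<psi> - (u + v)) < e" using \<phi>(2) \<psi>(2) e by linarith
    have "(\<integral>\<^sup>+x\<in>\<Gamma>D. ennreal (((\<phi> + \<psi>) x)\<^sup>2) \<partial>surface_measure)
       \<le> (\<integral>\<^sup>+x. 2 * (ennreal ((\<phi> x)\<^sup>2) * indicator \<Gamma>D x) + 2 * (ennreal ((\<psi> x)\<^sup>2) * indicator \<Gamma>D x) \<partial>surface_measure)"
    proof (rule nn_integral_mono)
      fix x
      have "(\<phi> x + \<psi> x)\<^sup>2 \<le> 2 * (\<phi> x)\<^sup>2 + 2 * (\<psi> x)\<^sup>2"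
        using zero_le_power2[of "\<phi> x - \<psi> x"] by (simp add: power2_sum power2_diff)
      then have "ennreal ((\<phi> x + \<psi> x)\<^sup>2) \<le> ennreal (2 * (\<phi> x)\<^sup>2 + 2 * (\<psi> x)\<^sup>2)" by (rule ennreal_leI)
      also have "\<dots> = 2 * ennreal ((\<phi> x)\<^sup>2) + 2 * ennreal ((\<psi> x)\<^sup>2)"
        by (simp add: ennreal_mult)
      finally show "ennreal (((\<phi> + \<psi>) x)\<^sup>2) * indicator \<Gamma>D x
        \<le> 2 * (ennreal ((\<phi> x)\<^sup>2) * indicator \<Gamma>D x) + 2 * (ennreal ((\<psi> x)\<^sup>2) * indicator \<Gamma>D x)"
        by (simp split: split_indicator)
    qed
    also have "\<dots> = 2 * (\<integral>\<^sup>+x\<in>\<Gamma>D. ennreal ((\<phi> x)\<^sup>2) \<partial>surface_measure) + 2 * (\<integral>\<^sup>+x\<in>\<Gamma>D. ennreal ((\<psi> x)\<^sup>2) \<partial>surface_measure)"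
      using trace_integral_measurable[OF \<phi>(1)] trace_integral_measurable[OF \<psi>(1)]
      by (simp add: nn_integral_add nn_integral_cmult)
    also have "\<dots> < 2 * ennreal (e/4) + 2 * ennreal (e/4)"
      using \<phi>(3) \<psi>(3) by (intro add_strict_mono ennreal_mult_strict_left_mono) auto
    also have "\<dots> = ennreal e"
      using e by (simp add: ennreal_plus[symmetric] ennreal_mult'[symmetric] flip: ennreal_numeral)
    finally show ?thesis using sm n by blast
  qed
  then show ?thesis using uv unfolding H1D_def zero_trace_iff by (simp add: H1_add)
qed

lemma H1D_scale:
  assumes u: "u \<in> H1D \<Omega> \<Gamma>D"
  shows "r *\<^sub>R u \<in> H1D \<Omega> \<Gamma>D"
proof -
  have u1: "u \<in> H1 \<Omega>" using u by (auto simp: H1D_def)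
  have "\<exists>\<phi>. smooth \<phi> \<and> H1_norm \<Omega> (\<phi> - r *\<^sub>R u) < e \<and>
     (\<integral>\<^sup>+x\<in>\<Gamma>D. ennreal ((\<phi> x)\<^sup>2) \<partial>surface_measure) < ennreal e" if e: "0 < e" for e
  proof -
    define d where "d = e / (\<bar>r\<bar> + r\<^sup>2 + 1)"
    have den: "0 < \<bar>r\<bar> + r\<^sup>2 + 1" by (simp add: add_nonneg_pos)
    have d: "0 < d" using e den by (simp add: d_def)
    have dr: "0 \<le> d * \<bar>r\<bar>" "0 \<le> d * r\<^sup>2" using d by simp_all
    have de: "d * (\<bar>r\<bar> + r\<^sup>2 + 1) = e" using den by (simp add: d_def)
    obtain \<phi> where \<phi>: "smooth \<phi>" "H1_norm \<Omega> (\<phi> - u) < d"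
      "(\<integral>\<^sup>+x\<in>\<Gamma>D. ennreal ((\<phi> x)\<^sup>2) \<partial>surface_measure) < ennreal d"
      using u d unfolding H1D_def zero_trace_iff by auto
    have sm: "smooth (r *\<^sub>R \<phi>)" using smooth_mult[OF smooth_const \<phi>(1)] by (simp add: scaleR_fun_def)
    have "H1_norm \<Omega> (r *\<^sub>R \<phi> - r *\<^sub>R u) = \<bar>r\<bar> * H1_norm \<Omega> (\<phi> - u)"
      using H1.nrm_scale[of "\<phi> - u" r] smooth_H1(1)[OF \<phi>(1)] u1 by (simp add: scaleR_diff_right)
    also have "\<dots> \<le> \<bar>r\<bar> * d" using \<phi>(2) by (intro mult_left_mono) auto
    also have "\<dots> < e" using de d dr(2) unfolding distrib_left mult.commute[of "\<bar>r\<bar>" d] by linarith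
    finally have n: "H1_norm \<Omega> (r *\<^sub>R \<phi> - r *\<^sub>R u) < e" .
    have "(\<integral>\<^sup>+x\<in>\<Gamma>D. ennreal (((r *\<^sub>R \<phi>) x)\<^sup>2) \<partial>surface_measure)
      = ennreal (r\<^sup>2) * (\<integral>\<^sup>+x\<in>\<Gamma>D. ennreal ((\<phi> x)\<^sup>2) \<partial>surface_measure)"
      using trace_integral_measurable[OF \<phi>(1)]
      by (subst nn_integral_cmult[symmetric]) (auto simp: power_mult_distrib ennreal_mult mult.assoc)
    also have "\<dots> \<le> ennreal (r\<^sup>2) * ennreal d" using \<phi>(3) by (intro mult_left_mono) auto
    also have "\<dots> = ennreal (r\<^sup>2 * d)" using d by (simp add: ennreal_mult)
    also have "\<dots> < ennreal e"
    proof (rule ennreal_lessI[OF e])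
      show "r\<^sup>2 * d < e" using de d dr(1) unfolding distrib_left mult.commute[of "r\<^sup>2" d] by linarith
    qed
    finally show ?thesis using sm n by blast
  qed
  then show ?thesis using u1 unfolding H1D_def zero_trace_iff by (simp add: H1_scale)
qed

lemma H1D_zero: "0 \<in> H1D \<Omega> \<Gamma>D"
proof -
  have "smooth (0 :: real^'n \<Rightarrow> real)" using smooth_const[of 0] by (simp add: zero_fun_def)
  moreover have "H1_norm \<Omega> (0 - 0) = 0" by simp
  ultimately show ?thesis
    unfolding H1D_def zero_trace_iff by (auto intro!: exI[of _ 0] smooth_H1)
qed

text \<open>
  \<open>H1D\<close> is closed: smooth approximants of elements near \<open>v\<close> that are small on \<open>\<Gamma>D\<close> also approximate \<open>v\<close>.
\<close>

lemma semi_hilbert_H1D: "semi_hilbert (H1D \<Omega> \<Gamma>D) H1_inner"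
proof (rule H1.closed_subspace)
  show "subspace (H1D \<Omega> \<Gamma>D)" by (simp add: subspace_def H1D_zero H1D_add H1D_scale)
  show "H1D \<Omega> \<Gamma>D \<subseteq> H1 \<Omega>" by (rule H1D_subset)
  fix s :: "nat \<Rightarrow> real^'n \<Rightarrow> real" and v
  assume s: "\<And>n. s n \<in> H1D \<Omega> \<Gamma>D" and v: "v \<in> H1 \<Omega>" and lim: "(\<lambda>n. H1_norm \<Omega> (s n - v)) \<longlonglongrightarrow> 0"
  have sH: "s n \<in> H1 \<Omega>" for n using s H1D_subset by blast
  have "\<exists>\<phi>. smooth \<phi> \<and> H1_norm \<Omega> (\<phi> - v) < e \<and>
     (\<integral>\<^sup>+x\<in>\<Gamma>D. ennreal ((\<phi> x)\<^sup>2) \<partial>surface_measure) < ennreal e" if e: "0 < e" for e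
  proof -
    obtain n where n: "H1_norm \<Omega> (s n - v) < e/2"
      using order_tendstoD(2)[OF lim, of "e/2"] e by (auto simp: eventually_sequentially)
    obtain \<phi> where \<phi>: "smooth \<phi>" "H1_norm \<Omega> (\<phi> - s n) < e/2"
      "(\<integral>\<^sup>+x\<in>\<Gamma>D. ennreal ((\<phi> x)\<^sup>2) \<partial>surface_measure) < ennreal (e/2)"
      using s[of n] e unfolding H1D_def zero_trace_iff by (auto dest!: spec[of _ "e/2"])
    have "H1_norm \<Omega> (\<phi> - v) \<le> H1_norm \<Omega> (\<phi> - s n) + H1_norm \<Omega> (s n - v)"
      using H1.nrm_triangle[of "\<phi> - s n" "s n - v"] smooth_H1(1)[OF \<phi>(1)] sH v by simp
    then have "H1_norm \<Omega> (\<phi> - v) < e" using \<phi>(2) n by linarith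
    moreover have "ennreal (e/2) \<le> ennreal e" using e by (intro ennreal_leI) simp
    ultimately show ?thesis using \<phi>(1,3) less_le_trans by blast
  qed
  then show "v \<in> H1D \<Omega> \<Gamma>D" using v unfolding H1D_def zero_trace_iff by simp
qed

end

sublocale trace_domain \<subseteq> H1D: semi_hilbert "H1D \<Omega> \<Gamma>D" H1_inner
  rewrites "semi_inner.nrm H1_inner = H1_norm \<Omega>"
  by (rule semi_hilbert_H1D) (rule H1_nrm)

section \<open>Controlling a function by its means over finitely many balls\<close>

lemma set_integral_square_le:
  fixes g :: "'a \<Rightarrow> real"
  assumes S: "S \<in> sets M" "emeasure M S < \<infinity>" "0 < measure M S"
    and g: "set_integrable M S g" "set_integrable M S (\<lambda>x. (g x)\<^sup>2)"
  shows "(LINT x:S|M. g x)\<^sup>2 \<le> measure M S * (LINT x:S|M. (g x)\<^sup>2)"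
proof -
  define \<mu> where "\<mu> = measure M S"
  define I where "I = (LINT x:S|M. g x)"
  define m where "m = I / \<mu>"
  have \<mu>: "0 < \<mu>" using S by (simp add: \<mu>_def)
  have const: "set_integrable M S (\<lambda>x. m\<^sup>2)" "(LINT x:S|M. m\<^sup>2) = \<mu> * m\<^sup>2"
    using S by (auto simp: set_integrable_def set_lebesgue_integral_def \<mu>_def)
  have i2: "set_integrable M S (\<lambda>x. 2 * m * g x)" using g(1) by (rule set_integrable_mult_right)
  have "0 \<le> (LINT x:S|M. (g x - m)\<^sup>2)"
    unfolding set_lebesgue_integral_def by (intro integral_nonneg_AE) auto
  also have "\<dots> = (LINT x:S|M. ((g x)\<^sup>2 - 2 * m * g x) + m\<^sup>2)"
    by (simp add: power2_diff algebra_simps)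
  also have "\<dots> = (LINT x:S|M. (g x)\<^sup>2 - 2 * m * g x) + (LINT x:S|M. m\<^sup>2)"
    by (intro set_integral_add(2) set_integral_diff(1) g i2 const)
  also have "(LINT x:S|M. (g x)\<^sup>2 - 2 * m * g x) = (LINT x:S|M. (g x)\<^sup>2) - (LINT x:S|M. 2 * m * g x)"
    by (intro set_integral_diff(2) g i2)
  also have "(LINT x:S|M. 2 * m * g x) = 2 * m * I"
    by (simp add: I_def)
  finally have "0 \<le> \<mu> * ((LINT x:S|M. (g x)\<^sup>2) - 2 * m * I + \<mu> * m\<^sup>2)"
    using \<mu> const by simp
  also have "\<dots> = \<mu> * (LINT x:S|M. (g x)\<^sup>2) - I\<^sup>2"
    using \<mu> by (simp add: m_def field_simps power2_eq_square)
  finally show ?thesis by (simp add: \<mu>_def I_def)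
qed

lemma smooth_borel [measurable]:
  assumes "smooth \<phi>"
  shows "\<phi> \<in> borel_measurable borel" "grad \<phi> \<in> borel_measurable borel"
  using assms by (auto intro!: borel_measurable_continuous_onI smooth_continuous continuous_grad)

text \<open>
  Fundamental theorem of calculus along a segment, followed by Cauchy-Schwarz.
\<close>

lemma smooth_increment_square:
  fixes \<phi> :: "real^'n::finite \<Rightarrow> real"
  assumes \<phi>: "smooth \<phi>" and T: "0 < T"
  shows "ennreal ((\<phi> (x + T *\<^sub>R y) - \<phi> x)\<^sup>2) \<le>
    ennreal (T * (norm y)\<^sup>2) * (\<integral>\<^sup>+s\<in>{0..T}. ennreal ((norm (grad \<phi> (x + s *\<^sub>R y)))\<^sup>2) \<partial>lborel)"
proof -
  define g where "g s = grad \<phi> (x + s *\<^sub>R y) \<bullet> y" for s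
  have cg: "continuous_on S (\<lambda>s. grad \<phi> (x + s *\<^sub>R y))" for S
    by (intro continuous_on_compose2[OF continuous_grad[OF \<phi>, of UNIV]] continuous_intros) auto
  have cont: "continuous_on {0..T} g" unfolding g_def by (intro continuous_intros cg)
  have g: "set_integrable lborel {0..T} g" "set_integrable lborel {0..T} (\<lambda>s. (g s)\<^sup>2)"
    by (intro borel_integrable_atLeastAtMost' cont continuous_intros)+
  have "(LINT s:{0..T}|lborel. g s) = \<phi> (x + T *\<^sub>R y) - \<phi> (x + 0 *\<^sub>R y)"
    unfolding set_lebesgue_integral_def
  proof (rule integral_FTC_Icc)
    fix s :: real
    have "((\<lambda>s. \<phi> (x + s *\<^sub>R y)) has_derivative (\<lambda>h. grad \<phi> (x + s *\<^sub>R y) \<bullet> (h *\<^sub>R y))) (at s within {0..T})"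
      by (rule has_derivative_compose[where f = "\<lambda>s. x + s *\<^sub>R y" and g = \<phi>])
         (auto intro!: derivative_eq_intros smooth_has_derivative[OF \<phi>])
    then show "((\<lambda>s. \<phi> (x + s *\<^sub>R y)) has_vector_derivative g s) (at s within {0..T})"
      by (simp add: has_vector_derivative_def g_def mult.commute)
  qed (use cont T in auto)
  then have "(\<phi> (x + T *\<^sub>R y) - \<phi> x)\<^sup>2 \<le> T * (LINT s:{0..T}|lborel. (g s)\<^sup>2)"
    using set_integral_square_le[OF _ _ _ g] T by simp
  then have "ennreal ((\<phi> (x + T *\<^sub>R y) - \<phi> x)\<^sup>2) \<le> ennreal (T * (LINT s:{0..T}|lborel. (g s)\<^sup>2))"
    by (rule ennreal_leI)
  also have "\<dots> = ennreal T * ennreal (LINT s:{0..T}|lborel. (g s)\<^sup>2)"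
    using T by (intro ennreal_mult') simp
  also have "ennreal (LINT s:{0..T}|lborel. (g s)\<^sup>2) = (\<integral>\<^sup>+s. ennreal (indicator {0..T} s *\<^sub>R (g s)\<^sup>2) \<partial>lborel)"
    unfolding set_lebesgue_integral_def
    by (rule nn_integral_eq_integral[symmetric]) (use g(2) in \<open>auto simp: set_integrable_def\<close>)
  also have "\<dots> \<le> (\<integral>\<^sup>+s. ennreal ((norm y)\<^sup>2) * (ennreal ((norm (grad \<phi> (x + s *\<^sub>R y)))\<^sup>2) * indicator {0..T} s) \<partial>lborel)"
  proof (rule nn_integral_mono)
    fix s
    have "(g s)\<^sup>2 \<le> (norm (grad \<phi> (x + s *\<^sub>R y)) * norm y)\<^sup>2"
      unfolding g_def using Cauchy_Schwarz_ineq2 by (metis abs_ge_zero power2_abs power_mono)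
    then have "ennreal ((g s)\<^sup>2) \<le> ennreal ((norm y)\<^sup>2 * (norm (grad \<phi> (x + s *\<^sub>R y)))\<^sup>2)"
      by (intro ennreal_leI) (simp add: power_mult_distrib mult.commute)
    also have "\<dots> = ennreal ((norm y)\<^sup>2) * ennreal ((norm (grad \<phi> (x + s *\<^sub>R y)))\<^sup>2)"
      by (simp add: ennreal_mult)
    finally show "ennreal (indicator {0..T} s *\<^sub>R (g s)\<^sup>2)
       \<le> ennreal ((norm y)\<^sup>2) * (ennreal ((norm (grad \<phi> (x + s *\<^sub>R y)))\<^sup>2) * indicator {0..T} s)"
      by (simp split: split_indicator)
  qed
  also have "\<dots> = ennreal ((norm y)\<^sup>2) * (\<integral>\<^sup>+s\<in>{0..T}. ennreal ((norm (grad \<phi> (x + s *\<^sub>R y)))\<^sup>2) \<partial>lborel)"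
  proof (rule nn_integral_cmult)
    have "(\<lambda>s. grad \<phi> (x + s *\<^sub>R y)) \<in> borel_measurable borel"
      by (rule borel_measurable_continuous_onI[OF cg])
    then show "(\<lambda>s. ennreal ((norm (grad \<phi> (x + s *\<^sub>R y)))\<^sup>2) * indicator {0..T} s) \<in> borel_measurable lborel"
      by measurable
  qed
  also have "ennreal T * (ennreal ((norm y)\<^sup>2) * (\<integral>\<^sup>+s\<in>{0..T}. ennreal ((norm (grad \<phi> (x + s *\<^sub>R y)))\<^sup>2) \<partial>lborel))
     = ennreal (T * (norm y)\<^sup>2) * (\<integral>\<^sup>+s\<in>{0..T}. ennreal ((norm (grad \<phi> (x + s *\<^sub>R y)))\<^sup>2) \<partial>lborel)"
    using T by (simp add: ennreal_mult mult.assoc)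
  finally show ?thesis by (simp add: mult_left_mono)
qed

lemma nn_integral_lborel_translate:
  fixes f :: "'a::euclidean_space \<Rightarrow> ennreal"
  assumes [measurable]: "f \<in> borel_measurable borel"
  shows "(\<integral>\<^sup>+x. f (x + y) \<partial>lborel) = (\<integral>\<^sup>+x. f x \<partial>lborel)"
proof -
  have "(\<integral>\<^sup>+x. f x \<partial>lborel) = (\<integral>\<^sup>+x. f x \<partial>distr lborel borel ((+) y))"
    by (simp add: lborel_distr_plus)
  also have "\<dots> = (\<integral>\<^sup>+x. f (x + y) \<partial>lborel)"
    by (subst nn_integral_distr) (auto simp: add.commute)
  finally show ?thesis by simp
qed

text \<open>
  Integrate \<open>smooth_increment_square\<close> over \<open>x\<close> and exchange the integrals: each translate of \<open>P\<close> along the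
  segment stays in \<open>\<Omega>\<close>.
\<close>

lemma translation_estimate:
  fixes \<phi> :: "real^'n::finite \<Rightarrow> real"
  assumes \<phi>: "smooth \<phi>" and [measurable]: "P \<in> sets borel" "\<Omega> \<in> sets borel"
    and seg: "\<And>x s. x \<in> P \<Longrightarrow> 0 \<le> s \<Longrightarrow> s \<le> 1 \<Longrightarrow> x + s *\<^sub>R y \<in> \<Omega>"
  shows "(\<integral>\<^sup>+x\<in>P. ennreal ((\<phi> (x + y) - \<phi> x)\<^sup>2) \<partial>lborel)
    \<le> ennreal ((norm y)\<^sup>2) * (\<integral>\<^sup>+x\<in>\<Omega>. ennreal ((norm (grad \<phi> x))\<^sup>2) \<partial>lborel)"
proof -
  note [measurable] = smooth_borel[OF \<phi>]
  let ?G = "\<lambda>x. ennreal ((norm (grad \<phi> x))\<^sup>2)"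
  let ?h = "\<lambda>x s. ?G (x + s *\<^sub>R y) * indicator {0..1} s * indicator P x"
  have "(\<integral>\<^sup>+x\<in>P. ennreal ((\<phi> (x + y) - \<phi> x)\<^sup>2) \<partial>lborel)
    \<le> (\<integral>\<^sup>+x. ennreal ((norm y)\<^sup>2) * (\<integral>\<^sup>+s. ?h x s \<partial>lborel) \<partial>lborel)"
  proof (rule nn_integral_mono)
    fix x
    have "(\<integral>\<^sup>+s. ?h x s \<partial>lborel) = (\<integral>\<^sup>+s\<in>{0..1}. ?G (x + s *\<^sub>R y) \<partial>lborel) * indicator P x"
      by (intro nn_integral_multc) measurable
    then show "ennreal ((\<phi> (x + y) - \<phi> x)\<^sup>2) * indicator P x \<le> ennreal ((norm y)\<^sup>2) * (\<integral>\<^sup>+s. ?h x s \<partial>lborel)"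
      using smooth_increment_square[OF \<phi>, of 1 x y] by (simp split: split_indicator)
  qed
  also have "\<dots> = ennreal ((norm y)\<^sup>2) * (\<integral>\<^sup>+x. (\<integral>\<^sup>+s. ?h x s \<partial>lborel) \<partial>lborel)"
    by (intro nn_integral_cmult) measurable
  also have "(\<integral>\<^sup>+x. (\<integral>\<^sup>+s. ?h x s \<partial>lborel) \<partial>lborel) = (\<integral>\<^sup>+s. (\<integral>\<^sup>+x. ?h x s \<partial>lborel) \<partial>lborel)"
    by (rule lborel_pair.Fubini'[symmetric]) measurable
  also have "\<dots> \<le> (\<integral>\<^sup>+s. (\<integral>\<^sup>+x\<in>\<Omega>. ?G x \<partial>lborel) * indicator {0..1::real} s \<partial>lborel)"
  proof (rule nn_integral_mono)
    fix s :: real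
    show "(\<integral>\<^sup>+x. ?h x s \<partial>lborel) \<le> (\<integral>\<^sup>+x\<in>\<Omega>. ?G x \<partial>lborel) * indicator {0..1} s"
    proof (cases "s \<in> {0..1}")
      case True
      have "(\<integral>\<^sup>+x. ?h x s \<partial>lborel) \<le> (\<integral>\<^sup>+x. ?G (x + s *\<^sub>R y) * indicator \<Omega> (x + s *\<^sub>R y) \<partial>lborel)"
        by (rule nn_integral_mono) (use seg True in \<open>auto split: split_indicator\<close>)
      also have "\<dots> = (\<integral>\<^sup>+x\<in>\<Omega>. ?G x \<partial>lborel)"
        by (rule nn_integral_lborel_translate) measurable
      finally show ?thesis using True by simp
    qed simp
  qed
  also have "\<dots> = (\<integral>\<^sup>+x\<in>\<Omega>. ?G x \<partial>lborel)" by (simp add: nn_integral_cmult)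
  finally show ?thesis by (simp add: mult_left_mono)
qed

lemma smooth_ball_integrable:
  assumes "smooth \<phi>"
  shows "set_integrable lborel (ball z r) \<phi>"
proof -
  have "set_integrable lborel (cball z r) \<phi>"
    unfolding set_integrable_def by (intro borel_integrable_compact compact_cball smooth_continuous assms)
  then show ?thesis by (rule set_integrable_subset) auto
qed

definition mean_on :: "(real^'n::finite) set \<Rightarrow> (real^'n \<Rightarrow> real) \<Rightarrow> real" where
  "mean_on B \<phi> = (LINT z:B|lborel. \<phi> z) / measure lborel B"

text \<open>
  The difference to the mean is the mean of the differences, so that Cauchy-Schwarz applies.
\<close>

lemma smooth_minus_mean_square:
  fixes \<phi> :: "real^'n::finite \<Rightarrow> real"
  assumes \<phi>: "smooth \<phi>" and r: "0 < r"
    and [measurable]: "Y \<in> sets borel" and Y: "\<And>z. z \<in> ball b r \<Longrightarrow> z - x \<in> Y"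
  shows "ennreal (measure lborel (ball b r)) * ennreal ((\<phi> x - mean_on (ball b r) \<phi>)\<^sup>2)
    \<le> (\<integral>\<^sup>+y\<in>Y. ennreal ((\<phi> (x + y) - \<phi> x)\<^sup>2) \<partial>lborel)"
proof -
  note [measurable] = smooth_borel[OF \<phi>]
  let ?B = "ball b r"
  define \<mu> where "\<mu> = measure lborel ?B"
  have fin: "emeasure lborel ?B < \<infinity>"
    by (rule emeasure_lborel_ball_finite)
  have \<mu>: "0 < \<mu>" unfolding \<mu>_def using content_ball_pos[OF r, of b] by simp
  have int: "set_integrable lborel ?B \<phi>" by (rule smooth_ball_integrable[OF \<phi>])
  have i1: "set_integrable lborel ?B (\<lambda>z. \<phi> z - \<phi> x)"
    using smooth_ball_integrable[OF smooth_add[OF \<phi> smooth_const[of "- \<phi> x"]]] by simp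
  have i2: "set_integrable lborel ?B (\<lambda>z. (\<phi> z - \<phi> x)\<^sup>2)"
    using smooth_ball_integrable[OF smooth_mult[OF smooth_add[OF \<phi> smooth_const[of "- \<phi> x"]] smooth_add[OF \<phi> smooth_const[of "- \<phi> x"]]]]
    by (simp add: power2_eq_square)
  have c: "set_integrable lborel ?B (\<lambda>z. \<phi> x)" "(LINT z:?B|lborel. \<phi> x) = \<mu> * \<phi> x"
    using fin by (auto simp: set_integrable_def set_lebesgue_integral_def \<mu>_def)
  have mean: "(LINT z:?B|lborel. \<phi> z) = \<mu> * mean_on ?B \<phi>"
    using \<mu> by (simp add: mean_on_def \<mu>_def)
  have "(LINT z:?B|lborel. \<phi> z - \<phi> x) = \<mu> * (mean_on ?B \<phi> - \<phi> x)"
    using set_integral_diff(2)[OF int c(1)] c(2) mean by (simp add: right_diff_distrib)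
  then have "\<mu>\<^sup>2 * (\<phi> x - mean_on ?B \<phi>)\<^sup>2 \<le> \<mu> * (LINT z:?B|lborel. (\<phi> z - \<phi> x)\<^sup>2)"
    using set_integral_square_le[OF _ fin _ i1 i2] \<mu> by (simp add: \<mu>_def power_mult_distrib power2_commute)
  then have "\<mu> * (\<phi> x - mean_on ?B \<phi>)\<^sup>2 \<le> (LINT z:?B|lborel. (\<phi> z - \<phi> x)\<^sup>2)"
    using \<mu> by (simp add: power2_eq_square[of \<mu>] mult.assoc)
  then have "ennreal (\<mu> * (\<phi> x - mean_on ?B \<phi>)\<^sup>2) \<le> ennreal (LINT z:?B|lborel. (\<phi> z - \<phi> x)\<^sup>2)"
    by (rule ennreal_leI)
  also have "\<dots> = (\<integral>\<^sup>+z. ennreal (indicator ?B z *\<^sub>R (\<phi> z - \<phi> x)\<^sup>2) \<partial>lborel)"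
    unfolding set_lebesgue_integral_def
    by (rule nn_integral_eq_integral[symmetric]) (use i2 in \<open>auto simp: set_integrable_def\<close>)
  also have "\<dots> \<le> (\<integral>\<^sup>+z. ennreal ((\<phi> z - \<phi> x)\<^sup>2) * indicator Y (z - x) \<partial>lborel)"
    by (rule nn_integral_mono) (use Y in \<open>auto split: split_indicator\<close>)
  also have "\<dots> = (\<integral>\<^sup>+y. ennreal ((\<phi> (y + x) - \<phi> x)\<^sup>2) * indicator Y (y + x - x) \<partial>lborel)"
    by (rule nn_integral_lborel_translate[symmetric]) measurable
  finally show ?thesis using \<mu> by (simp add: \<mu>_def ennreal_mult add.commute)
qed

text \<open>
  Here \<open>Y\<close> is a set of displacements that lead from \<open>P\<close> into the domain along segments, and every point of
  \<open>P\<close> reaches a whole ball around some centre in \<open>Z\<close> by displacements in \<open>Y\<close>. The deviation from the mean over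
  that ball is an average of increments \<open>\<phi> (x + y) - \<phi> x\<close>; enlarging the ball to all of \<open>Y\<close> makes the bound
  independent of the centre, and the translation estimate applies to each \<open>y\<close>.
  The term \<open>e\<close> is left abstract so that it can absorb the means, or be zero when the mean is zero.
\<close>

lemma square_estimate_by_means:
  fixes \<phi> :: "real^'n::finite \<Rightarrow> real"
  assumes \<phi>: "smooth \<phi>" and r: "0 < r" and [measurable]: "P \<in> sets borel" "\<Omega> \<in> sets borel" "Y \<in> sets borel"
    and Y: "\<And>y. y \<in> Y \<Longrightarrow> norm y \<le> \<rho>" "\<And>x y s. x \<in> P \<Longrightarrow> y \<in> Y \<Longrightarrow> 0 \<le> s \<Longrightarrow> s \<le> 1 \<Longrightarrow> x + s *\<^sub>R y \<in> \<Omega>"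
    and Z: "\<And>x. x \<in> P \<Longrightarrow> \<exists>b\<in>Z. \<forall>z\<in>ball b r. z - x \<in> Y"
    and E: "\<And>x b. x \<in> P \<Longrightarrow> b \<in> Z \<Longrightarrow> \<forall>z\<in>ball b r. z - x \<in> Y \<Longrightarrow> (\<phi> x)\<^sup>2 \<le> e + 2 * (\<phi> x - mean_on (ball b r) \<phi>)\<^sup>2"
    and e: "0 \<le> e" and \<mu>: "\<And>b :: real^'n. measure lborel (ball b r) = \<mu>" "0 < \<mu>"
  shows "(\<integral>\<^sup>+x\<in>P. ennreal ((\<phi> x)\<^sup>2) \<partial>lborel) \<le> ennreal e * emeasure lborel P
     + ennreal (2 / \<mu> * \<rho>\<^sup>2) * emeasure lborel Y * (\<integral>\<^sup>+x\<in>\<Omega>. ennreal ((norm (grad \<phi> x))\<^sup>2) \<partial>lborel)"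
proof -
  note [measurable] = smooth_borel[OF \<phi>]
  let ?D = "\<lambda>x y. ennreal ((\<phi> (x + y) - \<phi> x)\<^sup>2) * indicator Y y * indicator P x"
  let ?G = "\<integral>\<^sup>+x\<in>\<Omega>. ennreal ((norm (grad \<phi> x))\<^sup>2) \<partial>lborel"
  have "(\<integral>\<^sup>+x\<in>P. ennreal ((\<phi> x)\<^sup>2) \<partial>lborel)
     \<le> (\<integral>\<^sup>+x. ennreal e * indicator P x + ennreal (2 / \<mu>) * (\<integral>\<^sup>+y. ?D x y \<partial>lborel) \<partial>lborel)"
  proof (rule nn_integral_mono)
    fix x
    show "ennreal ((\<phi> x)\<^sup>2) * indicator P x
       \<le> ennreal e * indicator P x + ennreal (2 / \<mu>) * (\<integral>\<^sup>+y. ?D x y \<partial>lborel)"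
    proof (cases "x \<in> P")
      case True
      then obtain b where b: "b \<in> Z" "\<forall>z\<in>ball b r. z - x \<in> Y" using Z by blast
      let ?q = "(\<phi> x - mean_on (ball b r) \<phi>)\<^sup>2"
      have "ennreal ((\<phi> x)\<^sup>2) \<le> ennreal (e + 2 * ?q)" by (rule ennreal_leI[OF E[OF True b]])
      also have "\<dots> = ennreal e + ennreal (2 / \<mu> * (\<mu> * ?q))"
        using e \<mu>(2) by (subst ennreal_plus[symmetric]) auto
      also have "ennreal (2 / \<mu> * (\<mu> * ?q)) = ennreal (2 / \<mu>) * (ennreal \<mu> * ennreal ?q)"
        using \<mu>(2) by (subst ennreal_mult[symmetric], simp_all)+
      also have "\<dots> \<le> ennreal (2 / \<mu>) * (\<integral>\<^sup>+y\<in>Y. ennreal ((\<phi> (x + y) - \<phi> x)\<^sup>2) \<partial>lborel)"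
        using smooth_minus_mean_square[OF \<phi> r, of Y b x] b(2) \<mu>(1) by (intro mult_left_mono) auto
      finally show ?thesis using True by (simp add: add_left_mono)
    qed simp
  qed
  also have "\<dots> = ennreal e * emeasure lborel P + ennreal (2 / \<mu>) * (\<integral>\<^sup>+x. (\<integral>\<^sup>+y. ?D x y \<partial>lborel) \<partial>lborel)"
    by (simp add: nn_integral_add nn_integral_cmult)
  also have "(\<integral>\<^sup>+x. (\<integral>\<^sup>+y. ?D x y \<partial>lborel) \<partial>lborel) = (\<integral>\<^sup>+y. (\<integral>\<^sup>+x. ?D x y \<partial>lborel) \<partial>lborel)"
    by (rule lborel_pair.Fubini'[symmetric]) measurable
  also have "\<dots> \<le> (\<integral>\<^sup>+y. ennreal (\<rho>\<^sup>2) * ?G * indicator Y y \<partial>lborel)"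
  proof (rule nn_integral_mono)
    fix y
    show "(\<integral>\<^sup>+x. ?D x y \<partial>lborel) \<le> ennreal (\<rho>\<^sup>2) * ?G * indicator Y y"
    proof (cases "y \<in> Y")
      case True
      have "(\<integral>\<^sup>+x. ?D x y \<partial>lborel) = (\<integral>\<^sup>+x\<in>P. ennreal ((\<phi> (x + y) - \<phi> x)\<^sup>2) \<partial>lborel)"
        using True by simp
      also have "\<dots> \<le> ennreal ((norm y)\<^sup>2) * ?G"
        by (rule translation_estimate[OF \<phi>]) (use Y(2) True in auto)
      also have "\<dots> \<le> ennreal (\<rho>\<^sup>2) * ?G"
        using Y(1)[OF True] by (intro mult_right_mono ennreal_leI power_mono) auto
      finally show ?thesis using True by simp
    qed simp
  qed
  also have "\<dots> = ennreal (\<rho>\<^sup>2) * ?G * emeasure lborel Y" by (simp add: nn_integral_cmult)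
  also have "ennreal (2 / \<mu>) * (ennreal (\<rho>\<^sup>2) * ?G * emeasure lborel Y) = ennreal (2 / \<mu> * \<rho>\<^sup>2) * emeasure lborel Y * ?G"
    using \<mu>(2) by (subst ennreal_mult) (auto simp: mult_ac)
  finally show ?thesis by (simp add: add_left_mono mult_left_mono)
qed

text \<open>
  \<open>\<tau> x = x \<bullet> e - \<gamma> (projection of x)\<close> is the height of \<open>x\<close> above the graph, measured along \<open>e\<close>. In this form the
  projection to the hyperplane is no longer visible: only \<open>\<tau>\<close>, its Lipschitz constant and its behaviour
  under shifts by \<open>e\<close> matter.
\<close>

lemma boundary_chart:
  fixes \<Omega> :: "(real^'n::finite) set"
  assumes lip: "Lipschitz_boundary \<Omega>" and x0: "x0 \<in> frontier \<Omega>"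
  obtains r e \<tau> L where "0 < r" "norm e = 1" "0 \<le> L"
    "\<And>x t. \<tau> (x + t *\<^sub>R e) = \<tau> x + t"
    "\<And>x y. \<bar>\<tau> x - \<tau> y\<bar> \<le> L * dist x y"
    "\<Omega> \<inter> ball x0 r = {x \<in> ball x0 r. 0 < \<tau> x}"
proof -
  have "\<exists>r>0. \<exists>e \<gamma> K. norm e = 1 \<and> K-lipschitz_on {y. y \<bullet> e = 0} \<gamma> \<and>
      \<Omega> \<inter> ball x0 r = {x \<in> ball x0 r. \<gamma> (x - (x \<bullet> e) *\<^sub>R e) < x \<bullet> e}"
    using lip x0 unfolding Lipschitz_boundary_def by blast
  then obtain r e \<gamma> K where r: "0 < r" and e: "norm e = 1" and \<gamma>: "K-lipschitz_on {y. y \<bullet> e = 0} \<gamma>"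
    and graph: "\<Omega> \<inter> ball x0 r = {x \<in> ball x0 r. \<gamma> (x - (x \<bullet> e) *\<^sub>R e) < x \<bullet> e}"
    by blast
  have K: "0 \<le> K" using \<gamma> by (rule lipschitz_on_nonneg)
  have ee: "e \<bullet> e = 1" using e by (simp add: dot_square_norm)
  define p where "p x = x - (x \<bullet> e) *\<^sub>R e" for x
  have p0: "p x \<bullet> e = 0" for x by (simp add: p_def inner_diff_left ee)
  have p_diff: "p (x - y) = p x - p y" and p_shift: "p (x + t *\<^sub>R e) = p x" for x y t
    by (simp_all add: p_def inner_add_left inner_diff_left algebra_simps ee)
  have p_le: "norm (p x) \<le> norm x" for x
  proof -
    have "p x \<bullet> p x = x \<bullet> x - (x \<bullet> e)\<^sup>2"
      by (simp add: p_def inner_diff_left inner_diff_right ee inner_commute power2_eq_square)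
    then have "(norm (p x))\<^sup>2 = (norm x)\<^sup>2 - (x \<bullet> e)\<^sup>2" by (simp add: power2_norm_eq_inner)
    then have "(norm (p x))\<^sup>2 \<le> (norm x)\<^sup>2" by simp
    then show ?thesis by (rule power2_le_imp_le) simp
  qed
  define \<tau> where "\<tau> x = x \<bullet> e - \<gamma> (p x)" for x
  show thesis
  proof (rule that[OF r e])
    show "0 \<le> 1 + K" using K by simp
    show "\<tau> (x + t *\<^sub>R e) = \<tau> x + t" for x t
      by (simp add: \<tau>_def p_shift inner_add_left ee)
    show "\<bar>\<tau> x - \<tau> y\<bar> \<le> (1 + K) * dist x y" for x y
    proof -
      have "\<bar>\<gamma> (p x) - \<gamma> (p y)\<bar> \<le> K * dist (p x) (p y)"
        using lipschitz_onD[OF \<gamma>, of "p x" "p y"] by (simp add: p0 dist_real_def)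
      also have "\<dots> \<le> K * dist x y"
        using p_le[of "x - y"] K by (intro mult_left_mono) (simp_all add: dist_norm p_diff)
      finally have "\<bar>\<gamma> (p x) - \<gamma> (p y)\<bar> \<le> K * dist x y" .
      moreover have "\<bar>(x - y) \<bullet> e\<bar> \<le> dist x y"
        using Cauchy_Schwarz_ineq2[of "x - y" e] e by (simp add: dist_norm)
      ultimately show ?thesis unfolding \<tau>_def inner_diff_left distrib_right by linarith
    qed
    show "\<Omega> \<inter> ball x0 r = {x \<in> ball x0 r. 0 < \<tau> x}"
      unfolding graph by (simp add: \<tau>_def p_def)
  qed
qed

text \<open>
  Near the boundary the height increases by \<open>t\<close> when moving up by \<open>t *\<^sub>R e\<close>, and the Lipschitz bound allows a
  sideways deviation proportional to \<open>t\<close>.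
\<close>

lemma interior_cone:
  fixes \<Omega> :: "(real^'n::finite) set"
  assumes \<Omega>: "open \<Omega>" "Lipschitz_boundary \<Omega>" and x0: "x0 \<in> closure \<Omega>"
  shows "\<exists>r>0. \<exists>e \<kappa>. norm e = 1 \<and> 0 < \<kappa> \<and> \<kappa> \<le> 1 \<and>
    (\<forall>x\<in>\<Omega> \<inter> ball x0 r. \<forall>t y. 0 < t \<longrightarrow> t < r \<longrightarrow> norm (y - t *\<^sub>R e) \<le> \<kappa> * t \<longrightarrow> x + y \<in> \<Omega>)"
proof (cases "x0 \<in> \<Omega>")
  case True
  then obtain R where R: "0 < R" "ball x0 R \<subseteq> \<Omega>" using \<Omega>(1) open_contains_ball by blast
  define e :: "real^'n" where "e = axis undefined 1"
  have e: "norm e = 1" by (simp add: e_def)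
  have "x + y \<in> \<Omega>" if "x \<in> ball x0 (R/4)" "0 < t" "t < R/4" "norm (y - t *\<^sub>R e) \<le> 1 * t" for x t y
  proof -
    have "norm y \<le> norm (y - t *\<^sub>R e) + norm (t *\<^sub>R e)" using norm_triangle_ineq[of "y - t *\<^sub>R e" "t *\<^sub>R e"] by simp
    then have "norm y \<le> 2 * t" using that e by simp
    then have "dist x0 (x + y) < R"
      using norm_triangle_ineq[of "x - x0" y] that by (simp add: dist_norm norm_minus_commute algebra_simps)
    then show ?thesis using R(2) by auto
  qed
  then show ?thesis using R(1) e by (intro exI[of _ "R/4"] conjI exI[of _ e] exI[of _ 1]) auto
next
  case False
  then have "x0 \<in> frontier \<Omega>" using x0 \<Omega>(1) by (simp add: frontier_def interior_open)
  then obtain r e \<tau> L where r: "0 < r" and e: "norm e = 1" and L: "0 \<le> L"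
    and shift: "\<And>x t. \<tau> (x + t *\<^sub>R e) = \<tau> x + t"
    and lip: "\<And>x y. \<bar>\<tau> x - \<tau> y\<bar> \<le> L * dist x y"
    and graph: "\<Omega> \<inter> ball x0 r = {x \<in> ball x0 r. 0 < \<tau> x}"
    by (rule boundary_chart[OF \<Omega>(2)]) (rule that)
  \<comment> \<open>A sideways deviation of \<open>\<kappa> t\<close> lowers the height by at most \<open>L \<kappa> t < t\<close>.\<close>
  define \<kappa> where "\<kappa> = 1 / (1 + L)"
  have \<kappa>: "0 < \<kappa>" "\<kappa> \<le> 1" "L * \<kappa> \<le> 1" using L by (auto simp: \<kappa>_def field_simps)
  have "x + y \<in> \<Omega>" if x: "x \<in> \<Omega>" "x \<in> ball x0 (r/4)" and t: "0 < t" "t < r/4" and y: "norm (y - t *\<^sub>R e) \<le> \<kappa> * t" for x t y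
  proof -
    have "norm y \<le> norm (y - t *\<^sub>R e) + norm (t *\<^sub>R e)" using norm_triangle_ineq[of "y - t *\<^sub>R e" "t *\<^sub>R e"] by simp
    then have "norm y \<le> \<kappa> * t + t" using y t e by simp
    also have "\<dots> \<le> 2 * t" using \<kappa>(2) t by simp
    finally have "dist x0 (x + y) < r"
      using norm_triangle_ineq[of "x - x0" y] x t by (simp add: dist_norm norm_minus_commute algebra_simps)
    then have ball: "x + y \<in> ball x0 r" by simp
    have "0 < \<tau> x"
    proof -
      have "x \<in> \<Omega> \<inter> ball x0 r" using x r by auto
      then show ?thesis unfolding graph by simp
    qed
    moreover have "\<bar>\<tau> (x + t *\<^sub>R e) - \<tau> (x + y)\<bar> \<le> t"
    proof -
      have "\<bar>\<tau> (x + t *\<^sub>R e) - \<tau> (x + y)\<bar> \<le> L * norm (y - t *\<^sub>R e)"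
        using lip[of "x + t *\<^sub>R e" "x + y"] by (simp add: dist_norm norm_minus_commute)
      also have "\<dots> \<le> L * (\<kappa> * t)" using y L by (rule mult_left_mono)
      also have "\<dots> \<le> 1 * t" unfolding mult.assoc[symmetric] using \<kappa>(3) t(1) by (intro mult_right_mono) auto
      finally show ?thesis by simp
    qed
    ultimately have "0 < \<tau> (x + y)" unfolding shift by linarith
    then have "x + y \<in> \<Omega> \<inter> ball x0 r" unfolding graph using ball by simp
    then show ?thesis by simp
  qed
  then show ?thesis using r e \<kappa> by (intro exI[of _ "r/4"] conjI exI[of _ e] exI[of _ \<kappa>]) auto
qed

locale lipschitz_domain = bounded_domain \<Omega> for \<Omega> :: "(real^'n::finite) set" +
  assumes lipschitz: "Lipschitz_boundary \<Omega>"
begin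

definition mean_sets :: "(real^'n) set set \<Rightarrow> bool" where
  "mean_sets \<B> \<longleftrightarrow> finite \<B> \<and> (\<forall>B\<in>\<B>. B \<in> sets borel \<and> B \<subseteq> \<Omega>)"

text \<open>
  Each point near \<open>x0\<close> is compared with the mean over a ball of radius \<open>s\<close> whose centre is about \<open>t *\<^sub>R e\<close>
  away, inside the cone. The error is of order \<open>t\<^sup>2\<close> times the square of the gradient norm, so a
  small \<open>t\<close> gives any prescribed \<open>\<epsilon>\<close>; by compactness finitely many centres serve all points. The radius \<open>r\<close> does not
  depend on \<open>\<epsilon>\<close>, which permits a covering of the closure before \<open>\<epsilon>\<close> is distributed among its members.
\<close>

lemma local_mean_estimate:
  assumes x0: "x0 \<in> closure \<Omega>"
  shows "\<exists>r>0. \<forall>\<epsilon>>0. \<exists>\<B> C. mean_sets \<B> \<and> 0 \<le> C \<and> (\<forall>\<phi>. smooth \<phi> \<longrightarrow>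
    (\<integral>\<^sup>+x\<in>\<Omega> \<inter> ball x0 r. ennreal ((\<phi> x)\<^sup>2) \<partial>lborel) \<le> ennreal (C * (\<Sum>B\<in>\<B>. (mean_on B \<phi>)\<^sup>2))
       + ennreal \<epsilon> * (\<integral>\<^sup>+x\<in>\<Omega>. ennreal ((norm (grad \<phi> x))\<^sup>2) \<partial>lborel))"
proof -
  obtain r e \<kappa> where r: "0 < r" and e: "norm e = 1" and \<kappa>: "0 < \<kappa>" "\<kappa> \<le> 1"
    and cone: "\<And>x t y. x \<in> \<Omega> \<inter> ball x0 r \<Longrightarrow> 0 < t \<Longrightarrow> t < r \<Longrightarrow> norm (y - t *\<^sub>R e) \<le> \<kappa> * t \<Longrightarrow> x + y \<in> \<Omega>"
    using interior_cone[OF open_domain lipschitz x0] by metis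
  define P where "P = \<Omega> \<inter> ball x0 r"
  have Pm: "P \<in> sets borel" using open_domain by (simp add: P_def borel_open open_Int)
  show ?thesis
  proof (intro exI[of _ r] conjI r allI impI)
    fix \<epsilon> :: real assume \<epsilon>: "0 < \<epsilon>"
    define d where "d = CARD('n)"
    \<comment> \<open>\<open>8 * 2^d * t\<^sup>2\<close> is the factor of the gradient term that results from balls of radius \<open>s\<close> and \<open>2 * s\<close> below.\<close>
    define t where "t = min (r/2) (sqrt (\<epsilon> / (8 * 2^d)))"
    have t: "0 < t" "t < r" using r \<epsilon> by (auto simp: t_def)
    have "t\<^sup>2 \<le> (sqrt (\<epsilon> / (8 * 2^d)))\<^sup>2" using t(1) by (intro power_mono) (auto simp: t_def)
    also have "\<dots> = \<epsilon> / (8 * 2^d)" using \<epsilon> by simp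
    finally have t2: "8 * 2^d * t\<^sup>2 \<le> \<epsilon>" by (simp add: field_simps)
    define s where "s = \<kappa> * t / 2"
    have s: "0 < s" using \<kappa> t by (simp add: s_def)
    define Y where "Y = ball (t *\<^sub>R e) (2 * s)"
    define \<mu> where "\<mu> = measure lborel (ball (0::real^'n) s)"
    have \<mu>: "measure lborel (ball b s) = \<mu>" "0 < \<mu>" for b :: "real^'n"
      using s content_ball_pos[OF s, of "0::real^'n"] by (simp_all add: \<mu>_def content_ball)
    have Y\<mu>: "emeasure lborel Y = ennreal (2^d * \<mu>)"
      using s by (simp add: Y_def emeasure_ball \<mu>_def content_ball power_mult_distrib d_def mult_ac)
    have Ynorm: "norm y \<le> 2 * t" if "y \<in> Y" for y
    proof -
      have "norm (y - t *\<^sub>R e) \<le> t"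
      proof -
        have "norm (y - t *\<^sub>R e) \<le> \<kappa> * t" using that by (simp add: Y_def s_def dist_norm norm_minus_commute)
        also have "\<dots> \<le> t" using \<kappa>(2) t(1) by simp
        finally show ?thesis .
      qed
      then show ?thesis using norm_triangle_ineq[of "y - t *\<^sub>R e" "t *\<^sub>R e"] e t by simp
    qed
    have Yseg: "x + \<sigma> *\<^sub>R y \<in> \<Omega>" if x: "x \<in> P" and y: "y \<in> Y" and \<sigma>: "0 \<le> \<sigma>" "\<sigma> \<le> 1" for x y \<sigma>
    proof (cases "\<sigma> = 0")
      case False
      have "norm (y - t *\<^sub>R e) \<le> \<kappa> * t" using y by (simp add: Y_def s_def dist_norm norm_minus_commute)
      then have "norm (\<sigma> *\<^sub>R (y - t *\<^sub>R e)) \<le> \<sigma> * (\<kappa> * t)" using \<sigma> by (simp add: mult_left_mono)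
      then have "norm (\<sigma> *\<^sub>R y - (\<sigma> * t) *\<^sub>R e) \<le> \<kappa> * (\<sigma> * t)" by (simp add: scaleR_diff_right mult_ac)
      moreover have "0 < \<sigma> * t" using False \<sigma> t by simp
      moreover have "\<sigma> * t < r"
      proof -
        have "\<sigma> * t \<le> t" using \<sigma>(2) t(1) by simp
        then show ?thesis using t(2) by simp
      qed
      ultimately show ?thesis using cone[of x] x by (simp add: P_def)
    qed (use x in \<open>simp add: P_def\<close>)
    have "compact (closure P)" using bounded_domain by (simp add: P_def bounded_Int compact_closure)
    moreover have "closure P \<subseteq> (\<Union>c\<in>closure P. ball c s)" using s by auto
    ultimately obtain Z0 where Z0: "Z0 \<subseteq> closure P" "finite Z0" "closure P \<subseteq> (\<Union>c\<in>Z0. ball c s)"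
      using compactE_image[of "closure P" "closure P" "\<lambda>c. ball c s"] by (metis open_ball)
    define Z where "Z = {c + t *\<^sub>R e |c. c \<in> Z0 \<and> (\<exists>x\<in>P. dist x c < s)}"
    have finZ: "finite Z" unfolding Z_def using Z0(2) by simp
    have shift: "z - x \<in> Y" if "z \<in> ball (c + t *\<^sub>R e) s" "dist x c < s" for z x c
    proof -
      have "norm ((z - x) - t *\<^sub>R e) \<le> norm (z - (c + t *\<^sub>R e)) + norm (c - x)"
        using norm_triangle_ineq[of "z - (c + t *\<^sub>R e)" "c - x"] by (simp add: algebra_simps)
      then show ?thesis using that by (simp add: Y_def dist_norm norm_minus_commute)
    qed
    have Zcov: "\<exists>b\<in>Z. \<forall>z\<in>ball b s. z - x \<in> Y" if x: "x \<in> P" for x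
    proof -
      obtain c where "c \<in> Z0" "x \<in> ball c s" using Z0(3) x closure_subset by blast
      then show ?thesis using x shift by (intro bexI[of _ "c + t *\<^sub>R e"]) (auto simp: Z_def dist_commute)
    qed
    define \<B> where "\<B> = (\<lambda>b. ball b s) ` Z"
    have sub: "ball b s \<subseteq> \<Omega>" if "b \<in> Z" for b
    proof
      fix z assume z: "z \<in> ball b s"
      obtain c x where c: "b = c + t *\<^sub>R e" "x \<in> P" "dist x c < s" using \<open>b \<in> Z\<close> by (auto simp: Z_def)
      then have "z - x \<in> Y" using shift z by blast
      then show "z \<in> \<Omega>" using Yseg[OF c(2), of "z - x" 1] by simp
    qed
    have ms: "mean_sets \<B>" using finZ sub by (auto simp: mean_sets_def \<B>_def)
    define C where "C = 2 * measure lborel (ball x0 r)"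
    have C: "0 \<le> C" by (simp add: C_def)
    have "(\<integral>\<^sup>+x\<in>P. ennreal ((\<phi> x)\<^sup>2) \<partial>lborel) \<le> ennreal (C * (\<Sum>B\<in>\<B>. (mean_on B \<phi>)\<^sup>2))
       + ennreal \<epsilon> * (\<integral>\<^sup>+x\<in>\<Omega>. ennreal ((norm (grad \<phi> x))\<^sup>2) \<partial>lborel)" if \<phi>: "smooth \<phi>" for \<phi>
    proof -
      define S where "S = (\<Sum>B\<in>\<B>. (mean_on B \<phi>)\<^sup>2)"
      have S0: "0 \<le> S" by (simp add: S_def sum_nonneg)
      have E: "(\<phi> x)\<^sup>2 \<le> 2 * S + 2 * (\<phi> x - mean_on (ball b s) \<phi>)\<^sup>2" if "b \<in> Z" for x b
      proof -
        have "(mean_on (ball b s) \<phi>)\<^sup>2 \<le> S"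
          unfolding S_def by (rule member_le_sum) (use that finZ in \<open>auto simp: \<B>_def\<close>)
        moreover have "(\<phi> x)\<^sup>2 \<le> 2 * (mean_on (ball b s) \<phi>)\<^sup>2 + 2 * (\<phi> x - mean_on (ball b s) \<phi>)\<^sup>2"
          using zero_le_power2[of "\<phi> x - 2 * mean_on (ball b s) \<phi>"] by (simp add: power2_eq_square algebra_simps)
        ultimately show ?thesis by linarith
      qed
      have "(\<integral>\<^sup>+x\<in>P. ennreal ((\<phi> x)\<^sup>2) \<partial>lborel) \<le> ennreal (2 * S) * emeasure lborel P
         + ennreal (2 / \<mu> * (2 * t)\<^sup>2) * emeasure lborel Y * (\<integral>\<^sup>+x\<in>\<Omega>. ennreal ((norm (grad \<phi> x))\<^sup>2) \<partial>lborel)"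
        by (rule square_estimate_by_means[OF \<phi> s Pm _ _ Ynorm Yseg Zcov E _ \<mu>]) (use S0 in \<open>auto simp: Y_def\<close>)
      also have "ennreal (2 / \<mu> * (2 * t)\<^sup>2) * emeasure lborel Y = ennreal (8 * 2^d * t\<^sup>2)"
        using \<mu>(2) by (simp add: Y\<mu> ennreal_mult[symmetric] power_mult_distrib mult_ac)
      also have "ennreal (2 * S) * emeasure lborel P \<le> ennreal (2 * S) * emeasure lborel (ball x0 r)"
        by (intro mult_left_mono emeasure_mono) (auto simp: P_def)
      also have "\<dots> = ennreal (C * S)"
        using S0 emeasure_lborel_ball_finite[of x0 r]
        by (simp add: C_def emeasure_eq_ennreal_measure less_top ennreal_mult[symmetric] mult_ac)
      finally have "(\<integral>\<^sup>+x\<in>P. ennreal ((\<phi> x)\<^sup>2) \<partial>lborel) \<le> ennreal (C * S)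
         + ennreal (8 * 2^d * t\<^sup>2) * (\<integral>\<^sup>+x\<in>\<Omega>. ennreal ((norm (grad \<phi> x))\<^sup>2) \<partial>lborel)"
        by (simp add: add_right_mono)
      also have "\<dots> \<le> ennreal (C * S) + ennreal \<epsilon> * (\<integral>\<^sup>+x\<in>\<Omega>. ennreal ((norm (grad \<phi> x))\<^sup>2) \<partial>lborel)"
        by (intro add_left_mono mult_right_mono ennreal_leI t2) simp
      finally show ?thesis by (simp add: S_def)
    qed
    then show "\<exists>\<B> C. mean_sets \<B> \<and> 0 \<le> C \<and> (\<forall>\<phi>. smooth \<phi> \<longrightarrow>
      (\<integral>\<^sup>+x\<in>\<Omega> \<inter> ball x0 r. ennreal ((\<phi> x)\<^sup>2) \<partial>lborel) \<le> ennreal (C * (\<Sum>B\<in>\<B>. (mean_on B \<phi>)\<^sup>2))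
       + ennreal \<epsilon> * (\<integral>\<^sup>+x\<in>\<Omega>. ennreal ((norm (grad \<phi> x))\<^sup>2) \<partial>lborel))"
      using ms C unfolding P_def by blast
  qed
qed

end

context bounded_domain
begin

lemma nn_integral_domain:
  assumes "f \<in> borel_measurable borel"
  shows "(\<integral>\<^sup>+x. f x \<partial>lebesgue_on \<Omega>) = (\<integral>\<^sup>+x\<in>\<Omega>. f x \<partial>lborel)"
proof -
  have "(\<integral>\<^sup>+x. f x \<partial>lebesgue_on \<Omega>) = (\<integral>\<^sup>+x\<in>\<Omega>. f x \<partial>lebesgue)"
    by (rule nn_integral_restrict_space) simp
  then show ?thesis by (simp add: nn_integral_completion)
qed

lemma smooth_nn_integral_domain:
  assumes "smooth \<phi>"
  shows "(\<integral>\<^sup>+x\<in>\<Omega>. ennreal ((\<phi> x)\<^sup>2) \<partial>lborel) = ennreal ((L2_norm \<Omega> \<phi>)\<^sup>2)"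
    "(\<integral>\<^sup>+x\<in>\<Omega>. ennreal ((norm (grad \<phi> x))\<^sup>2) \<partial>lborel) = ennreal ((L2_norm \<Omega> (grad \<phi>))\<^sup>2)"
proof -
  note [measurable] = smooth_borel[OF assms]
  note L = smooth_L2[OF assms bounded_domain domain_sets(1)]
  show "(\<integral>\<^sup>+x\<in>\<Omega>. ennreal ((\<phi> x)\<^sup>2) \<partial>lborel) = ennreal ((L2_norm \<Omega> \<phi>)\<^sup>2)"
    using L2_nn_integral[OF L(1)] by (subst nn_integral_domain[symmetric]) auto
  show "(\<integral>\<^sup>+x\<in>\<Omega>. ennreal ((norm (grad \<phi> x))\<^sup>2) \<partial>lborel) = ennreal ((L2_norm \<Omega> (grad \<phi>))\<^sup>2)"
    using L2_nn_integral[OF L(2)] by (subst nn_integral_domain[symmetric]) auto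
qed

lemma smooth_weak_grad_norm:
  assumes "smooth \<phi>" shows "L2_norm \<Omega> (weak_grad \<Omega> \<phi>) = L2_norm \<Omega> (grad \<phi>)"
  using smooth_H1[OF assms] weak_grad(1) smooth_L2(2)[OF assms bounded_domain domain_sets(1)]
  by (intro L2_norm_cong_AE) auto

text \<open>
  The element of \<open>L2\<close> that represents the mean over \<open>B\<close>.
\<close>

definition mean_weight :: "(real^'n) set \<Rightarrow> real^'n \<Rightarrow> real" where
  "mean_weight B = (\<lambda>x. indicator B x / measure lborel B)"

lemma indicator_L2:
  assumes "B \<in> sets borel" "B \<subseteq> \<Omega>" shows "(indicator B :: real^'n \<Rightarrow> real) \<in> L2 \<Omega>"
proof -
  have "(\<lambda>x. 1::real) \<in> L2 \<Omega>" using smooth_L2(1)[OF smooth_const bounded_domain domain_sets(1)] .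
  moreover have "B \<in> sets (lebesgue_on \<Omega>)" using assms by (auto simp: sets_restrict_space_iff)
  then have "(indicator B :: _ \<Rightarrow> real) \<in> borel_measurable (lebesgue_on \<Omega>)" by (rule borel_measurable_indicator)
  ultimately show ?thesis by (rule L2_bound(1)[where K=1]) (simp split: split_indicator)
qed

lemma mean_weight_L2: "B \<in> sets borel \<Longrightarrow> B \<subseteq> \<Omega> \<Longrightarrow> mean_weight B \<in> L2 \<Omega>"
  using L2_scale[OF indicator_L2, of B "1 / measure lborel B"] by (simp add: mean_weight_def)

lemma mean_on_eq_L2_inner:
  assumes \<phi>: "smooth \<phi>" and B: "B \<in> sets borel" "B \<subseteq> \<Omega>"
  shows "mean_on B \<phi> = L2_inner \<Omega> \<phi> (mean_weight B)"
proof -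
  note [measurable] = smooth_borel[OF \<phi>] B(1)
  have "L2_inner \<Omega> \<phi> (mean_weight B) = (LINT x|lebesgue. indicator \<Omega> x *\<^sub>R (\<phi> x * mean_weight B x))"
    unfolding L2_inner_def inner_real_def by (rule integral_restrict_space) simp
  also have "\<dots> = (LINT x|lebesgue. indicator B x * \<phi> x / measure lborel B)"
    by (rule Bochner_Integration.integral_cong) (use B in \<open>auto simp: mean_weight_def split: split_indicator\<close>)
  also have "\<dots> = (LINT x|lborel. indicator B x * \<phi> x / measure lborel B)"
    by (rule integral_completion) measurable
  finally show ?thesis by (simp add: mean_on_def set_lebesgue_integral_def)
qed

lemma H1_limit_estimate:
  assumes v: "v \<in> H1 \<Omega>" and \<phi>: "\<And>k. smooth (\<phi> k)" "(\<lambda>k. H1_norm \<Omega> (\<phi> k - v)) \<longlonglongrightarrow> 0"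
  shows "(\<lambda>k. L2_norm \<Omega> (\<phi> k)) \<longlonglongrightarrow> L2_norm \<Omega> v"
    "(\<lambda>k. L2_norm \<Omega> (grad (\<phi> k))) \<longlonglongrightarrow> L2_norm \<Omega> (weak_grad \<Omega> v)"
    "\<psi> \<in> L2 \<Omega> \<Longrightarrow> (\<lambda>k. L2_inner \<Omega> (\<phi> k) \<psi>) \<longlonglongrightarrow> L2_inner \<Omega> v \<psi>"
proof -
  note S = smooth_H1(1)[OF \<phi>(1)]
  have lim1: "(\<lambda>k. L2_norm \<Omega> (\<phi> k - v)) \<longlonglongrightarrow> 0"
  proof (rule Lim_null_comparison[OF _ \<phi>(2)], intro always_eventually allI)
    show "norm (L2_norm \<Omega> (\<phi> k - v)) \<le> H1_norm \<Omega> (\<phi> k - v)" for k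
      using L2_le_H1_norm(1) L2.nrm_nonneg[of "\<phi> k - v" \<Omega>] S v H1_L2 by simp
  qed
  have lim2: "(\<lambda>k. L2_norm \<Omega> (weak_grad \<Omega> (\<phi> k - v))) \<longlonglongrightarrow> 0"
  proof (rule Lim_null_comparison[OF _ \<phi>(2)], intro always_eventually allI)
    show "norm (L2_norm \<Omega> (weak_grad \<Omega> (\<phi> k - v))) \<le> H1_norm \<Omega> (\<phi> k - v)" for k
      using L2_le_H1_norm(2) L2.nrm_nonneg[of "weak_grad \<Omega> (\<phi> k - v)" \<Omega>] weak_grad(1)[OF H1_diff(1)[OF S v]] by simp
  qed
  have "(\<lambda>k. L2_norm \<Omega> (\<phi> k) - L2_norm \<Omega> v) \<longlonglongrightarrow> 0"
    by (rule Lim_null_comparison[OF _ lim1], intro always_eventually allI)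
       (use L2.nrm_diff_abs[OF H1_L2[OF S] H1_L2[OF v]] in simp)
  then show "(\<lambda>k. L2_norm \<Omega> (\<phi> k)) \<longlonglongrightarrow> L2_norm \<Omega> v" by (simp add: LIM_zero_iff)
  have "(\<lambda>k. L2_norm \<Omega> (weak_grad \<Omega> (\<phi> k)) - L2_norm \<Omega> (weak_grad \<Omega> v)) \<longlonglongrightarrow> 0"
  proof (rule Lim_null_comparison[OF _ lim2], intro always_eventually allI)
    show "norm (L2_norm \<Omega> (weak_grad \<Omega> (\<phi> k)) - L2_norm \<Omega> (weak_grad \<Omega> v)) \<le> L2_norm \<Omega> (weak_grad \<Omega> (\<phi> k - v))" for k
      using L2.nrm_diff_abs[OF weak_grad(1)[OF S] weak_grad(1)[OF v]] H1_norm_diff[OF S v] by simp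
  qed
  then show "(\<lambda>k. L2_norm \<Omega> (grad (\<phi> k))) \<longlonglongrightarrow> L2_norm \<Omega> (weak_grad \<Omega> v)"
    by (simp add: LIM_zero_iff smooth_weak_grad_norm[OF \<phi>(1)])
  show "(\<lambda>k. L2_inner \<Omega> (\<phi> k) \<psi>) \<longlonglongrightarrow> L2_inner \<Omega> v \<psi>" if "\<psi> \<in> L2 \<Omega>"
    by (rule L2_inner_tendsto[OF that _ _ lim1]) (use S v H1_L2 in auto)
qed

end

context lipschitz_domain
begin

text \<open>
  Finitely many of the balls from \<open>local_mean_estimate\<close> cover the closure; each of them receives an equal share
  of \<open>\<epsilon>\<close>.
\<close>

lemma smooth_mean_estimate:
  assumes \<epsilon>: "0 < \<epsilon>"
  shows "\<exists>\<B> C. mean_sets \<B> \<and> 0 \<le> C \<and> (\<forall>\<phi>. smooth \<phi> \<longrightarrow>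
    (L2_norm \<Omega> \<phi>)\<^sup>2 \<le> C * (\<Sum>B\<in>\<B>. (mean_on B \<phi>)\<^sup>2) + \<epsilon> * (L2_norm \<Omega> (grad \<phi>))\<^sup>2)"
proof -
  have "\<forall>x0\<in>closure \<Omega>. \<exists>r>0. \<forall>\<epsilon>>0. \<exists>\<B> C. mean_sets \<B> \<and> 0 \<le> C \<and> (\<forall>\<phi>. smooth \<phi> \<longrightarrow>
    (\<integral>\<^sup>+x\<in>\<Omega> \<inter> ball x0 r. ennreal ((\<phi> x)\<^sup>2) \<partial>lborel) \<le> ennreal (C * (\<Sum>B\<in>\<B>. (mean_on B \<phi>)\<^sup>2))
       + ennreal \<epsilon> * (\<integral>\<^sup>+x\<in>\<Omega>. ennreal ((norm (grad \<phi> x))\<^sup>2) \<partial>lborel))"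
    using local_mean_estimate by blast
  from bchoice[OF this] obtain r where r: "\<And>x0. x0 \<in> closure \<Omega> \<Longrightarrow> 0 < r x0"
    and loc: "\<And>x0 \<epsilon>. x0 \<in> closure \<Omega> \<Longrightarrow> 0 < \<epsilon> \<Longrightarrow> \<exists>\<B> C. mean_sets \<B> \<and> 0 \<le> C \<and> (\<forall>\<phi>. smooth \<phi> \<longrightarrow>
    (\<integral>\<^sup>+x\<in>\<Omega> \<inter> ball x0 (r x0). ennreal ((\<phi> x)\<^sup>2) \<partial>lborel) \<le> ennreal (C * (\<Sum>B\<in>\<B>. (mean_on B \<phi>)\<^sup>2))
       + ennreal \<epsilon> * (\<integral>\<^sup>+x\<in>\<Omega>. ennreal ((norm (grad \<phi> x))\<^sup>2) \<partial>lborel))"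
    by blast
  have "compact (closure \<Omega>)" using bounded_domain by (simp add: compact_closure)
  moreover have "closure \<Omega> \<subseteq> (\<Union>c\<in>closure \<Omega>. ball c (r c))" using r by auto
  ultimately obtain D where D: "D \<subseteq> closure \<Omega>" "finite D" "closure \<Omega> \<subseteq> (\<Union>c\<in>D. ball c (r c))"
    using compactE_image[of "closure \<Omega>" "closure \<Omega>" "\<lambda>c. ball c (r c)"] by (metis open_ball)
  define \<delta> where "\<delta> = \<epsilon> / (card D + 1)"
  have \<delta>: "0 < \<delta>" "card D * \<delta> \<le> \<epsilon>" using \<epsilon> by (auto simp: \<delta>_def field_simps)
  have "\<forall>x0\<in>D. \<exists>\<B> C. mean_sets \<B> \<and> 0 \<le> C \<and> (\<forall>\<phi>. smooth \<phi> \<longrightarrow>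
    (\<integral>\<^sup>+x\<in>\<Omega> \<inter> ball x0 (r x0). ennreal ((\<phi> x)\<^sup>2) \<partial>lborel) \<le> ennreal (C * (\<Sum>B\<in>\<B>. (mean_on B \<phi>)\<^sup>2))
       + ennreal \<delta> * (\<integral>\<^sup>+x\<in>\<Omega>. ennreal ((norm (grad \<phi> x))\<^sup>2) \<partial>lborel))"
    using loc[OF subsetD[OF D(1)] \<delta>(1)] by blast
  from bchoice[OF this] obtain \<B> where "\<forall>x0\<in>D. \<exists>C. mean_sets (\<B> x0) \<and> 0 \<le> C \<and> (\<forall>\<phi>. smooth \<phi> \<longrightarrow>
    (\<integral>\<^sup>+x\<in>\<Omega> \<inter> ball x0 (r x0). ennreal ((\<phi> x)\<^sup>2) \<partial>lborel) \<le> ennreal (C * (\<Sum>B\<in>\<B> x0. (mean_on B \<phi>)\<^sup>2))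
       + ennreal \<delta> * (\<integral>\<^sup>+x\<in>\<Omega>. ennreal ((norm (grad \<phi> x))\<^sup>2) \<partial>lborel))" by blast
  from bchoice[OF this] obtain C where \<B>: "\<And>x0. x0 \<in> D \<Longrightarrow> mean_sets (\<B> x0)" and C: "\<And>x0. x0 \<in> D \<Longrightarrow> 0 \<le> C x0"
    and est: "\<And>x0 \<phi>. x0 \<in> D \<Longrightarrow> smooth \<phi> \<Longrightarrow>
    (\<integral>\<^sup>+x\<in>\<Omega> \<inter> ball x0 (r x0). ennreal ((\<phi> x)\<^sup>2) \<partial>lborel) \<le> ennreal (C x0 * (\<Sum>B\<in>\<B> x0. (mean_on B \<phi>)\<^sup>2))
       + ennreal \<delta> * (\<integral>\<^sup>+x\<in>\<Omega>. ennreal ((norm (grad \<phi> x))\<^sup>2) \<partial>lborel)"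
    by blast
  define \<B>' where "\<B>' = (\<Union>x0\<in>D. \<B> x0)"
  have ms: "mean_sets \<B>'" using \<B> D(2) by (auto simp: mean_sets_def \<B>'_def)
  have "(L2_norm \<Omega> \<phi>)\<^sup>2 \<le> sum C D * (\<Sum>B\<in>\<B>'. (mean_on B \<phi>)\<^sup>2) + \<epsilon> * (L2_norm \<Omega> (grad \<phi>))\<^sup>2"
    if \<phi>: "smooth \<phi>" for \<phi>
  proof -
    note [measurable] = smooth_borel[OF \<phi>]
    have [measurable]: "\<Omega> \<inter> ball x0 (r x0) \<in> sets borel" for x0 using open_domain by (simp add: borel_open open_Int)
    let ?S = "\<Sum>B\<in>\<B>'. (mean_on B \<phi>)\<^sup>2" and ?G = "(L2_norm \<Omega> (grad \<phi>))\<^sup>2"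
    have S: "0 \<le> ?S" by (simp add: sum_nonneg)
    have "ennreal ((L2_norm \<Omega> \<phi>)\<^sup>2) = (\<integral>\<^sup>+x\<in>\<Omega>. ennreal ((\<phi> x)\<^sup>2) \<partial>lborel)"
      by (simp add: smooth_nn_integral_domain \<phi>)
    also have "\<dots> \<le> (\<integral>\<^sup>+x. (\<Sum>x0\<in>D. ennreal ((\<phi> x)\<^sup>2) * indicator (\<Omega> \<inter> ball x0 (r x0)) x) \<partial>lborel)"
    proof (rule nn_integral_mono)
      fix x
      show "ennreal ((\<phi> x)\<^sup>2) * indicator \<Omega> x \<le> (\<Sum>x0\<in>D. ennreal ((\<phi> x)\<^sup>2) * indicator (\<Omega> \<inter> ball x0 (r x0)) x)"
      proof (cases "x \<in> \<Omega>")
        case True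
        then obtain c where c: "c \<in> D" "x \<in> ball c (r c)" using D(3) closure_subset by blast
        have "ennreal ((\<phi> x)\<^sup>2) * indicator (\<Omega> \<inter> ball c (r c)) x
           \<le> (\<Sum>x0\<in>D. ennreal ((\<phi> x)\<^sup>2) * indicator (\<Omega> \<inter> ball x0 (r x0)) x)"
          by (rule member_le_sum) (use c D(2) in auto)
        then show ?thesis using True c by simp
      qed simp
    qed
    also have "\<dots> = (\<Sum>x0\<in>D. \<integral>\<^sup>+x\<in>\<Omega> \<inter> ball x0 (r x0). ennreal ((\<phi> x)\<^sup>2) \<partial>lborel)"
      by (rule nn_integral_sum) measurable
    also have "\<dots> \<le> (\<Sum>x0\<in>D. ennreal (C x0 * ?S + \<delta> * ?G))"
    proof (rule sum_mono)
      fix x0 assume x0: "x0 \<in> D"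
      have "(\<Sum>B\<in>\<B> x0. (mean_on B \<phi>)\<^sup>2) \<le> ?S"
        by (rule sum_mono2) (use ms x0 in \<open>auto simp: \<B>'_def mean_sets_def\<close>)
      then have "C x0 * (\<Sum>B\<in>\<B> x0. (mean_on B \<phi>)\<^sup>2) \<le> C x0 * ?S" using C[OF x0] by (rule mult_left_mono)
      then have "ennreal (C x0 * (\<Sum>B\<in>\<B> x0. (mean_on B \<phi>)\<^sup>2)) + ennreal \<delta> * ennreal ?G \<le> ennreal (C x0 * ?S) + ennreal (\<delta> * ?G)"
        using \<delta>(1) by (intro add_mono ennreal_leI) (simp_all add: ennreal_mult)
      also have "\<dots> = ennreal (C x0 * ?S + \<delta> * ?G)"
        using C[OF x0] S \<delta>(1) by (intro ennreal_plus[symmetric]) auto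
      finally show "(\<integral>\<^sup>+x\<in>\<Omega> \<inter> ball x0 (r x0). ennreal ((\<phi> x)\<^sup>2) \<partial>lborel) \<le> ennreal (C x0 * ?S + \<delta> * ?G)"
        using est[OF x0 \<phi>] by (simp add: smooth_nn_integral_domain(2)[OF \<phi>])
    qed
    also have "\<dots> = ennreal (\<Sum>x0\<in>D. C x0 * ?S + \<delta> * ?G)"
      using C S \<delta>(1) by (intro sum_ennreal) auto
    also have "(\<Sum>x0\<in>D. C x0 * ?S + \<delta> * ?G) = sum C D * ?S + card D * \<delta> * ?G"
      by (simp add: sum.distrib sum_distrib_right)
    finally have "ennreal ((L2_norm \<Omega> \<phi>)\<^sup>2) \<le> ennreal (sum C D * ?S + card D * \<delta> * ?G)" .
    moreover have "0 \<le> sum C D * ?S + card D * \<delta> * ?G"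
      using C S \<delta>(1) by (intro add_nonneg_nonneg mult_nonneg_nonneg sum_nonneg) auto
    ultimately have "(L2_norm \<Omega> \<phi>)\<^sup>2 \<le> sum C D * ?S + card D * \<delta> * ?G" by simp
    also have "\<dots> \<le> sum C D * ?S + \<epsilon> * ?G" using \<delta>(2) by (intro add_left_mono mult_right_mono) auto
    finally show ?thesis .
  qed
  then show ?thesis using ms C by (intro exI[of _ \<B>'] exI[of _ "sum C D"]) (auto intro: sum_nonneg)
qed

end

locale dirichlet_domain = lipschitz_domain \<Omega> + trace_domain \<Omega> \<Gamma>D
  for \<Omega> \<Gamma>D :: "(real^'n::finite) set"
begin

lemma H1D_approx:
  assumes "v \<in> H1D \<Omega> \<Gamma>D"
  obtains \<phi> where "\<And>k. smooth (\<phi> k)" "(\<lambda>k. H1_norm \<Omega> (\<phi> k - v)) \<longlonglongrightarrow> 0"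
  using assms by (auto simp: H1D_def has_trace_def fun_diff_def)

text \<open>
  Both sides are continuous for the \<open>H1\<close> norm, so the estimate passes from smooth functions to their limits.
\<close>

lemma mean_estimate:
  assumes \<epsilon>: "0 < \<epsilon>"
  shows "\<exists>\<B> C. mean_sets \<B> \<and> 0 \<le> C \<and> (\<forall>v\<in>H1D \<Omega> \<Gamma>D.
    (L2_norm \<Omega> v)\<^sup>2 \<le> C * (\<Sum>B\<in>\<B>. (L2_inner \<Omega> v (mean_weight B))\<^sup>2) + \<epsilon> * (L2_norm \<Omega> (weak_grad \<Omega> v))\<^sup>2)"
proof -
  obtain \<B> C where \<B>: "mean_sets \<B>" "0 \<le> C" and est: "\<And>\<phi>. smooth \<phi> \<Longrightarrow>
    (L2_norm \<Omega> \<phi>)\<^sup>2 \<le> C * (\<Sum>B\<in>\<B>. (mean_on B \<phi>)\<^sup>2) + \<epsilon> * (L2_norm \<Omega> (grad \<phi>))\<^sup>2"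
    using smooth_mean_estimate[OF \<epsilon>] by blast
  have "(L2_norm \<Omega> v)\<^sup>2 \<le> C * (\<Sum>B\<in>\<B>. (L2_inner \<Omega> v (mean_weight B))\<^sup>2) + \<epsilon> * (L2_norm \<Omega> (weak_grad \<Omega> v))\<^sup>2"
    if v: "v \<in> H1D \<Omega> \<Gamma>D" for v
  proof -
    obtain \<phi> where \<phi>: "\<And>k. smooth (\<phi> k)" "(\<lambda>k. H1_norm \<Omega> (\<phi> k - v)) \<longlonglongrightarrow> 0"
      using H1D_approx[OF v] by blast
    have vH: "v \<in> H1 \<Omega>" using v H1D_subset by blast
    note lim = H1_limit_estimate[OF vH \<phi>]
    show ?thesis
    proof (rule LIMSEQ_le)
      show "(\<lambda>k. (L2_norm \<Omega> (\<phi> k))\<^sup>2) \<longlonglongrightarrow> (L2_norm \<Omega> v)\<^sup>2" by (intro tendsto_intros lim)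
      show "(\<lambda>k. C * (\<Sum>B\<in>\<B>. (L2_inner \<Omega> (\<phi> k) (mean_weight B))\<^sup>2) + \<epsilon> * (L2_norm \<Omega> (grad (\<phi> k)))\<^sup>2)
        \<longlonglongrightarrow> C * (\<Sum>B\<in>\<B>. (L2_inner \<Omega> v (mean_weight B))\<^sup>2) + \<epsilon> * (L2_norm \<Omega> (weak_grad \<Omega> v))\<^sup>2"
        using \<B>(1) by (intro tendsto_intros lim mean_weight_L2) (auto simp: mean_sets_def)
      have "(\<Sum>B\<in>\<B>. (mean_on B (\<phi> k))\<^sup>2) = (\<Sum>B\<in>\<B>. (L2_inner \<Omega> (\<phi> k) (mean_weight B))\<^sup>2)" for k
        using \<B>(1) mean_on_eq_L2_inner[OF \<phi>(1)] by (intro sum.cong) (auto simp: mean_sets_def)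
      then show "\<exists>N. \<forall>k\<ge>N. (L2_norm \<Omega> (\<phi> k))\<^sup>2
         \<le> C * (\<Sum>B\<in>\<B>. (L2_inner \<Omega> (\<phi> k) (mean_weight B))\<^sup>2) + \<epsilon> * (L2_norm \<Omega> (grad (\<phi> k)))\<^sup>2"
        using est[OF \<phi>(1)] by simp
    qed
  qed
  then show ?thesis using \<B> by blast
qed

end

section \<open>Functions with zero gradient are constant\<close>

text \<open>
  Poincare inequality on a ball, a case of \<open>square_estimate_by_means\<close> with a single centre, applied after
  subtracting the mean. The factor \<open>3\<close> leaves room for displacements of length up to \<open>2 * s\<close>, the diameter of the ball.
\<close>

lemma (in bounded_domain) ball_oscillation_estimate:
  assumes s: "0 < s" and sub: "ball x0 (3 * s) \<subseteq> \<Omega>"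
  shows "\<exists>C\<ge>0. \<forall>\<phi>. smooth \<phi> \<longrightarrow>
    (\<integral>\<^sup>+x\<in>ball x0 s. ennreal ((\<phi> x - mean_on (ball x0 s) \<phi>)\<^sup>2) \<partial>lborel) \<le> ennreal (C * (L2_norm \<Omega> (grad \<phi>))\<^sup>2)"
proof -
  let ?B = "ball x0 s"
  define \<mu> where "\<mu> = measure lborel ?B"
  have \<mu>: "measure lborel (ball b s) = \<mu>" "0 < \<mu>" for b :: "real^'n"
    using s content_ball_pos[OF s, of x0] by (simp_all add: \<mu>_def content_ball)
  define C where "C = 2 / \<mu> * (2 * s)\<^sup>2 * measure lborel (ball (0::real^'n) (2 * s))"
  have C: "0 \<le> C" using \<mu>(2) by (simp add: C_def)
  have "(\<integral>\<^sup>+x\<in>?B. ennreal ((\<phi> x - mean_on ?B \<phi>)\<^sup>2) \<partial>lborel) \<le> ennreal (C * (L2_norm \<Omega> (grad \<phi>))\<^sup>2)"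
    if \<phi>: "smooth \<phi>" for \<phi>
  proof -
    define \<psi> where "\<psi> x = \<phi> x + - mean_on ?B \<phi>" for x
    have \<psi>: "smooth \<psi>" unfolding \<psi>_def by (intro smooth_add \<phi> smooth_const)
    have g: "grad \<psi> = grad \<phi>"
      using grad_add[OF \<phi> smooth_const[of "- mean_on ?B \<phi>"]] by (auto simp: \<psi>_def[abs_def] grad_const fun_eq_iff)
    have "(LINT z:?B|lborel. \<psi> z) = (LINT z:?B|lborel. \<phi> z) + (LINT z:?B|lborel. - mean_on ?B \<phi>)"
      unfolding \<psi>_def by (intro set_integral_add smooth_ball_integrable \<phi> smooth_const)
    also have "(LINT z:?B|lborel. - mean_on ?B \<phi>) = - (\<mu> * mean_on ?B \<phi>)"
      using emeasure_lborel_ball_finite[of x0 s] by (simp add: set_lebesgue_integral_def \<mu>_def)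
    finally have m0: "mean_on ?B \<psi> = 0"
      using \<mu>(2) by (simp add: mean_on_def \<mu>_def[symmetric])
    have "(\<integral>\<^sup>+x\<in>?B. ennreal ((\<psi> x)\<^sup>2) \<partial>lborel) \<le> ennreal 0 * emeasure lborel ?B
       + ennreal (2 / \<mu> * (2 * s)\<^sup>2) * emeasure lborel (ball (0::real^'n) (2 * s)) * (\<integral>\<^sup>+x\<in>\<Omega>. ennreal ((norm (grad \<psi> x))\<^sup>2) \<partial>lborel)"
    proof (rule square_estimate_by_means[OF \<psi> s, where Z = "{x0}"])
      fix x y :: "real^'n" and \<sigma> :: real
      assume "x \<in> ?B" "y \<in> ball 0 (2 * s)" "0 \<le> \<sigma>" "\<sigma> \<le> 1"
      then have "norm (\<sigma> *\<^sub>R y) < 2 * s" "dist x0 x < s"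
        using mult_right_mono[of \<sigma> 1 "norm y"] by auto
      then have "dist x0 (x + \<sigma> *\<^sub>R y) < 3 * s"
        using norm_triangle_ineq[of "x - x0" "\<sigma> *\<^sub>R y"] by (simp add: dist_norm norm_minus_commute algebra_simps)
      then show "x + \<sigma> *\<^sub>R y \<in> \<Omega>" using sub by auto
    next
      fix x :: "real^'n"
      assume x: "x \<in> ?B"
      show "\<exists>b\<in>{x0}. \<forall>z\<in>ball b s. z - x \<in> ball 0 (2 * s)"
      proof (intro bexI[of _ x0] ballI)
        fix z assume "z \<in> ?B"
        then show "z - x \<in> ball 0 (2 * s)"
          using x norm_triangle_ineq[of "z - x0" "x0 - x"] by (simp add: dist_norm norm_minus_commute)
      qed simp
    qed (use \<mu> m0 in auto)
    also have "\<dots> = ennreal (C * (L2_norm \<Omega> (grad \<phi>))\<^sup>2)"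
      using \<mu>(2) C emeasure_lborel_ball_finite[of "0::real^'n" "2 * s"]
      unfolding g smooth_nn_integral_domain(2)[OF \<phi>] C_def
      by (simp add: emeasure_eq_ennreal_measure less_top ennreal_mult[symmetric] mult_ac)
    finally show ?thesis by (simp add: \<psi>_def)
  qed
  then show ?thesis using C by blast
qed

context dirichlet_domain
begin

text \<open>
  The oscillation estimate for smooth approximants passes to the limit. Its right-hand side tends to zero, and
  the means over the ball converge to the constant \<open>m\<close>.
\<close>

lemma locally_constant_if_weak_grad_zero:
  assumes v: "v \<in> H1D \<Omega> \<Gamma>D" and g0: "L2_norm \<Omega> (weak_grad \<Omega> v) = 0"
    and s: "0 < s" "ball x0 (3 * s) \<subseteq> \<Omega>"
  shows "\<exists>m. AE x in lebesgue_on \<Omega>. x \<in> ball x0 s \<longrightarrow> v x = m"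
proof -
  let ?B = "ball x0 s"
  have Bsub: "?B \<subseteq> \<Omega>" using s subset_ball[of s "3 * s" x0] by auto
  have B: "?B \<in> sets borel" by simp
  obtain C where C: "0 \<le> C" and est: "\<And>\<phi>. smooth \<phi> \<Longrightarrow>
    (\<integral>\<^sup>+x\<in>?B. ennreal ((\<phi> x - mean_on ?B \<phi>)\<^sup>2) \<partial>lborel) \<le> ennreal (C * (L2_norm \<Omega> (grad \<phi>))\<^sup>2)"
    using ball_oscillation_estimate[OF s] by blast
  obtain \<phi> where \<phi>: "\<And>k. smooth (\<phi> k)" "(\<lambda>k. H1_norm \<Omega> (\<phi> k - v)) \<longlonglongrightarrow> 0"
    using H1D_approx[OF v] by blast
  have vH: "v \<in> H1 \<Omega>" using v H1D_subset by blast
  note lim = H1_limit_estimate[OF vH \<phi>]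
  define m where "m = L2_inner \<Omega> v (mean_weight ?B)"
  define mk where "mk k = mean_on ?B (\<phi> k)" for k
  have mk: "(\<lambda>k. mk k) \<longlonglongrightarrow> m"
    unfolding mk_def m_def mean_on_eq_L2_inner[OF \<phi>(1) B Bsub] by (rule lim(3)[OF mean_weight_L2[OF B Bsub]])
  have L\<phi>: "\<phi> k \<in> L2 \<Omega>" for k by (rule smooth_L2(1)[OF \<phi>(1) bounded_domain domain_sets(1)])
  have Lv: "v \<in> L2 \<Omega>" by (rule H1_L2[OF vH])
  let ?I = "indicator ?B :: real^'n \<Rightarrow> real"
  have LI: "?I \<in> L2 \<Omega>" by (rule indicator_L2[OF B Bsub])
  have Im: "?I \<in> borel_measurable (lebesgue_on \<Omega>)" by (rule L2_measurable[OF LI])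
  have Imul: "(\<lambda>x. ?I x * f x) \<in> L2 \<Omega> \<and> L2_norm \<Omega> (\<lambda>x. ?I x * f x) \<le> L2_norm \<Omega> f" if f: "f \<in> L2 \<Omega>" for f
  proof -
    have me: "(\<lambda>x. ?I x * f x) \<in> borel_measurable (lebesgue_on \<Omega>)"
      by (rule borel_measurable_times[OF Im L2_measurable[OF f]])
    have ae: "AE x in lebesgue_on \<Omega>. norm (?I x * f x) \<le> 1 * norm (f x)" by (simp split: split_indicator)
    show ?thesis using L2_bound[OF f me ae] by simp
  qed
  define w where "w k x = ?I x * (\<phi> k x - mk k)" for k x
  have wsplit: "w k = (\<lambda>x. ?I x * \<phi> k x) - mk k *\<^sub>R ?I" for k
    by (auto simp: w_def fun_eq_iff algebra_simps)
  have Lw: "w k \<in> L2 \<Omega>" for k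
    unfolding wsplit using Imul[OF L\<phi>] LI by (intro L2.V_simps) auto
  have "(L2_norm \<Omega> (w k))\<^sup>2 \<le> C * (L2_norm \<Omega> (grad (\<phi> k)))\<^sup>2" for k
  proof -
    have "(\<lambda>x. ?I x * (\<phi> k x - mk k)) \<in> borel_measurable borel"
      by (intro borel_measurable_times borel_measurable_indicator B borel_measurable_diff smooth_borel(1)[OF \<phi>(1)]
          borel_measurable_const)
    then have [measurable]: "w k \<in> borel_measurable borel" by (simp add: w_def[abs_def])
    have "ennreal ((L2_norm \<Omega> (w k))\<^sup>2) = (\<integral>\<^sup>+x. ennreal ((norm (w k x))\<^sup>2) \<partial>lebesgue_on \<Omega>)"
      by (rule L2_nn_integral[OF Lw, symmetric])
    also have "\<dots> = (\<integral>\<^sup>+x\<in>\<Omega>. ennreal ((norm (w k x))\<^sup>2) \<partial>lborel)"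
      by (rule nn_integral_domain) measurable
    also have "\<dots> = (\<integral>\<^sup>+x\<in>?B. ennreal ((\<phi> k x - mean_on ?B (\<phi> k))\<^sup>2) \<partial>lborel)"
      by (rule nn_integral_cong) (use Bsub in \<open>auto simp: w_def mk_def split: split_indicator\<close>)
    also have "\<dots> \<le> ennreal (C * (L2_norm \<Omega> (grad (\<phi> k)))\<^sup>2)" by (rule est[OF \<phi>(1)])
    finally show ?thesis using C by simp
  qed
  then have wle: "L2_norm \<Omega> (w k) \<le> sqrt (C * (L2_norm \<Omega> (grad (\<phi> k)))\<^sup>2)" for k
    by (rule real_le_rsqrt)
  \<comment> \<open>\<open>u\<close> is the limit of the functions \<open>w k\<close>, whose norms are controlled by the vanishing gradients.\<close>
  define u where "u x = ?I x * (v x - m)" for x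
  have usplit: "u = ((\<lambda>x. ?I x * (v - \<phi> k) x) + w k) + (mk k - m) *\<^sub>R ?I" for k
    by (auto simp: u_def w_def fun_eq_iff algebra_simps)
  have Lu: "u \<in> L2 \<Omega>"
    unfolding usplit[of 0] using Imul[of "v - \<phi> 0"] LI Lw L\<phi> Lv by (intro L2.V_simps) auto
  have ule: "L2_norm \<Omega> u \<le> (H1_norm \<Omega> (\<phi> k - v) + sqrt (C * (L2_norm \<Omega> (grad (\<phi> k)))\<^sup>2)) + \<bar>mk k - m\<bar> * L2_norm \<Omega> ?I" for k
  proof -
    have vp: "v - \<phi> k \<in> L2 \<Omega>" by (rule L2.V_simps(4)[OF Lv L\<phi>])
    note I1 = Imul[OF vp]
    have sI: "(mk k - m) *\<^sub>R ?I \<in> L2 \<Omega>" by (rule L2.V_simps(3)[OF LI])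
    have "L2_norm \<Omega> u \<le> L2_norm \<Omega> ((\<lambda>x. ?I x * (v - \<phi> k) x) + w k) + L2_norm \<Omega> ((mk k - m) *\<^sub>R ?I)"
      unfolding usplit[of k] by (rule L2.nrm_triangle[OF L2.V_simps(2)[OF conjunct1[OF I1] Lw] sI])
    moreover have "L2_norm \<Omega> ((\<lambda>x. ?I x * (v - \<phi> k) x) + w k) \<le> L2_norm \<Omega> (\<lambda>x. ?I x * (v - \<phi> k) x) + L2_norm \<Omega> (w k)"
      by (rule L2.nrm_triangle[OF conjunct1[OF I1] Lw])
    moreover have "L2_norm \<Omega> (\<lambda>x. ?I x * (v - \<phi> k) x) \<le> H1_norm \<Omega> (\<phi> k - v)"
      using I1 L2.nrm_diff_commute[OF Lv L\<phi>] L2_le_H1_norm(1)[of "\<phi> k - v"] by simp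
    moreover have "L2_norm \<Omega> ((mk k - m) *\<^sub>R ?I) = \<bar>mk k - m\<bar> * L2_norm \<Omega> ?I" by (rule L2.nrm_scale[OF LI])
    ultimately show ?thesis using wle[of k] by linarith
  qed
  have "L2_norm \<Omega> u \<le> (0 + sqrt (C * 0\<^sup>2)) + \<bar>m - m\<bar> * L2_norm \<Omega> ?I"
  proof (rule LIMSEQ_le_const)
    show "(\<lambda>k. (H1_norm \<Omega> (\<phi> k - v) + sqrt (C * (L2_norm \<Omega> (grad (\<phi> k)))\<^sup>2)) + \<bar>mk k - m\<bar> * L2_norm \<Omega> ?I)
      \<longlonglongrightarrow> (0 + sqrt (C * 0\<^sup>2)) + \<bar>m - m\<bar> * L2_norm \<Omega> ?I"
      using lim(2) unfolding g0 by (intro tendsto_intros \<phi>(2) mk)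
  qed (use ule in blast)
  then have "L2_norm \<Omega> u = 0" using L2.nrm_nonneg[OF Lu] by simp
  then have "AE x in lebesgue_on \<Omega>. u x = 0" using L2_norm_eq_0_iff[OF Lu] by blast
  then have "AE x in lebesgue_on \<Omega>. x \<in> ?B \<longrightarrow> v x = m"
    by eventually_elim (auto simp: u_def)
  then show ?thesis by blast
qed

text \<open>
  Overlapping balls share their constant, since their intersection is open and thus not null. Connectedness
  makes all constants equal, and countably many balls cover the domain.
\<close>

lemma constant_if_weak_grad_zero:
  assumes conn: "connected \<Omega>" and v: "v \<in> H1D \<Omega> \<Gamma>D" and g0: "L2_norm \<Omega> (weak_grad \<Omega> v) = 0"
  shows "\<exists>m. AE x in lebesgue_on \<Omega>. v x = m"
proof (cases "\<Omega> = {}")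
  case False
  then obtain a0 where a0: "a0 \<in> \<Omega>" by blast
  have "\<exists>s>0. ball x (3 * s) \<subseteq> \<Omega>" if x: "x \<in> \<Omega>" for x
  proof -
    obtain e where "0 < e" "ball x e \<subseteq> \<Omega>" using openE[OF open_domain x] by blast
    then show ?thesis by (intro exI[of _ "e / 3"]) auto
  qed
  then have "\<forall>x\<in>\<Omega>. \<exists>s. 0 < s \<and> ball x (3 * s) \<subseteq> \<Omega>" by blast
  from bchoice[OF this] obtain s
    where s: "\<And>x. x \<in> \<Omega> \<Longrightarrow> 0 < s x" "\<And>x. x \<in> \<Omega> \<Longrightarrow> ball x (3 * s x) \<subseteq> \<Omega>" by blast
  have sub: "ball x (s x) \<subseteq> \<Omega>" if "x \<in> \<Omega>" for x
    using s[OF that] subset_ball[of "s x" "3 * s x" x] by auto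
  have "\<exists>m. AE y in lebesgue_on \<Omega>. y \<in> ball x (s x) \<longrightarrow> v y = m" if "x \<in> \<Omega>" for x
    by (rule locally_constant_if_weak_grad_zero[OF v g0 s[OF that]])
  then have "\<forall>x\<in>\<Omega>. \<exists>m. AE y in lebesgue_on \<Omega>. y \<in> ball x (s x) \<longrightarrow> v y = m" by blast
  from bchoice[OF this] obtain m
    where m: "\<And>x. x \<in> \<Omega> \<Longrightarrow> AE y in lebesgue_on \<Omega>. y \<in> ball x (s x) \<longrightarrow> v y = m x" by blast
  have local: "m a = m b" if ab: "a \<in> \<Omega>" "b \<in> \<Omega>" "b \<in> ball a (s a)" for a b
  proof (rule ccontr)
    assume ne: "m a \<noteq> m b"
    define U where "U = ball a (s a) \<inter> ball b (s b)"
    have "open U" "U \<noteq> {}" using ab s(1) by (auto simp: U_def)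
    then have "\<not> negligible U" by (rule open_not_negligible)
    moreover have "AE y in lebesgue_on \<Omega>. y \<notin> U"
      using m[OF ab(1)] m[OF ab(2)] by eventually_elim (use ne in \<open>auto simp: U_def\<close>)
    then have "AE y in lebesgue. y \<in> \<Omega> \<longrightarrow> y \<notin> U" by (subst (asm) AE_restrict_space_iff) auto
    then have "AE y in lebesgue. y \<notin> U"
      by eventually_elim (use sub[OF ab(1)] in \<open>auto simp: U_def\<close>)
    then have "U \<in> null_sets lebesgue"
      using \<open>open U\<close> by (subst (asm) AE_iff_null_sets[symmetric]) (auto simp: borel_open)
    ultimately show False by (simp add: negligible_iff_null_sets)
  qed
  have const: "m x = m a0" if "x \<in> \<Omega>" for x
  proof (rule connected_local_const[OF conn that a0], intro ballI)
    fix a assume a: "a \<in> \<Omega>"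
    show "\<forall>\<^sub>F b in at a within \<Omega>. m a = m b"
      unfolding eventually_at using s(1)[OF a] local[OF a] by (intro exI[of _ "s a"]) (auto simp: dist_commute)
  qed
  obtain F where F: "F \<subseteq> (\<lambda>x. ball x (s x)) ` \<Omega>" "countable F" "\<Union>F = (\<Union>x\<in>\<Omega>. ball x (s x))"
    using Lindelof[of "(\<lambda>x. ball x (s x)) ` \<Omega>"] by auto
  have "AE y in lebesgue_on \<Omega>. \<forall>X\<in>F. y \<in> X \<longrightarrow> v y = m a0"
    unfolding AE_ball_countable[OF F(2)]
  proof
    fix X assume "X \<in> F"
    then obtain x where "x \<in> \<Omega>" "X = ball x (s x)" using F(1) by blast
    then show "AE y in lebesgue_on \<Omega>. y \<in> X \<longrightarrow> v y = m a0" using m[of x] const[of x] by simp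
  qed
  then have "AE y in lebesgue_on \<Omega>. v y = m a0"
    using AE_space
  proof eventually_elim
    case (elim y)
    then have "y \<in> (\<Union>x\<in>\<Omega>. ball x (s x))" using s(1) by force
    then show ?case using elim F(3) by blast
  qed
  then show ?thesis by blast
next
  case True
  then show ?thesis by (auto intro!: AE_I2)
qed

end

section \<open>Bases of negligible cylinders\<close>

text \<open>
  The covering lemma for gauges yields nonoverlapping dyadic cubes that are small and stay inside an open set
  of small measure; for cubes the diameter is comparable with the edge, so the sum of \<open>a i ^ d\<close> is
  comparable with the total volume.
\<close>

lemma negligible_cube_cover:
  fixes S :: "(real^'n::finite) set"
  assumes S: "negligible S" "bounded S" and \<eta>: "0 < \<eta>" and \<delta>: "0 < \<delta>"
  shows "\<exists>U a. S \<subseteq> (\<Union>i::nat. U i) \<and> (\<forall>i. 0 \<le> a i \<and> (\<forall>x\<in>U i. \<forall>y\<in>U i. dist x y \<le> a i \<and> dist x y \<le> \<delta>))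
    \<and> (\<Sum>i. ennreal (a i ^ CARD('n))) \<le> ennreal \<eta>"
proof -
  define d where "d = CARD('n)"
  have d: "0 < d" by (simp add: d_def)
  define \<eta>' where "\<eta>' = \<eta> / real d ^ d"
  have \<eta>': "0 < \<eta>'" using \<eta> d by (simp add: \<eta>'_def)
  have "S \<in> sets lebesgue" using S(1) by (rule negligible_imp_sets)
  then obtain T where T: "open T" "S \<subseteq> T" "(T - S) \<in> lmeasurable" "emeasure lebesgue (T - S) < ennreal \<eta>'"
    using sets_lebesgue_outer_open[OF _ \<eta>'] by blast
  have "emeasure lebesgue T \<le> emeasure lebesgue (S \<union> (T - S))"
    using T(1-3) \<open>S \<in> sets lebesgue\<close> by (intro emeasure_mono) (auto intro: sets.Un)
  also have "\<dots> \<le> emeasure lebesgue S + emeasure lebesgue (T - S)"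
    using T(3) \<open>S \<in> sets lebesgue\<close> by (intro emeasure_subadditive) auto
  also have "\<dots> \<le> ennreal \<eta>'" using T(4) S(1) by (simp add: negligible_iff_null_sets null_setsD1 less_imp_le)
  finally have T\<eta>: "emeasure lborel T \<le> ennreal \<eta>'" using T(1) by (simp add: borel_open)
  obtain R where R: "0 < R" "S \<subseteq> cbox (- R *\<^sub>R One) (R *\<^sub>R One)"
  proof -
    obtain R where R: "0 < R" "\<And>x. x \<in> S \<Longrightarrow> norm x \<le> R" using S(2) by (auto simp: bounded_pos)
    have "x \<in> cbox (- R *\<^sub>R One) (R *\<^sub>R One)" if x: "x \<in> S" for x
    proof -
      have "\<bar>x \<bullet> i\<bar> \<le> R" if "i \<in> Basis" for i
        using Basis_le_norm[OF that, of x] R(2)[OF x] by linarith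
      then show ?thesis by (auto simp: mem_box abs_le_iff minus_le_iff)
    qed
    then show ?thesis using that[of R] R(1) by blast
  qed
  \<comment> \<open>Cubes subordinate to this gauge and tagged in \<open>S\<close> are small and contained in \<open>T\<close>.\<close>
  define g where "g x = ball x (\<delta>/2) \<inter> (if x \<in> T then T else UNIV)" for x
  have gg: "gauge g" using T(1) \<delta> by (auto simp: gauge_def g_def)
  have bx: "box (- R *\<^sub>R One) (R *\<^sub>R One :: real^'n) \<noteq> {}" using R(1) by (simp add: box_ne_empty)
  obtain \<D> where \<D>: "countable \<D>" "\<And>K. K \<in> \<D> \<Longrightarrow> interior K \<noteq> {} \<and> (\<exists>c d. K = cbox c d)"
    "pairwise (\<lambda>A B. interior A \<inter> interior B = {}) \<D>" "\<And>K. K \<in> \<D> \<Longrightarrow> \<exists>x\<in>S \<inter> K. K \<subseteq> g x"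
    "\<And>u v. cbox u v \<in> \<D> \<Longrightarrow> \<exists>n. \<forall>i\<in>Basis. v \<bullet> i - u \<bullet> i = ((R *\<^sub>R One) \<bullet> i - (- R *\<^sub>R One) \<bullet> i) / 2^n"
    "S \<subseteq> \<Union>\<D>"
    by (rule covering_lemma[OF R(2) bx gg]) (rule that)
  have cube: "\<exists>l::real. 0 \<le> l \<and> (\<forall>x\<in>K. \<forall>y\<in>K. dist x y \<le> d * l) \<and> emeasure lborel (interior K) = ennreal (l ^ d)" if K: "K \<in> \<D>" for K
  proof -
    obtain u v where uv: "K = cbox u v" using \<D>(2)[OF K] by blast
    obtain n where n: "\<And>i. i \<in> Basis \<Longrightarrow> v \<bullet> i - u \<bullet> i = 2 * R / 2^n"
      using \<D>(5)[of u v] K uv by (auto simp: algebra_simps)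
    define l where "l = 2 * R / 2^n"
    have l: "0 \<le> l" using R(1) by (simp add: l_def)
    have "dist x y \<le> d * l" if "x \<in> K" "y \<in> K" for x y
    proof -
      have "norm (x - y) \<le> (\<Sum>i\<in>Basis. \<bar>(x - y) \<bullet> i\<bar>)" by (rule norm_le_l1)
      also have "\<dots> \<le> (\<Sum>i\<in>(Basis :: (real^'n) set). l)"
      proof (rule sum_mono)
        fix i :: "real^'n" assume i: "i \<in> Basis"
        have "u \<bullet> i \<le> x \<bullet> i" "x \<bullet> i \<le> v \<bullet> i" "u \<bullet> i \<le> y \<bullet> i" "y \<bullet> i \<le> v \<bullet> i"
          using that i unfolding uv by (auto simp: mem_box)
        then show "\<bar>(x - y) \<bullet> i\<bar> \<le> l" using n[OF i] unfolding l_def inner_diff_left by linarith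
      qed
      finally show ?thesis by (simp add: dist_norm d_def)
    qed
    moreover have "emeasure lborel (interior K) = ennreal (l ^ d)"
    proof -
      have "u \<bullet> i \<le> v \<bullet> i" if "i \<in> Basis" for i using n[OF that] l unfolding l_def by linarith
      then have "emeasure lborel (box u v) = ennreal (\<Prod>i\<in>Basis. (v - u) \<bullet> i)"
        by (simp add: emeasure_lborel_box)
      also have "(\<Prod>i\<in>Basis. (v - u) \<bullet> i) = l ^ d"
        using n by (simp add: inner_diff_left l_def d_def)
      finally show ?thesis by (simp add: uv interior_cbox)
    qed
    ultimately show ?thesis using l by (intro exI[of _ l] conjI ballI) simp_all
  qed
  then have "\<forall>K\<in>\<D>. \<exists>l::real. 0 \<le> l \<and> (\<forall>x\<in>K. \<forall>y\<in>K. dist x y \<le> d * l) \<and> emeasure lborel (interior K) = ennreal (l ^ d)" by blast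
  from bchoice[OF this] obtain l :: "(real^'n) set \<Rightarrow> real" where l_all: "\<forall>K\<in>\<D>. 0 \<le> l K \<and>
    (\<forall>x\<in>K. \<forall>y\<in>K. dist x y \<le> d * l K) \<and> emeasure lborel (interior K) = ennreal (l K ^ d)" ..
  have l: "0 \<le> l K" "\<And>x y. x \<in> K \<Longrightarrow> y \<in> K \<Longrightarrow> dist x y \<le> d * l K"
    "emeasure lborel (interior K) = ennreal (l K ^ d)" if "K \<in> \<D>" for K
    using bspec[OF l_all that] by simp_all
  define N where "N = to_nat_on \<D> ` \<D>"
  define F where "F i = from_nat_into \<D> i" for i
  have FN: "F i \<in> \<D>" if "i \<in> N" for i
    using that \<D>(1) by (auto simp: N_def F_def)
  have Finj: "i = j" if "i \<in> N" "j \<in> N" "F i = F j" for i j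
    using that \<D>(1) by (auto simp: N_def F_def)
  define U where "U i = (if i \<in> N then F i else {})" for i
  define a where "a i = (if i \<in> N then real d * l (F i) else 0)" for i
  have cover: "S \<subseteq> (\<Union>i. U i)"
  proof
    fix x assume "x \<in> S"
    then obtain K where K: "K \<in> \<D>" "x \<in> K" using \<D>(6) by blast
    then have "x \<in> U (to_nat_on \<D> K)" using \<D>(1) by (simp add: U_def N_def F_def)
    then show "x \<in> (\<Union>i. U i)" by blast
  qed
  have small: "dist x y \<le> \<delta>" if "K \<in> \<D>" "x \<in> K" "y \<in> K" for K x y
  proof -
    obtain z where "K \<subseteq> g z" using \<D>(4)[OF \<open>K \<in> \<D>\<close>] by blast
    then have "dist z x < \<delta>/2" "dist z y < \<delta>/2" using that by (auto simp: g_def)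
    then show ?thesis using dist_triangle2[of x y z] by (simp add: dist_commute)
  qed
  have subT: "K \<subseteq> T" if K: "K \<in> \<D>" for K
  proof -
    obtain z where "z \<in> S" "K \<subseteq> g z" using \<D>(4)[OF K] by blast
    then show ?thesis using T(2) by (auto simp: g_def split: if_splits)
  qed
  have "(\<Sum>i. ennreal (a i ^ d)) = (\<Sum>i. ennreal (real d ^ d) * emeasure lborel (interior (U i)))"
  proof (rule suminf_cong)
    fix i
    show "ennreal (a i ^ d) = ennreal (real d ^ d) * emeasure lborel (interior (U i))"
      using d l(1,3)[OF FN[of i]] by (simp add: a_def U_def power_mult_distrib ennreal_mult)
  qed
  also have "\<dots> = ennreal (real d ^ d) * (\<Sum>i. emeasure lborel (interior (U i)))" by simp
  also have "(\<Sum>i. emeasure lborel (interior (U i))) = emeasure lborel (\<Union>i. interior (U i))"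
  proof (rule suminf_emeasure)
    show "disjoint_family (\<lambda>i. interior (U i))"
      unfolding disjoint_family_on_def
    proof (intro ballI impI)
      fix i j :: nat assume "i \<noteq> j"
      then show "interior (U i) \<inter> interior (U j) = {}"
        using \<D>(3) FN[of i] FN[of j] Finj[of i j] by (auto simp: U_def pairwise_def)
    qed
  qed auto
  also have "\<dots> \<le> emeasure lborel T"
  proof (rule emeasure_mono)
    have "U i \<subseteq> T" for i using subT[OF FN[of i]] by (simp add: U_def)
    then show "(\<Union>i. interior (U i)) \<subseteq> T" using interior_subset by blast
  qed (use T(1) in \<open>simp add: borel_open\<close>)
  finally have "(\<Sum>i. ennreal (a i ^ d)) \<le> ennreal (real d ^ d) * ennreal \<eta>'"
    using T\<eta> by (meson mult_left_mono order_trans zero_le)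
  also have "\<dots> = ennreal \<eta>" using \<eta>' d by (simp add: ennreal_mult[symmetric] \<eta>'_def)
  finally have sum: "(\<Sum>i. ennreal (a i ^ d)) \<le> ennreal \<eta>" .
  have "0 \<le> a i \<and> (\<forall>x\<in>U i. \<forall>y\<in>U i. dist x y \<le> a i \<and> dist x y \<le> \<delta>)" for i
    using l FN[of i] small[OF FN[of i]] by (auto simp: a_def U_def)
  then show ?thesis using cover sum unfolding d_def by blast
qed

text \<open>
  An averaging argument: cover the cylinder over \<open>E\<close> by sets \<open>U i\<close> of diameter at most \<open>a i\<close> with \<open>\<Sum>\<^sub>i a\<^sub>i\<^sup>d\<close> tiny.
  For each height \<open>t\<close> the sets \<open>V t i\<close> of base points whose translate by \<open>t *\<^sub>R e\<close> lies in \<open>U i\<close> cover \<open>E\<close>. As \<open>E\<close> is a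
  Lipschitz graph over directions transversal to \<open>e\<close>, the heights at which \<open>V t i\<close> is nonempty form a set of length
  at most \<open>2 L a\<^sub>i\<close>, so the integral over \<open>t\<close> of \<open>\<Sum>\<^sub>i a\<^sub>i\<^sup>d\<^sup>-\<^sup>1\<close>, taken over the nonempty sets, is
  tiny as well. Hence some height \<open>t\<close> gives a good covering of \<open>E\<close>.
\<close>

lemma hausdorff_outer_zero_if_cylinder_negligible:
  fixes E :: "(real^'n::finite) set"
  assumes card: "2 \<le> CARD('n)" and E: "bounded E" and h: "0 < h" and L: "0 \<le> L"
    and cyl: "negligible {x + t *\<^sub>R e |x t. x \<in> E \<and> 0 < t \<and> t < h}"
    and slope: "\<And>x x' t t'. x \<in> E \<Longrightarrow> x' \<in> E \<Longrightarrow> \<bar>t - t'\<bar> \<le> L * dist (x + t *\<^sub>R e) (x' + t' *\<^sub>R e)"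
  shows "hausdorff_outer (CARD('n) - 1) E = 0"
proof -
  define s where "s = CARD('n) - 1"
  have s: "0 < s" "CARD('n) = Suc s" using card by (auto simp: s_def)
  define c where "c = unit_ball_vol (real s)"
  have c: "0 \<le> c" by (simp add: c_def)
  let ?Cyl = "{x + t *\<^sub>R e |x t. x \<in> E \<and> 0 < t \<and> t < h}"
  have bC: "bounded ?Cyl"
  proof -
    obtain R where R: "\<And>x. x \<in> E \<Longrightarrow> norm x \<le> R" using E by (auto simp: bounded_iff)
    show ?thesis
      unfolding bounded_iff
    proof (intro exI[of _ "R + h * norm e"] ballI)
      fix z assume "z \<in> ?Cyl"
      then obtain x t where z: "z = x + t *\<^sub>R e" "x \<in> E" "0 < t" "t < h" by blast
      have "norm z \<le> norm x + t * norm e" using norm_triangle_ineq[of x "t *\<^sub>R e"] z by simp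
      also have "\<dots> \<le> R + h * norm e" using R[OF z(2)] z by (intro add_mono mult_right_mono) auto
      finally show "norm z \<le> R + h * norm e" .
    qed
  qed
  have pre: "hausdorff_pre s \<delta> E \<le> ennreal \<epsilon>" if \<delta>: "0 < \<delta>" and \<epsilon>: "0 < \<epsilon>" for \<delta> \<epsilon> :: real
  proof -
    \<comment> \<open>The additions of \<open>1\<close> keep the denominator positive when \<open>c\<close> or \<open>L\<close> vanishes.\<close>
    define \<eta> where "\<eta> = \<epsilon> * h / ((c + 1) * (2 * L + 1))"
    have \<eta>: "0 < \<eta>" using \<epsilon> h c L by (simp add: \<eta>_def)
    obtain U a where cover: "?Cyl \<subseteq> (\<Union>i::nat. U i)" and a: "\<And>i. 0 \<le> a i"
      and U: "\<And>i x y. x \<in> U i \<Longrightarrow> y \<in> U i \<Longrightarrow> dist x y \<le> a i \<and> dist x y \<le> \<delta>"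
      and sum: "(\<Sum>i. ennreal (a i ^ Suc s)) \<le> ennreal \<eta>"
      using negligible_cube_cover[OF cyl bC \<eta> \<delta>] unfolding s(2) by blast
    define V where "V t i = {x \<in> E. x + t *\<^sub>R e \<in> U i}" for t i
    define J where "J i = {t. V t i \<noteq> {}}" for i
    \<comment> \<open>The heights in \<open>J i\<close> differ by at most \<open>L * a i\<close>, so an interval around any one of them contains all.\<close>
    define I where "I i = (if J i = {} then {} else {(SOME t. t \<in> J i) - L * a i .. (SOME t. t \<in> J i) + L * a i})" for i
    have JI: "t \<in> I i" if ne: "V t i \<noteq> {}" for t i
    proof -
      define t' where "t' = (SOME t. t \<in> J i)"
      have tJ: "t \<in> J i" using ne by (simp add: J_def)
      then have "t' \<in> J i" unfolding t'_def by (rule someI)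
      then obtain x x' where "x \<in> E" "x' \<in> E" "x + t *\<^sub>R e \<in> U i" "x' + t' *\<^sub>R e \<in> U i"
        using ne by (auto simp: J_def V_def)
      then have "\<bar>t - t'\<bar> \<le> L * a i"
        using slope[of x x' t t'] U[of "x + t *\<^sub>R e" i "x' + t' *\<^sub>R e"] mult_left_mono[OF _ L] by (meson order_trans)
      then show ?thesis using tJ by (auto simp: I_def t'_def[symmetric] abs_le_iff)
    qed
    have Im[measurable]: "I i \<in> sets borel" for i by (simp add: I_def)
    have Iem: "emeasure lborel (I i) \<le> ennreal (2 * L * a i)" for i
      using L a[of i] by (simp add: I_def)
    \<comment> \<open>\<open>F t\<close> bounds the sum that belongs to the covering of \<open>E\<close> at height \<open>t\<close>.\<close>
    define F where "F t = (\<Sum>i. ennreal (a i ^ s) * indicator (I i) t)" for t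
    have Fm[measurable]: "F \<in> borel_measurable borel" unfolding F_def by measurable
    have "(\<integral>\<^sup>+t. F t \<partial>lborel) = (\<Sum>i. ennreal (a i ^ s) * emeasure lborel (I i))"
      unfolding F_def by (subst nn_integral_suminf) (auto simp: nn_integral_cmult)
    also have "\<dots> \<le> (\<Sum>i. ennreal (2 * L) * ennreal (a i ^ Suc s))"
    proof (rule suminf_le)
      fix i
      have "ennreal (a i ^ s) * emeasure lborel (I i) \<le> ennreal (a i ^ s) * ennreal (2 * L * a i)"
        by (intro mult_left_mono Iem) simp
      also have "\<dots> = ennreal (2 * L) * ennreal (a i ^ Suc s)"
        using L a[of i] by (simp add: ennreal_mult[symmetric] mult_ac)
      finally show "ennreal (a i ^ s) * emeasure lborel (I i) \<le> ennreal (2 * L) * ennreal (a i ^ Suc s)" .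
    qed auto
    also have "\<dots> = ennreal (2 * L) * (\<Sum>i. ennreal (a i ^ Suc s))" by simp
    also have "\<dots> \<le> ennreal (2 * L) * ennreal \<eta>" by (intro mult_left_mono sum) simp
    also have "\<dots> < ennreal ((2 * L + 1) * \<eta>)"
      using L \<eta> by (simp add: ennreal_mult[symmetric] ennreal_lessI distrib_right)
    finally have FI: "(\<integral>\<^sup>+t. F t \<partial>lborel) < ennreal ((2 * L + 1) * \<eta>)" .
    define q where "q = (2 * L + 1) * \<eta> / h"
    have q: "0 \<le> q" using L \<eta> h by (simp add: q_def)
    have "\<exists>t. 0 < t \<and> t < h \<and> F t \<le> ennreal q"
    proof (rule ccontr)
      assume "\<not> ?thesis"
      then have "ennreal q \<le> F t" if "0 < t" "t < h" for t using that by (meson linear not_le less_imp_le)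
      then have "(\<integral>\<^sup>+t. ennreal q * indicator {0<..<h} t \<partial>lborel) \<le> (\<integral>\<^sup>+t. F t \<partial>lborel)"
        by (intro nn_integral_mono) (auto split: split_indicator)
      moreover have "(\<integral>\<^sup>+t. ennreal q * indicator {0<..<h} t \<partial>lborel) = ennreal ((2 * L + 1) * \<eta>)"
        using h q by (simp add: nn_integral_cmult ennreal_mult[symmetric] q_def)
      ultimately show False using FI by simp
    qed
    then obtain t where t: "0 < t" "t < h" "F t \<le> ennreal q" by blast
    have diam: "bounded (V t i) \<and> diameter (V t i) \<le> \<delta> \<and> diameter (V t i) \<le> a i" for i
    proof (intro conjI)
      have D: "dist x y \<le> a i \<and> dist x y \<le> \<delta>" if "x \<in> V t i" "y \<in> V t i" for x y
        using U[of "x + t *\<^sub>R e" i "y + t *\<^sub>R e"] that by (simp add: V_def)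
      show "bounded (V t i)" by (rule bounded_subset[OF E]) (auto simp: V_def)
      show "diameter (V t i) \<le> \<delta>" "diameter (V t i) \<le> a i"
        using D \<delta> a[of i] by (auto intro!: diameter_le simp: dist_norm)
    qed
    have "E \<subseteq> (\<Union>i. V t i)"
      using cover t(1,2) by (auto simp: V_def subset_eq)
    then have "hausdorff_pre s \<delta> E \<le> (\<Sum>i. ennreal (c * (diameter (V t i) / 2) ^ s))"
      unfolding hausdorff_pre_def c_def by (intro INF_lower) (use diam in auto)
    also have "\<dots> \<le> (\<Sum>i. ennreal c * (ennreal (a i ^ s) * indicator (I i) t))"
    proof (rule suminf_le)
      fix i
      show "ennreal (c * (diameter (V t i) / 2) ^ s) \<le> ennreal c * (ennreal (a i ^ s) * indicator (I i) t)"
      proof (cases "V t i = {}")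
        case True
        then show ?thesis using s(1) by (simp add: diameter_def zero_power)
      next
        case False
        have "0 \<le> diameter (V t i)" using diam by (simp add: diameter_ge_0)
        then have "(diameter (V t i) / 2) ^ s \<le> a i ^ s" using diam[of i] by (intro power_mono) auto
        then have "c * (diameter (V t i) / 2) ^ s \<le> c * a i ^ s" using c by (rule mult_left_mono)
        then show ?thesis using JI[OF False] c a[of i] by (simp add: ennreal_mult[symmetric] ennreal_leI)
      qed
    qed auto
    also have "\<dots> = ennreal c * F t" by (simp add: F_def)
    also have "\<dots> \<le> ennreal c * ennreal q" by (intro mult_left_mono t) simp
    also have "\<dots> \<le> ennreal \<epsilon>"
    proof -
      have "(c + 1) * q = \<epsilon>" using c L h by (simp add: q_def \<eta>_def)
      then have "c * q \<le> \<epsilon>" using q by (simp add: distrib_right)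
      then show ?thesis using c q by (simp add: ennreal_mult[symmetric] ennreal_leI)
    qed
    finally show ?thesis .
  qed
  have "hausdorff_pre s \<delta> E = 0" if "0 < \<delta>" for \<delta>
    using pre[OF that] ennreal_le_epsilon[of 0 "hausdorff_pre s \<delta> E"] by auto
  then show ?thesis unfolding hausdorff_outer_def s_def[symmetric] by (simp add: SUP_eq_const)
qed

section \<open>A constant with zero trace vanishes\<close>

lemma lipschitz_imp_continuous:
  assumes "0 \<le> L" "\<And>x y. \<bar>\<tau> x - \<tau> y\<bar> \<le> L * dist x y"
  shows "continuous_on S (\<tau> :: 'a::metric_space \<Rightarrow> real)"
  by (rule lipschitz_on_continuous_on[of L]) (use assms in \<open>auto intro!: lipschitz_onI simp: dist_real_def\<close>)

text \<open>
  The value at the foot \<open>z - \<tau> z *\<^sub>R e\<close> of the ray through \<open>z\<close> differs from the value at \<open>z\<close> by an integral of the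
  gradient along the ray. Averaging over \<open>z\<close> gives a trace inequality that uses Lebesgue measure only.
\<close>

lemma (in bounded_domain) cylinder_trace_estimate:
  fixes \<tau> :: "real^'n \<Rightarrow> real"
  assumes \<psi>: "smooth \<psi>" and e: "norm e = 1" and h: "0 < h"
    and cont: "continuous_on UNIV \<tau>" and shift: "\<And>x t. \<tau> (x + t *\<^sub>R e) = \<tau> x + t"
    and D: "D \<in> sets borel" "\<And>z. z \<in> D \<Longrightarrow> 0 < \<tau> z \<and> \<tau> z < h"
    and down: "\<And>z t. z \<in> D \<Longrightarrow> 0 \<le> t \<Longrightarrow> t < \<tau> z \<Longrightarrow> z - t *\<^sub>R e \<in> \<Omega>"
  shows "(\<integral>\<^sup>+z\<in>D. ennreal ((\<psi> (z - \<tau> z *\<^sub>R e))\<^sup>2) \<partial>lborel)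
    \<le> ennreal (2 * (L2_norm \<Omega> \<psi>)\<^sup>2 + 2 * h\<^sup>2 * (L2_norm \<Omega> (grad \<psi>))\<^sup>2)"
proof -
  note [measurable] = smooth_borel[OF \<psi>] D(1)
  have [measurable]: "\<Omega> \<in> sets borel" by simp
  let ?G = "\<lambda>x. ennreal ((norm (grad \<psi> x))\<^sup>2) * indicator \<Omega> x"
  let ?H = "\<lambda>z s. ?G (z + s *\<^sub>R (- e)) * indicator {0..h} s"
  have "(\<integral>\<^sup>+z\<in>D. ennreal ((\<psi> (z - \<tau> z *\<^sub>R e))\<^sup>2) \<partial>lborel)
    \<le> (\<integral>\<^sup>+z. ennreal 2 * (ennreal ((\<psi> z)\<^sup>2) * indicator \<Omega> z) + ennreal (2 * h) * (\<integral>\<^sup>+s. ?H z s \<partial>lborel) \<partial>lborel)"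
  proof (rule nn_integral_mono)
    fix z
    show "ennreal ((\<psi> (z - \<tau> z *\<^sub>R e))\<^sup>2) * indicator D z
       \<le> ennreal 2 * (ennreal ((\<psi> z)\<^sup>2) * indicator \<Omega> z) + ennreal (2 * h) * (\<integral>\<^sup>+s. ?H z s \<partial>lborel)"
    proof (cases "z \<in> D")
      case True
      then have z: "0 < \<tau> z" "\<tau> z < h" "z \<in> \<Omega>" using D(2) down[of z 0] by auto
      have "(\<psi> (z - \<tau> z *\<^sub>R e))\<^sup>2 \<le> 2 * (\<psi> z)\<^sup>2 + 2 * (\<psi> (z + \<tau> z *\<^sub>R (- e)) - \<psi> z)\<^sup>2"
        using zero_le_power2[of "\<psi> (z - \<tau> z *\<^sub>R e) - 2 * \<psi> z"] by (simp add: power2_eq_square algebra_simps)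
      then have "ennreal ((\<psi> (z - \<tau> z *\<^sub>R e))\<^sup>2) \<le> ennreal (2 * (\<psi> z)\<^sup>2 + 2 * (\<psi> (z + \<tau> z *\<^sub>R (- e)) - \<psi> z)\<^sup>2)"
        by (rule ennreal_leI)
      also have "\<dots> = ennreal 2 * ennreal ((\<psi> z)\<^sup>2) + ennreal 2 * ennreal ((\<psi> (z + \<tau> z *\<^sub>R (- e)) - \<psi> z)\<^sup>2)"
        by (simp add: ennreal_mult[symmetric] ennreal_plus[symmetric] del: ennreal_numeral ennreal_plus)
      also have "ennreal ((\<psi> (z + \<tau> z *\<^sub>R (- e)) - \<psi> z)\<^sup>2)
         \<le> ennreal (\<tau> z * (norm (- e))\<^sup>2) * (\<integral>\<^sup>+s\<in>{0..\<tau> z}. ennreal ((norm (grad \<psi> (z + s *\<^sub>R (- e))))\<^sup>2) \<partial>lborel)"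
        by (rule smooth_increment_square[OF \<psi> z(1)])
      also have "\<dots> \<le> ennreal h * (\<integral>\<^sup>+s. ?H z s \<partial>lborel)"
      proof (rule mult_mono)
        show "ennreal (\<tau> z * (norm (- e))\<^sup>2) \<le> ennreal h" using e z by (intro ennreal_leI) simp
        show "(\<integral>\<^sup>+s\<in>{0..\<tau> z}. ennreal ((norm (grad \<psi> (z + s *\<^sub>R (- e))))\<^sup>2) \<partial>lborel) \<le> (\<integral>\<^sup>+s. ?H z s \<partial>lborel)"
        proof (rule nn_integral_mono_AE)
          have "AE s in lborel. s \<noteq> \<tau> z" by (rule AE_lborel_singleton)
          then show "AE s in lborel. ennreal ((norm (grad \<psi> (z + s *\<^sub>R (- e))))\<^sup>2) * indicator {0..\<tau> z} s \<le> ?H z s"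
          proof eventually_elim
            case (elim s)
            then show ?case using down[OF True, of s] z by (auto split: split_indicator)
          qed
        qed
      qed auto
      finally have "ennreal ((\<psi> (z - \<tau> z *\<^sub>R e))\<^sup>2) \<le> ennreal 2 * ennreal ((\<psi> z)\<^sup>2) + ennreal 2 * (ennreal h * (\<integral>\<^sup>+s. ?H z s \<partial>lborel))"
        by (simp add: add_left_mono mult_left_mono)
      moreover have "ennreal 2 * (ennreal h * (\<integral>\<^sup>+s. ?H z s \<partial>lborel)) = ennreal (2 * h) * (\<integral>\<^sup>+s. ?H z s \<partial>lborel)"
        using h by (subst ennreal_mult) (auto simp: mult.assoc)
      ultimately show ?thesis using True z(3) by simp
    qed simp
  qed
  also have "\<dots> = ennreal 2 * (\<integral>\<^sup>+z\<in>\<Omega>. ennreal ((\<psi> z)\<^sup>2) \<partial>lborel) + ennreal (2 * h) * (\<integral>\<^sup>+z. (\<integral>\<^sup>+s. ?H z s \<partial>lborel) \<partial>lborel)"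
    by (subst nn_integral_add) (auto simp: nn_integral_cmult)
  also have "(\<integral>\<^sup>+z. (\<integral>\<^sup>+s. ?H z s \<partial>lborel) \<partial>lborel) = (\<integral>\<^sup>+s. (\<integral>\<^sup>+z. ?H z s \<partial>lborel) \<partial>lborel)"
    by (rule lborel_pair.Fubini'[symmetric]) measurable
  also have "\<dots> = (\<integral>\<^sup>+s. (\<integral>\<^sup>+z. ?G z \<partial>lborel) * indicator {0..h} s \<partial>lborel)"
  proof (rule nn_integral_cong)
    fix s :: real
    have "(\<integral>\<^sup>+z. ?H z s \<partial>lborel) = (\<integral>\<^sup>+z. ?G (z + s *\<^sub>R (- e)) \<partial>lborel) * indicator {0..h} s"
      by (rule nn_integral_multc) measurable
    also have "(\<integral>\<^sup>+z. ?G (z + s *\<^sub>R (- e)) \<partial>lborel) = (\<integral>\<^sup>+z. ?G z \<partial>lborel)"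
      by (rule nn_integral_lborel_translate) measurable
    finally show "(\<integral>\<^sup>+z. ?H z s \<partial>lborel) = (\<integral>\<^sup>+z. ?G z \<partial>lborel) * indicator {0..h} s" .
  qed
  also have "\<dots> = (\<integral>\<^sup>+z. ?G z \<partial>lborel) * ennreal h" using h by (simp add: nn_integral_cmult)
  also have "ennreal 2 * (\<integral>\<^sup>+z\<in>\<Omega>. ennreal ((\<psi> z)\<^sup>2) \<partial>lborel) + ennreal (2 * h) * ((\<integral>\<^sup>+z. ?G z \<partial>lborel) * ennreal h)
     = ennreal (2 * (L2_norm \<Omega> \<psi>)\<^sup>2 + 2 * h\<^sup>2 * (L2_norm \<Omega> (grad \<psi>))\<^sup>2)"
    unfolding smooth_nn_integral_domain[OF \<psi>] using h
    by (simp add: ennreal_mult[symmetric] ennreal_plus[symmetric] power2_eq_square mult_ac del: ennreal_numeral ennreal_plus)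
  finally show ?thesis .
qed

text \<open>
  The sum of the squares has finite integral, so it is finite almost everywhere and its terms tend to zero.
\<close>

lemma AE_tendsto_zero_if_summable:
  fixes f :: "nat \<Rightarrow> 'a \<Rightarrow> real"
  assumes f[measurable]: "\<And>j. f j \<in> borel_measurable M" and A[measurable]: "A \<in> sets M"
    and le: "\<And>j. (\<integral>\<^sup>+x\<in>A. ennreal ((f j x)\<^sup>2) \<partial>M) \<le> ennreal (c j)" and c: "summable c" "\<And>j. 0 \<le> c j"
  shows "AE x in M. x \<in> A \<longrightarrow> (\<lambda>j. f j x) \<longlonglongrightarrow> 0"
proof -
  have "(\<integral>\<^sup>+x. (\<Sum>j. ennreal ((f j x)\<^sup>2) * indicator A x) \<partial>M) = (\<Sum>j. \<integral>\<^sup>+x\<in>A. ennreal ((f j x)\<^sup>2) \<partial>M)"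
    by (rule nn_integral_suminf) measurable
  also have "\<dots> \<le> (\<Sum>j. ennreal (c j))" by (intro suminf_le le) auto
  also have "\<dots> = ennreal (suminf c)" by (intro suminf_ennreal2 c)
  also have "\<dots> < \<infinity>" by simp
  finally have "AE x in M. (\<Sum>j. ennreal ((f j x)\<^sup>2) * indicator A x) \<noteq> \<infinity>"
    by (intro nn_integral_noteq_infinite) auto
  then show ?thesis
  proof eventually_elim
    case (elim x)
    show ?case
    proof
      assume x: "x \<in> A"
      then have "(\<Sum>j. ennreal ((f j x)\<^sup>2)) \<noteq> top" using elim by simp
      then have "summable (\<lambda>j. (f j x)\<^sup>2)" by (intro summable_suminf_not_top) auto
      then have "(\<lambda>j. (f j x)\<^sup>2) \<longlonglongrightarrow> 0" by (rule summable_LIMSEQ_zero)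
      then have "(\<lambda>j. sqrt ((f j x)\<^sup>2)) \<longlonglongrightarrow> sqrt 0" by (rule tendsto_real_sqrt)
      then have "(\<lambda>j. \<bar>f j x\<bar>) \<longlonglongrightarrow> 0" by simp
      then show "(\<lambda>j. f j x) \<longlonglongrightarrow> 0" by (rule tendsto_rabs_zero_cancel)
    qed
  qed
qed

text \<open>
  \<open>measure_of\<close> yields the zero measure unless its argument is countably additive. A set of positive
  measure rules that case out.
\<close>

lemma emeasure_surface_measure:
  fixes B :: "(real^'n::finite) set"
  assumes "emeasure (surface_measure :: (real^'n) measure) A \<noteq> 0" and B: "B \<in> sets borel"
  shows "emeasure surface_measure B = hausdorff_outer (CARD('n) - 1) B"
proof -
  let ?\<mu> = "hausdorff_outer (CARD('n) - 1) :: (real^'n) set \<Rightarrow> ennreal"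
  have S: "(surface_measure :: (real^'n) measure) = measure_of UNIV (sets borel) ?\<mu>"
    by (simp add: surface_measure_def hausdorff_measure_def)
  have sig: "sigma_sets UNIV (sets (borel :: (real^'n) measure)) = sets borel"
    using sets.sigma_sets_eq[of "borel :: (real^'n) measure"] by simp
  have conv: "emeasure (surface_measure :: (real^'n) measure) X
     = (if X \<in> sets borel \<and> measure_space UNIV (sets borel) ?\<mu> then ?\<mu> X else 0)" for X
    unfolding S emeasure_measure_of_conv sig by simp
  have "measure_space UNIV (sets borel) ?\<mu>" using assms(1) conv[of A] by presburger
  then show ?thesis using conv[of B] B by simp
qed

context dirichlet_domain
begin

text \<open>
  The function is a constant \<open>m\<close>. Suppose \<open>m \<noteq> 0\<close>. By the Lindelof property some small piece of \<open>\<Gamma>D\<close> inside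
  one boundary chart has positive surface measure. Approximants \<open>\<phi> j\<close> that converge geometrically
  tend to \<open>0\<close> almost everywhere on that piece, while by \<open>cylinder_trace_estimate\<close> they tend to \<open>m\<close> at the foot of almost every
  ray above it. So the rays above almost all of the piece form a null set, and
  \<open>hausdorff_outer_zero_if_cylinder_negligible\<close> contradicts the positive measure.
\<close>

lemma zero_if_weak_grad_zero:
  assumes conn: "connected \<Omega>" and sub: "\<Gamma>D \<subseteq> frontier \<Omega>" and card: "2 \<le> CARD('n)"
    and pos: "emeasure surface_measure \<Gamma>D \<noteq> 0"
    and v: "v \<in> H1D \<Omega> \<Gamma>D" and g0: "L2_norm \<Omega> (weak_grad \<Omega> v) = 0"
  shows "AE x in lebesgue_on \<Omega>. v x = 0"
proof -
  obtain m where m: "AE x in lebesgue_on \<Omega>. v x = m"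
    using constant_if_weak_grad_zero[OF conn v g0] by blast
  have "m = 0"
  proof (rule ccontr)
    assume m0: "m \<noteq> 0"
    have "\<forall>x\<in>\<Gamma>D. \<exists>r>0. \<exists>e \<tau> L. norm e = 1 \<and> 0 \<le> L \<and> (\<forall>x t. \<tau> (x + t *\<^sub>R e) = \<tau> x + t) \<and>
      (\<forall>x y. \<bar>\<tau> x - \<tau> y\<bar> \<le> L * dist x y) \<and> \<Omega> \<inter> ball x r = {y \<in> ball x r. 0 < \<tau> y}"
    proof
      fix x assume "x \<in> \<Gamma>D"
      then have "x \<in> frontier \<Omega>" using sub by blast
      then obtain r e \<tau> L where R: "0 < r" "norm e = 1" "0 \<le> L" "\<And>x t. \<tau> (x + t *\<^sub>R e) = \<tau> x + t"
        "\<And>x y. \<bar>\<tau> x - \<tau> y\<bar> \<le> L * dist x y" "\<Omega> \<inter> ball x r = {y \<in> ball x r. 0 < \<tau> y}"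
        by (rule boundary_chart[OF lipschitz]) (rule that)
      show "\<exists>r>0. \<exists>e \<tau> L. norm e = 1 \<and> 0 \<le> L \<and> (\<forall>x t. \<tau> (x + t *\<^sub>R e) = \<tau> x + t) \<and>
        (\<forall>x y. \<bar>\<tau> x - \<tau> y\<bar> \<le> L * dist x y) \<and> \<Omega> \<inter> ball x r = {y \<in> ball x r. 0 < \<tau> y}"
        by (intro exI[of _ r] exI[of _ e] exI[of _ \<tau>] exI[of _ L] conjI allI R)
    qed
    from bchoice[OF this] obtain rad where rad: "\<forall>x\<in>\<Gamma>D. 0 < rad x \<and> (\<exists>e \<tau> L. norm e = 1 \<and> 0 \<le> L \<and>
      (\<forall>x t. \<tau> (x + t *\<^sub>R e) = \<tau> x + t) \<and> (\<forall>x y. \<bar>\<tau> x - \<tau> y\<bar> \<le> L * dist x y) \<and>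
      \<Omega> \<inter> ball x (rad x) = {y \<in> ball x (rad x). 0 < \<tau> y})" ..
    have "\<exists>x0\<in>\<Gamma>D. emeasure surface_measure (\<Gamma>D \<inter> ball x0 (rad x0 / 2)) \<noteq> 0"
    proof (rule ccontr)
      assume neg: "\<not> ?thesis"
      obtain F where F: "F \<subseteq> (\<lambda>x. ball x (rad x / 2)) ` \<Gamma>D" "countable F" "\<Union>F = (\<Union>x\<in>\<Gamma>D. ball x (rad x / 2))"
        using Lindelof[of "(\<lambda>x. ball x (rad x / 2)) ` \<Gamma>D"] by auto
      have "(\<Union>X\<in>F. \<Gamma>D \<inter> X) \<in> null_sets surface_measure"
      proof (rule null_sets_UN'[OF F(2)])
        fix X assume "X \<in> F"
        then obtain x where x: "x \<in> \<Gamma>D" "X = ball x (rad x / 2)" using F(1) by blast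
        then show "\<Gamma>D \<inter> X \<in> null_sets surface_measure"
          using neg boundary_part_borel by (intro null_setsI) auto
      qed
      moreover have "\<Gamma>D = (\<Union>X\<in>F. \<Gamma>D \<inter> X)"
      proof
        show "\<Gamma>D \<subseteq> (\<Union>X\<in>F. \<Gamma>D \<inter> X)"
        proof
          fix x assume x: "x \<in> \<Gamma>D"
          then have "x \<in> \<Union>F" using F(3) rad by force
          then show "x \<in> (\<Union>X\<in>F. \<Gamma>D \<inter> X)" using x by blast
        qed
      qed blast
      ultimately show False using pos by auto
    qed
    then obtain x0 where x0: "x0 \<in> \<Gamma>D" and posb: "emeasure surface_measure (\<Gamma>D \<inter> ball x0 (rad x0 / 2)) \<noteq> 0" by blast
    define r where "r = rad x0"
    obtain e \<tau> L where r: "0 < r" and e: "norm e = 1" and L: "0 \<le> L"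
      and shift: "\<And>x t. \<tau> (x + t *\<^sub>R e) = \<tau> x + t"
      and lip: "\<And>x y. \<bar>\<tau> x - \<tau> y\<bar> \<le> L * dist x y"
      and graph: "\<Omega> \<inter> ball x0 r = {y \<in> ball x0 r. 0 < \<tau> y}"
      using bspec[OF rad x0] unfolding r_def by blast
    have cont: "continuous_on UNIV \<tau>" by (rule lipschitz_imp_continuous[OF L lip])
    define h where "h = r / 2"
    have h: "0 < h" using r by (simp add: h_def)
    define \<pi> where "\<pi> z = z - \<tau> z *\<^sub>R e" for z
    have c\<pi>: "continuous_on UNIV \<pi>" unfolding \<pi>_def by (intro continuous_intros cont)
    have shift': "\<tau> (z - t *\<^sub>R e) = \<tau> z - t" for z t using shift[of z "- t"] by simp
    \<comment> \<open>\<open>\<pi> z\<close> is the foot of the ray through \<open>z\<close>, and \<open>D\<close> is the cylinder of height \<open>h\<close> above the piece of boundary in the ball.\<close>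
    define D where "D = {z. 0 < \<tau> z \<and> \<tau> z < h \<and> \<pi> z \<in> ball x0 h}"
    have "open D"
    proof -
      have "D = {z. 0 < \<tau> z} \<inter> {z. \<tau> z < h} \<inter> {z. dist x0 (\<pi> z) < h}" by (auto simp: D_def)
      then show ?thesis
        by (simp add: open_Int open_Collect_less cont continuous_on_const continuous_on_dist c\<pi>)
    qed
    then have Db: "D \<in> sets borel" by (rule borel_open)
    have D\<tau>: "0 < \<tau> z \<and> \<tau> z < h" if "z \<in> D" for z using that by (simp add: D_def)
    have down: "z - t *\<^sub>R e \<in> \<Omega>" if z: "z \<in> D" and t: "0 \<le> t" "t < \<tau> z" for z t
    proof -
      have "z - t *\<^sub>R e = \<pi> z + (\<tau> z - t) *\<^sub>R e" by (simp add: \<pi>_def algebra_simps)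
      then have "dist x0 (z - t *\<^sub>R e) \<le> dist x0 (\<pi> z) + norm ((\<tau> z - t) *\<^sub>R e)"
        using norm_triangle_ineq[of "\<pi> z - x0" "(\<tau> z - t) *\<^sub>R e"] by (simp add: dist_norm norm_minus_commute algebra_simps)
      also have "\<dots> < h + h" using z t e by (simp add: D_def)
      finally have "z - t *\<^sub>R e \<in> ball x0 r" by (simp add: h_def)
      then have "z - t *\<^sub>R e \<in> \<Omega> \<inter> ball x0 r" unfolding graph using t by (simp add: shift')
      then show ?thesis by simp
    qed
    have "\<exists>\<phi>. smooth \<phi> \<and> H1_norm \<Omega> (\<phi> - v) < (1/4)^j \<and>
       (\<integral>\<^sup>+x\<in>\<Gamma>D. ennreal ((\<phi> x)\<^sup>2) \<partial>surface_measure) < ennreal ((1/4)^j)" for j :: nat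
    proof -
      have "0 < (1/4::real)^j" by simp
      then show ?thesis using v unfolding H1D_def zero_trace_iff by blast
    qed
    then have "\<forall>j::nat. \<exists>\<phi>. smooth \<phi> \<and> H1_norm \<Omega> (\<phi> - v) < (1/4)^j \<and>
       (\<integral>\<^sup>+x\<in>\<Gamma>D. ennreal ((\<phi> x)\<^sup>2) \<partial>surface_measure) < ennreal ((1/4)^j)" by blast
    from choice[OF this] obtain \<phi> where \<phi>: "\<And>j. smooth (\<phi> j)" "\<And>j. H1_norm \<Omega> (\<phi> j - v) < (1/4)^j"
       "\<And>j. (\<integral>\<^sup>+x\<in>\<Gamma>D. ennreal ((\<phi> j x)\<^sup>2) \<partial>surface_measure) < ennreal ((1/4)^j)" by blast
    have vH: "v \<in> H1 \<Omega>" using v H1D_subset by blast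
    note \<phi>H = smooth_H1(1)[OF \<phi>(1)]
    define \<psi> where "\<psi> j x = \<phi> j x + - m" for j x
    have \<psi>: "smooth (\<psi> j)" for j unfolding \<psi>_def by (intro smooth_add \<phi> smooth_const)
    have g\<psi>: "grad (\<psi> j) = grad (\<phi> j)" for j
      using grad_add[OF \<phi>(1) smooth_const[of "- m"]] by (auto simp: \<psi>_def[abs_def] grad_const fun_eq_iff)
    have n1: "L2_norm \<Omega> (\<psi> j) \<le> (1/4)^j" for j
    proof -
      have "L2_norm \<Omega> (\<psi> j) = L2_norm \<Omega> (\<phi> j - v)"
      proof (rule L2_norm_cong_AE)
        show "AE x in lebesgue_on \<Omega>. \<psi> j x = (\<phi> j - v) x" using m by eventually_elim (simp add: \<psi>_def)
        show "\<psi> j \<in> L2 \<Omega>" by (rule smooth_L2(1)[OF \<psi> bounded_domain domain_sets(1)])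
        show "\<phi> j - v \<in> L2 \<Omega>" by (rule H1_L2[OF H1_diff(1)[OF \<phi>H vH]])
      qed
      then show ?thesis using L2_le_H1_norm(1)[of "\<phi> j - v"] \<phi>(2)[of j] by linarith
    qed
    have n2: "L2_norm \<Omega> (grad (\<psi> j)) \<le> (1/4)^j" for j
    proof -
      have "\<bar>L2_norm \<Omega> (weak_grad \<Omega> (\<phi> j)) - L2_norm \<Omega> (weak_grad \<Omega> v)\<bar> \<le> L2_norm \<Omega> (weak_grad \<Omega> (\<phi> j - v))"
        using L2.nrm_diff_abs[OF weak_grad(1)[OF \<phi>H] weak_grad(1)[OF vH]] H1_norm_diff[OF \<phi>H vH] by simp
      then show ?thesis
        using L2_le_H1_norm(2)[of "\<phi> j - v"] \<phi>(2)[of j] by (simp add: g0 g\<psi> smooth_weak_grad_norm[OF \<phi>(1)])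
    qed
    have "(\<integral>\<^sup>+z\<in>D. ennreal ((\<psi> j (\<pi> z))\<^sup>2) \<partial>lborel) \<le> ennreal ((2 + 2 * h\<^sup>2) * (1/4)^j)" for j
    proof -
      have sq: "x\<^sup>2 \<le> (1/4)^j" if "0 \<le> x" "x \<le> (1/4)^j" for x :: real
      proof -
        have "x\<^sup>2 \<le> (1/4)^j * (1/4)^j" unfolding power2_eq_square using that by (intro mult_mono) auto
        also have "\<dots> \<le> (1/4)^j * 1" by (intro mult_left_mono power_le_one) auto
        finally show ?thesis by simp
      qed
      have "(\<integral>\<^sup>+z\<in>D. ennreal ((\<psi> j (\<pi> z))\<^sup>2) \<partial>lborel)
         \<le> ennreal (2 * (L2_norm \<Omega> (\<psi> j))\<^sup>2 + 2 * h\<^sup>2 * (L2_norm \<Omega> (grad (\<psi> j)))\<^sup>2)"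
        unfolding \<pi>_def by (rule cylinder_trace_estimate[OF \<psi> e h cont shift Db D\<tau> down])
      also have "\<dots> \<le> ennreal (2 * (1/4)^j + 2 * h\<^sup>2 * (1/4)^j)"
        using sq[OF _ n1] sq[OF _ n2] L2.nrm_nonneg[OF smooth_L2(1)[OF \<psi> bounded_domain domain_sets(1)]]
          L2.nrm_nonneg[OF smooth_L2(2)[OF \<psi> bounded_domain domain_sets(1)]]
        by (intro ennreal_leI add_mono mult_left_mono) auto
      finally show ?thesis by (simp add: distrib_right)
    qed
    moreover have "(\<lambda>z. \<psi> j (\<pi> z)) \<in> borel_measurable lborel" for j
      using continuous_on_compose2[OF smooth_continuous[OF \<psi>, of UNIV] c\<pi>] by (simp add: borel_measurable_continuous_onI)
    ultimately have A1: "AE z in lborel. z \<in> D \<longrightarrow> (\<lambda>j. \<psi> j (\<pi> z)) \<longlonglongrightarrow> 0"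
      using Db by (intro AE_tendsto_zero_if_summable) (auto intro!: summable_mult summable_geometric)
    have m\<phi>: "\<phi> j \<in> borel_measurable surface_measure" for j
      using smooth_borel(1)[OF \<phi>(1)] by (simp cong: measurable_cong_sets)
    have A2: "AE x in surface_measure. x \<in> \<Gamma>D \<longrightarrow> (\<lambda>j. \<phi> j x) \<longlonglongrightarrow> 0"
      using \<phi>(3) boundary_part_borel
      by (intro AE_tendsto_zero_if_summable[where c = "\<lambda>j. (1/4)^j"] m\<phi>) (auto intro!: summable_geometric less_imp_le)
    from AE_E[OF A2] obtain N where N: "{x. \<not> (x \<in> \<Gamma>D \<longrightarrow> (\<lambda>j. \<phi> j x) \<longlonglongrightarrow> 0)} \<subseteq> N" "N \<in> null_sets surface_measure"
      by (auto simp: null_sets_def)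
    define E where "E = \<Gamma>D \<inter> ball x0 h - N"
    have E: "E \<in> sets borel" using N(2) boundary_part_borel by (auto simp: E_def null_sets_def)
    have "emeasure surface_measure E = emeasure surface_measure (\<Gamma>D \<inter> ball x0 h)"
      unfolding E_def using N(2) boundary_part_borel by (intro emeasure_Diff_null_set) auto
    then have Epos: "emeasure surface_measure E \<noteq> 0" using posb by (simp add: h_def r_def)
    have E\<tau>: "\<tau> x = 0" if x: "x \<in> E" for x
    proof -
      have xb: "x \<in> ball x0 r" "x \<in> frontier \<Omega>" using x sub r by (auto simp: E_def h_def)
      have "x \<notin> \<Omega>" using xb(2) open_domain by (simp add: frontier_def interior_open)
      then have "\<not> 0 < \<tau> x" using xb(1) graph by blast
      moreover have "\<not> \<tau> x < 0"
      proof
        assume neg: "\<tau> x < 0"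
        have "open ({y. \<tau> y < 0} \<inter> ball x0 r)"
          by (intro open_Int open_Collect_less cont continuous_on_const) simp
        moreover have "({y. \<tau> y < 0} \<inter> ball x0 r) \<inter> \<Omega> = {}" using graph by force
        ultimately have "({y. \<tau> y < 0} \<inter> ball x0 r) \<inter> closure \<Omega> = {}"
          by (simp add: open_Int_closure_eq_empty)
        then show False using neg xb by (auto simp: frontier_def)
      qed
      ultimately show ?thesis by simp
    qed
    have "negligible {x + t *\<^sub>R e |x t. x \<in> E \<and> 0 < t \<and> t < h}"
    proof -
      from AE_E[OF A1] obtain N' where N': "{z. \<not> (z \<in> D \<longrightarrow> (\<lambda>j. \<psi> j (\<pi> z)) \<longlonglongrightarrow> 0)} \<subseteq> N'" "N' \<in> null_sets lborel"
        by (auto simp: null_sets_def)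
      have "{x + t *\<^sub>R e |x t. x \<in> E \<and> 0 < t \<and> t < h} \<subseteq> N'"
      proof
        fix z assume "z \<in> {x + t *\<^sub>R e |x t. x \<in> E \<and> 0 < t \<and> t < h}"
        then obtain x t where z: "z = x + t *\<^sub>R e" "x \<in> E" "0 < t" "t < h" by blast
        have \<tau>z: "\<tau> z = t" using shift[of x t] E\<tau>[OF z(2)] z(1) by simp
        have \<pi>z: "\<pi> z = x" using \<tau>z z(1) by (simp add: \<pi>_def)
        have zD: "z \<in> D" using z \<tau>z \<pi>z by (auto simp: D_def E_def)
        have "(\<lambda>j. \<phi> j x) \<longlonglongrightarrow> 0" using N(1) z(2) by (auto simp: E_def)
        then have "(\<lambda>j. \<psi> j (\<pi> z)) \<longlonglongrightarrow> 0 + - m"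
          unfolding \<pi>z \<psi>_def by (intro tendsto_add tendsto_const)
        then have "\<not> (\<lambda>j. \<psi> j (\<pi> z)) \<longlonglongrightarrow> 0"
          using m0 LIMSEQ_unique by fastforce
        then show "z \<in> N'" using N'(1) zD by blast
      qed
      moreover have "negligible N'" using N'(2) by (simp add: negligible_iff_null_sets null_sets_completionI)
      ultimately show ?thesis by (rule negligible_subset[rotated])
    qed
    moreover have "\<bar>t - t'\<bar> \<le> L * dist (x + t *\<^sub>R e) (x' + t' *\<^sub>R e)" if "x \<in> E" "x' \<in> E" for x x' t t'
      using lip[of "x + t *\<^sub>R e" "x' + t' *\<^sub>R e"] by (simp add: shift E\<tau> that)
    moreover have "bounded E" by (rule bounded_subset[of "ball x0 h"]) (auto simp: E_def)
    ultimately have "hausdorff_outer (CARD('n) - 1) E = 0"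
      by (intro hausdorff_outer_zero_if_cylinder_negligible[OF card _ h L])
    then show False using Epos emeasure_surface_measure[OF pos E] by simp
  qed
  then show ?thesis using m by simp
qed

end

section \<open>The Poincare inequality and the dual norm\<close>

lemma measurable_matrix_vector_mult:
  fixes A :: "'a \<Rightarrow> real^'n::finite^'m::finite" and G :: "'a \<Rightarrow> real^'n"
  assumes "A \<in> borel_measurable M" "G \<in> borel_measurable M"
  shows "(\<lambda>x. A x *v G x) \<in> borel_measurable M"
proof (rule borel_measurable_continuous_Pair[OF assms])
  show "continuous_on UNIV (\<lambda>x :: (real^'n^'m) \<times> (real^'n). fst x *v snd x)"
    unfolding matrix_vector_mult_def by (intro continuous_intros)
qed

lemma bounded_coefficient:
  fixes b :: "real^'n::finite \<Rightarrow> real^'n" and c :: "real^'n \<Rightarrow> real"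
  assumes "b \<in> Linf \<Omega>" "c \<in> Linf \<Omega>"
  obtains K where "0 \<le> K"
    "\<And>G. G \<in> L2 \<Omega> \<Longrightarrow> (\<lambda>x. b x \<bullet> G x) \<in> L2 \<Omega> \<and> L2_norm \<Omega> (\<lambda>x. b x \<bullet> G x) \<le> K * L2_norm \<Omega> G"
    "\<And>v. v \<in> L2 \<Omega> \<Longrightarrow> (\<lambda>x. v x *\<^sub>R b x) \<in> L2 \<Omega> \<and> L2_norm \<Omega> (\<lambda>x. v x *\<^sub>R b x) \<le> K * L2_norm \<Omega> v"
    "\<And>v. v \<in> L2 \<Omega> \<Longrightarrow> (\<lambda>x. c x * v x) \<in> L2 \<Omega> \<and> L2_norm \<Omega> (\<lambda>x. c x * v x) \<le> K * L2_norm \<Omega> v"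
proof -
  obtain Kb Kc where bd: "AE x in lebesgue_on \<Omega>. norm (b x) \<le> Kb" "AE x in lebesgue_on \<Omega>. norm (c x) \<le> Kc"
    and [measurable]: "b \<in> borel_measurable (lebesgue_on \<Omega>)" "c \<in> borel_measurable (lebesgue_on \<Omega>)"
    using assms by (auto simp: Linf_def)
  define K where "K = max \<bar>Kb\<bar> \<bar>Kc\<bar>"
  have K: "0 \<le> K" by (simp add: K_def)
  have b: "AE x in lebesgue_on \<Omega>. norm (b x) \<le> K" using bd(1) by eventually_elim (simp add: K_def)
  have c: "AE x in lebesgue_on \<Omega>. norm (c x) \<le> K" using bd(2) by eventually_elim (simp add: K_def)
  show thesis
  proof (rule that[OF K])
    fix G :: "real^'n \<Rightarrow> real^'n" assume G: "G \<in> L2 \<Omega>"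
    have [measurable]: "G \<in> borel_measurable (lebesgue_on \<Omega>)" by (rule L2_measurable[OF G])
    have "AE x in lebesgue_on \<Omega>. norm (b x \<bullet> G x) \<le> K * norm (G x)"
      using b by eventually_elim (metis Cauchy_Schwarz_ineq2 mult_right_mono norm_ge_zero order_trans real_norm_def)
    from L2_bound[OF G _ this] show "(\<lambda>x. b x \<bullet> G x) \<in> L2 \<Omega> \<and> L2_norm \<Omega> (\<lambda>x. b x \<bullet> G x) \<le> K * L2_norm \<Omega> G"
      using K by simp
  next
    fix v :: "real^'n \<Rightarrow> real" assume v: "v \<in> L2 \<Omega>"
    have [measurable]: "v \<in> borel_measurable (lebesgue_on \<Omega>)" by (rule L2_measurable[OF v])
    have "AE x in lebesgue_on \<Omega>. norm (v x *\<^sub>R b x) \<le> K * norm (v x)"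
      using b by eventually_elim (simp add: mult_left_mono mult.commute[of K])
    from L2_bound[OF v _ this] show "(\<lambda>x. v x *\<^sub>R b x) \<in> L2 \<Omega> \<and> L2_norm \<Omega> (\<lambda>x. v x *\<^sub>R b x) \<le> K * L2_norm \<Omega> v"
      using K by simp
    have "AE x in lebesgue_on \<Omega>. norm (c x * v x) \<le> K * norm (v x)"
      using c by eventually_elim (simp add: abs_mult mult_right_mono)
    from L2_bound[OF v _ this] show "(\<lambda>x. c x * v x) \<in> L2 \<Omega> \<and> L2_norm \<Omega> (\<lambda>x. c x * v x) \<le> K * L2_norm \<Omega> v"
      using K by simp
  qed
qed

locale poincare_domain = dirichlet_domain \<Omega> \<Gamma>D for \<Omega> \<Gamma>D :: "(real^'n::finite) set" +
  assumes connected_domain: "connected \<Omega>" and dirichlet_part: "\<Gamma>D \<subseteq> frontier \<Omega>"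
    and dimension: "2 \<le> CARD('n)" and dirichlet_part_nonnull: "emeasure surface_measure \<Gamma>D \<noteq> 0"
begin

lemma H1D_H1: "v \<in> H1D \<Omega> \<Gamma>D \<Longrightarrow> v \<in> H1 \<Omega>" using H1D_subset by blast
lemma H1D_L2: "v \<in> H1D \<Omega> \<Gamma>D \<Longrightarrow> v \<in> L2 \<Omega>" by (intro H1_L2 H1D_H1)
lemma H1D_grad: "v \<in> H1D \<Omega> \<Gamma>D \<Longrightarrow> weak_grad \<Omega> v \<in> L2 \<Omega>" by (intro weak_grad H1D_H1)

lemma ae_zero_if_grad_zero:
  assumes "v \<in> H1D \<Omega> \<Gamma>D" "L2_norm \<Omega> (weak_grad \<Omega> v) = 0"
  shows "eq_ae \<Omega> v (\<lambda>_. 0)"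
  unfolding eq_ae_def
  by (rule zero_if_weak_grad_zero[OF connected_domain dirichlet_part dimension dirichlet_part_nonnull assms])

lemma H1_inner_diag: "H1_inner v v = (L2_norm \<Omega> v)\<^sup>2 + (L2_norm \<Omega> (weak_grad \<Omega> v))\<^sup>2"
  by (simp add: H1_inner_def L2_norm_def L2_inner_nonneg)

lemma mean_functional_bounded:
  assumes "mean_sets \<B>" "B \<in> \<B>"
  shows "H1D.bounded_fun (\<lambda>v. L2_inner \<Omega> v (mean_weight B))"
  unfolding H1D.bounded_fun_def
proof (intro conjI exI ballI)
  have B: "mean_weight B \<in> L2 \<Omega>" using assms by (intro mean_weight_L2) (auto simp: mean_sets_def)
  show "lin_fun (H1D \<Omega> \<Gamma>D) (\<lambda>v. L2_inner \<Omega> v (mean_weight B))"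
    using bilinD(1)[OF L2.bilin_ip B] H1D_L2 by (auto simp: lin_fun_def)
  fix v assume v: "v \<in> H1D \<Omega> \<Gamma>D"
  have "\<bar>L2_inner \<Omega> v (mean_weight B)\<bar> \<le> L2_norm \<Omega> v * L2_norm \<Omega> (mean_weight B)"
    by (rule L2.cauchy_schwarz[OF H1D_L2[OF v] B])
  also have "\<dots> \<le> H1_norm \<Omega> v * L2_norm \<Omega> (mean_weight B)"
    by (rule mult_right_mono[OF L2_le_H1_norm(1) L2.nrm_nonneg[OF B]])
  finally show "\<bar>L2_inner \<Omega> v (mean_weight B)\<bar> \<le> L2_norm \<Omega> (mean_weight B) * H1_norm \<Omega> v"
    by (simp add: mult.commute)
qed

text \<open>
  The gradient inner product satisfies a Garding inequality in which the perturbation consists of means, and it is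
  injective because a function in \<open>H1D\<close> with zero gradient vanishes; its inf-sup estimate is the claim.
\<close>

lemma poincare: "\<exists>C>0. \<forall>v\<in>H1D \<Omega> \<Gamma>D. H1_norm \<Omega> v \<le> C * L2_norm \<Omega> (weak_grad \<Omega> v)"
proof -
  let ?\<alpha> = "\<lambda>u v. L2_inner \<Omega> (weak_grad \<Omega> u) (weak_grad \<Omega> v)"
  let ?\<l> = "\<lambda>B v. L2_inner \<Omega> v (mean_weight B)"
  obtain \<B> C where \<B>: "mean_sets \<B>" "0 \<le> C" and est: "\<And>v. v \<in> H1D \<Omega> \<Gamma>D \<Longrightarrow>
    (L2_norm \<Omega> v)\<^sup>2 \<le> C * (\<Sum>B\<in>\<B>. (?\<l> B v)\<^sup>2) + 1 * (L2_norm \<Omega> (weak_grad \<Omega> v))\<^sup>2"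
    using mean_estimate[of 1] zero_less_one by blast
  have cs: "\<bar>?\<alpha> u v\<bar> \<le> L2_norm \<Omega> (weak_grad \<Omega> u) * H1_norm \<Omega> v" if "u \<in> H1D \<Omega> \<Gamma>D" "v \<in> H1D \<Omega> \<Gamma>D" for u v
    by (rule order_trans[OF L2.cauchy_schwarz[OF that[THEN H1D_grad]]])
       (rule mult_left_mono[OF L2_le_H1_norm(2) L2.nrm_nonneg[OF H1D_grad[OF that(1)]]])
  have "garding (H1D \<Omega> \<Gamma>D) H1_inner ?\<alpha> 1 (1/2) C \<B> ?\<l>"
  proof (rule garding.intro[OF H1D.semi_hilbert_axioms], unfold_locales)
    show "bilin (H1D \<Omega> \<Gamma>D) ?\<alpha>" by (rule bilin_subset[OF grad_inner_bilin H1D_subset])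
    show "finite \<B>" using \<B>(1) by (simp add: mean_sets_def)
    show "semi_inner.bounded_fun (H1D \<Omega> \<Gamma>D) H1_inner (?\<l> B)" if "B \<in> \<B>" for B
      using mean_functional_bounded[OF \<B>(1) that] .
    show "\<bar>?\<alpha> u v\<bar> \<le> 1 * semi_inner.nrm H1_inner u * semi_inner.nrm H1_inner v"
      if "u \<in> H1D \<Omega> \<Gamma>D" "v \<in> H1D \<Omega> \<Gamma>D" for u v
      using order_trans[OF cs[OF that] mult_right_mono[OF L2_le_H1_norm(2) H1D.nrm_nonneg[OF that(2)]]]
      by (simp add: H1_nrm)
    show "1/2 * H1_inner u u \<le> ?\<alpha> u u + C * (\<Sum>B\<in>\<B>. (?\<l> B u)\<^sup>2)" if "u \<in> H1D \<Omega> \<Gamma>D" for u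
    proof -
      have "0 \<le> C * (\<Sum>B\<in>\<B>. (?\<l> B u)\<^sup>2)" using \<B>(2) by (intro mult_nonneg_nonneg sum_nonneg) auto
      moreover have "?\<alpha> u u = (L2_norm \<Omega> (weak_grad \<Omega> u))\<^sup>2" by (simp add: L2_norm_def L2_inner_nonneg)
      ultimately show ?thesis using est[OF that] by (simp add: H1_inner_diag)
    qed
  qed (use \<B>(2) in auto)
  then interpret G: garding "H1D \<Omega> \<Gamma>D" H1_inner ?\<alpha> 1 "1/2" C \<B> ?\<l> .
  have "\<exists>K>0. \<forall>u\<in>H1D \<Omega> \<Gamma>D. \<forall>B\<ge>0. (\<forall>w\<in>H1D \<Omega> \<Gamma>D. ?\<alpha> u w \<le> B * semi_inner.nrm H1_inner w) \<longrightarrow>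
      semi_inner.nrm H1_inner u \<le> K * B"
  proof (rule G.inf_sup)
    fix u assume u: "u \<in> H1D \<Omega> \<Gamma>D" and 0: "\<And>v. v \<in> H1D \<Omega> \<Gamma>D \<Longrightarrow> ?\<alpha> u v = 0"
    have g0: "L2_norm \<Omega> (weak_grad \<Omega> u) = 0" using 0[OF u] by (simp add: L2_norm_def)
    then have "L2_norm \<Omega> u = 0"
      using ae_zero_if_grad_zero[OF u g0] L2_norm_eq_0_iff[OF H1D_L2[OF u]] by (simp add: eq_ae_def)
    then show "H1_inner u u = 0" using g0 by (simp add: H1_inner_diag)
  qed
  then obtain K where K: "0 < K" "\<And>u B. u \<in> H1D \<Omega> \<Gamma>D \<Longrightarrow> 0 \<le> B \<Longrightarrow>
      (\<And>w. w \<in> H1D \<Omega> \<Gamma>D \<Longrightarrow> ?\<alpha> u w \<le> B * H1_norm \<Omega> w) \<Longrightarrow> H1_norm \<Omega> u \<le> K * B"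
    by (auto simp: H1_nrm)
  have "H1_norm \<Omega> u \<le> K * L2_norm \<Omega> (weak_grad \<Omega> u)" if u: "u \<in> H1D \<Omega> \<Gamma>D" for u
    by (rule K(2)[OF u L2.nrm_nonneg[OF H1D_grad[OF u]]]) (rule order_trans[OF abs_ge_self cs[OF u]])
  then show ?thesis using K(1) by blast
qed

text \<open>
  \<open>dual_norm\<close> is a conditional supremum, and the Poincare inequality bounds the quotients. The absolute value covers a
  space \<open>H1D\<close> without nonzero elements, where the supremum is taken over the empty set and is unspecified.
\<close>

lemma dual_norm_bound:
  assumes f: "f \<in> L2 \<Omega>" and w: "w \<in> H1D \<Omega> \<Gamma>D"
  shows "L2_inner \<Omega> f w \<le> \<bar>dual_norm \<Omega> \<Gamma>D (L2_functional \<Omega> f)\<bar> * L2_norm \<Omega> (weak_grad \<Omega> w)"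
proof (cases "eq_ae \<Omega> w (\<lambda>_. 0)")
  case True
  then have "L2_inner \<Omega> f w = L2_inner \<Omega> f (\<lambda>_. 0)"
    by (intro L2_inner_cong_AE f H1D_L2 w L2_zero) (auto simp: eq_ae_def)
  then show ?thesis using L2.nrm_nonneg[OF H1D_grad[OF w]] by (simp add: L2_inner_def)
next
  case False
  let ?S = "{w \<in> H1D \<Omega> \<Gamma>D. \<not> eq_ae \<Omega> w (\<lambda>_. 0)}"
  have pos: "0 < L2_norm \<Omega> (weak_grad \<Omega> v)" if "v \<in> ?S" for v
    using that ae_zero_if_grad_zero[of v] L2.nrm_nonneg[OF H1D_grad, of v] by fastforce
  obtain C where C: "0 < C" "\<And>v. v \<in> H1D \<Omega> \<Gamma>D \<Longrightarrow> H1_norm \<Omega> v \<le> C * L2_norm \<Omega> (weak_grad \<Omega> v)"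
    using poincare by blast
  have "bdd_above ((\<lambda>w. L2_functional \<Omega> f w / L2_norm \<Omega> (weak_grad \<Omega> w)) ` ?S)"
  proof (rule bdd_aboveI2)
    fix v assume v: "v \<in> ?S"
    then have vD: "v \<in> H1D \<Omega> \<Gamma>D" by simp
    have "L2_inner \<Omega> f v \<le> L2_norm \<Omega> f * L2_norm \<Omega> v"
      using L2.cauchy_schwarz[OF f H1D_L2[OF vD]] by simp
    also have "\<dots> \<le> L2_norm \<Omega> f * (C * L2_norm \<Omega> (weak_grad \<Omega> v))"
      by (rule mult_left_mono[OF order_trans[OF L2_le_H1_norm(1) C(2)[OF vD]] L2.nrm_nonneg[OF f]])
    finally show "L2_functional \<Omega> f v / L2_norm \<Omega> (weak_grad \<Omega> v) \<le> L2_norm \<Omega> f * C"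
      using pos[OF v] by (simp add: L2_functional_def divide_le_eq mult.assoc)
  qed
  then have "L2_functional \<Omega> f w / L2_norm \<Omega> (weak_grad \<Omega> w) \<le> dual_norm \<Omega> \<Gamma>D (L2_functional \<Omega> f)"
    unfolding dual_norm_def by (rule cSUP_upper2) (use False w in auto)
  then have "L2_inner \<Omega> f w \<le> dual_norm \<Omega> \<Gamma>D (L2_functional \<Omega> f) * L2_norm \<Omega> (weak_grad \<Omega> w)"
    using pos[of w] False w by (simp add: L2_functional_def divide_le_eq)
  also have "\<dots> \<le> \<bar>dual_norm \<Omega> \<Gamma>D (L2_functional \<Omega> f)\<bar> * L2_norm \<Omega> (weak_grad \<Omega> w)"
    by (rule mult_right_mono[OF abs_ge_self L2.nrm_nonneg[OF H1D_grad[OF w]]])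
  finally show ?thesis .
qed

end

section \<open>Square roots of positive definite matrices\<close>

lemma symmetric_matrix_inner:
  fixes M :: "real^'n::finite^'n"
  assumes "transpose M = M"
  shows "(M *v x) \<bullet> y = x \<bullet> (M *v y)"
  using dot_lmul_matrix[of x M y] assms by (metis transpose_matrix_vector)

lemma symmetric_matrix_if_inner:
  fixes M :: "real^'n::finite^'n"
  assumes "\<And>x y. (M *v x) \<bullet> y = x \<bullet> (M *v y)"
  shows "transpose M = M"
proof -
  have "(transpose M *v x) \<bullet> y = (M *v x) \<bullet> y" for x y
    by (metis assms dot_lmul_matrix transpose_matrix_vector)
  then have "transpose M *v x = M *v x" for x by (metis vector_eq_rdot)
  then show ?thesis by (simp add: matrix_eq)
qed

text \<open>
  Cauchy-Schwarz for the semi-inner product \<open>u \<bullet> (M *v v)\<close>, applied to \<open>M *v y\<close> and \<open>y\<close>.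
\<close>

lemma psd_matrix_bound:
  fixes M :: "real^'n::finite^'n"
  assumes sym: "transpose M = M" and psd: "\<And>y. 0 \<le> y \<bullet> (M *v y)" and le: "\<And>y. y \<bullet> (M *v y) \<le> L * (y \<bullet> y)"
  shows "norm (M *v y) \<le> L * norm y"
proof -
  interpret semi_inner "UNIV :: (real^'n) set" "\<lambda>u v. u \<bullet> (M *v v)"
  proof
    show "bilin UNIV (\<lambda>u v. u \<bullet> (M *v v))"
      by (simp add: bilin_def lin_fun_def inner_add_left inner_add_right matrix_vector_right_distrib
          matrix_vector_mult_scaleR)
    show "u \<bullet> (M *v v) = v \<bullet> (M *v u)" for u v
      using symmetric_matrix_inner[OF sym, of v u] by (simp add: inner_commute)
  qed (use psd in auto)
  have nrm_le: "(nrm y)\<^sup>2 \<le> L * (norm y)\<^sup>2" for y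
    using le[of y] by (simp add: nrm_sq power2_norm_eq_inner)
  have L: "0 \<le> L"
    using order_trans[OF psd le, of "axis undefined 1"] by (simp add: inner_axis_axis)
  have "(norm (M *v y))\<^sup>2 = (M *v y) \<bullet> (M *v y)" by (simp add: power2_norm_eq_inner)
  also have "\<dots> \<le> nrm (M *v y) * nrm y" using cauchy_schwarz[of "M *v y" y] by simp
  also have "\<dots> \<le> sqrt (L * (norm (M *v y))\<^sup>2) * sqrt (L * (norm y)\<^sup>2)"
    by (intro mult_mono real_le_rsqrt nrm_le) (use L in simp_all)
  also have "\<dots> = (norm (M *v y)) * (L * norm y)"
    using L by (simp add: real_sqrt_mult)
  finally have "norm (M *v y) * norm (M *v y) \<le> norm (M *v y) * (L * norm y)" by (simp add: power2_eq_square)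
  then show ?thesis
    using L by (cases "norm (M *v y) = 0") auto
qed

text \<open>
  After scaling, \<open>M = \<Lambda>1 (1 - N)\<close> with \<open>N\<close> symmetric of norm at most \<open>\<theta> < 1\<close>. A root of \<open>1 - N\<close> of the form \<open>1 - Y\<close> amounts to
  \<open>Y = (N + Y\<^sup>2) / 2\<close>, a contraction on symmetric operators of norm at most \<open>r = 1 - sqrt (1 - \<theta>)\<close>, because \<open>r\<close> solves
  \<open>\<theta> + r\<^sup>2 = 2 r\<close>.
\<close>

lemma symmetric_positive_sqrt_exists:
  fixes M :: "real^'n::finite^'n"
  assumes sym: "transpose M = M" and \<Lambda>: "0 < \<Lambda>0" "\<Lambda>0 \<le> \<Lambda>1"
    and bounds: "\<And>y. \<Lambda>0 * (y \<bullet> y) \<le> y \<bullet> (M *v y)" "\<And>y. y \<bullet> (M *v y) \<le> \<Lambda>1 * (y \<bullet> y)"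
  shows "\<exists>B. transpose B = B \<and> (\<forall>y. 0 \<le> y \<bullet> (B *v y)) \<and> B ** B = M"
proof -
  define N where "N = mat 1 - (1 / \<Lambda>1) *\<^sub>R M"
  have Nv: "N *v x = x - (1 / \<Lambda>1) *\<^sub>R (M *v x)" for x
    by (simp add: N_def matrix_vector_mult_diff_rdistrib scaleR_matrix_vector_assoc)
  define \<theta> where "\<theta> = 1 - \<Lambda>0 / \<Lambda>1"
  have \<theta>: "0 \<le> \<theta>" "\<theta> < 1" using \<Lambda> by (auto simp: \<theta>_def)
  have Nsym: "(N *v x) \<bullet> y = x \<bullet> (N *v y)" for x y
    using symmetric_matrix_inner[OF sym] by (simp add: Nv inner_diff_left inner_diff_right)
  have Nnorm: "norm (N *v y) \<le> \<theta> * norm y" for y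
  proof (rule psd_matrix_bound)
    show "transpose N = N" by (rule symmetric_matrix_if_inner[OF Nsym])
    show "0 \<le> y \<bullet> (N *v y)" for y
      using bounds(2)[of y] \<Lambda> by (simp add: Nv inner_diff_right field_simps)
    show "y \<bullet> (N *v y) \<le> \<theta> * (y \<bullet> y)" for y
      using bounds(1)[of y] \<Lambda> by (simp add: Nv inner_diff_right \<theta>_def field_simps)
  qed
  define E where "E = Blinfun ((*v) N)"
  have E: "blinfun_apply E x = N *v x" for x
    unfolding E_def by (simp add: bounded_linear_Blinfun_apply)
  have Enorm: "norm E \<le> \<theta>"
    by (rule norm_blinfun_bound) (use \<theta> Nnorm in \<open>auto simp: E\<close>)
  define r where "r = 1 - sqrt (1 - \<theta>)"
  have r: "0 \<le> r" "r < 1" "\<theta> + r\<^sup>2 = 2 * r"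
  proof -
    have "(sqrt (1 - \<theta>))\<^sup>2 = 1 - \<theta>" using \<theta> by simp
    then show "\<theta> + r\<^sup>2 = 2 * r" by (simp add: r_def power2_diff)
    show "0 \<le> r" "r < 1" using \<theta> by (auto simp: r_def)
  qed
  define S where "S = {Y :: (real^'n) \<Rightarrow>\<^sub>L (real^'n). norm Y \<le> r \<and> (\<forall>x y. blinfun_apply Y x \<bullet> y = x \<bullet> blinfun_apply Y y)}"
  define f where "f Y = (1/2) *\<^sub>R (E + (Y o\<^sub>L Y))" for Y
  have "\<exists>!Y. Y \<in> S \<and> f Y = Y"
  proof (rule Banach_fix)
    have "S = {Y. norm Y \<le> r} \<inter> (\<Inter>x. \<Inter>y. {Y. blinfun_apply Y x \<bullet> y = x \<bullet> blinfun_apply Y y})"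
      by (auto simp: S_def)
    moreover have "closed {Y :: (real^'n) \<Rightarrow>\<^sub>L (real^'n). norm Y \<le> r}"
      by (intro closed_Collect_le continuous_intros)
    moreover have "closed {Y :: (real^'n) \<Rightarrow>\<^sub>L (real^'n). blinfun_apply Y x \<bullet> y = x \<bullet> blinfun_apply Y y}" for x y
      by (intro closed_Collect_eq continuous_intros)
    ultimately have "closed S" by (auto intro!: closed_Int closed_INT)
    then show "complete S" by (simp add: complete_eq_closed)
    show "S \<noteq> {}" using r(1) by (auto simp: S_def intro!: exI[of _ 0])
    show "0 \<le> r" "r < 1" by (fact r)+
    show "f ` S \<subseteq> S"
    proof safe
      fix Y assume Y: "Y \<in> S"
      have "norm (Y o\<^sub>L Y) \<le> r * r"
        using norm_blinfun_compose[of Y Y] Y mult_mono[of "norm Y" r "norm Y" r] r(1) by (auto simp: S_def)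
      then have "norm (f Y) \<le> (1/2) * (\<theta> + r\<^sup>2)"
        using order_trans[OF norm_triangle_ineq[of E "Y o\<^sub>L Y"] add_mono[OF Enorm]] by (simp add: f_def power2_eq_square)
      then have "norm (f Y) \<le> r" using r(3) by simp
      then show "f Y \<in> S"
        using Y Nsym by (auto simp: S_def f_def E blinfun.add_left blinfun.scaleR_left inner_add_left inner_add_right)
    qed
    fix Y Z assume YZ: "Y \<in> S" "Z \<in> S"
    have "f Y - f Z = (1/2) *\<^sub>R ((Y o\<^sub>L (Y - Z)) + ((Y - Z) o\<^sub>L Z))"
      by (rule blinfun_eqI) (simp add: f_def blinfun.add_left blinfun.diff_left blinfun.scaleR_left blinfun.diff_right algebra_simps)
    then have "norm (f Y - f Z) \<le> (1/2) * (norm (Y o\<^sub>L (Y - Z)) + norm ((Y - Z) o\<^sub>L Z))"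
      using norm_triangle_ineq[of "Y o\<^sub>L (Y - Z)" "(Y - Z) o\<^sub>L Z"] by simp
    also have "\<dots> \<le> (1/2) * (r * norm (Y - Z) + norm (Y - Z) * r)"
    proof -
      have "norm (Y o\<^sub>L (Y - Z)) \<le> r * norm (Y - Z)"
        using YZ by (intro order_trans[OF norm_blinfun_compose] mult_right_mono) (auto simp: S_def)
      moreover have "norm ((Y - Z) o\<^sub>L Z) \<le> norm (Y - Z) * r"
        using YZ by (intro order_trans[OF norm_blinfun_compose] mult_left_mono) (auto simp: S_def)
      ultimately show ?thesis by (simp add: mult.commute[of _ r])
    qed
    finally show "dist (f Y) (f Z) \<le> r * dist Y Z" by (simp add: dist_norm mult.commute)
  qed
  then obtain Y where Y: "norm Y \<le> r" "\<And>x y. blinfun_apply Y x \<bullet> y = x \<bullet> blinfun_apply Y y" and fp: "f Y = Y"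
    by (auto simp: S_def)
  have YY: "blinfun_apply Y (blinfun_apply Y x) = 2 *\<^sub>R blinfun_apply Y x - N *v x" for x
  proof -
    have "2 *\<^sub>R blinfun_apply Y x = 2 *\<^sub>R blinfun_apply (f Y) x" by (simp only: fp)
    also have "\<dots> = N *v x + blinfun_apply Y (blinfun_apply Y x)"
      by (simp add: f_def E blinfun.add_left blinfun.scaleR_left)
    finally show ?thesis by simp
  qed
  define g where "g x = sqrt \<Lambda>1 *\<^sub>R (x - blinfun_apply Y x)" for x
  define B where "B = matrix g"
  have "linear g"
    by (rule linearI) (simp_all add: g_def blinfun.add_right blinfun.scaleR_right algebra_simps)
  then have B: "B *v x = g x" for x by (simp add: B_def matrix_works)
  have "transpose B = B"
    by (rule symmetric_matrix_if_inner) (simp add: B g_def inner_diff_left inner_diff_right Y(2))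
  moreover have "0 \<le> y \<bullet> (B *v y)" for y
  proof -
    have "\<bar>y \<bullet> blinfun_apply Y y\<bar> \<le> norm y * norm (blinfun_apply Y y)" by (rule Cauchy_Schwarz_ineq2)
    also have "\<dots> \<le> norm y * (1 * norm y)"
      using norm_blinfun[of Y y] Y(1) r(2) by (intro mult_left_mono order_trans[OF norm_blinfun] mult_right_mono) auto
    also have "\<dots> = y \<bullet> y" by (simp add: dot_square_norm power2_eq_square)
    finally show ?thesis using \<Lambda> by (simp add: B g_def inner_diff_right)
  qed
  moreover have "B ** B = M"
  proof -
    have "B *v (B *v x) = M *v x" for x
    proof -
      have "B *v (B *v x) = \<Lambda>1 *\<^sub>R ((x - blinfun_apply Y x) - blinfun_apply Y (x - blinfun_apply Y x))"
        using \<Lambda> by (simp add: B g_def blinfun.scaleR_right flip: scaleR_diff_right)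
      also have "\<dots> = \<Lambda>1 *\<^sub>R (x - N *v x)"
        by (simp add: blinfun.diff_right YY algebra_simps scaleR_2)
      finally show ?thesis using \<Lambda> by (simp add: Nv)
    qed
    then show ?thesis by (simp add: matrix_eq matrix_vector_mul_assoc)
  qed
  ultimately show ?thesis by blast
qed

text \<open>
  Cauchy-Schwarz for the semi-inner product \<open>u \<bullet> (B *v v)\<close> gives \<open>B *v y = 0\<close>, hence \<open>M *v y = 0\<close>.
\<close>

lemma psd_square_root_definite:
  fixes B :: "real^'n::finite^'n"
  assumes B: "transpose B = B" "\<And>y. 0 \<le> y \<bullet> (B *v y)" and M: "B ** B = M"
    and pos: "0 < \<Lambda>0" "\<And>y. \<Lambda>0 * (y \<bullet> y) \<le> y \<bullet> (M *v y)" and zero: "y \<bullet> (B *v y) = 0"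
  shows "y = 0"
proof -
  interpret semi_inner "UNIV :: (real^'n) set" "\<lambda>u v. u \<bullet> (B *v v)"
  proof
    show "bilin UNIV (\<lambda>u v. u \<bullet> (B *v v))"
      by (simp add: bilin_def lin_fun_def inner_add_left inner_add_right matrix_vector_right_distrib
          matrix_vector_mult_scaleR)
    show "u \<bullet> (B *v v) = v \<bullet> (B *v u)" for u v
      using symmetric_matrix_inner[OF B(1), of v u] by (simp add: inner_commute)
  qed (use B(2) in auto)
  have "(B *v y) \<bullet> (B *v y) \<le> 0"
    using cauchy_schwarz[of "B *v y" y] zero by (simp add: nrm_def)
  then have "B *v y = 0" by (metis inner_ge_zero inner_eq_zero_iff antisym)
  then have "M *v y = 0" by (simp add: M[symmetric] matrix_vector_mul_assoc[symmetric])
  then have "\<Lambda>0 * (y \<bullet> y) \<le> 0" using pos(2)[of y] by simp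
  then have "y \<bullet> y \<le> 0" using pos(1) by (simp add: mult_le_0_iff)
  then show ?thesis by (metis inner_ge_zero inner_eq_zero_iff antisym)
qed

text \<open>
  For \<open>D = B - C\<close> one has \<open>B D + D C = B\<^sup>2 - C\<^sup>2 = 0\<close>. Multiplying by \<open>D\<close> and taking the trace gives
  \<open>tr (D B D) + tr (D C D) = 0\<close>; both terms are nonnegative, and \<open>tr (D B D) = 0\<close> with \<open>B\<close> definite
  forces \<open>D = 0\<close>.
\<close>

lemma symmetric_positive_sqrt_unique:
  fixes B C :: "real^'n::finite^'n"
  assumes B: "transpose B = B" "\<And>y. 0 \<le> y \<bullet> (B *v y)" "B ** B = M"
    and C: "transpose C = C" "\<And>y. 0 \<le> y \<bullet> (C *v y)" "C ** C = M"
    and pos: "0 < \<Lambda>0" "\<And>y. \<Lambda>0 * (y \<bullet> y) \<le> y \<bullet> (M *v y)"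
  shows "B = C"
proof -
  define D where "D = B - C"
  have Dsym: "transpose D = D" using B(1) C(1) by (simp add: D_def transpose_def vec_eq_iff)
  have sylv: "B ** D + D ** C = 0"
    using B(3) C(3) by (simp add: D_def matrix_eq algebra_simps flip: matrix_vector_mul_assoc)
  have tr: "trace (D ** (X ** D)) = (\<Sum>i\<in>UNIV. (D *v axis i 1) \<bullet> (X *v (D *v axis i 1)))" for X :: "real^'n^'n"
  proof -
    have "(D ** (X ** D)) $ i $ i = (D *v axis i 1) \<bullet> (X *v (D *v axis i 1))" for i
    proof -
      have "(D ** (X ** D)) $ i $ i = axis i 1 \<bullet> ((D ** (X ** D)) *v axis i 1)"
        by (simp add: matrix_vector_mul_component inner_axis' matrix_vector_mult_basis column_def)
      also have "\<dots> = axis i 1 \<bullet> (D *v (X *v (D *v axis i 1)))" by (simp add: matrix_vector_mul_assoc matrix_mul_assoc)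
      also have "\<dots> = (D *v axis i 1) \<bullet> (X *v (D *v axis i 1))" by (simp add: symmetric_matrix_inner[OF Dsym])
      finally show ?thesis .
    qed
    then show ?thesis by (simp add: trace_def)
  qed
  have "trace (D ** (B ** D)) + trace (D ** (C ** D)) = trace (D ** (B ** D)) + trace (D ** (D ** C))"
    using trace_mul_sym[of "D ** C" D] by (simp add: matrix_mul_assoc)
  also have "\<dots> = trace (D ** (B ** D + D ** C))" by (simp add: matrix_add_ldistrib trace_add)
  also have "\<dots> = 0" by (simp only: sylv) (simp add: trace_def matrix_matrix_mult_def)
  finally have "trace (D ** (B ** D)) + trace (D ** (C ** D)) = 0" .
  moreover have "0 \<le> trace (D ** (C ** D))" unfolding tr by (intro sum_nonneg C(2))
  moreover have "0 \<le> trace (D ** (B ** D))" unfolding tr by (intro sum_nonneg B(2))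
  ultimately have "(\<Sum>i\<in>UNIV. (D *v axis i 1) \<bullet> (B *v (D *v axis i 1))) = 0" unfolding tr by linarith
  then have "(D *v axis i 1) \<bullet> (B *v (D *v axis i 1)) = 0" for i
    using B(2) by (subst (asm) sum_nonneg_eq_0_iff) auto
  then have "D *v axis i 1 = 0" for i
    by (rule psd_square_root_definite[OF B pos])
  then have "column i D = 0" for i by (simp add: matrix_vector_mult_basis)
  then have "D = 0" by (simp add: column_def vec_eq_iff)
  then show ?thesis by (simp add: D_def)
qed

lemma matrix_sqrt:
  fixes M :: "real^'n::finite^'n"
  assumes sym: "transpose M = M" and \<Lambda>: "0 < \<Lambda>0" "\<Lambda>0 \<le> \<Lambda>1"
    and bounds: "\<And>y. \<Lambda>0 * (y \<bullet> y) \<le> y \<bullet> (M *v y)" "\<And>y. y \<bullet> (M *v y) \<le> \<Lambda>1 * (y \<bullet> y)"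
  shows "transpose (matrix_sqrt M) = matrix_sqrt M" "matrix_sqrt M ** matrix_sqrt M = M" "invertible (matrix_sqrt M)"
proof -
  let ?P = "\<lambda>B. transpose B = B \<and> (\<forall>y. 0 \<le> y \<bullet> (B *v y)) \<and> B ** B = M"
  have "\<exists>!B. ?P B"
    using symmetric_positive_sqrt_exists[OF assms] symmetric_positive_sqrt_unique[OF _ _ _ _ _ _ \<Lambda>(1) bounds(1)] by blast
  then have P: "?P (matrix_sqrt M)" unfolding matrix_sqrt_def by (rule theI')
  then show "transpose (matrix_sqrt M) = matrix_sqrt M" "matrix_sqrt M ** matrix_sqrt M = M" by auto
  have "matrix_sqrt M *v y = 0 \<Longrightarrow> y = 0" for y
    using psd_square_root_definite[of "matrix_sqrt M" M \<Lambda>0 y] P \<Lambda>(1) bounds(1) by simp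
  then show "invertible (matrix_sqrt M)"
    by (metis invertible_left_inverse matrix_left_invertible_ker)
qed

section \<open>The bilinear form of the elliptic problem\<close>

locale elliptic_problem = poincare_domain \<Omega> \<Gamma>D for \<Omega> \<Gamma>D :: "(real^'n::finite) set" +
  fixes A :: "real^'n \<Rightarrow> real^'n^'n" and b :: "real^'n \<Rightarrow> real^'n" and c :: "real^'n \<Rightarrow> real"
    and \<Lambda>0 \<Lambda>1 :: real
  assumes A_Linf: "A \<in> Linf \<Omega>" and A_symmetric: "AE x in lebesgue_on \<Omega>. transpose (A x) = A x"
    and ellipticity: "0 < \<Lambda>0" "\<Lambda>0 \<le> \<Lambda>1"
      "AE x in lebesgue_on \<Omega>. \<forall>y. \<Lambda>0 * (y \<bullet> y) \<le> y \<bullet> (A x *v y) \<and> y \<bullet> (A x *v y) \<le> \<Lambda>1 * (y \<bullet> y)"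
    and b_Linf: "b \<in> Linf \<Omega>" and c_Linf: "c \<in> Linf \<Omega>"
begin

lemma A_measurable [measurable]: "A \<in> borel_measurable (lebesgue_on \<Omega>)"
  using A_Linf by (simp add: Linf_def)

lemma A_bound: "AE x in lebesgue_on \<Omega>. \<forall>y. norm (A x *v y) \<le> \<Lambda>1 * norm y"
  using A_symmetric ellipticity(3)
proof eventually_elim
  case (elim x)
  have "0 \<le> y \<bullet> (A x *v y)" for y
    by (rule order_trans[of _ "\<Lambda>0 * (y \<bullet> y)"]) (use elim(2) ellipticity(1) in auto)
  then show ?case using psd_matrix_bound[OF elim(1), of \<Lambda>1] elim(2) by blast
qed

lemma A_L2:
  assumes "G \<in> L2 \<Omega>"
  shows "(\<lambda>x. A x *v G x) \<in> L2 \<Omega>" "L2_norm \<Omega> (\<lambda>x. A x *v G x) \<le> \<Lambda>1 * L2_norm \<Omega> G"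
proof -
  have m: "(\<lambda>x. A x *v G x) \<in> borel_measurable (lebesgue_on \<Omega>)"
    by (rule measurable_matrix_vector_mult[OF A_measurable L2_measurable[OF assms]])
  have "AE x in lebesgue_on \<Omega>. norm (A x *v G x) \<le> \<Lambda>1 * norm (G x)" using A_bound by eventually_elim blast
  from L2_bound[OF assms m this] show "(\<lambda>x. A x *v G x) \<in> L2 \<Omega>"
    "L2_norm \<Omega> (\<lambda>x. A x *v G x) \<le> \<Lambda>1 * L2_norm \<Omega> G" using ellipticity(1,2) by auto
qed

lemma A_inner_symmetric:
  assumes "G \<in> L2 \<Omega>" "H \<in> L2 \<Omega>"
  shows "L2_inner \<Omega> (\<lambda>x. A x *v G x) H = L2_inner \<Omega> G (\<lambda>x. A x *v H x)"
  unfolding L2_inner_def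
proof (rule integral_cong_AE)
  show "AE x in lebesgue_on \<Omega>. (A x *v G x) \<bullet> H x = G x \<bullet> (A x *v H x)"
    using A_symmetric by eventually_elim (simp add: symmetric_matrix_inner)
qed (rule borel_measurable_inner[OF L2_measurable L2_measurable], use assms A_L2(1) in auto)+

lemma A_coercive:
  assumes "G \<in> L2 \<Omega>"
  shows "\<Lambda>0 * (L2_norm \<Omega> G)\<^sup>2 \<le> L2_inner \<Omega> (\<lambda>x. A x *v G x) G"
proof -
  have "\<Lambda>0 * (L2_norm \<Omega> G)\<^sup>2 = (LINT x|lebesgue_on \<Omega>. \<Lambda>0 * (G x \<bullet> G x))"
    using L2_inner_nonneg[of \<Omega> G] by (simp add: L2_norm_def) (simp add: L2_inner_def)
  also have "\<dots> \<le> L2_inner \<Omega> (\<lambda>x. A x *v G x) G"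
    unfolding L2_inner_def
  proof (rule integral_mono_AE)
    show "AE x in lebesgue_on \<Omega>. \<Lambda>0 * (G x \<bullet> G x) \<le> (A x *v G x) \<bullet> G x"
      using ellipticity(3) by eventually_elim (simp add: inner_commute)
  qed (use L2_inner_integrable assms A_L2 in auto)
  finally show ?thesis .
qed

lemma lower_order_L2:
  assumes "v \<in> H1D \<Omega> \<Gamma>D"
  shows "lower_order \<Omega> b c v \<in> L2 \<Omega>"
proof -
  obtain K where K: "\<And>G. G \<in> L2 \<Omega> \<Longrightarrow> (\<lambda>x. b x \<bullet> G x) \<in> L2 \<Omega> \<and> L2_norm \<Omega> (\<lambda>x. b x \<bullet> G x) \<le> K * L2_norm \<Omega> G"
    "\<And>v. v \<in> L2 \<Omega> \<Longrightarrow> (\<lambda>x. c x * v x) \<in> L2 \<Omega> \<and> L2_norm \<Omega> (\<lambda>x. c x * v x) \<le> K * L2_norm \<Omega> v"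
    by (rule bounded_coefficient[OF b_Linf c_Linf]) (rule that)
  show ?thesis unfolding lower_order_def
    using L2_add K(1)[OF H1D_grad[OF assms]] K(2)[OF H1D_L2[OF assms]] by blast
qed

lemma lower_order_bound:
  obtains K where "0 \<le> K" "\<And>v. v \<in> H1D \<Omega> \<Gamma>D \<Longrightarrow>
    L2_norm \<Omega> (lower_order \<Omega> b c v) \<le> K * (L2_norm \<Omega> (weak_grad \<Omega> v) + L2_norm \<Omega> v)"
proof -
  obtain K where K: "0 \<le> K" "\<And>G. G \<in> L2 \<Omega> \<Longrightarrow> (\<lambda>x. b x \<bullet> G x) \<in> L2 \<Omega> \<and> L2_norm \<Omega> (\<lambda>x. b x \<bullet> G x) \<le> K * L2_norm \<Omega> G"
    "\<And>v. v \<in> L2 \<Omega> \<Longrightarrow> (\<lambda>x. c x * v x) \<in> L2 \<Omega> \<and> L2_norm \<Omega> (\<lambda>x. c x * v x) \<le> K * L2_norm \<Omega> v"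
    by (rule bounded_coefficient[OF b_Linf c_Linf]) (rule that)
  show thesis
  proof (rule that[OF K(1)])
    fix v assume v: "v \<in> H1D \<Omega> \<Gamma>D"
    note B = K(2)[OF H1D_grad[OF v]] and C = K(3)[OF H1D_L2[OF v]]
    have eq: "lower_order \<Omega> b c v = (\<lambda>x. b x \<bullet> weak_grad \<Omega> v x) + (\<lambda>x. c x * v x)"
      by (simp add: lower_order_def plus_fun_def)
    show "L2_norm \<Omega> (lower_order \<Omega> b c v) \<le> K * (L2_norm \<Omega> (weak_grad \<Omega> v) + L2_norm \<Omega> v)"
      unfolding eq using L2.nrm_triangle[OF conjunct1[OF B] conjunct1[OF C]] B C
      by (simp add: distrib_left)
  qed
qed

text \<open>
  All coefficients moved to the second argument. This makes linearity in the first argument evident, and it is the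
  form in which the residuals of \<open>J\<close> appear.
\<close>

lemma bil_as_weighted_inner:
  assumes u: "u \<in> H1D \<Omega> \<Gamma>D" and w: "w \<in> H1D \<Omega> \<Gamma>D"
  shows "bil \<Omega> A b c u w = L2_inner \<Omega> (weak_grad \<Omega> u) (\<lambda>x. A x *v weak_grad \<Omega> w x + w x *\<^sub>R b x)
     + L2_inner \<Omega> u (\<lambda>x. c x * w x)"
    and "(\<lambda>x. A x *v weak_grad \<Omega> w x + w x *\<^sub>R b x) \<in> L2 \<Omega>" "(\<lambda>x. c x * w x) \<in> L2 \<Omega>"
proof -
  obtain K where K: "0 \<le> K" "\<And>G. G \<in> L2 \<Omega> \<Longrightarrow> (\<lambda>x. b x \<bullet> G x) \<in> L2 \<Omega> \<and> L2_norm \<Omega> (\<lambda>x. b x \<bullet> G x) \<le> K * L2_norm \<Omega> G"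
    "\<And>v. v \<in> L2 \<Omega> \<Longrightarrow> (\<lambda>x. v x *\<^sub>R b x) \<in> L2 \<Omega> \<and> L2_norm \<Omega> (\<lambda>x. v x *\<^sub>R b x) \<le> K * L2_norm \<Omega> v"
    "\<And>v. v \<in> L2 \<Omega> \<Longrightarrow> (\<lambda>x. c x * v x) \<in> L2 \<Omega> \<and> L2_norm \<Omega> (\<lambda>x. c x * v x) \<le> K * L2_norm \<Omega> v"
    by (rule bounded_coefficient[OF b_Linf c_Linf]) (rule that)
  note gu = H1D_grad[OF u] and gw = H1D_grad[OF w] and uL = H1D_L2[OF u] and wL = H1D_L2[OF w]
  note bw = conjunct1[OF K(3)[OF wL]] and cw = conjunct1[OF K(4)[OF wL]]
    and bu = conjunct1[OF K(2)[OF gu]] and cu = conjunct1[OF K(4)[OF uL]]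
  have eq: "(\<lambda>x. A x *v weak_grad \<Omega> w x + w x *\<^sub>R b x) = (\<lambda>x. A x *v weak_grad \<Omega> w x) + (\<lambda>x. w x *\<^sub>R b x)"
    "lower_order \<Omega> b c u = (\<lambda>x. b x \<bullet> weak_grad \<Omega> u x) + (\<lambda>x. c x * u x)"
    by (simp_all add: lower_order_def plus_fun_def)
  show "(\<lambda>x. A x *v weak_grad \<Omega> w x + w x *\<^sub>R b x) \<in> L2 \<Omega>"
    unfolding eq by (rule L2.V_simps(2)[OF A_L2(1)[OF gw] bw])
  show "(\<lambda>x. c x * w x) \<in> L2 \<Omega>" by (rule cw)
  have "L2_inner \<Omega> (\<lambda>x. b x \<bullet> weak_grad \<Omega> u x) w = L2_inner \<Omega> (weak_grad \<Omega> u) (\<lambda>x. w x *\<^sub>R b x)"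
    "L2_inner \<Omega> (\<lambda>x. c x * u x) w = L2_inner \<Omega> u (\<lambda>x. c x * w x)"
    by (simp_all add: L2_inner_def inner_commute mult_ac)
  then show "bil \<Omega> A b c u w = L2_inner \<Omega> (weak_grad \<Omega> u) (\<lambda>x. A x *v weak_grad \<Omega> w x + w x *\<^sub>R b x)
     + L2_inner \<Omega> u (\<lambda>x. c x * w x)"
    unfolding bil_def eq
    by (simp add: L2.ip_simps(1)[OF bu cu wL] L2.ip_simps(2)[OF A_L2(1)[OF gw] bw gu] A_inner_symmetric[OF gu gw])
qed

lemma bil_bilin: "bilin (H1D \<Omega> \<Gamma>D) (bil \<Omega> A b c)"
  unfolding bilin_def
proof (intro conjI ballI)
  fix w assume w: "w \<in> H1D \<Omega> \<Gamma>D"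
  let ?F = "\<lambda>x. A x *v weak_grad \<Omega> w x + w x *\<^sub>R b x" and ?h = "\<lambda>x. c x * w x"
  note F = bil_as_weighted_inner(2)[OF w w] and h = bil_as_weighted_inner(3)[OF w w]
  have "lin_fun (H1D \<Omega> \<Gamma>D) (\<lambda>u. L2_inner \<Omega> (weak_grad \<Omega> u) ?F)" "lin_fun (H1D \<Omega> \<Gamma>D) (\<lambda>u. L2_inner \<Omega> u ?h)"
    using grad_inner_lin_fun[OF F] bilinD(1)[OF L2.bilin_ip h] H1D_H1 H1D_L2 unfolding lin_fun_def by blast+
  then show "lin_fun (H1D \<Omega> \<Gamma>D) (\<lambda>u. bil \<Omega> A b c u w)"
    unfolding lin_fun_def
    by (simp add: bil_as_weighted_inner(1)[OF _ w] distrib_left del: scaleR_fun_apply)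
next
  fix u assume u: "u \<in> H1D \<Omega> \<Gamma>D"
  note F = A_L2(1)[OF H1D_grad[OF u]] and h = lower_order_L2[OF u]
  have "lin_fun (H1D \<Omega> \<Gamma>D) (\<lambda>w. L2_inner \<Omega> (weak_grad \<Omega> w) (\<lambda>x. A x *v weak_grad \<Omega> u x))"
    "lin_fun (H1D \<Omega> \<Gamma>D) (\<lambda>w. L2_inner \<Omega> w (lower_order \<Omega> b c u))"
    using grad_inner_lin_fun[OF F] bilinD(1)[OF L2.bilin_ip h] H1D_H1 H1D_L2 unfolding lin_fun_def by blast+
  then show "lin_fun (H1D \<Omega> \<Gamma>D) (bil \<Omega> A b c u)"
    unfolding lin_fun_def bil_def L2_inner_commute[of \<Omega> "\<lambda>x. A x *v weak_grad \<Omega> u x"]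
      L2_inner_commute[of \<Omega> "lower_order \<Omega> b c u"] by (simp add: distrib_left)
qed

lemma bil_bounded:
  "\<exists>M. \<forall>u\<in>H1D \<Omega> \<Gamma>D. \<forall>v\<in>H1D \<Omega> \<Gamma>D. \<bar>bil \<Omega> A b c u v\<bar> \<le> M * H1_norm \<Omega> u * H1_norm \<Omega> v"
proof -
  obtain K where K: "0 \<le> K" "\<And>v. v \<in> H1D \<Omega> \<Gamma>D \<Longrightarrow>
    L2_norm \<Omega> (lower_order \<Omega> b c v) \<le> K * (L2_norm \<Omega> (weak_grad \<Omega> v) + L2_norm \<Omega> v)"
    by (rule lower_order_bound) (rule that)
  have "\<bar>bil \<Omega> A b c u v\<bar> \<le> (\<Lambda>1 + 2 * K) * H1_norm \<Omega> u * H1_norm \<Omega> v"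
    if u: "u \<in> H1D \<Omega> \<Gamma>D" and v: "v \<in> H1D \<Omega> \<Gamma>D" for u v
  proof -
    note nu = H1D.nrm_nonneg[OF u] and nv = H1D.nrm_nonneg[OF v]
    have "\<bar>L2_inner \<Omega> (\<lambda>x. A x *v weak_grad \<Omega> u x) (weak_grad \<Omega> v)\<bar>
      \<le> L2_norm \<Omega> (\<lambda>x. A x *v weak_grad \<Omega> u x) * L2_norm \<Omega> (weak_grad \<Omega> v)"
      by (rule L2.cauchy_schwarz[OF A_L2(1)[OF H1D_grad[OF u]] H1D_grad[OF v]])
    also have "\<dots> \<le> (\<Lambda>1 * H1_norm \<Omega> u) * H1_norm \<Omega> v"
    proof (intro mult_mono L2_le_H1_norm(2) L2.nrm_nonneg H1D_grad v)
      have "0 \<le> \<Lambda>1" using ellipticity(1,2) by simp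
      from mult_left_mono[OF L2_le_H1_norm(2) this]
      show "L2_norm \<Omega> (\<lambda>x. A x *v weak_grad \<Omega> u x) \<le> \<Lambda>1 * H1_norm \<Omega> u"
        by (rule order_trans[OF A_L2(2)[OF H1D_grad[OF u]]])
    qed (use ellipticity(1,2) nu in simp)
    finally have 1: "\<bar>L2_inner \<Omega> (\<lambda>x. A x *v weak_grad \<Omega> u x) (weak_grad \<Omega> v)\<bar> \<le> \<Lambda>1 * H1_norm \<Omega> u * H1_norm \<Omega> v" .
    have "\<bar>L2_inner \<Omega> (lower_order \<Omega> b c u) v\<bar> \<le> L2_norm \<Omega> (lower_order \<Omega> b c u) * L2_norm \<Omega> v"
      by (rule L2.cauchy_schwarz[OF lower_order_L2[OF u] H1D_L2[OF v]])
    also have "\<dots> \<le> (K * (H1_norm \<Omega> u + H1_norm \<Omega> u)) * H1_norm \<Omega> v"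
    proof (intro mult_mono L2_le_H1_norm(1) L2.nrm_nonneg H1D_L2 v)
      show "L2_norm \<Omega> (lower_order \<Omega> b c u) \<le> K * (H1_norm \<Omega> u + H1_norm \<Omega> u)"
        by (rule order_trans[OF K(2)[OF u] mult_left_mono[OF add_mono[OF L2_le_H1_norm(2,1)] K(1)]])
    qed (use K(1) nu in simp)
    finally have "\<bar>L2_inner \<Omega> (lower_order \<Omega> b c u) v\<bar> \<le> 2 * K * H1_norm \<Omega> u * H1_norm \<Omega> v" by simp
    then show ?thesis using 1 abs_triangle_ineq unfolding bil_def distrib_right by (smt (verit, best))
  qed
  then show ?thesis by blast
qed

text \<open>
  Young's inequality absorbs the lower-order terms up to a multiple of \<open>(L2_norm \<Omega> u)\<^sup>2\<close>, the mean estimate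
  with small \<open>\<epsilon>\<close> trades that for means and a fraction of the gradient, and the Poincare inequality turns the
  remaining gradient term into the full \<open>H1\<close> norm.
\<close>

lemma bil_garding:
  "\<exists>M c' C' \<B>. garding (H1D \<Omega> \<Gamma>D) H1_inner (bil \<Omega> A b c) M c' C' \<B> (\<lambda>B v. L2_inner \<Omega> v (mean_weight B))"
proof -
  let ?\<l> = "\<lambda>B v. L2_inner \<Omega> v (mean_weight B)"
  obtain M where M: "\<And>u v. u \<in> H1D \<Omega> \<Gamma>D \<Longrightarrow> v \<in> H1D \<Omega> \<Gamma>D \<Longrightarrow> \<bar>bil \<Omega> A b c u v\<bar> \<le> M * H1_norm \<Omega> u * H1_norm \<Omega> v"
    using bil_bounded by blast
  obtain K where K: "0 \<le> K" "\<And>v. v \<in> H1D \<Omega> \<Gamma>D \<Longrightarrow>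
    L2_norm \<Omega> (lower_order \<Omega> b c v) \<le> K * (L2_norm \<Omega> (weak_grad \<Omega> v) + L2_norm \<Omega> v)"
    by (rule lower_order_bound) (rule that)
  obtain P where P: "0 < P" "\<And>v. v \<in> H1D \<Omega> \<Gamma>D \<Longrightarrow> H1_norm \<Omega> v \<le> P * L2_norm \<Omega> (weak_grad \<Omega> v)"
    using poincare by blast
  \<comment> \<open>\<open>S\<close> is the factor of \<open>\<parallel>u\<parallel>\<^sup>2\<close> left over by Young's inequality; the choice of \<open>\<epsilon>\<close> makes \<open>S \<epsilon> \<le> \<Lambda>0 / 4\<close>.\<close>
  define S where "S = K\<^sup>2 / (2 * \<Lambda>0) + K"
  have S: "0 \<le> S" using K(1) ellipticity(1) by (simp add: S_def)
  define \<epsilon> where "\<epsilon> = \<Lambda>0 / (4 * (S + 1))"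
  have \<epsilon>: "0 < \<epsilon>" "S * \<epsilon> \<le> \<Lambda>0 / 4" using S ellipticity(1) by (auto simp: \<epsilon>_def field_simps)
  obtain \<B> C where \<B>: "mean_sets \<B>" "0 \<le> C" and est: "\<And>v. v \<in> H1D \<Omega> \<Gamma>D \<Longrightarrow>
    (L2_norm \<Omega> v)\<^sup>2 \<le> C * (\<Sum>B\<in>\<B>. (?\<l> B v)\<^sup>2) + \<epsilon> * (L2_norm \<Omega> (weak_grad \<Omega> v))\<^sup>2"
    using mean_estimate[OF \<epsilon>(1)] by blast
  have lower: "\<Lambda>0 / (4 * P\<^sup>2) * H1_inner u u \<le> bil \<Omega> A b c u u + S * C * (\<Sum>B\<in>\<B>. (?\<l> B u)\<^sup>2)"
    if u: "u \<in> H1D \<Omega> \<Gamma>D" for u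
  proof -
    define g l where "g = L2_norm \<Omega> (weak_grad \<Omega> u)" and "l = L2_norm \<Omega> u"
    have nn: "0 \<le> g" "0 \<le> l" using L2.nrm_nonneg H1D_grad[OF u] H1D_L2[OF u] by (auto simp: g_def l_def)
    have "\<bar>L2_inner \<Omega> (lower_order \<Omega> b c u) u\<bar> \<le> L2_norm \<Omega> (lower_order \<Omega> b c u) * l"
      unfolding l_def by (rule L2.cauchy_schwarz[OF lower_order_L2[OF u] H1D_L2[OF u]])
    also have "\<dots> \<le> K * (g + l) * l"
      by (rule mult_right_mono[OF _ nn(2)]) (use K(2)[OF u] in \<open>simp add: g_def l_def\<close>)
    finally have low: "- (K * (g + l) * l) \<le> L2_inner \<Omega> (lower_order \<Omega> b c u) u" by linarith
    have "0 \<le> (\<Lambda>0 * g - K * l)\<^sup>2 / (2 * \<Lambda>0)" using ellipticity(1) by simp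
    also have "\<dots> = \<Lambda>0 / 2 * g\<^sup>2 - K * g * l + K\<^sup>2 / (2 * \<Lambda>0) * l\<^sup>2"
      using ellipticity(1) by (simp add: power2_eq_square field_simps)
    finally have young: "K * g * l \<le> \<Lambda>0 / 2 * g\<^sup>2 + K\<^sup>2 / (2 * \<Lambda>0) * l\<^sup>2" by simp
    have "K * (g + l) * l = K * g * l + K * l\<^sup>2" by (simp add: power2_eq_square algebra_simps)
    also have "\<dots> \<le> \<Lambda>0 / 2 * g\<^sup>2 + S * l\<^sup>2" using young by (simp add: S_def distrib_right)
    finally have kgl: "K * (g + l) * l \<le> \<Lambda>0 / 2 * g\<^sup>2 + S * l\<^sup>2" .
    have "S * l\<^sup>2 \<le> S * (C * (\<Sum>B\<in>\<B>. (?\<l> B u)\<^sup>2) + \<epsilon> * g\<^sup>2)"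
      by (rule mult_left_mono[OF _ S]) (use est[OF u] in \<open>simp add: g_def l_def\<close>)
    also have "\<dots> \<le> S * C * (\<Sum>B\<in>\<B>. (?\<l> B u)\<^sup>2) + \<Lambda>0 / 4 * g\<^sup>2"
      using mult_right_mono[OF \<epsilon>(2), of "g\<^sup>2"] by (simp add: algebra_simps)
    finally have "\<Lambda>0 / 4 * g\<^sup>2 \<le> bil \<Omega> A b c u u + S * C * (\<Sum>B\<in>\<B>. (?\<l> B u)\<^sup>2)"
      using low kgl A_coercive[OF H1D_grad[OF u]] unfolding bil_def g_def[symmetric] by linarith
    moreover have "\<Lambda>0 / (4 * P\<^sup>2) * H1_inner u u \<le> \<Lambda>0 / 4 * g\<^sup>2"
    proof -
      have "H1_inner u u = (H1_norm \<Omega> u)\<^sup>2" by (rule H1D.nrm_sq[OF u, symmetric])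
      also have "\<dots> \<le> (P * g)\<^sup>2" unfolding g_def by (rule power_mono[OF P(2)[OF u] H1D.nrm_nonneg[OF u]])
      finally have "\<Lambda>0 / (4 * P\<^sup>2) * H1_inner u u \<le> \<Lambda>0 / (4 * P\<^sup>2) * (P * g)\<^sup>2"
        by (rule mult_left_mono) (use ellipticity(1) in simp)
      then show ?thesis using P(1) by (simp add: power_mult_distrib)
    qed
    ultimately show ?thesis by linarith
  qed
  have "garding (H1D \<Omega> \<Gamma>D) H1_inner (bil \<Omega> A b c) M (\<Lambda>0 / (4 * P\<^sup>2)) (S * C) \<B> ?\<l>"
  proof (rule garding.intro[OF H1D.semi_hilbert_axioms], unfold_locales)
    show "bilin (H1D \<Omega> \<Gamma>D) (bil \<Omega> A b c)" by (rule bil_bilin)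
    show "finite \<B>" using \<B>(1) by (simp add: mean_sets_def)
    show "semi_inner.bounded_fun (H1D \<Omega> \<Gamma>D) H1_inner (?\<l> B)" if "B \<in> \<B>" for B
      using mean_functional_bounded[OF \<B>(1) that] .
    show "\<bar>bil \<Omega> A b c u v\<bar> \<le> M * semi_inner.nrm H1_inner u * semi_inner.nrm H1_inner v"
      if "u \<in> H1D \<Omega> \<Gamma>D" "v \<in> H1D \<Omega> \<Gamma>D" for u v
      using M[OF that] by (simp add: H1_nrm)
    show "\<Lambda>0 / (4 * P\<^sup>2) * H1_inner u u \<le> bil \<Omega> A b c u u + S * C * (\<Sum>B\<in>\<B>. (?\<l> B u)\<^sup>2)"
      if "u \<in> H1D \<Omega> \<Gamma>D" for u by (rule lower[OF that])
  qed (use \<B>(2) S ellipticity(1) P(1) in auto)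
  then show ?thesis by blast
qed

end

section \<open>Stability of the problem and of its adjoint\<close>

context elliptic_problem
begin

lemma zero_functional_dual: "(\<lambda>_. 0) \<in> H1D_dual \<Omega> \<Gamma>D"
  unfolding H1D_dual_def by (auto intro!: exI[of _ 0])

text \<open>
  If \<open>u\<close> were nonzero, the supremum defining \<open>dual_norm\<close> would range over a nonempty set and equal \<open>0\<close>.
\<close>

lemma zero_functional_stability:
  assumes u: "u \<in> H1D \<Omega> \<Gamma>D" and le: "L2_norm \<Omega> (weak_grad \<Omega> u) \<le> C * dual_norm \<Omega> \<Gamma>D (\<lambda>_. 0)"
  shows "eq_ae \<Omega> u (\<lambda>_. 0)"
proof (rule ccontr)
  assume neg: "\<not> eq_ae \<Omega> u (\<lambda>_. 0)"
  then have "{w \<in> H1D \<Omega> \<Gamma>D. \<not> eq_ae \<Omega> w (\<lambda>_. 0)} \<noteq> {}" using u by blast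
  then have "dual_norm \<Omega> \<Gamma>D (\<lambda>_. 0) = 0" by (simp add: dual_norm_def)
  then have "L2_norm \<Omega> (weak_grad \<Omega> u) = 0" using le L2.nrm_nonneg[OF H1D_grad[OF u]] by simp
  then show False using ae_zero_if_grad_zero[OF u] neg by blast
qed

lemma bil_zero:
  assumes "w \<in> H1D \<Omega> \<Gamma>D"
  shows "bil \<Omega> A b c (\<lambda>_. 0) w = 0" "bil \<Omega> A b c w (\<lambda>_. 0) = 0"
proof -
  have z: "(\<lambda>_. 0) = (0 :: real^'n \<Rightarrow> real)" by (simp add: zero_fun_def)
  show "bil \<Omega> A b c (\<lambda>_. 0) w = 0"
    using lin_funD(2)[OF bilinD(1)[OF bil_bilin assms] H1D_zero, of 0] by (simp add: z)
  show "bil \<Omega> A b c w (\<lambda>_. 0) = 0"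
    using lin_funD(2)[OF bilinD(2)[OF bil_bilin assms] H1D_zero, of 0] by (simp add: z)
qed

text \<open>
  Both conditions are used for the zero functional, for which \<open>0\<close> is a solution.
\<close>

lemma injective_if_stable:
  assumes "(\<exists>C>0. \<forall>g\<in>H1D_dual \<Omega> \<Gamma>D. \<forall>u. solves \<Omega> \<Gamma>D A b c g u \<longrightarrow>
        L2_norm \<Omega> (weak_grad \<Omega> u) \<le> C * dual_norm \<Omega> \<Gamma>D g) \<or>
      (\<forall>g\<in>H1D_dual \<Omega> \<Gamma>D. (\<exists>u. solves \<Omega> \<Gamma>D A b c g u) \<and>
        (\<forall>u u'. solves \<Omega> \<Gamma>D A b c g u \<and> solves \<Omega> \<Gamma>D A b c g u' \<longrightarrow> eq_ae \<Omega> u u'))"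
    and u: "u \<in> H1D \<Omega> \<Gamma>D" "\<And>v. v \<in> H1D \<Omega> \<Gamma>D \<Longrightarrow> bil \<Omega> A b c u v = 0"
  shows "eq_ae \<Omega> u (\<lambda>_. 0)"
proof -
  have su: "solves \<Omega> \<Gamma>D A b c (\<lambda>_. 0) u" using u by (simp add: solves_def)
  have s0: "solves \<Omega> \<Gamma>D A b c (\<lambda>_. 0) (\<lambda>_. 0)"
    using H1D_zero bil_zero by (simp add: solves_def zero_fun_def)
  from assms(1) show ?thesis
  proof
    assume "\<exists>C>0. \<forall>g\<in>H1D_dual \<Omega> \<Gamma>D. \<forall>u. solves \<Omega> \<Gamma>D A b c g u \<longrightarrow>
        L2_norm \<Omega> (weak_grad \<Omega> u) \<le> C * dual_norm \<Omega> \<Gamma>D g"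
    then show ?thesis using zero_functional_dual su zero_functional_stability[OF u(1)] by blast
  qed (use zero_functional_dual su s0 in blast)
qed

lemma injective_if_adjoint_stable:
  assumes "(\<exists>C>0. \<forall>g\<in>H1D_dual \<Omega> \<Gamma>D. \<forall>u. solves_adj \<Omega> \<Gamma>D A b c g u \<longrightarrow>
        L2_norm \<Omega> (weak_grad \<Omega> u) \<le> C * dual_norm \<Omega> \<Gamma>D g) \<or>
      (\<forall>g\<in>H1D_dual \<Omega> \<Gamma>D. (\<exists>u. solves_adj \<Omega> \<Gamma>D A b c g u) \<and>
        (\<forall>u u'. solves_adj \<Omega> \<Gamma>D A b c g u \<and> solves_adj \<Omega> \<Gamma>D A b c g u' \<longrightarrow> eq_ae \<Omega> u u'))"
    and u: "u \<in> H1D \<Omega> \<Gamma>D" "\<And>v. v \<in> H1D \<Omega> \<Gamma>D \<Longrightarrow> bil \<Omega> A b c v u = 0"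
  shows "eq_ae \<Omega> u (\<lambda>_. 0)"
proof -
  have su: "solves_adj \<Omega> \<Gamma>D A b c (\<lambda>_. 0) u" using u by (simp add: solves_adj_def)
  have s0: "solves_adj \<Omega> \<Gamma>D A b c (\<lambda>_. 0) (\<lambda>_. 0)"
    using H1D_zero bil_zero by (simp add: solves_adj_def zero_fun_def)
  from assms(1) show ?thesis
  proof
    assume "\<exists>C>0. \<forall>g\<in>H1D_dual \<Omega> \<Gamma>D. \<forall>u. solves_adj \<Omega> \<Gamma>D A b c g u \<longrightarrow>
        L2_norm \<Omega> (weak_grad \<Omega> u) \<le> C * dual_norm \<Omega> \<Gamma>D g"
    then show ?thesis using zero_functional_dual su zero_functional_stability[OF u(1)] by blast
  qed (use zero_functional_dual su s0 in blast)
qed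

text \<open>
  The weak gradient depends on \<open>u\<close> only up to null sets, so that it vanishes together with \<open>u\<close>.
\<close>

lemma H1_inner_zero_if_ae_zero:
  assumes u: "u \<in> H1D \<Omega> \<Gamma>D" and ae: "eq_ae \<Omega> u (\<lambda>_. 0)"
  shows "H1_inner u u = 0"
proof -
  have l: "L2_norm \<Omega> u = 0" using ae L2_norm_eq_0_iff[OF H1D_L2[OF u]] by (simp add: eq_ae_def)
  have "AE x in lebesgue_on \<Omega>. weak_grad \<Omega> u x = 0"
  proof (rule H1I(2)[OF H1D_L2[OF u] L2_zero])
    have "L2_inner \<Omega> u (pderiv_dir i \<phi>) = 0" if "\<phi> \<in> test_functions \<Omega>" for i \<phi>
    proof -
      have "L2_inner \<Omega> u (pderiv_dir i \<phi>) = (LINT x|lebesgue_on \<Omega>. (0::real))"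
        unfolding L2_inner_def
      proof (rule integral_cong_AE)
        show "AE x in lebesgue_on \<Omega>. u x \<bullet> pderiv_dir i \<phi> x = 0"
          using ae unfolding eq_ae_def by eventually_elim simp
        have "continuous_on UNIV (pderiv_dir i \<phi>)"
          using that smooth_pderiv smooth_continuous by (auto simp: test_functions_def)
        then have "pderiv_dir i \<phi> \<in> borel_measurable (lebesgue_on \<Omega>)"
          by (metis borel_measurable_continuous_onI measurable_completion measurable_lborel2 measurable_restrict_space1)
        then show "(\<lambda>x. u x \<bullet> pderiv_dir i \<phi> x) \<in> borel_measurable (lebesgue_on \<Omega>)"
          by (rule borel_measurable_inner[OF L2_measurable[OF H1D_L2[OF u]]])
      qed simp
      then show ?thesis by simp
    qed
    then show "is_weak_grad \<Omega> u (\<lambda>_. 0)"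
      by (simp add: is_weak_grad_iff_L2_inner) (simp add: L2_inner_def)
  qed
  then have "L2_norm \<Omega> (weak_grad \<Omega> u) = 0" using L2_norm_eq_0_iff[OF H1D_grad[OF u]] by simp
  with l show ?thesis by (simp add: H1_inner_diag)
qed

text \<open>
  Inf-sup estimates in both arguments, with a common constant.
\<close>

definition well_posed :: bool where
  "well_posed \<longleftrightarrow> (\<exists>K>0. \<forall>u\<in>H1D \<Omega> \<Gamma>D. \<forall>B\<ge>0.
     ((\<forall>w\<in>H1D \<Omega> \<Gamma>D. bil \<Omega> A b c u w \<le> B * H1_norm \<Omega> w) \<longrightarrow> H1_norm \<Omega> u \<le> K * B) \<and>
     ((\<forall>w\<in>H1D \<Omega> \<Gamma>D. bil \<Omega> A b c w u \<le> B * H1_norm \<Omega> w) \<longrightarrow> H1_norm \<Omega> u \<le> K * B))"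

lemma well_posed_if_injective:
  assumes inj: "(\<forall>u\<in>H1D \<Omega> \<Gamma>D. (\<forall>v\<in>H1D \<Omega> \<Gamma>D. bil \<Omega> A b c u v = 0) \<longrightarrow> eq_ae \<Omega> u (\<lambda>_. 0)) \<or>
       (\<forall>u\<in>H1D \<Omega> \<Gamma>D. (\<forall>v\<in>H1D \<Omega> \<Gamma>D. bil \<Omega> A b c v u = 0) \<longrightarrow> eq_ae \<Omega> u (\<lambda>_. 0))"
  shows well_posed
proof -
  let ?\<l> = "\<lambda>B v. L2_inner \<Omega> v (mean_weight B)"
  obtain M c' C' \<B> where G: "garding (H1D \<Omega> \<Gamma>D) H1_inner (bil \<Omega> A b c) M c' C' \<B> ?\<l>"
    using bil_garding by blast
  interpret G: garding "H1D \<Omega> \<Gamma>D" H1_inner "bil \<Omega> A b c" M c' C' \<B> ?\<l> by (rule G)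
  interpret G': garding "H1D \<Omega> \<Gamma>D" H1_inner "\<lambda>u v. bil \<Omega> A b c v u" M c' C' \<B> ?\<l> by (rule G.garding_flip)
  let ?inj = "\<forall>u\<in>H1D \<Omega> \<Gamma>D. (\<forall>v\<in>H1D \<Omega> \<Gamma>D. bil \<Omega> A b c u v = 0) \<longrightarrow> H1_inner u u = 0"
  let ?inj' = "\<forall>u\<in>H1D \<Omega> \<Gamma>D. (\<forall>v\<in>H1D \<Omega> \<Gamma>D. bil \<Omega> A b c v u = 0) \<longrightarrow> H1_inner u u = 0"
  have "?inj \<or> ?inj'" using inj H1_inner_zero_if_ae_zero by blast
  moreover have "?inj \<Longrightarrow> ?inj'" using G.injective_transpose by blast
  moreover have "?inj' \<Longrightarrow> ?inj" using G'.injective_transpose by blast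
  ultimately have both: ?inj ?inj' by blast+
  obtain K where K: "0 < K" "\<And>u B. u \<in> H1D \<Omega> \<Gamma>D \<Longrightarrow> 0 \<le> B \<Longrightarrow>
     (\<forall>w\<in>H1D \<Omega> \<Gamma>D. bil \<Omega> A b c u w \<le> B * H1_norm \<Omega> w) \<Longrightarrow> H1_norm \<Omega> u \<le> K * B"
    using G.inf_sup both(1) unfolding H1_nrm by blast
  obtain K' where K': "0 < K'" "\<And>u B. u \<in> H1D \<Omega> \<Gamma>D \<Longrightarrow> 0 \<le> B \<Longrightarrow>
     (\<forall>w\<in>H1D \<Omega> \<Gamma>D. bil \<Omega> A b c w u \<le> B * H1_norm \<Omega> w) \<Longrightarrow> H1_norm \<Omega> u \<le> K' * B"
    using G'.inf_sup both(2) unfolding H1_nrm by blast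
  show ?thesis unfolding well_posed_def
  proof (intro exI[of _ "max K K'"] conjI ballI allI impI)
    fix u B assume u: "u \<in> H1D \<Omega> \<Gamma>D" and B: "(0::real) \<le> B"
    { assume "\<forall>w\<in>H1D \<Omega> \<Gamma>D. bil \<Omega> A b c u w \<le> B * H1_norm \<Omega> w"
      then have "H1_norm \<Omega> u \<le> K * B" by (rule K(2)[OF u B])
      also have "\<dots> \<le> max K K' * B" by (rule mult_right_mono[OF _ B]) simp
      finally show "H1_norm \<Omega> u \<le> max K K' * B" . }
    { assume "\<forall>w\<in>H1D \<Omega> \<Gamma>D. bil \<Omega> A b c w u \<le> B * H1_norm \<Omega> w"
      then have "H1_norm \<Omega> u \<le> K' * B" by (rule K'(2)[OF u B])
      also have "\<dots> \<le> max K K' * B" by (rule mult_right_mono[OF _ B]) simp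
      finally show "H1_norm \<Omega> u \<le> max K K' * B" . }
  qed (use K(1) in simp)
qed

end

section \<open>Coercivity of the least-squares functionals\<close>

text \<open>
  Cramer's rule, which shows that the solution of a linear system depends measurably on the data.
\<close>

definition cramer_solution :: "real^'n::finite^'n \<Rightarrow> real^'n \<Rightarrow> real^'n" where
  "cramer_solution M q = (\<chi> k. det (\<chi> i j. if j = k then q $ i else M $ i $ j) / det M)"

lemma measurable_cramer_solution:
  fixes A :: "'a \<Rightarrow> real^'n::finite^'n" and q :: "'a \<Rightarrow> real^'n"
  assumes A: "A \<in> borel_measurable M" and q: "q \<in> borel_measurable M"
  shows "(\<lambda>x. cramer_solution (A x) (q x)) \<in> borel_measurable M"
proof -
  have If: "continuous_on UNIV (\<lambda>x. if P then f x else g x)"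
    if "continuous_on UNIV f" "continuous_on UNIV g" for P and f g :: "(real^'n^'n) \<times> (real^'n) \<Rightarrow> real"
    using that by (cases P) auto
  have "continuous_on UNIV (\<lambda>x :: (real^'n^'n) \<times> (real^'n).
     (\<chi> k. det (\<chi> i j. if j = k then snd x $ i else fst x $ i $ j)))"
    unfolding det_def by (simp, intro continuous_intros If)
  from borel_measurable_continuous_Pair[OF A q this]
  have num: "(\<lambda>x. \<chi> k. det (\<chi> i j. if j = k then q x $ i else A x $ i $ j)) \<in> borel_measurable M" .
  have "continuous_on UNIV (\<lambda>B :: real^'n^'n. det B)"
    unfolding det_def by (intro continuous_intros)
  from borel_measurable_continuous_on[OF this A] have den: "(\<lambda>x. det (A x)) \<in> borel_measurable M" .
  have eq: "cramer_solution (A x) (q x) =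
     (1 / det (A x)) *\<^sub>R (\<chi> k. det (\<chi> i j. if j = k then q x $ i else A x $ i $ j))" for x
    by (simp add: cramer_solution_def vec_eq_iff)
  show ?thesis unfolding eq using num den by measurable
qed

lemma matrix_inv_left_right:
  fixes B :: "real^'n::finite^'n"
  assumes "invertible B"
  shows "matrix_inv B ** B = mat 1" "B ** matrix_inv B = mat 1"
  using someI_ex[OF assms[unfolded invertible_def]] by (auto simp: matrix_inv_def)

text \<open>
  Let \<open>S\<close> be the square root of \<open>M\<close>. Then \<open>S p = q\<close> and hence \<open>p = S M\<^sup>-\<^sup>1 q\<close>, so \<open>p \<bullet> p = (M\<^sup>-\<^sup>1 q) \<bullet> q\<close>,
  an expression without the square root. The bounds follow from \<open>q \<bullet> q = p \<bullet> (M *v p)\<close>.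
\<close>

lemma flux_transform:
  fixes M :: "real^'n::finite^'n" and t g :: "real^'n"
  assumes sym: "transpose M = M" and \<Lambda>: "0 < \<Lambda>0" "\<Lambda>0 \<le> \<Lambda>1"
    and bounds: "\<And>y. \<Lambda>0 * (y \<bullet> y) \<le> y \<bullet> (M *v y)" "\<And>y. y \<bullet> (M *v y) \<le> \<Lambda>1 * (y \<bullet> y)"
  defines "p \<equiv> matrix_inv (matrix_sqrt M) *v t + matrix_sqrt M *v g" and "q \<equiv> t + M *v g"
  shows "p \<bullet> p = cramer_solution M q \<bullet> q" "\<Lambda>0 * (p \<bullet> p) \<le> q \<bullet> q" "q \<bullet> q \<le> \<Lambda>1 * (p \<bullet> p)"
proof -
  let ?B = "matrix_sqrt M" and ?r = "cramer_solution M q"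
  note B = matrix_sqrt[OF assms(1-5)]
  have BB: "?B *v (?B *v x) = M *v x" for x by (simp add: matrix_vector_mul_assoc B(2))
  have Bp: "?B *v p = q"
    unfolding p_def q_def
    by (simp add: matrix_vector_right_distrib matrix_vector_mul_assoc B(2) matrix_inv_left_right(2)[OF B(3)])
  have "invertible M" using invertible_mult[OF B(3) B(3)] by (simp add: B(2))
  then have "det M \<noteq> 0" by (simp add: invertible_det_nz)
  from cramer[OF this, of ?r q] have r: "M *v ?r = q" by (simp add: cramer_solution_def)
  have inj: "x = y" if "?B *v x = ?B *v y" for x y
    using that by (metis B(3) matrix_inv_left_right(1) matrix_vector_mul_assoc matrix_vector_mul_lid)
  have Br: "?B *v ?r = p" by (rule inj) (simp add: BB r Bp)
  have "p \<bullet> p = (?B *v ?r) \<bullet> p" by (simp add: Br)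
  also have "\<dots> = ?r \<bullet> (?B *v p)" by (rule symmetric_matrix_inner[OF B(1)])
  finally show "p \<bullet> p = ?r \<bullet> q" by (simp add: Bp)
  have "q \<bullet> q = (?B *v p) \<bullet> (?B *v p)" by (simp add: Bp)
  also have "\<dots> = p \<bullet> (M *v p)" by (simp add: symmetric_matrix_inner[OF B(1)] BB)
  finally show "\<Lambda>0 * (p \<bullet> p) \<le> q \<bullet> q" "q \<bullet> q \<le> \<Lambda>1 * (p \<bullet> p)" using bounds[of p] by simp_all
qed

lemma square_sum_estimate:
  fixes t d g x y R :: real
  assumes nn: "0 \<le> t" "0 \<le> d" "0 \<le> g" and R: "0 < R"
    and le: "t \<le> R * (x + y)" "d \<le> R * (x + y)" "g \<le> R * (x + y)"
  shows "1 / (6 * R\<^sup>2) * (t\<^sup>2 + d\<^sup>2 + g\<^sup>2) \<le> x\<^sup>2 + y\<^sup>2"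
proof -
  have "t\<^sup>2 + d\<^sup>2 + g\<^sup>2 \<le> 3 * (R * (x + y))\<^sup>2"
    using power_mono[OF le(1) nn(1), of 2] power_mono[OF le(2) nn(2), of 2] power_mono[OF le(3) nn(3), of 2] by simp
  also have "\<dots> = 3 * R\<^sup>2 * (x + y)\<^sup>2" by (simp add: power_mult_distrib)
  also have "\<dots> \<le> 3 * R\<^sup>2 * (2 * (x\<^sup>2 + y\<^sup>2))"
    using sum_squares_ge_zero[of "x - y" 0] by (intro mult_left_mono) (auto simp: power2_eq_square algebra_simps)
  finally have "t\<^sup>2 + d\<^sup>2 + g\<^sup>2 \<le> (x\<^sup>2 + y\<^sup>2) * (6 * R\<^sup>2)" by (simp add: algebra_simps)
  then have "(t\<^sup>2 + d\<^sup>2 + g\<^sup>2) / (6 * R\<^sup>2) \<le> x\<^sup>2 + y\<^sup>2" using R by (subst pos_divide_le_eq) auto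
  then show ?thesis by simp
qed

context elliptic_problem
begin

lemma HNdiv_props:
  assumes "\<tau> \<in> HNdiv \<Omega> \<Gamma>D"
  shows "\<tau> \<in> L2 \<Omega>" "weak_div \<Omega> \<tau> \<in> L2 \<Omega>"
    "w \<in> H1D \<Omega> \<Gamma>D \<Longrightarrow> L2_inner \<Omega> \<tau> (weak_grad \<Omega> w) + L2_inner \<Omega> (weak_div \<Omega> \<tau>) w = 0"
proof -
  show "\<tau> \<in> L2 \<Omega>" using assms by (simp add: HNdiv_def Hdiv_def)
  have "\<exists>D. D \<in> L2 \<Omega> \<and> is_weak_div \<Omega> \<tau> D" using assms by (simp add: HNdiv_def Hdiv_def)
  from someI_ex[OF this] show "weak_div \<Omega> \<tau> \<in> L2 \<Omega>" by (simp add: weak_div_def)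
  show "w \<in> H1D \<Omega> \<Gamma>D \<Longrightarrow> L2_inner \<Omega> \<tau> (weak_grad \<Omega> w) + L2_inner \<Omega> (weak_div \<Omega> \<tau>) w = 0"
    using assms by (simp add: HNdiv_def)
qed

text \<open>
  The main point is the measurability of \<open>|p|\<^sup>2\<close> for the flux defect \<open>p\<close>, which involves a pointwise matrix square root:
  almost everywhere it agrees with a rational expression in \<open>A\<close> and \<open>q\<close>.
\<close>

lemma flux_defect_bound:
  assumes \<tau>: "\<tau> \<in> L2 \<Omega>" and v: "v \<in> H1D \<Omega> \<Gamma>D"
  shows "0 \<le> L2_norm \<Omega> (flux_defect \<Omega> A \<tau> v)"
    "L2_norm \<Omega> (\<lambda>x. \<tau> x + A x *v weak_grad \<Omega> v x) \<le> sqrt \<Lambda>1 * L2_norm \<Omega> (flux_defect \<Omega> A \<tau> v)"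
proof -
  let ?p = "flux_defect \<Omega> A \<tau> v" and ?q = "\<lambda>x. \<tau> x + A x *v weak_grad \<Omega> v x" and ?M = "lebesgue_on \<Omega>"
  let ?h = "\<lambda>x. cramer_solution (A x) (?q x) \<bullet> ?q x"
  have q: "?q \<in> L2 \<Omega>" by (rule L2_add[OF \<tau> A_L2(1)[OF H1D_grad[OF v]]])
  have hm: "?h \<in> borel_measurable ?M"
    by (intro borel_measurable_inner measurable_cramer_solution A_measurable L2_measurable[OF q])
  have all: "AE x in ?M. ?p x \<bullet> ?p x = ?h x \<and> \<Lambda>0 * (?p x \<bullet> ?p x) \<le> ?q x \<bullet> ?q x \<and> ?q x \<bullet> ?q x \<le> \<Lambda>1 * (?p x \<bullet> ?p x)"
    using A_symmetric ellipticity(3)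
  proof eventually_elim
    case (elim x)
    from flux_transform[OF elim(1) ellipticity(1,2), of "\<tau> x" "weak_grad \<Omega> v x"] elim(2)
    show ?case by (simp add: flux_defect_def)
  qed
  have "AE x in ?M. ?p x \<bullet> ?p x = ?h x" using all by eventually_elim blast
  then obtain N where N: "\<And>x. x \<in> space ?M - N \<Longrightarrow> ?p x \<bullet> ?p x = ?h x" "N \<in> null_sets ?M"
    by (rule AE_E3) (rule that)
  have "(\<lambda>x. ?p x \<bullet> ?p x) \<in> borel_measurable ?M \<longleftrightarrow> (\<lambda>x. ?p x \<bullet> ?p x) \<in> borel_measurable (lebesgue_on (\<Omega> - N))"
    by (rule borel_measurable_diff_null[OF N(2) domain_sets(1), symmetric])
  also have "\<dots> \<longleftrightarrow> ?h \<in> borel_measurable (lebesgue_on (\<Omega> - N))"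
    by (rule measurable_cong) (use N(1) in auto)
  also have "\<dots> \<longleftrightarrow> ?h \<in> borel_measurable ?M"
    by (rule borel_measurable_diff_null[OF N(2) domain_sets(1)])
  finally have pm: "(\<lambda>x. ?p x \<bullet> ?p x) \<in> borel_measurable ?M" using hm by simp
  have pint: "integrable ?M (\<lambda>x. ?p x \<bullet> ?p x)"
  proof (rule Bochner_Integration.integrable_bound)
    show "integrable ?M (\<lambda>x. 1 / \<Lambda>0 * (?q x \<bullet> ?q x))" using L2_inner_integrable[OF q q] by simp
    show "AE x in ?M. norm (?p x \<bullet> ?p x) \<le> norm (1 / \<Lambda>0 * (?q x \<bullet> ?q x))"
      using all
    proof eventually_elim
      case (elim x)
      then have "\<Lambda>0 * (?p x \<bullet> ?p x) \<le> ?q x \<bullet> ?q x" by blast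
      then have "?p x \<bullet> ?p x \<le> 1 / \<Lambda>0 * (?q x \<bullet> ?q x)"
        using ellipticity(1) by (simp add: pos_le_divide_eq mult.commute)
      then show ?case using inner_ge_zero[of "?p x"] by (simp only: real_norm_def abs_of_nonneg)
    qed
  qed (rule pm)
  show "0 \<le> L2_norm \<Omega> ?p" by (simp add: L2_norm_def L2_inner_nonneg)
  have "L2_inner \<Omega> ?q ?q \<le> (LINT x|?M. \<Lambda>1 * (?p x \<bullet> ?p x))"
    unfolding L2_inner_def
  proof (rule integral_mono_AE)
    show "AE x in ?M. ?q x \<bullet> ?q x \<le> \<Lambda>1 * (?p x \<bullet> ?p x)" using all by eventually_elim blast
  qed (use L2_inner_integrable[OF q q] pint in auto)
  also have "\<dots> = \<Lambda>1 * L2_inner \<Omega> ?p ?p" by (simp add: L2_inner_def)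
  finally show "L2_norm \<Omega> ?q \<le> sqrt \<Lambda>1 * L2_norm \<Omega> ?p"
    unfolding L2_norm_def real_sqrt_mult[symmetric] by (rule real_sqrt_le_mono)
qed

text \<open>
  Green's formula cancels the contributions of \<open>\<tau>\<close>.
\<close>

lemma bil_first_order_system:
  assumes \<tau>: "\<tau> \<in> HNdiv \<Omega> \<Gamma>D" and v: "v \<in> H1D \<Omega> \<Gamma>D" and w: "w \<in> H1D \<Omega> \<Gamma>D"
  shows "bil \<Omega> A b c v w = L2_inner \<Omega> (\<lambda>x. \<tau> x + A x *v weak_grad \<Omega> v x) (weak_grad \<Omega> w)
      + L2_inner \<Omega> (\<lambda>x. weak_div \<Omega> \<tau> x + lower_order \<Omega> b c v x) w"
    and "bil \<Omega> A b c w v = L2_inner \<Omega> (\<lambda>x. \<tau> x + A x *v weak_grad \<Omega> v x + v x *\<^sub>R b x) (weak_grad \<Omega> w)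
      + L2_inner \<Omega> (\<lambda>x. weak_div \<Omega> \<tau> x + c x * v x) w"
proof -
  note T = HNdiv_props(1,2)[OF \<tau>] and green = HNdiv_props(3)[OF \<tau> w]
  note gw = H1D_grad[OF w] and wL = H1D_L2[OF w]
  have "L2_inner \<Omega> (\<tau> + (\<lambda>x. A x *v weak_grad \<Omega> v x)) (weak_grad \<Omega> w) + L2_inner \<Omega> (weak_div \<Omega> \<tau> + lower_order \<Omega> b c v) w
     = bil \<Omega> A b c v w"
    using green unfolding L2.ip_simps(1)[OF T(1) A_L2(1)[OF H1D_grad[OF v]] gw]
      L2.ip_simps(1)[OF T(2) lower_order_L2[OF v] wL] bil_def by simp
  then show "bil \<Omega> A b c v w = L2_inner \<Omega> (\<lambda>x. \<tau> x + A x *v weak_grad \<Omega> v x) (weak_grad \<Omega> w)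
      + L2_inner \<Omega> (\<lambda>x. weak_div \<Omega> \<tau> x + lower_order \<Omega> b c v x) w" by (simp add: plus_fun_def)
  have "L2_inner \<Omega> (\<tau> + (\<lambda>x. A x *v weak_grad \<Omega> v x + v x *\<^sub>R b x)) (weak_grad \<Omega> w)
      + L2_inner \<Omega> (weak_div \<Omega> \<tau> + (\<lambda>x. c x * v x)) w = bil \<Omega> A b c w v"
    using green unfolding L2.ip_simps(1)[OF T(1) bil_as_weighted_inner(2)[OF w v] gw]
      L2.ip_simps(1)[OF T(2) bil_as_weighted_inner(3)[OF w v] wL] bil_as_weighted_inner(1)[OF w v]
    by (simp add: L2_inner_commute[of _ _ "weak_grad \<Omega> w"] L2_inner_commute[of _ _ w])
  then show "bil \<Omega> A b c w v = L2_inner \<Omega> (\<lambda>x. \<tau> x + A x *v weak_grad \<Omega> v x + v x *\<^sub>R b x) (weak_grad \<Omega> w)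
      + L2_inner \<Omega> (\<lambda>x. weak_div \<Omega> \<tau> x + c x * v x) w" by (simp add: plus_fun_def add.assoc)
qed

text \<open>
  The two choices of \<open>y\<close> serve the functionals with the \<open>L2\<close> norm and with the dual norm.
\<close>

lemma residual_functional_bound:
  assumes q: "q \<in> L2 \<Omega>" and f: "f \<in> L2 \<Omega>" and w: "w \<in> H1D \<Omega> \<Gamma>D"
    and y: "y = L2_norm \<Omega> f \<or> y = \<bar>dual_norm \<Omega> \<Gamma>D (L2_functional \<Omega> f)\<bar>"
  shows "L2_inner \<Omega> q (weak_grad \<Omega> w) + L2_inner \<Omega> f w \<le> (L2_norm \<Omega> q + y) * H1_norm \<Omega> w"
proof -
  have "L2_inner \<Omega> q (weak_grad \<Omega> w) \<le> L2_norm \<Omega> q * L2_norm \<Omega> (weak_grad \<Omega> w)"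
    using L2.cauchy_schwarz[OF q H1D_grad[OF w]] by simp
  also have "\<dots> \<le> L2_norm \<Omega> q * H1_norm \<Omega> w"
    by (rule mult_left_mono[OF L2_le_H1_norm(2) L2.nrm_nonneg[OF q]])
  finally have 1: "L2_inner \<Omega> q (weak_grad \<Omega> w) \<le> L2_norm \<Omega> q * H1_norm \<Omega> w" .
  have "L2_inner \<Omega> f w \<le> y * H1_norm \<Omega> w"
    using y
  proof
    assume y: "y = L2_norm \<Omega> f"
    have "L2_inner \<Omega> f w \<le> L2_norm \<Omega> f * L2_norm \<Omega> w" using L2.cauchy_schwarz[OF f H1D_L2[OF w]] by simp
    also have "\<dots> \<le> L2_norm \<Omega> f * H1_norm \<Omega> w"
      by (rule mult_left_mono[OF L2_le_H1_norm(1) L2.nrm_nonneg[OF f]])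
    finally show ?thesis by (simp add: y)
  next
    assume y: "y = \<bar>dual_norm \<Omega> \<Gamma>D (L2_functional \<Omega> f)\<bar>"
    show ?thesis unfolding y
      by (rule order_trans[OF dual_norm_bound[OF f w] mult_left_mono[OF L2_le_H1_norm(2)]]) simp
  qed
  with 1 show ?thesis by (simp add: distrib_right)
qed

text \<open>
  By \<open>bil_first_order_system\<close> the residuals bound the functional \<open>a(v, \<cdot>)\<close>, or \<open>a(\<cdot>, v)\<close> in the case of \<open>J\<close>, so the
  inf-sup estimates bound \<open>v\<close>; the triangle inequality then bounds \<open>\<tau>\<close> and its divergence.
\<close>

lemma least_squares_coercive:
  assumes well_posed
  shows "\<exists>C>0. \<forall>\<tau>\<in>HNdiv \<Omega> \<Gamma>D. \<forall>v\<in>H1D \<Omega> \<Gamma>D.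
      C * ((L2_norm \<Omega> \<tau>)\<^sup>2 + (L2_norm \<Omega> (weak_div \<Omega> \<tau>))\<^sup>2 + (L2_norm \<Omega> (weak_grad \<Omega> v))\<^sup>2)
        \<le> LS_L \<Omega> A b c \<tau> v (\<lambda>_. 0) \<and>
      C * ((L2_norm \<Omega> \<tau>)\<^sup>2 + (L2_norm \<Omega> (weak_grad \<Omega> v))\<^sup>2)
        \<le> LS_L_minus1 \<Omega> \<Gamma>D A b c \<tau> v (\<lambda>_. 0) \<and>
      C * ((L2_norm \<Omega> \<tau>)\<^sup>2 + (L2_norm \<Omega> (weak_div \<Omega> \<tau>))\<^sup>2 + (L2_norm \<Omega> (weak_grad \<Omega> v))\<^sup>2)
        \<le> LS_J \<Omega> A b c \<tau> v (\<lambda>_. 0) \<and>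
      C * ((L2_norm \<Omega> \<tau>)\<^sup>2 + (L2_norm \<Omega> (weak_grad \<Omega> v))\<^sup>2)
        \<le> LS_J_minus1 \<Omega> \<Gamma>D A b c \<tau> v (\<lambda>_. 0)"
proof -
  obtain K where K: "0 < K" "\<And>u B. u \<in> H1D \<Omega> \<Gamma>D \<Longrightarrow> 0 \<le> B \<Longrightarrow>
     (\<forall>w\<in>H1D \<Omega> \<Gamma>D. bil \<Omega> A b c u w \<le> B * H1_norm \<Omega> w) \<Longrightarrow> H1_norm \<Omega> u \<le> K * B"
    "\<And>u B. u \<in> H1D \<Omega> \<Gamma>D \<Longrightarrow> 0 \<le> B \<Longrightarrow>
     (\<forall>w\<in>H1D \<Omega> \<Gamma>D. bil \<Omega> A b c w u \<le> B * H1_norm \<Omega> w) \<Longrightarrow> H1_norm \<Omega> u \<le> K * B"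
    using assms unfolding well_posed_def by blast
  obtain K1 where K1: "0 \<le> K1" "\<And>v. v \<in> H1D \<Omega> \<Gamma>D \<Longrightarrow>
    L2_norm \<Omega> (lower_order \<Omega> b c v) \<le> K1 * (L2_norm \<Omega> (weak_grad \<Omega> v) + L2_norm \<Omega> v)"
    by (rule lower_order_bound) (rule that)
  obtain K2 where K2: "0 \<le> K2"
    "\<And>v. v \<in> L2 \<Omega> \<Longrightarrow> (\<lambda>x. v x *\<^sub>R b x) \<in> L2 \<Omega> \<and> L2_norm \<Omega> (\<lambda>x. v x *\<^sub>R b x) \<le> K2 * L2_norm \<Omega> v"
    "\<And>v. v \<in> L2 \<Omega> \<Longrightarrow> (\<lambda>x. c x * v x) \<in> L2 \<Omega> \<and> L2_norm \<Omega> (\<lambda>x. c x * v x) \<le> K2 * L2_norm \<Omega> v"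
    by (rule bounded_coefficient[OF b_Linf c_Linf]) (rule that)
  define s where "s = max 1 (sqrt \<Lambda>1)"
  \<comment> \<open>\<open>T\<close> bounds the norms of all operators that are subtracted from the residuals.\<close>
  define T where "T = 1 + \<Lambda>1 + K2 + 2 * K1"
  define R where "R = (1 + T * K) * s"
  have \<Lambda>1: "0 < \<Lambda>1" using ellipticity(1,2) by simp
  have s: "1 \<le> s" "sqrt \<Lambda>1 \<le> s" by (auto simp: s_def)
  have T: "1 \<le> T" "\<Lambda>1 + K2 \<le> T" "2 * K1 \<le> T" "K2 \<le> T" using \<Lambda>1 K1(1) K2(1) by (auto simp: T_def)
  have R: "0 < R" unfolding R_def using s(1) T(1) K(1) by (intro mult_pos_pos add_pos_nonneg) auto
  \<comment> \<open>\<open>Q\<close> is the size of the residuals, \<open>H\<close> that of \<open>v\<close>, and \<open>z\<close> any of the quantities to be bounded.\<close>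
  have scale: "z \<le> R * (x + y)"
    if "0 \<le> x" "0 \<le> y" "Q \<le> s * x + y" "H \<le> K * Q" "z \<le> Q + T * H" for z x y Q H :: real
  proof -
    have "z \<le> Q + T * (K * Q)" using that(5) mult_left_mono[OF that(4), of T] T(1) by linarith
    also have "\<dots> = (1 + T * K) * Q" by (simp add: algebra_simps)
    also have "\<dots> \<le> (1 + T * K) * (s * (x + y))"
    proof (rule mult_left_mono)
      have "1 * y \<le> s * y" by (rule mult_right_mono[OF s(1) that(2)])
      then show "Q \<le> s * (x + y)" using that(3) by (simp add: distrib_left)
    qed (use T(1) K(1) in simp)
    finally show ?thesis by (simp add: R_def mult.assoc)
  qed
  show ?thesis
  proof (intro exI[of _ "1 / (6 * R\<^sup>2)"] conjI ballI)
    show "0 < 1 / (6 * R\<^sup>2)" using R by simp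
    fix \<tau> v assume \<tau>: "\<tau> \<in> HNdiv \<Omega> \<Gamma>D" and v: "v \<in> H1D \<Omega> \<Gamma>D"
    define t d g l H where "t = L2_norm \<Omega> \<tau>" and "d = L2_norm \<Omega> (weak_div \<Omega> \<tau>)"
      and "g = L2_norm \<Omega> (weak_grad \<Omega> v)" and "l = L2_norm \<Omega> v" and "H = H1_norm \<Omega> v"
    note tL = HNdiv_props(1)[OF \<tau>] and dL = HNdiv_props(2)[OF \<tau>] and gL = H1D_grad[OF v] and vL = H1D_L2[OF v]
    have nn: "0 \<le> t" "0 \<le> d" "0 \<le> g" "0 \<le> l" "0 \<le> H"
      using L2.nrm_nonneg[OF tL] L2.nrm_nonneg[OF dL] L2.nrm_nonneg[OF gL] L2.nrm_nonneg[OF vL] H1D.nrm_nonneg[OF v]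
      by (simp_all add: t_def d_def g_def l_def H_def)
    have gH: "g \<le> H" and lH: "l \<le> H" unfolding g_def l_def H_def by (rule L2_le_H1_norm)+
    have TH: "H \<le> T * H" "(\<Lambda>1 + K2) * H \<le> T * H" "2 * K1 * H \<le> T * H" "K2 * H \<le> T * H"
      using mult_right_mono[OF T(1) nn(5)] mult_right_mono[OF T(2) nn(5)] mult_right_mono[OF T(3) nn(5)]
        mult_right_mono[OF T(4) nn(5)] by simp_all
    have Kg: "\<Lambda>1 * g \<le> \<Lambda>1 * H" "K2 * l \<le> K2 * H" "K1 * (g + l) \<le> 2 * K1 * H"
      using mult_left_mono[OF gH, of \<Lambda>1] mult_left_mono[OF lH, of K2] mult_left_mono[OF add_mono[OF gH lH], of K1]
        \<Lambda>1 K1(1) K2(1) by simp_all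
    have K2H: "0 \<le> K2 * H" using K2(1) nn(5) by simp
    let ?q = "\<lambda>x. \<tau> x + A x *v weak_grad \<Omega> v x" and ?f = "\<lambda>x. weak_div \<Omega> \<tau> x + lower_order \<Omega> b c v x"
    let ?q' = "\<lambda>x. \<tau> x + A x *v weak_grad \<Omega> v x + v x *\<^sub>R b x" and ?f' = "\<lambda>x. weak_div \<Omega> \<tau> x + c x * v x"
    define x where "x = L2_norm \<Omega> (flux_defect \<Omega> A \<tau> v)"
    have x: "0 \<le> x" "L2_norm \<Omega> ?q \<le> sqrt \<Lambda>1 * x" unfolding x_def by (rule flux_defect_bound[OF tL v])+
    have AG: "(\<lambda>x. A x *v weak_grad \<Omega> v x) \<in> L2 \<Omega>" "L2_norm \<Omega> (\<lambda>x. A x *v weak_grad \<Omega> v x) \<le> \<Lambda>1 * g"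
      using A_L2[OF gL] by (simp_all add: g_def)
    have X: "lower_order \<Omega> b c v \<in> L2 \<Omega>" "L2_norm \<Omega> (lower_order \<Omega> b c v) \<le> K1 * (g + l)"
      using lower_order_L2[OF v] K1(2)[OF v] by (simp_all add: g_def l_def)
    have vb: "(\<lambda>x. v x *\<^sub>R b x) \<in> L2 \<Omega>" "L2_norm \<Omega> (\<lambda>x. v x *\<^sub>R b x) \<le> K2 * l"
      and cv: "(\<lambda>x. c x * v x) \<in> L2 \<Omega>" "L2_norm \<Omega> (\<lambda>x. c x * v x) \<le> K2 * l"
      using K2(2,3)[OF vL] by (auto simp: l_def)
    have qL: "?q \<in> L2 \<Omega>" by (rule L2_add[OF tL AG(1)])
    have q'L: "?q' \<in> L2 \<Omega>" by (rule L2_add[OF qL vb(1)])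
    have fL: "?f \<in> L2 \<Omega>" by (rule L2_add[OF dL X(1)])
    have f'L: "?f' \<in> L2 \<Omega>" by (rule L2_add[OF dL cv(1)])
    have tq: "t \<le> L2_norm \<Omega> ?q + \<Lambda>1 * g"
    proof -
      have "\<tau> = ?q - (\<lambda>x. A x *v weak_grad \<Omega> v x)" by (simp add: fun_eq_iff)
      then show ?thesis unfolding t_def using L2.nrm_diff_le[OF qL AG(1)] AG(2) by (metis (no_types, lifting) add_left_mono order_trans)
    qed
    have qq': "L2_norm \<Omega> ?q \<le> L2_norm \<Omega> ?q' + K2 * l"
    proof -
      have "?q = ?q' - (\<lambda>x. v x *\<^sub>R b x)" by (simp add: fun_eq_iff)
      then show ?thesis using L2.nrm_diff_le[OF q'L vb(1)] vb(2) by (metis (no_types, lifting) add_left_mono order_trans)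
    qed
    have df: "d \<le> L2_norm \<Omega> ?f + K1 * (g + l)"
    proof -
      have "weak_div \<Omega> \<tau> = ?f - lower_order \<Omega> b c v" by (simp add: fun_eq_iff)
      then show ?thesis unfolding d_def using L2.nrm_diff_le[OF fL X(1)] X(2) by (metis (no_types, lifting) add_left_mono order_trans)
    qed
    have df': "d \<le> L2_norm \<Omega> ?f' + K2 * l"
    proof -
      have "weak_div \<Omega> \<tau> = ?f' - (\<lambda>x. c x * v x)" by (simp add: fun_eq_iff)
      then show ?thesis unfolding d_def using L2.nrm_diff_le[OF f'L cv(1)] cv(2) by (metis (no_types, lifting) add_left_mono order_trans)
    qed
    have qnn: "0 \<le> L2_norm \<Omega> ?q" "0 \<le> L2_norm \<Omega> ?q'" by (rule L2.nrm_nonneg[OF qL], rule L2.nrm_nonneg[OF q'L])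
    have L: "t \<le> R * (x + y) \<and> g \<le> R * (x + y) \<and> (y = L2_norm \<Omega> ?f \<longrightarrow> d \<le> R * (x + y))"
      if y: "y = L2_norm \<Omega> ?f \<or> y = \<bar>dual_norm \<Omega> \<Gamma>D (L2_functional \<Omega> ?f)\<bar>" for y
    proof -
      let ?Q = "L2_norm \<Omega> ?q + y"
      have ynn: "0 \<le> y" using y L2.nrm_nonneg[OF fL] by auto
      have "H \<le> K * ?Q" unfolding H_def
        by (rule K(2)[OF v]) (use ynn qnn residual_functional_bound[OF qL fL _ y] bil_first_order_system(1)[OF \<tau> v] in auto)
      moreover have "?Q \<le> s * x + y" using x mult_right_mono[OF s(2) x(1)] by linarith
      ultimately have sc: "\<And>z. z \<le> ?Q + T * H \<Longrightarrow> z \<le> R * (x + y)" using scale[OF x(1) ynn] by blast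
      have "t \<le> ?Q + T * H" "g \<le> ?Q + T * H"
        using tq Kg TH gH ynn qnn K2H nn unfolding distrib_right by linarith+
      moreover have "d \<le> ?Q + T * H" if "y = L2_norm \<Omega> ?f" using df Kg TH qnn that by linarith
      ultimately show ?thesis using sc by blast
    qed
    define x' where "x' = L2_norm \<Omega> ?q'"
    have J: "t \<le> R * (x' + y) \<and> g \<le> R * (x' + y) \<and> (y = L2_norm \<Omega> ?f' \<longrightarrow> d \<le> R * (x' + y))"
      if y: "y = L2_norm \<Omega> ?f' \<or> y = \<bar>dual_norm \<Omega> \<Gamma>D (L2_functional \<Omega> ?f')\<bar>" for y
    proof -
      let ?Q = "x' + y"
      have ynn: "0 \<le> y" using y L2.nrm_nonneg[OF f'L] by auto
      have xnn: "0 \<le> x'" using qnn by (simp add: x'_def)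
      have "H \<le> K * ?Q" unfolding H_def x'_def
        by (rule K(3)[OF v]) (use ynn qnn residual_functional_bound[OF q'L f'L _ y] bil_first_order_system(2)[OF \<tau> v] in auto)
      moreover have "?Q \<le> s * x' + y" using mult_right_mono[OF s(1) xnn] by simp
      ultimately have sc: "\<And>z. z \<le> ?Q + T * H \<Longrightarrow> z \<le> R * (x' + y)" using scale[OF xnn ynn] by blast
      have "t \<le> ?Q + T * H" "g \<le> ?Q + T * H"
        using tq qq' Kg TH gH ynn qnn K2H nn unfolding distrib_right x'_def by linarith+
      moreover have "d \<le> ?Q + T * H" if "y = L2_norm \<Omega> ?f'" using df' Kg TH xnn that by linarith
      ultimately show ?thesis using sc by blast
    qed
    let ?D = "\<lambda>f. \<bar>dual_norm \<Omega> \<Gamma>D (L2_functional \<Omega> f)\<bar>"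
    show "1 / (6 * R\<^sup>2) * ((L2_norm \<Omega> \<tau>)\<^sup>2 + (L2_norm \<Omega> (weak_div \<Omega> \<tau>))\<^sup>2 + (L2_norm \<Omega> (weak_grad \<Omega> v))\<^sup>2)
        \<le> LS_L \<Omega> A b c \<tau> v (\<lambda>_. 0)"
      using square_sum_estimate[OF nn(1-3) R, of x "L2_norm \<Omega> ?f"] L[of "L2_norm \<Omega> ?f"]
      unfolding LS_L_def t_def d_def g_def x_def diff_zero by blast
    show "1 / (6 * R\<^sup>2) * ((L2_norm \<Omega> \<tau>)\<^sup>2 + (L2_norm \<Omega> (weak_div \<Omega> \<tau>))\<^sup>2 + (L2_norm \<Omega> (weak_grad \<Omega> v))\<^sup>2)
        \<le> LS_J \<Omega> A b c \<tau> v (\<lambda>_. 0)"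
      using square_sum_estimate[OF nn(1-3) R, of x' "L2_norm \<Omega> ?f'"] J[of "L2_norm \<Omega> ?f'"]
      unfolding LS_J_def t_def d_def g_def x'_def diff_zero by blast
    have "1 / (6 * R\<^sup>2) * (t\<^sup>2 + 0\<^sup>2 + g\<^sup>2) \<le> x\<^sup>2 + (?D ?f)\<^sup>2"
    proof (rule square_sum_estimate[OF nn(1) order_refl nn(3) R])
      show *: "t \<le> R * (x + ?D ?f)" "g \<le> R * (x + ?D ?f)" using L[of "?D ?f"] by auto
      show "0 \<le> R * (x + ?D ?f)" using * nn(1) by linarith
    qed
    then show "1 / (6 * R\<^sup>2) * ((L2_norm \<Omega> \<tau>)\<^sup>2 + (L2_norm \<Omega> (weak_grad \<Omega> v))\<^sup>2)
        \<le> LS_L_minus1 \<Omega> \<Gamma>D A b c \<tau> v (\<lambda>_. 0)"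
      by (simp add: LS_L_minus1_def t_def g_def x_def)
    have "1 / (6 * R\<^sup>2) * (t\<^sup>2 + 0\<^sup>2 + g\<^sup>2) \<le> x'\<^sup>2 + (?D ?f')\<^sup>2"
    proof (rule square_sum_estimate[OF nn(1) order_refl nn(3) R])
      show *: "t \<le> R * (x' + ?D ?f')" "g \<le> R * (x' + ?D ?f')" using J[of "?D ?f'"] by auto
      show "0 \<le> R * (x' + ?D ?f')" using * nn(1) by linarith
    qed
    then show "1 / (6 * R\<^sup>2) * ((L2_norm \<Omega> \<tau>)\<^sup>2 + (L2_norm \<Omega> (weak_grad \<Omega> v))\<^sup>2)
        \<le> LS_J_minus1 \<Omega> \<Gamma>D A b c \<tau> v (\<lambda>_. 0)"
      by (simp add: LS_J_minus1_def t_def g_def x'_def)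
  qed
qed

end

theorem theorem3p1:
  fixes \<Omega> \<Gamma>D \<Gamma>N :: "(real^'n::finite) set"
    and A :: "real^'n \<Rightarrow> real^'n^'n" and b :: "real^'n \<Rightarrow> real^'n" and c :: "real^'n \<Rightarrow> real"
    and \<Lambda>0 \<Lambda>1 :: real
  assumes dim: "CARD('n) = 2 \<or> CARD('n) = 3"
    and domain: "bounded \<Omega>" "open \<Omega>" "connected \<Omega>" "Lipschitz_boundary \<Omega>"
    and boundary: "frontier \<Omega> = closure \<Gamma>D \<union> closure \<Gamma>N"
      "openin (top_of_set (frontier \<Omega>)) \<Gamma>D" "openin (top_of_set (frontier \<Omega>)) \<Gamma>N"
      "\<Gamma>D \<inter> \<Gamma>N = {}" "connected \<Gamma>D" "emeasure surface_measure \<Gamma>D \<noteq> 0"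
    and A: "A \<in> Linf \<Omega>" "AE x in lebesgue_on \<Omega>. transpose (A x) = A x"
      "0 < \<Lambda>0" "\<Lambda>0 \<le> \<Lambda>1"
      "AE x in lebesgue_on \<Omega>. \<forall>y. \<Lambda>0 * (y \<bullet> y) \<le> y \<bullet> (A x *v y) \<and> y \<bullet> (A x *v y) \<le> \<Lambda>1 * (y \<bullet> y)"
    and bc: "b \<in> Linf \<Omega>" "c \<in> Linf \<Omega>"
    and conditions:
      "(\<forall>u\<in>H1D \<Omega> \<Gamma>D. (\<forall>v\<in>H1D \<Omega> \<Gamma>D. bil \<Omega> A b c u v = 0) \<longrightarrow> eq_ae \<Omega> u (\<lambda>_. 0)) \<or>
       (\<exists>C>0. \<forall>g\<in>H1D_dual \<Omega> \<Gamma>D. \<forall>u. solves \<Omega> \<Gamma>D A b c g u \<longrightarrow>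
          L2_norm \<Omega> (weak_grad \<Omega> u) \<le> C * dual_norm \<Omega> \<Gamma>D g) \<or>
       (\<forall>g\<in>H1D_dual \<Omega> \<Gamma>D. (\<exists>u. solves \<Omega> \<Gamma>D A b c g u) \<and>
          (\<forall>u u'. solves \<Omega> \<Gamma>D A b c g u \<and> solves \<Omega> \<Gamma>D A b c g u' \<longrightarrow> eq_ae \<Omega> u u')) \<or>
       (\<forall>u\<in>H1D \<Omega> \<Gamma>D. (\<forall>v\<in>H1D \<Omega> \<Gamma>D. bil \<Omega> A b c v u = 0) \<longrightarrow> eq_ae \<Omega> u (\<lambda>_. 0)) \<or>
       (\<exists>C>0. \<forall>g\<in>H1D_dual \<Omega> \<Gamma>D. \<forall>u. solves_adj \<Omega> \<Gamma>D A b c g u \<longrightarrow>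
          L2_norm \<Omega> (weak_grad \<Omega> u) \<le> C * dual_norm \<Omega> \<Gamma>D g) \<or>
       (\<forall>g\<in>H1D_dual \<Omega> \<Gamma>D. (\<exists>u. solves_adj \<Omega> \<Gamma>D A b c g u) \<and>
          (\<forall>u u'. solves_adj \<Omega> \<Gamma>D A b c g u \<and> solves_adj \<Omega> \<Gamma>D A b c g u' \<longrightarrow> eq_ae \<Omega> u u'))"
  shows "\<exists>C>0. \<forall>\<tau>\<in>HNdiv \<Omega> \<Gamma>D. \<forall>v\<in>H1D \<Omega> \<Gamma>D.
      C * ((L2_norm \<Omega> \<tau>)\<^sup>2 + (L2_norm \<Omega> (weak_div \<Omega> \<tau>))\<^sup>2 + (L2_norm \<Omega> (weak_grad \<Omega> v))\<^sup>2)
        \<le> LS_L \<Omega> A b c \<tau> v (\<lambda>_. 0) \<and>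
      C * ((L2_norm \<Omega> \<tau>)\<^sup>2 + (L2_norm \<Omega> (weak_grad \<Omega> v))\<^sup>2)
        \<le> LS_L_minus1 \<Omega> \<Gamma>D A b c \<tau> v (\<lambda>_. 0) \<and>
      C * ((L2_norm \<Omega> \<tau>)\<^sup>2 + (L2_norm \<Omega> (weak_div \<Omega> \<tau>))\<^sup>2 + (L2_norm \<Omega> (weak_grad \<Omega> v))\<^sup>2)
        \<le> LS_J \<Omega> A b c \<tau> v (\<lambda>_. 0) \<and>
      C * ((L2_norm \<Omega> \<tau>)\<^sup>2 + (L2_norm \<Omega> (weak_grad \<Omega> v))\<^sup>2)
        \<le> LS_J_minus1 \<Omega> \<Gamma>D A b c \<tau> v (\<lambda>_. 0)"
proof -
  have fin: "closed (frontier \<Omega>)" by simp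
  have sub: "\<Gamma>D \<subseteq> frontier \<Omega>" using boundary(2) openin_imp_subset by blast
  obtain U where "open U" "\<Gamma>D = frontier \<Omega> \<inter> U" using boundary(2) by (auto simp: openin_open)
  then have bor: "\<Gamma>D \<in> sets borel" using fin by (auto intro!: sets.Int)
  have card: "2 \<le> CARD('n)" using dim by auto
  interpret elliptic_problem \<Omega> \<Gamma>D A b c \<Lambda>0 \<Lambda>1
    by unfold_locales (use domain sub bor card boundary A bc in auto)
  have "(\<forall>u\<in>H1D \<Omega> \<Gamma>D. (\<forall>v\<in>H1D \<Omega> \<Gamma>D. bil \<Omega> A b c u v = 0) \<longrightarrow> eq_ae \<Omega> u (\<lambda>_. 0)) \<or>
       (\<forall>u\<in>H1D \<Omega> \<Gamma>D. (\<forall>v\<in>H1D \<Omega> \<Gamma>D. bil \<Omega> A b c v u = 0) \<longrightarrow> eq_ae \<Omega> u (\<lambda>_. 0))"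
    using conditions
    apply (elim disjE)
    subgoal by blast
    subgoal using injective_if_stable by blast
    subgoal using injective_if_stable by blast
    subgoal by blast
    subgoal using injective_if_adjoint_stable by blast
    subgoal using injective_if_adjoint_stable by blast
    done
  then show ?thesis by (intro least_squares_coercive well_posed_if_injective)
qed

end
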